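(* The Artin groups of type $A_n$ (these are the braid groups), $B_n=C_n$, $I_2(n)$, $\tilde{A}_n$ and $\tilde{C}_n$ are virtually RFR$p$ for any prime $p$.
   Context: For a group $G$, let $\operatorname{rad}_{\mathbb{Q}}(G)=\ker\bigl(G\to H_1(G;\mathbb{Q})\bigr)$. Let $p$ be a prime. A finitely generated group $G$ is called RFR$p$ (residually finite rationally $p$) if there is a sequence of subgroups $\{G_i\}_{i\ge 0}$ of $G$ with $G_0=G$ such that: (1) for each $i$, $G_{i+1}$ is a normal subgroup of $G_i$ and $\operatorname{rad}_{\mathbb{Q}}(G_i)\leq G_{i+1}$; (2) $\bigcap_{i\ge 0}G_i=\{1\}$; (3) for each $i$, the quotient $G_i/G_{i+1}$ is a finite elementary abelian $p$-group. A group is virtually RFR$p$ if it has a finite-index subgroup that is RFR$p$. Given a Coxeter graph with finite vertex set $V$ and labels $m_{st}=m_{ts}\in\{2,3,\dots,\infty\}$ for $s\neq t$ in $V$ (with $m_{st}=2$ when $s,t$ are not joined by an edge, and $m_{st}=3$ when they are joined by an unlabelled edge), the associated Artin group is generated by $V$ with relations $sts\cdots=tst\cdots$ (both sides alternating words of length $m_{st}$) for all $s\ne t$ with $m_{st}<\infty$. The Coxeter graphs are the usual ones: $A_n$ ($n\ge1$) is a path with $n$ vertices and all edges unlabelled (its Artin group is the braid group on $n+1$ strands); $B_n=C_n$ ($n\ge2$) is a path with $n$ vertices in which one end edge is labelled $4$ and the others are unlabelled; $I_2(n)$ ($n\ge 3$) is a single edge labelled $n$; $\tilde{A}_n$ is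 a cycle with $n+1$ vertices and unlabelled edges for $n\ge 2$, and a single edge labelled $\infty$ for $n=1$; $\tilde{C}_n$ ($n\ge2$) is a path with $n+1$ vertices in which the two end edges are labelled $4$ and the others are unlabelled. *)

theory Defs
  imports
    "HOL-Algebra.Generated_Groups"
    "HOL-Computational_Algebra.Primes"
    "HOL-Library.Extended_Nat"
    "HOL-Library.Poly_Mapping"
begin

section \<open>First rational homology of a group\<close>

text \<open>
  \<open>H\<^sub>1(G; \<rat>)\<close> is taken from the inhomogeneous bar complex of \<open>G\<close> with trivial coefficients
  \<open>\<rat>\<close>: the \<open>n\<close>-chains are the finitely supported rational combinations of \<open>n\<close>-tuples
  \<open>[g\<^sub>1|...|g\<^sub>n]\<close>, and the low boundary maps are
  \<open>\<partial>\<^sub>2 [g|h] = [h] - [gh] + [g]\<close> and \<open>\<partial>\<^sub>1 [g] = [] - [] = 0\<close>.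
  Every 1-chain is therefore a cycle, and \<open>H\<^sub>1\<close> is the quotient of all 1-chains by the image
  of \<open>\<partial>\<^sub>2\<close>.
\<close>

definition rat_chains :: "'k set \<Rightarrow> ('k \<Rightarrow>\<^sub>0 rat) monoid" where
  "rat_chains S = \<lparr>carrier = {c. Poly_Mapping.keys c \<subseteq> S}, monoid.mult = (+), one = 0\<rparr>"

definition bar_boundary2 ::
    "('a, 'b) monoid_scheme \<Rightarrow> ('a \<times> 'a \<Rightarrow>\<^sub>0 rat) \<Rightarrow> ('a \<Rightarrow>\<^sub>0 rat)" where
  "bar_boundary2 G c =
     (\<Sum>(g, h) \<in> Poly_Mapping.keys c.
        Poly_Mapping.single h (Poly_Mapping.lookup c (g, h))
        - Poly_Mapping.single (g \<otimes>\<^bsub>G\<^esub> h) (Poly_Mapping.lookup c (g, h))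
        + Poly_Mapping.single g (Poly_Mapping.lookup c (g, h)))"

definition bar_boundaries1 :: "('a, 'b) monoid_scheme \<Rightarrow> ('a \<Rightarrow>\<^sub>0 rat) set" where
  "bar_boundaries1 G = bar_boundary2 G ` carrier (rat_chains (carrier G \<times> carrier G))"

definition H1_rat :: "('a, 'b) monoid_scheme \<Rightarrow> ('a \<Rightarrow>\<^sub>0 rat) set monoid" where
  "H1_rat G = rat_chains (carrier G) Mod bar_boundaries1 G"

text \<open>The canonical map \<open>G \<rightarrow> H\<^sub>1(G; \<rat>)\<close>, \<open>g \<mapsto> [g]\<close>.\<close>

definition to_H1_rat :: "('a, 'b) monoid_scheme \<Rightarrow> 'a \<Rightarrow> ('a \<Rightarrow>\<^sub>0 rat) set" where
  "to_H1_rat G g = bar_boundaries1 G #>\<^bsub>rat_chains (carrier G)\<^esub> Poly_Mapping.single g 1"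

definition rad_rat :: "('a, 'b) monoid_scheme \<Rightarrow> 'a set" where
  "rad_rat G = kernel G (H1_rat G) (to_H1_rat G)"

lemma bar_boundary2_superset:
  assumes "finite A" "Poly_Mapping.keys c \<subseteq> A"
  shows "bar_boundary2 G c = (\<Sum>(g, h) \<in> A.
        Poly_Mapping.single h (Poly_Mapping.lookup c (g, h))
        - Poly_Mapping.single (g \<otimes>\<^bsub>G\<^esub> h) (Poly_Mapping.lookup c (g, h))
        + Poly_Mapping.single g (Poly_Mapping.lookup c (g, h)))"
  unfolding bar_boundary2_def using assms
  by (intro sum.mono_neutral_left) (auto simp: in_keys_iff)

lemma bar_boundary2_add: "bar_boundary2 G (c + d) = bar_boundary2 G c + bar_boundary2 G d"
proof -
  let ?A = "Poly_Mapping.keys c \<union> Poly_Mapping.keys d"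
  have A: "finite ?A" by simp
  show ?thesis
    unfolding bar_boundary2_superset[OF A Poly_Mapping.keys_add]
      bar_boundary2_superset[OF A Un_upper1] bar_boundary2_superset[OF A Un_upper2]
    by (simp add: sum.distrib[symmetric] case_prod_unfold lookup_add single_add algebra_simps)
qed

lemma bar_boundary2_single:
  "bar_boundary2 G (Poly_Mapping.single (g, h) q) =
   Poly_Mapping.single h q - Poly_Mapping.single (g \<otimes>\<^bsub>G\<^esub> h) q + Poly_Mapping.single g q"
  by (subst bar_boundary2_superset[of "{(g,h)}"]) auto

lemma comm_group_rat_chains: "comm_group (rat_chains S)"
proof (rule comm_groupI)
  fix x y assume "x \<in> carrier (rat_chains S)" "y \<in> carrier (rat_chains S)"
  then show "x \<otimes>\<^bsub>rat_chains S\<^esub> y \<in> carrier (rat_chains S)"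
    using Poly_Mapping.keys_add[of x y] by (auto simp: rat_chains_def)
next
  fix x assume "x \<in> carrier (rat_chains S)"
  then show "\<exists>y\<in>carrier (rat_chains S). y \<otimes>\<^bsub>rat_chains S\<^esub> x = \<one>\<^bsub>rat_chains S\<^esub>"
    by (auto simp: rat_chains_def intro!: exI[of _ "-x"])
qed (auto simp: rat_chains_def algebra_simps)

lemma bar_boundary2_hom:
  assumes "group G"
  shows "bar_boundary2 G \<in> hom (rat_chains (carrier G \<times> carrier G)) (rat_chains (carrier G))"
proof (rule homI)
  fix c assume "c \<in> carrier (rat_chains (carrier G \<times> carrier G))"
  then have c: "Poly_Mapping.keys c \<subseteq> carrier G \<times> carrier G" by (simp add: rat_chains_def)
  interpret group G by fact
  have one: "Poly_Mapping.keys (Poly_Mapping.single h q - Poly_Mapping.single (g \<otimes>\<^bsub>G\<^esub> h) q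
     + Poly_Mapping.single g q) \<subseteq> carrier G" if "g \<in> carrier G" "h \<in> carrier G" for g h and q :: rat
  proof -
    have s: "Poly_Mapping.keys (Poly_Mapping.single x q) \<subseteq> carrier G" if "x \<in> carrier G" for x
      using that by simp
    show ?thesis
      by (rule order.trans[OF Poly_Mapping.keys_add], rule Un_least, rule order.trans[OF keys_diff],
          rule Un_least) (use that in \<open>auto simp del: keys_single intro!: s\<close>)
  qed
  show "bar_boundary2 G c \<in> carrier (rat_chains (carrier G))"
    unfolding bar_boundary2_def rat_chains_def partial_object.simps mem_Collect_eq
  proof (rule order.trans[OF keys_sum], rule UN_least, clarify)
    fix g h x assume "(g, h) \<in> Poly_Mapping.keys c" and x: "x \<in> Poly_Mapping.keys
         (Poly_Mapping.single h (Poly_Mapping.lookup c (g, h))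
        - Poly_Mapping.single (g \<otimes>\<^bsub>G\<^esub> h) (Poly_Mapping.lookup c (g, h))
        + Poly_Mapping.single g (Poly_Mapping.lookup c (g, h)))"
    then have "g \<in> carrier G" "h \<in> carrier G" using c by auto
    from subsetD[OF one[OF this] x] show "x \<in> carrier G" .
  qed
qed (simp add: bar_boundary2_add rat_chains_def)

lemma subgroup_bar_boundaries1:
  assumes "group G" shows "subgroup (bar_boundaries1 G) (rat_chains (carrier G))"
proof -
  interpret group_hom "rat_chains (carrier G \<times> carrier G)" "rat_chains (carrier G)" "bar_boundary2 G"
    by (intro group_hom.intro group_hom_axioms.intro comm_group.axioms(2)[OF comm_group_rat_chains]
        bar_boundary2_hom assms)
  show ?thesis unfolding bar_boundaries1_def by (rule img_is_subgroup)
qed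

lemma comm_group_H1_rat: "group G \<Longrightarrow> comm_group (H1_rat G)"
  unfolding H1_rat_def
  by (intro comm_group.abelian_FactGroup comm_group_rat_chains subgroup_bar_boundaries1)

lemma rad_rat_iff:
  assumes "group G"
  shows "g \<in> rad_rat G \<longleftrightarrow> g \<in> carrier G \<and> Poly_Mapping.single g 1 \<in> bar_boundaries1 G"
proof -
  interpret C: comm_group "rat_chains (carrier G)" by (rule comm_group_rat_chains)
  note S = subgroup_bar_boundaries1[OF assms]
  have "g \<in> carrier G \<Longrightarrow> Poly_Mapping.single g 1 \<in> carrier (rat_chains (carrier G))"
    by (simp add: rat_chains_def)
  then show ?thesis
    using C.coset_join1[OF _ _ S] C.coset_join2[OF _ S]
    unfolding rad_rat_def kernel_def H1_rat_def to_H1_rat_def one_FactGroup mem_Collect_eq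
    by blast
qed

lemma to_H1_rat_hom:
  assumes "group G" shows "to_H1_rat G \<in> hom G (H1_rat G)"
proof (rule homI)
  interpret group G by fact
  interpret C: comm_group "rat_chains (carrier G)" by (rule comm_group_rat_chains)
  interpret N: normal "bar_boundaries1 G" "rat_chains (carrier G)"
    using subgroup_bar_boundaries1[OF assms] by (simp add: C.normal_iff_subgroup)
  let ?e = "\<lambda>g. Poly_Mapping.single g (1::rat)"
  have e: "?e g \<in> carrier (rat_chains (carrier G))" if "g \<in> carrier G" for g
    using that by (simp add: rat_chains_def)
  show "to_H1_rat G g \<in> carrier (H1_rat G)" if "g \<in> carrier G" for g
    using e[OF that] by (auto simp: to_H1_rat_def H1_rat_def carrier_FactGroup)
  fix g h assume gh: "g \<in> carrier G" "h \<in> carrier G"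
  have b: "?e h - ?e (g \<otimes>\<^bsub>G\<^esub> h) + ?e g \<in> bar_boundaries1 G"
    unfolding bar_boundaries1_def bar_boundary2_single[symmetric]
    using gh by (intro imageI) (simp add: rat_chains_def)
  have "?e g + ?e h \<in> bar_boundaries1 G #>\<^bsub>rat_chains (carrier G)\<^esub> ?e (g \<otimes>\<^bsub>G\<^esub> h)"
    unfolding r_coset_def using b by (auto simp: rat_chains_def algebra_simps intro!: bexI[OF _ b])
  then have "bar_boundaries1 G #>\<^bsub>rat_chains (carrier G)\<^esub> ?e (g \<otimes>\<^bsub>G\<^esub> h) =
        bar_boundaries1 G #>\<^bsub>rat_chains (carrier G)\<^esub> (?e g + ?e h)"
    using e gh N.is_subgroup by (intro C.repr_independence) auto
  then show "to_H1_rat G (g \<otimes>\<^bsub>G\<^esub> h) = to_H1_rat G g \<otimes>\<^bsub>H1_rat G\<^esub> to_H1_rat G h"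
    using N.rcos_sum[OF e[OF gh(1)] e[OF gh(2)]]
    by (simp add: to_H1_rat_def H1_rat_def) (simp add: rat_chains_def)
qed


section \<open>Groups that are residually finite rationally \<open>p\<close>\<close>

definition finitely_generated_group :: "('a, 'b) monoid_scheme \<Rightarrow> bool" where
  "finitely_generated_group G \<longleftrightarrow>
     group G \<and> (\<exists>S \<subseteq> carrier G. finite S \<and> generate G S = carrier G)"

text \<open>The trivial group counts as an elementary abelian \<open>p\<close>-group (of rank 0).\<close>

definition finite_elementary_abelian :: "nat \<Rightarrow> ('a, 'b) monoid_scheme \<Rightarrow> bool" where
  "finite_elementary_abelian p Q \<longleftrightarrow>
     comm_group Q \<and> finite (carrier Q) \<and> (\<forall>x \<in> carrier Q. x [^]\<^bsub>Q\<^esub> p = \<one>\<^bsub>Q\<^esub>)"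

definition RFRp :: "nat \<Rightarrow> ('a, 'b) monoid_scheme \<Rightarrow> bool" where
  "RFRp p G \<longleftrightarrow>
     finitely_generated_group G \<and>
     (\<exists>K :: nat \<Rightarrow> 'a set.
        (\<forall>i. subgroup (K i) G) \<and>
        K 0 = carrier G \<and>
        (\<forall>i. K (Suc i) \<lhd> G\<lparr>carrier := K i\<rparr> \<and> rad_rat (G\<lparr>carrier := K i\<rparr>) \<subseteq> K (Suc i)) \<and>
        (\<Inter>i. K i) = {\<one>\<^bsub>G\<^esub>} \<and>
        (\<forall>i. finite_elementary_abelian p (G\<lparr>carrier := K i\<rparr> Mod K (Suc i))))"

definition virtually_RFRp :: "nat \<Rightarrow> ('a, 'b) monoid_scheme \<Rightarrow> bool" where
  "virtually_RFRp p G \<longleftrightarrow>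
     group G \<and> (\<exists>H. subgroup H G \<and> finite (rcosets\<^bsub>G\<^esub> H) \<and> RFRp p (G\<lparr>carrier := H\<rparr>))"


section \<open>Groups given by generators and relations\<close>

text \<open>
  The letter \<open>(s, True)\<close> stands for the generator \<open>s\<close> and \<open>(s, False)\<close> for its formal inverse.
  A pair \<open>(l, r)\<close> of words is the relation \<open>l = r\<close>.
\<close>

type_synonym 's word = "('s \<times> bool) list"

definition words :: "'s set \<Rightarrow> 's word set" where
  "words S = lists (S \<times> UNIV)"

inductive_set presentation_cong :: "'s set \<Rightarrow> ('s word \<times> 's word) set \<Rightarrow> ('s word \<times> 's word) set"
  for S R where
  refl: "w \<in> words S \<Longrightarrow> (w, w) \<in> presentation_cong S R"
| sym: "(u, v) \<in> presentation_cong S R \<Longrightarrow> (v, u) \<in> presentation_cong S R"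
| trans: "(u, v) \<in> presentation_cong S R \<Longrightarrow> (v, w) \<in> presentation_cong S R \<Longrightarrow>
    (u, w) \<in> presentation_cong S R"
| append: "(u, u') \<in> presentation_cong S R \<Longrightarrow> (v, v') \<in> presentation_cong S R \<Longrightarrow>
    (u @ v, u' @ v') \<in> presentation_cong S R"
| cancel: "s \<in> S \<Longrightarrow> ([(s, b), (s, \<not> b)], []) \<in> presentation_cong S R"
| relation: "(l, r) \<in> R \<Longrightarrow> l \<in> words S \<Longrightarrow> r \<in> words S \<Longrightarrow> (l, r) \<in> presentation_cong S R"

definition presented_group :: "'s set \<Rightarrow> ('s word \<times> 's word) set \<Rightarrow> 's word set monoid" where
  "presented_group S R =
     \<lparr>carrier = words S // presentation_cong S R,
      monoid.mult = (\<lambda>X Y. \<Union>x\<in>X. \<Union>y\<in>Y. presentation_cong S R `` {x @ y}),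
      one = presentation_cong S R `` {[]}\<rparr>"

lemma words_append [simp]: "u @ v \<in> words S \<longleftrightarrow> u \<in> words S \<and> v \<in> words S"
  by (auto simp: words_def)

lemma words_Nil [simp]: "[] \<in> words S"
  by (simp add: words_def)

lemma words_Cons [simp]: "(s, b) # w \<in> words S \<longleftrightarrow> s \<in> S \<and> w \<in> words S"
  by (simp add: words_def)

lemma presentation_cong_words:
  assumes "(u, v) \<in> presentation_cong S R"
  shows "u \<in> words S \<and> v \<in> words S"
  using assms by induction auto

lemma equiv_presentation_cong: "equiv (words S) (presentation_cong S R)"
  by (rule equivI)
     (auto simp: refl_on_def sym_def trans_def dest: presentation_cong_words
       intro: presentation_cong.refl presentation_cong.sym presentation_cong.trans)

lemma presented_group_mult:
  assumes "u \<in> words S" "v \<in> words S"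
  shows "presentation_cong S R `` {u} \<otimes>\<^bsub>presented_group S R\<^esub> presentation_cong S R `` {v} =
         presentation_cong S R `` {u @ v}"
proof -
  let ?cls = "\<lambda>w. presentation_cong S R `` {w}"
  have "(\<Union>x \<in> ?cls u. \<Union>y \<in> ?cls v. ?cls (x @ y)) = ?cls (u @ v)"
  proof (rule UN_equiv_class2[OF equiv_presentation_cong equiv_presentation_cong _ assms])
    show "congruent2 (presentation_cong S R) (presentation_cong S R) (\<lambda>x y. ?cls (x @ y))"
      by (rule congruent2I')
         (rule equiv_class_eq[OF equiv_presentation_cong], rule presentation_cong.append)
  qed
  then show ?thesis
    by (simp add: presented_group_def)
qed

lemma presentation_cong_inverse:
  assumes "w \<in> words S"
  shows "\<exists>w' \<in> words S. (w' @ w, []) \<in> presentation_cong S R"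
  using assms
proof (induction w)
  case Nil
  show ?case by (rule bexI[of _ "[]"]) (auto intro: presentation_cong.refl)
next
  case (Cons a w)
  obtain s b where a: "a = (s, b)" by (cases a)
  with Cons obtain w' where w': "w' \<in> words S" "(w' @ w, []) \<in> presentation_cong S R"
    by auto
  have s: "s \<in> S" "w \<in> words S" using Cons.prems a by auto
  have "([(s, \<not> b), (s, b)], []) \<in> presentation_cong S R"
    using presentation_cong.cancel[OF s(1), of "\<not> b"] by simp
  then have "(w' @ [(s, \<not> b), (s, b)] @ w, w' @ [] @ w) \<in> presentation_cong S R"
    using w'(1) s by (intro presentation_cong.append presentation_cong.refl) auto
  then have "(w' @ [(s, \<not> b), (s, b)] @ w, []) \<in> presentation_cong S R"
    using w'(2) by (auto intro: presentation_cong.trans)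
  then show ?case
    using w'(1) s a by (intro bexI[of _ "w' @ [(s, \<not> b)]"]) auto
qed

lemma group_presented_group: "group (presented_group S R)"
proof (rule groupI)
  let ?P = "presented_group S R"
  let ?cls = "\<lambda>w. presentation_cong S R `` {w}"
  have carr: "carrier ?P = ?cls ` words S"
    by (auto simp: presented_group_def quotient_def)
  have one: "\<one>\<^bsub>?P\<^esub> = ?cls []"
    by (simp add: presented_group_def)
  show "\<one>\<^bsub>?P\<^esub> \<in> carrier ?P"
    by (simp add: carr one)
  show "x \<otimes>\<^bsub>?P\<^esub> y \<in> carrier ?P" if "x \<in> carrier ?P" "y \<in> carrier ?P" for x y
    using that by (auto simp: carr presented_group_mult)
  show "x \<otimes>\<^bsub>?P\<^esub> y \<otimes>\<^bsub>?P\<^esub> z = x \<otimes>\<^bsub>?P\<^esub> (y \<otimes>\<^bsub>?P\<^esub> z)"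
    if "x \<in> carrier ?P" "y \<in> carrier ?P" "z \<in> carrier ?P" for x y z
    using that by (auto simp: carr presented_group_mult)
  show "\<one>\<^bsub>?P\<^esub> \<otimes>\<^bsub>?P\<^esub> x = x" if "x \<in> carrier ?P" for x
    using that by (auto simp: carr one presented_group_mult)
  show "\<exists>y \<in> carrier ?P. y \<otimes>\<^bsub>?P\<^esub> x = \<one>\<^bsub>?P\<^esub>" if x: "x \<in> carrier ?P" for x
  proof -
    obtain w where w: "w \<in> words S" "x = ?cls w" using x by (auto simp: carr)
    obtain w' where w': "w' \<in> words S" "(w' @ w, []) \<in> presentation_cong S R"
      using presentation_cong_inverse[OF w(1)] by blast
    have "?cls (w' @ w) = ?cls []"
      using w'(2) by (rule equiv_class_eq[OF equiv_presentation_cong])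
    then show ?thesis
      using w w' by (auto simp: carr one presented_group_mult)
  qed
qed


section \<open>Artin groups\<close>

text \<open>
  A Coxeter graph is recorded by its vertices and all its labels \<open>m\<^sub>s\<^sub>t\<close>: label \<open>2\<close> means that
  \<open>s\<close> and \<open>t\<close> are not joined, label \<open>3\<close> is an unlabelled edge. The diagonal carries no
  information.
\<close>

record 'v coxeter_graph =
  verts :: "'v set"
  label :: "'v \<Rightarrow> 'v \<Rightarrow> enat"

definition is_coxeter_graph :: "'v coxeter_graph \<Rightarrow> bool" where
  "is_coxeter_graph \<Gamma> \<longleftrightarrow> finite (verts \<Gamma>) \<and>
     (\<forall>s \<in> verts \<Gamma>. \<forall>t \<in> verts \<Gamma>. s \<noteq> t \<longrightarrow> label \<Gamma> s t = label \<Gamma> t s \<and> 2 \<le> label \<Gamma> s t)"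

text \<open>The positive word \<open>s t s \<dots>\<close> of length \<open>k\<close>.\<close>

fun alternating_word :: "'v \<Rightarrow> 'v \<Rightarrow> nat \<Rightarrow> 'v word" where
  "alternating_word s t 0 = []"
| "alternating_word s t (Suc k) = (s, True) # alternating_word t s k"

definition artin_relations :: "'v coxeter_graph \<Rightarrow> ('v word \<times> 'v word) set" where
  "artin_relations \<Gamma> =
     {(alternating_word s t k, alternating_word t s k) | s t k.
        s \<in> verts \<Gamma> \<and> t \<in> verts \<Gamma> \<and> s \<noteq> t \<and> label \<Gamma> s t = enat k}"

definition artin_group :: "'v coxeter_graph \<Rightarrow> 'v word set monoid" where
  "artin_group \<Gamma> = presented_group (verts \<Gamma>) (artin_relations \<Gamma>)"


subsection \<open>The Coxeter graphs of the statement\<close>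

text \<open>The path on \<open>0, \<dots>, n - 1\<close> whose edge joining \<open>i\<close> and \<open>i + 1\<close> is labelled \<open>l i\<close>.\<close>

definition coxeter_path :: "nat \<Rightarrow> (nat \<Rightarrow> enat) \<Rightarrow> nat coxeter_graph" where
  "coxeter_path n l =
     \<lparr>verts = {..<n},
      label = (\<lambda>i j. if j = Suc i then l i else if i = Suc j then l j else 2)\<rparr>"

text \<open>The cycle on \<open>0, \<dots>, n - 1\<close> with unlabelled edges, meant for \<open>n \<ge> 3\<close>.\<close>

definition coxeter_cycle :: "nat \<Rightarrow> nat coxeter_graph" where
  "coxeter_cycle n =
     \<lparr>verts = {..<n},
      label = (\<lambda>i j. if j = Suc i mod n \<or> i = Suc j mod n then 3 else 2)\<rparr>"

definition graph_A :: "nat \<Rightarrow> nat coxeter_graph" where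
  "graph_A n = coxeter_path n (\<lambda>_. 3)"

definition graph_B :: "nat \<Rightarrow> nat coxeter_graph" where
  "graph_B n = coxeter_path n (\<lambda>i. if i = 0 then 4 else 3)"

definition graph_I2 :: "nat \<Rightarrow> nat coxeter_graph" where
  "graph_I2 n = coxeter_path 2 (\<lambda>_. enat n)"

definition graph_affine_A :: "nat \<Rightarrow> nat coxeter_graph" where
  "graph_affine_A n = (if n = 1 then coxeter_path 2 (\<lambda>_. \<infinity>) else coxeter_cycle (n + 1))"

text \<open>The edges of \<open>graph_affine_C n\<close> are numbered \<open>0, \<dots>, n - 1\<close>.\<close>

definition graph_affine_C :: "nat \<Rightarrow> nat coxeter_graph" where
  "graph_affine_C n = coxeter_path (n + 1) (\<lambda>i. if i = 0 \<or> Suc i = n then 4 else 3)"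

lemma is_coxeter_graph_path: "(\<And>i. 2 \<le> l i) \<Longrightarrow> is_coxeter_graph (coxeter_path n l)"
  by (auto simp: is_coxeter_graph_def coxeter_path_def)

lemma is_coxeter_graph_cycle: "is_coxeter_graph (coxeter_cycle n)"
  by (auto simp: is_coxeter_graph_def coxeter_cycle_def numeral_eq_enat)

lemma is_coxeter_graph_graphs:
  "is_coxeter_graph (graph_A n)" "is_coxeter_graph (graph_B n)"
  "2 \<le> n \<Longrightarrow> is_coxeter_graph (graph_I2 n)"
  "is_coxeter_graph (graph_affine_A n)" "is_coxeter_graph (graph_affine_C n)"
  by (auto simp: graph_A_def graph_B_def graph_I2_def graph_affine_A_def graph_affine_C_def
      numeral_eq_enat intro!: is_coxeter_graph_path is_coxeter_graph_cycle)

end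

theory Submission
  imports Defs "HOL-Library.Nat_Bijection" "HOL-Algebra.Elementary_Groups"
begin

text \<open>
  For any group, let \<open>pstep p G\<close> consist of the elements on which all homomorphisms \<open>G \<rightarrow> \<int>\<close> are
  divisible by \<open>p\<close>. For finitely generated \<open>G\<close> it is a legitimate next term of a filtration as in the
  definition of the property, and iterating it gives a filtration that is functorial in \<open>G\<close>. So it suffices to find,
  in each of the Artin groups, a subgroup of finite index in which the intersection \<open>presidual\<close> of
  the iterates is trivial (\<open>RFRp_if_presidual_trivial\<close>, \<open>virtually_RFRp_if_virtually_separated\<close>). By functoriality
  this passes to subgroups, and it passes to overgroups of finite index.

  The main theorem \<open>presidual_free_normal\<close> treats a group \<open>P\<close> that contains a free group \<open>K\<close> of rank at
  least two with a basis such that conjugation by \<open>P\<close> sends every basis element to a \<open>K\<close>-conjugate of itself, as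
  pure braid groups do with the fundamental group of a punctured disc. No nontrivial element of \<open>K\<close>
  survives in \<open>presidual p P\<close>. Indeed, if \<open>h b h\<inverse> = v b v\<inverse>\<close>, then the exponent sum in \<open>v\<close> of another basis
  element \<open>c\<close> is a well-defined integer character of \<open>P\<close>. Imposing divisibility by \<open>p\<close> on these
  characters for all \<open>b \<noteq> c\<close> replaces \<open>K\<close> by the kernel of the exponent sum of \<open>c\<close> modulo \<open>p\<close>, that is, the punctured
  disc by its \<open>p\<close>-fold cyclic cover branched at one puncture. The cover is again a punctured disc, whose loops form a
  basis with the same property. If \<open>c\<close> is the first letter of a given word, the word becomes shorter in this
  basis, and induction applies.

  Consequently (\<open>virtually_separated_free_kernel_permuted\<close>) the property is inherited by an extension with free kernel if
  the group permutes the conjugacy classes of a finite basis of the kernel. The Artin groups are reached as follows. The group of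
  type \<open>B\<^sub>n\<close> is a semidirect product of a free group, on the loops of an axis around \<open>n\<close> strands,
  with the braid group \<open>A\<^sub>n\<^sub>-\<^sub>1\<close>; that of type \<open>A\<^sub>n\<close> contains \<open>B\<^sub>n\<close>
  with index \<open>n + 1\<close>, as the braids with one pure strand; the groups of affine type \<open>A\<^sub>n\<close> and \<open>C\<^sub>n\<close> embed into
  \<open>B\<^sub>n\<^sub>+\<^sub>1\<close>, realised as annular braids; dihedral groups are virtually products of a free group and \<open>\<int>\<close>. All these
  facts are proved algebraically: a homomorphism defined on generators with values in a permutational wreath
  product consists of an action and a cocycle, and the cocycle at a fixed point provides the permutation
  actions that witness freeness or the left inverses that witness injectivity.
\<close>

section \<open>Subgroups of finite index\<close>

lemma finite_image_if_determined:
  assumes "finite (t ` A)" "\<And>x y. x \<in> A \<Longrightarrow> y \<in> A \<Longrightarrow> t x = t y \<Longrightarrow> F x = F y"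
  shows "finite (F ` A)"
proof -
  have "F ` A \<subseteq> (\<lambda>v. F (SOME y. y \<in> A \<and> t y = v)) ` (t ` A)"
  proof
    fix z assume "z \<in> F ` A"
    then obtain x where x: "x \<in> A" "z = F x" by auto
    then have "(SOME y. y \<in> A \<and> t y = t x) \<in> A \<and> t (SOME y. y \<in> A \<and> t y = t x) = t x"
      by (intro someI[of "\<lambda>y. y \<in> A \<and> t y = t x" x]) auto
    then have "z = F (SOME y. y \<in> A \<and> t y = t x)" using x assms(2) by metis
    then show "z \<in> (\<lambda>v. F (SOME y. y \<in> A \<and> t y = v)) ` (t ` A)" using x by auto
  qed
  then show ?thesis using assms(1) finite_surj by blast
qed

lemma (in group) finite_index_if_invariant:
  assumes P: "subgroup P G" and fin: "finite (t ` carrier G)"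
    and t: "\<And>g h. g \<in> carrier G \<Longrightarrow> h \<in> carrier G \<Longrightarrow> t g = t h \<Longrightarrow> g \<otimes> inv h \<in> P"
  shows "finite (rcosets P)"
proof -
  have "finite ((\<lambda>g. P #> g) ` carrier G)"
  proof (rule finite_image_if_determined[OF fin])
    fix x y assume xy: "x \<in> carrier G" "y \<in> carrier G" "t x = t y"
    then have "x = (x \<otimes> inv y) \<otimes> y" by (simp add: m_assoc)
    then have "x \<in> P #> y" using t[OF xy] unfolding r_coset_def by blast
    then show "P #> x = P #> y" using repr_independence[OF _ xy(2) P] by simp
  qed
  moreover have "rcosets P = (\<lambda>g. P #> g) ` carrier G" by (auto simp: RCOSETS_def)
  ultimately show ?thesis by simp
qed

lemma (in group) rcos_eq_imp:
  assumes "subgroup P G" "g \<in> carrier G" "h \<in> carrier G" "P #> g = P #> h"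
  shows "g \<otimes> inv h \<in> P"
proof -
  have "g \<in> P #> h" using rcos_self[OF assms(2,1)] assms(4) by simp
  then obtain q where "q \<in> P" "g = q \<otimes> h" by (auto simp: r_coset_def)
  then show ?thesis using assms subgroup.mem_carrier[OF assms(1)] by (simp add: m_assoc)
qed

text \<open>
  Schreier's lemma: if \<open>T\<close> meets every coset, the elements \<open>t s t'\<inverse>\<close> of \<open>P\<close> with \<open>t, t' \<in> T\<close> and \<open>s\<close> a
  generator or its inverse generate \<open>P\<close> together with \<open>T \<inter> P\<close>.
\<close>

lemma finitely_generated_finite_index:
  fixes G (structure)
  assumes fg: "finitely_generated_group G" and P: "subgroup P G" and fin: "finite (rcosets\<^bsub>G\<^esub> P)"
  shows "finitely_generated_group (G\<lparr>carrier := P\<rparr>)"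
proof -
  interpret group G using fg by (simp add: finitely_generated_group_def)
  obtain S where S: "S \<subseteq> carrier G" "finite S" "generate G S = carrier G"
    using fg by (auto simp: finitely_generated_group_def)
  note Psub = subgroup.subset[OF P]
  define T where "T = insert \<one> ((\<lambda>C. SOME x. x \<in> C) ` (rcosets P))"
  define U where "U = S \<union> (\<lambda>s. inv s) ` S"
  define D where "D = (((\<lambda>(t, s, t'). t \<otimes> s \<otimes> inv t') ` (T \<times> U \<times> T)) \<union> T) \<inter> P"
  have U: "U \<subseteq> carrier G" "finite U" using S by (auto simp: U_def)
  have rep: "(SOME x. x \<in> P #> g) \<in> P #> g" if "g \<in> carrier G" for g
    using rcos_self[OF that P] by (rule someI)
  have T: "T \<subseteq> carrier G" "finite T"
  proof -
    show "finite T" using fin by (simp add: T_def)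
    show "T \<subseteq> carrier G"
    proof
      fix t assume "t \<in> T"
      then consider "t = \<one>" | g where "g \<in> carrier G" "t = (SOME x. x \<in> P #> g)"
        unfolding T_def RCOSETS_def by blast
      then show "t \<in> carrier G"
      proof cases
        case 2
        then show ?thesis using rep[OF 2(1)] r_coset_subset_G[OF Psub 2(1)] by (metis subsetD)
      qed simp
    qed
  qed
  have D: "finite D" "D \<subseteq> P" "D \<subseteq> carrier G" using U T Psub by (auto simp: D_def)
  have tr: "\<exists>t\<in>T. g \<otimes> inv t \<in> P" if g: "g \<in> carrier G" for g
  proof -
    obtain q where q: "q \<in> P" "(SOME x. x \<in> P #> g) = q \<otimes> g"
      using rep[OF g] by (auto simp: r_coset_def)
    have qc: "q \<in> carrier G" using q Psub by auto
    have "g \<otimes> inv (q \<otimes> g) = inv q" using qc g by (simp add: inv_mult_group m_assoc[symmetric])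
    then have "g \<otimes> inv (SOME x. x \<in> P #> g) \<in> P" using q subgroup.m_inv_closed[OF P] by simp
    then show ?thesis using g by (auto simp: T_def RCOSETS_def)
  qed
  define X where "X = {d \<otimes> t | d t. d \<in> generate G D \<and> t \<in> T}"
  have genD: "d \<in> generate G D \<Longrightarrow> d \<in> carrier G" for d using generate_in_carrier[OF D(3)] .
  have step: "x \<otimes> s \<in> X" if x: "x \<in> X" and s: "s \<in> U" for x s
  proof -
    obtain d t where dt: "x = d \<otimes> t" "d \<in> generate G D" "t \<in> T" using x by (auto simp: X_def)
    have c: "d \<in> carrier G" "t \<in> carrier G" "s \<in> carrier G" using dt genD T U s by auto
    obtain t' where t': "t' \<in> T" "t \<otimes> s \<otimes> inv t' \<in> P" using tr[of "t \<otimes> s"] c by auto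
    have c': "t' \<in> carrier G" using t' T by auto
    have "t \<otimes> s \<otimes> inv t' \<in> D" using t' dt s by (force simp: D_def)
    then have "d \<otimes> (t \<otimes> s \<otimes> inv t') \<in> generate G D" using dt(2) by (simp add: generate.eng generate.incl)
    moreover have "x \<otimes> s = d \<otimes> (t \<otimes> s \<otimes> inv t') \<otimes> t'" using c c' dt by (simp add: m_assoc)
    ultimately show ?thesis using t' by (auto simp: X_def)
  qed
  have Xc: "X \<subseteq> carrier G" using genD T by (auto simp: X_def)
  have all: "\<forall>x\<in>X. x \<otimes> g \<in> X" if "g \<in> generate G S" for g using that
  proof (induction rule: generate.induct)
    case one then show ?case using Xc by (auto simp: subset_iff)
  next
    case (eng h1 h2)
    have "h1 \<in> carrier G" "h2 \<in> carrier G" using eng generate_in_carrier[OF S(1)] by auto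
    then show ?case using eng Xc by (metis m_assoc subsetD)
  qed (auto intro: step simp: U_def)
  have "\<one> \<otimes> \<one> \<in> X" unfolding X_def T_def using generate.one by blast
  then have all: "g \<in> X" if "g \<in> carrier G" for g using all[of g] that S(3) by (metis l_one one_closed)
  have "generate G D = P"
  proof
    show "generate G D \<subseteq> P" using generate_subgroup_incl[OF D(2) P] .
    show "P \<subseteq> generate G D"
    proof
      fix q assume q: "q \<in> P"
      then obtain d t where dt: "q = d \<otimes> t" "d \<in> generate G D" "t \<in> T"
        using all[of q] Psub by (auto simp: X_def)
      have dP: "d \<in> P" using dt generate_subgroup_incl[OF D(2) P] by auto
      have "t = inv d \<otimes> q" using dt genD T by (simp add: m_assoc[symmetric] subsetD)
      then have "t \<in> P" using dP q P by (simp add: subgroup.m_closed subgroup.m_inv_closed)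
      then have "t \<in> D" using dt by (auto simp: D_def)
      then show "q \<in> generate G D" using dt by (auto intro: generate.eng generate.incl)
    qed
  qed
  moreover have "generate (G\<lparr>carrier := P\<rparr>) D = generate G D"
    using generate_consistent[OF D(2) P] by simp
  ultimately show ?thesis unfolding finitely_generated_group_def
    using D subgroup.subgroup_is_group[OF P is_group] by auto
qed

lemma (in comm_group) finite_if_fin_gen_exponent:
  assumes p: "0 < p" and ex: "\<And>x. x \<in> carrier G \<Longrightarrow> x [^] (p::nat) = \<one>"
    and S: "finite S" "S \<subseteq> carrier G"
  shows "finite (generate G S)"
  using S
proof (induction S rule: finite_induct)
  case empty
  then show ?case by (metis finite.intros(1,2) generate_empty)
next
  case (insert s S)
  then have s: "s \<in> carrier G" and Sc: "S \<subseteq> carrier G" by auto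
  note gc = generate_in_carrier[OF Sc]
  let ?X = "(\<lambda>(i, y). s [^] i \<otimes> y) ` ({..<p} \<times> generate G S)"
  have mem: "s [^] (i::nat) \<otimes> y \<in> ?X" if "y \<in> generate G S" for i y
  proof -
    have "s [^] i = s [^] (p * (i div p)) \<otimes> s [^] (i mod p)" using s by (simp add: nat_pow_mult)
    also have "s [^] (p * (i div p)) = \<one>" using s ex[OF s] by (simp flip: nat_pow_pow)
    finally have "s [^] i \<otimes> y = s [^] (i mod p) \<otimes> y" using s by simp
    then show ?thesis using p that by (force intro!: image_eqI[of _ _ "(i mod p, y)"])
  qed
  have "generate G (insert s S) \<subseteq> ?X"
  proof
    fix x assume "x \<in> generate G (insert s S)"
    then show "x \<in> ?X"
    proof (induction rule: generate.induct)
      case one show ?case using mem[OF generate.one, of 0] by simp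
    next
      case (incl h)
      show ?case
      proof (cases "h = s")
        case True then show ?thesis using mem[OF generate.one, of 1] s by simp
      next
        case False then show ?thesis using mem[OF generate.incl[of h S G], of 0] incl Sc by (auto simp: subset_iff)
      qed
    next
      case (inv h)
      show ?case
      proof (cases "h = s")
        case True
        have "s [^] (p - 1) \<otimes> s = \<one>" using ex[OF s] p s by (simp flip: nat_pow_Suc)
        then have "inv s = s [^] (p - 1)" using s by (simp add: inv_equality)
        then show ?thesis using True mem[OF generate.one, of "p-1"] s by simp
      next
        case False then show ?thesis using mem[OF generate.inv[of h S G], of 0] inv Sc by (auto simp: subset_iff)
      qed
    next
      case (eng h1 h2)
      then obtain i y j z where *: "h1 = s [^] (i::nat) \<otimes> y" "y \<in> generate G S"
        "h2 = s [^] (j::nat) \<otimes> z" "z \<in> generate G S" by auto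
      have "h1 \<otimes> h2 = s [^] (i + j) \<otimes> (y \<otimes> z)"
        using * s gc by (simp add: nat_pow_mult[symmetric] m_ac)
      then show ?case using mem[of "y \<otimes> z" "i+j"] * by (auto intro: generate.eng)
    qed
  qed
  then show ?case using insert(3) Sc by (meson finite_SigmaI finite_imageI finite_lessThan finite_subset)
qed

section \<open>The residual cut out by integer characters\<close>

definition int_character :: "('a, 'b) monoid_scheme \<Rightarrow> ('a \<Rightarrow> int) \<Rightarrow> bool" where
  "int_character G \<chi> \<longleftrightarrow> (\<forall>x\<in>carrier G. \<forall>y\<in>carrier G. \<chi> (x \<otimes>\<^bsub>G\<^esub> y) = \<chi> x + \<chi> y)"

text \<open>
  For finitely generated \<open>G\<close> this is the smallest subgroup that can follow \<open>G\<close> in a filtration as required: the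
  kernel of the reduction modulo \<open>p\<close> of the abelianisation of \<open>G\<close> divided by its torsion. Described by characters,
  it is visibly functorial in \<open>G\<close>.
\<close>

definition pstep :: "nat \<Rightarrow> ('a, 'b) monoid_scheme \<Rightarrow> 'a set" where
  "pstep p G = {g \<in> carrier G. \<forall>\<chi>. int_character G \<chi> \<longrightarrow> int p dvd \<chi> g}"

primrec pchain :: "nat \<Rightarrow> ('a, 'b) monoid_scheme \<Rightarrow> nat \<Rightarrow> 'a set" where
  "pchain p G 0 = carrier G"
| "pchain p G (Suc i) = pstep p (G\<lparr>carrier := pchain p G i\<rparr>)"

definition presidual :: "nat \<Rightarrow> ('a, 'b) monoid_scheme \<Rightarrow> 'a set" where
  "presidual p G = (\<Inter>i. pchain p G i)"

lemma pstepI: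
  assumes "g \<in> carrier G" "\<And>\<chi>. int_character G \<chi> \<Longrightarrow> int p dvd \<chi> g"
  shows "g \<in> pstep p G"
  unfolding pstep_def using assms by blast

lemma int_character_one:
  fixes G (structure)
  assumes "group G" "int_character G \<chi>" shows "\<chi> \<one>\<^bsub>G\<^esub> = 0"
proof -
  interpret group G by fact
  have "\<chi> (\<one>\<^bsub>G\<^esub> \<otimes>\<^bsub>G\<^esub> \<one>\<^bsub>G\<^esub>) = \<chi> \<one>\<^bsub>G\<^esub> + \<chi> \<one>\<^bsub>G\<^esub>" using assms(2) unfolding int_character_def by blast
  then show ?thesis by simp
qed

lemma int_character_inv:
  fixes G (structure)
  assumes "group G" "int_character G \<chi>" "x \<in> carrier G" shows "\<chi> (inv\<^bsub>G\<^esub> x) = - \<chi> x"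
proof -
  interpret group G by fact
  have "\<chi> (inv x \<otimes> x) = \<chi> (inv x) + \<chi> x" using assms unfolding int_character_def by blast
  then show ?thesis using assms int_character_one[OF assms(1,2)] by simp
qed

lemma int_character_pow:
  fixes G (structure)
  assumes "group G" "int_character G \<chi>" "x \<in> carrier G" shows "\<chi> (x [^]\<^bsub>G\<^esub> (n::nat)) = int n * \<chi> x"
proof -
  interpret group G by fact
  show ?thesis
  proof (induction n)
    case 0 then show ?case using int_character_one[OF assms(1,2)] by simp
  next
    case (Suc n)
    have "\<chi> (x [^] n \<otimes> x) = \<chi> (x [^] n) + \<chi> x" using assms unfolding int_character_def by blast
    then show ?case using Suc by (simp add: algebra_simps)
  qed
qed

lemma subgroup_pstep:
  fixes G (structure)
  assumes "group G" shows "subgroup (pstep p G) G"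
proof -
  interpret group G by fact
  have "int p dvd \<chi> \<one>" if "int_character G \<chi>" for \<chi> using int_character_one[OF assms that] by simp
  then have "\<one> \<in> pstep p G" by (intro pstepI) auto
  then have "pstep p G \<noteq> {}" by blast
  then show ?thesis
    by (intro subgroupI) (auto simp: pstep_def int_character_inv[OF assms] int_character_def)
qed

lemma subgroup_trans:
  assumes "subgroup H G" "subgroup K (G\<lparr>carrier := H\<rparr>)" "group G" shows "subgroup K G"
  using group.incl_subgroup[OF assms(3,1,2)] .

lemma subgroup_pchain: assumes "group G" shows "subgroup (pchain p G i) G"
proof (induction i)
  case 0 then show ?case using assms by (simp add: group.subgroup_self)
next
  case (Suc i)
  have "group (G\<lparr>carrier := pchain p G i\<rparr>)" using Suc assms subgroup.subgroup_is_group by blast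
  from subgroup_pstep[OF this] show ?case using Suc assms by (auto intro: subgroup_trans)
qed

lemma normal_pstep:
  fixes G (structure)
  assumes "group G" shows "pstep p G \<lhd> G"
proof -
  interpret group G by fact
  have "x \<otimes> h \<otimes> inv x \<in> pstep p G" if "x \<in> carrier G" "h \<in> pstep p G" for x h
  proof -
    have h: "h \<in> carrier G" using that by (auto simp: pstep_def)
    have "\<chi> (x \<otimes> h \<otimes> inv x) = \<chi> h" if "int_character G \<chi>" for \<chi>
    proof -
      have "\<chi> (x \<otimes> h \<otimes> inv x) = \<chi> (x \<otimes> h) + \<chi> (inv x)" "\<chi> (x \<otimes> h) = \<chi> x + \<chi> h"
        using that \<open>x \<in> carrier G\<close> h unfolding int_character_def by auto
      then show ?thesis using int_character_inv[OF assms that \<open>x \<in> carrier G\<close>] by simp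
    qed
    then have "int p dvd \<chi> (x \<otimes> h \<otimes> inv x)" if "int_character G \<chi>" for \<chi>
      unfolding \<open>\<And>\<chi>. int_character G \<chi> \<Longrightarrow> \<chi> (x \<otimes> h \<otimes> inv x) = \<chi> h\<close>[OF that]
      using that \<open>h \<in> pstep p G\<close> by (simp add: pstep_def)
    then show ?thesis using \<open>x \<in> carrier G\<close> h by (intro pstepI) auto
  qed
  then show ?thesis using subgroup_pstep[OF assms] normal_inv_iff by blast
qed

lemma chain_sum_single:
  "(\<Sum>k\<in>Poly_Mapping.keys (Poly_Mapping.single x q). Poly_Mapping.lookup (Poly_Mapping.single x q) k * f k) = q * (f x::rat)"
  by (cases "q = 0") auto

text \<open>
  A character extends linearly to rational chains, and additivity says exactly that the extension kills
  boundaries; so characters factor through rational homology.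
\<close>

lemma rad_rat_subset_pstep: assumes "group G" shows "rad_rat G \<subseteq> pstep p G"
proof
  fix g assume "g \<in> rad_rat G"
  then have g: "g \<in> carrier G" "Poly_Mapping.single g 1 \<in> bar_boundaries1 G" using rad_rat_iff[OF assms] by auto
  then obtain c where c: "Poly_Mapping.keys c \<subseteq> carrier G \<times> carrier G" "bar_boundary2 G c = Poly_Mapping.single g 1"
    by (auto simp: bar_boundaries1_def rat_chains_def)
  have "\<chi> g = 0" if ch: "int_character G \<chi>" for \<chi>
  proof -
    define L where "L d = (\<Sum>k\<in>Poly_Mapping.keys d. Poly_Mapping.lookup d k * rat_of_int (\<chi> k))" for d
    have sup: "L d = (\<Sum>k\<in>A. Poly_Mapping.lookup d k * rat_of_int (\<chi> k))"
      if "finite A" "Poly_Mapping.keys d \<subseteq> A" for d A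
      unfolding L_def using that by (intro sum.mono_neutral_left) (auto simp: in_keys_iff)
    have add: "L (d + e) = L d + L e" for d e
      using sup[of "Poly_Mapping.keys d \<union> Poly_Mapping.keys e" "d + e"]
        sup[of "Poly_Mapping.keys d \<union> Poly_Mapping.keys e" d] sup[of "Poly_Mapping.keys d \<union> Poly_Mapping.keys e" e]
        Poly_Mapping.keys_add[of d e]
      by (simp add: lookup_add sum.distrib distrib_right)
    have single: "L (Poly_Mapping.single x q) = q * rat_of_int (\<chi> x)" for x q
      unfolding L_def by (rule chain_sum_single)
    have z: "L 0 = 0" by (simp add: L_def)
    have diff: "L (d - e) = L d - L e" for d e using add[of "d - e" e] by simp
    have Lsum: "L (sum f A) = (\<Sum>a\<in>A. L (f a))" for f :: "'a \<times> 'a \<Rightarrow> 'a \<Rightarrow>\<^sub>0 rat" and A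
      by (induction A rule: infinite_finite_induct) (auto simp: z add)
    have "L (bar_boundary2 G c) = 0"
      unfolding bar_boundary2_def Lsum
    proof (rule sum.neutral, clarify)
      fix x y assume "(x, y) \<in> Poly_Mapping.keys c"
      then have "x \<in> carrier G" "y \<in> carrier G" using c by auto
      then have "\<chi> (x \<otimes>\<^bsub>G\<^esub> y) = \<chi> x + \<chi> y" using ch by (auto simp: int_character_def)
      then show "L (Poly_Mapping.single y (Poly_Mapping.lookup c (x, y)) -
            Poly_Mapping.single (x \<otimes>\<^bsub>G\<^esub> y) (Poly_Mapping.lookup c (x, y)) +
            Poly_Mapping.single x (Poly_Mapping.lookup c (x, y))) = 0"
        by (simp add: add diff single algebra_simps)
    qed
    then show ?thesis using c single by simp
  qed
  then have "int p dvd \<chi> g" if "int_character G \<chi>" for \<chi> using that by (metis dvd_0_right)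
  then show "g \<in> pstep p G" using g by (intro pstepI) assumption+
qed

lemma finite_elementary_abelian_Mod_pstep:
  fixes G (structure)
  assumes fg: "finitely_generated_group G" and p: "0 < p"
  shows "finite_elementary_abelian p (G Mod pstep p G)" and "finite (rcosets\<^bsub>G\<^esub> (pstep p G))"
proof -
  interpret group G using fg by (simp add: finitely_generated_group_def)
  obtain S where S: "S \<subseteq> carrier G" "finite S" "generate G S = carrier G"
    using fg by (auto simp: finitely_generated_group_def)
  let ?N = "pstep p G"
  interpret N: normal ?N G by (rule normal_pstep[OF is_group])
  have sN: "subgroup ?N G" by (rule N.is_subgroup)
  have cosI: "?N #> x = ?N #> y" if "x \<in> carrier G" "y \<in> carrier G" "x \<otimes> inv y \<in> ?N" for x y
  proof -
    have "x = (x \<otimes> inv y) \<otimes> y" using that by (simp add: m_assoc)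
    then have "x \<in> ?N #> y" using that(3) unfolding r_coset_def by blast
    then show ?thesis using repr_independence[OF _ that(2) sN] by simp
  qed
  have carr: "carrier (G Mod ?N) = (\<lambda>x. ?N #> x) ` carrier G" by (auto simp: FactGroup_def RCOSETS_def)
  have mult: "(?N #> x) \<otimes>\<^bsub>G Mod ?N\<^esub> (?N #> y) = ?N #> (x \<otimes> y)" if "x \<in> carrier G" "y \<in> carrier G" for x y
    using N.rcos_sum[OF that] by simp
  interpret Q: group "G Mod ?N" by (rule N.factorgroup_is_group)
  interpret h: group_hom G "G Mod ?N" "\<lambda>x. ?N #> x"
    by (rule group_hom.intro[OF is_group Q.is_group]) (simp add: group_hom_axioms_def N.r_coset_hom_Mod)
  have comm: "x \<otimes>\<^bsub>G Mod ?N\<^esub> y = y \<otimes>\<^bsub>G Mod ?N\<^esub> x" if xy: "x \<in> carrier (G Mod ?N)" "y \<in> carrier (G Mod ?N)" for x y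
  proof -
    obtain a where a: "a \<in> carrier G" "x = ?N #> a" using xy(1) unfolding carr by blast
    obtain b where b: "b \<in> carrier G" "y = ?N #> b" using xy(2) unfolding carr by blast
    note ab = a(1) b(1) a(2) b(2)
    have "\<chi> (a \<otimes> b \<otimes> inv (b \<otimes> a)) = 0" if "int_character G \<chi>" for \<chi>
    proof -
      have "\<chi> (a \<otimes> b \<otimes> inv (b \<otimes> a)) = \<chi> (a \<otimes> b) + \<chi> (inv (b \<otimes> a))"
        "\<chi> (a \<otimes> b) = \<chi> a + \<chi> b" "\<chi> (b \<otimes> a) = \<chi> b + \<chi> a"
        using ab(1,2) that by (simp_all add: int_character_def)
      moreover have "\<chi> (inv (b \<otimes> a)) = - \<chi> (b \<otimes> a)"
        using ab(1,2) by (intro int_character_inv[OF is_group that]) simp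
      ultimately show ?thesis by simp
    qed
    then have "int p dvd \<chi> (a \<otimes> b \<otimes> inv (b \<otimes> a))" if "int_character G \<chi>" for \<chi>
      using that by (metis dvd_0_right)
    then have "a \<otimes> b \<otimes> inv (b \<otimes> a) \<in> ?N" using ab(1,2) by (intro pstepI) auto
    then have "?N #> (a \<otimes> b) = ?N #> (b \<otimes> a)" using ab(1,2) by (intro cosI) simp_all
    then show ?thesis unfolding ab(3,4) mult[OF ab(1,2)] mult[OF ab(2,1)] .
  qed
  interpret Q: comm_group "G Mod ?N" by unfold_locales (rule comm)
  have ex: "x [^]\<^bsub>G Mod ?N\<^esub> p = \<one>\<^bsub>G Mod ?N\<^esub>" if x: "x \<in> carrier (G Mod ?N)" for x
  proof -
    obtain a where a: "a \<in> carrier G" "x = ?N #> a" using x unfolding carr by blast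
    have "int p dvd \<chi> (a [^] p)" if "int_character G \<chi>" for \<chi>
      unfolding int_character_pow[OF is_group that a(1)] by simp
    then have "a [^] p \<in> ?N" using a(1) by (intro pstepI) auto
    then have "?N #> (a [^] p) = ?N" using N.rcos_const[OF is_group] by simp
    moreover have "x [^]\<^bsub>G Mod ?N\<^esub> p = ?N #> (a [^] p)" unfolding a(2) h.hom_nat_pow[OF a(1)] ..
    ultimately show ?thesis by (simp add: FactGroup_def)
  qed
  have "generate (G Mod ?N) ((\<lambda>x. ?N #> x) ` S) = carrier (G Mod ?N)"
    using h.generate_img[OF S(1)] S(3) carr by simp
  moreover have "finite (generate (G Mod ?N) ((\<lambda>x. ?N #> x) ` S))"
    using S carr by (intro Q.finite_if_fin_gen_exponent[OF p ex]) auto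
  ultimately have fin: "finite (carrier (G Mod ?N))" by simp
  then show "finite_elementary_abelian p (G Mod ?N)" unfolding finite_elementary_abelian_def
    using Q.comm_group_axioms ex by blast
  show "finite (rcosets ?N)" using fin by (simp add: FactGroup_def)
qed

text \<open>
  The chain of \<open>pstep\<close>s satisfies every condition except triviality of its intersection. Finite
  generation has to be carried along, since it makes each quotient finite.
\<close>

theorem RFRp_if_presidual_trivial:
  assumes fg: "finitely_generated_group G" and p: "0 < p" and res: "presidual p G = {\<one>\<^bsub>G\<^esub>}"
  shows "RFRp p G"
proof -
  have G: "group G" using fg by (simp add: finitely_generated_group_def)
  let ?K = "pchain p G"
  let ?L = "\<lambda>i. G\<lparr>carrier := ?K i\<rparr>"
  have gL: "group (?L i)" for i using subgroup.subgroup_is_group[OF subgroup_pchain[OF G] G] .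
  have fgL: "finitely_generated_group (?L i)" for i
  proof (induction i)
    case 0 then show ?case using fg by simp
  next
    case (Suc i)
    from finitely_generated_finite_index[OF Suc subgroup_pstep[OF gL] finite_elementary_abelian_Mod_pstep(2)[OF Suc p]]
    show ?case by simp
  qed
  show ?thesis unfolding RFRp_def
    using fg subgroup_pchain[OF G] normal_pstep[OF gL] rad_rat_subset_pstep[OF gL] res
      finite_elementary_abelian_Mod_pstep(1)[OF fgL p]
    by (intro conjI exI[of _ ?K]) (auto simp: presidual_def)
qed

lemma hom_multD: "h \<in> hom G H \<Longrightarrow> x \<in> carrier G \<Longrightarrow> y \<in> carrier G \<Longrightarrow> h (x \<otimes>\<^bsub>G\<^esub> y) = h x \<otimes>\<^bsub>H\<^esub> h y"
  by (auto simp: hom_def)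

lemma pchain_subset_carrier: "pchain p G i \<subseteq> carrier G"
  by (induction i) (auto simp: pstep_def)

lemma pchain_Suc_subset: "pchain p G (Suc i) \<subseteq> pchain p G i"
  by (auto simp: pstep_def)

text \<open>
  Characters pull back along homomorphisms, so each term of the chain maps into the corresponding one.
  This is what allows elements to be detected in quotients and in overgroups.
\<close>

lemma pchain_hom:
  assumes "h \<in> hom G H" "g \<in> pchain p G i" shows "h g \<in> pchain p H i"
  using assms(2)
proof (induction i arbitrary: g)
  case 0 then show ?case using assms(1) by (auto simp: hom_def)
next
  case (Suc i)
  have g: "g \<in> pchain p G i" using Suc.prems pchain_Suc_subset[of p G i] by (rule rev_subsetD)
  have "int p dvd \<chi> (h g)" if ch: "int_character (H\<lparr>carrier := pchain p H i\<rparr>) \<chi>" for \<chi>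
  proof -
    have "int_character (G\<lparr>carrier := pchain p G i\<rparr>) (\<chi> \<circ> h)"
      using ch Suc.IH pchain_subset_carrier[of p G i] by (auto simp: int_character_def hom_multD[OF assms(1)] subset_iff)
    then show ?thesis using Suc.prems by (auto simp: pstep_def)
  qed
  then show ?case using Suc.IH[OF g] by (auto simp: pstep_def)
qed

lemma presidual_hom: "h \<in> hom G H \<Longrightarrow> g \<in> presidual p G \<Longrightarrow> h g \<in> presidual p H"
  by (auto simp: presidual_def intro: pchain_hom)

lemma pstep_mono:
  assumes "A \<subseteq> B" shows "pstep p (G\<lparr>carrier := A\<rparr>) \<subseteq> pstep p (G\<lparr>carrier := B\<rparr>)"
proof
  fix g assume g: "g \<in> pstep p (G\<lparr>carrier := A\<rparr>)"
  have "int_character (G\<lparr>carrier := A\<rparr>) \<chi>" if "int_character (G\<lparr>carrier := B\<rparr>) \<chi>" for \<chi>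
    using that assms by (auto simp: int_character_def subset_iff)
  then show "g \<in> pstep p (G\<lparr>carrier := B\<rparr>)" using g assms by (auto simp: pstep_def)
qed

lemma presidual_subgroup:
  assumes H: "pstep p G \<subseteq> H"
  shows "presidual p G \<subseteq> presidual p (G\<lparr>carrier := H\<rparr>)"
proof -
  have "pchain p G (Suc i) \<subseteq> pchain p (G\<lparr>carrier := H\<rparr>) i" for i
  proof (induction i)
    case 0 then show ?case using H by simp
  next
    case (Suc i)
    then show ?case using pstep_mono[OF Suc, of p G] by simp
  qed
  then show ?thesis unfolding presidual_def by blast
qed

lemma one_in_presidual: "group G \<Longrightarrow> \<one>\<^bsub>G\<^esub> \<in> presidual p G"
  using subgroup_pchain subgroup.one_closed by (fastforce simp: presidual_def)

lemma presidual_subset_pstep: "presidual p G \<subseteq> pstep p G"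
proof -
  have "presidual p G \<subseteq> pchain p G (Suc 0)" unfolding presidual_def by blast
  then show ?thesis by simp
qed

text \<open>
  Finite generation is left out so that the property passes to arbitrary subgroups; Artin groups
  have it anyway.
\<close>

definition virtually_separated :: "nat \<Rightarrow> ('a, 'b) monoid_scheme \<Rightarrow> bool" where
  "virtually_separated p G \<longleftrightarrow> group G \<and> (\<exists>H. subgroup H G \<and> finite (rcosets\<^bsub>G\<^esub> H) \<and> presidual p (G\<lparr>carrier := H\<rparr>) = {\<one>\<^bsub>G\<^esub>})"

lemma virtually_RFRp_if_virtually_separated:
  assumes "virtually_separated p G" "finitely_generated_group G" "0 < p" shows "virtually_RFRp p G"
  using assms finitely_generated_finite_index[of G] unfolding virtually_separated_def virtually_RFRp_def
  by (auto intro!: RFRp_if_presidual_trivial)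

section \<open>Free bases and their exponent characters\<close>

definition perm_rep :: "('a, 'b) monoid_scheme \<Rightarrow> 'a set \<Rightarrow> ('a \<Rightarrow> 'o \<Rightarrow> 'o) \<Rightarrow> bool" where
  "perm_rep G K h \<longleftrightarrow> (\<forall>x\<in>K. bij (h x)) \<and> (\<forall>x\<in>K. \<forall>y\<in>K. h (x \<otimes>\<^bsub>G\<^esub> y) = h x \<circ> h y)"

lemma perm_repD:
  assumes "perm_rep G K h"
  shows "x \<in> K \<Longrightarrow> bij (h x)" "x \<in> K \<Longrightarrow> y \<in> K \<Longrightarrow> h (x \<otimes>\<^bsub>G\<^esub> y) = h x \<circ> h y"
  using assms unfolding perm_rep_def by blast+

text \<open>
  Freeness as a universal property, tested on permutations of \<open>\<nat>\<close> only. Every use below constructs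
  or exploits such an action, and reduced words never enter.
\<close>

definition free_basis :: "('a, 'b) monoid_scheme \<Rightarrow> 'a set \<Rightarrow> bool" where
  "free_basis G B \<longleftrightarrow> B \<subseteq> carrier G \<and>
     (\<forall>f :: 'a \<Rightarrow> nat \<Rightarrow> nat. (\<forall>b\<in>B. bij (f b)) \<longrightarrow>
       (\<exists>h. perm_rep G (generate G B) h \<and> (\<forall>b\<in>B. h b = f b)))"

lemma free_basis_extend:
  fixes f :: "'a \<Rightarrow> 'o \<Rightarrow> 'o" and enc :: "'o \<Rightarrow> nat"
  assumes B: "free_basis G B" and enc: "bij enc" and f: "\<And>b. b \<in> B \<Longrightarrow> bij (f b)"
  shows "\<exists>h. perm_rep G (generate G B) h \<and> (\<forall>b\<in>B. h b = f b)"
proof -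
  let ?dec = "inv_into UNIV enc"
  have ie: "?dec (enc x) = x" "enc (?dec n) = n" for x n
    using enc by (simp_all add: bij_is_inj bij_is_surj surj_f_inv_f)
  have "\<forall>b\<in>B. bij (enc \<circ> f b \<circ> ?dec)" using enc f by (auto intro!: bij_comp bij_imp_bij_inv)
  then have "\<exists>H. perm_rep G (generate G B) H \<and> (\<forall>b\<in>B. H b = enc \<circ> f b \<circ> ?dec)"
    using B[unfolded free_basis_def, THEN conjunct2, THEN spec, of "\<lambda>b. enc \<circ> f b \<circ> ?dec"] by (rule rev_mp)
  then obtain H where H: "perm_rep G (generate G B) H" "\<forall>b\<in>B. H b = enc \<circ> f b \<circ> ?dec" by (elim exE conjE)
  have "perm_rep G (generate G B) (\<lambda>x. ?dec \<circ> H x \<circ> enc)"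
    unfolding perm_rep_def
  proof (intro conjI ballI)
    show "bij (?dec \<circ> H x \<circ> enc)" if "x \<in> generate G B" for x
      using perm_repD(1)[OF H(1) that] enc by (auto intro!: bij_comp bij_imp_bij_inv)
    show "?dec \<circ> H (x \<otimes>\<^bsub>G\<^esub> y) \<circ> enc = (?dec \<circ> H x \<circ> enc) \<circ> (?dec \<circ> H y \<circ> enc)"
      if "x \<in> generate G B" "y \<in> generate G B" for x y
      unfolding perm_repD(2)[OF H(1) that] using ie by (simp add: fun_eq_iff)
  qed
  moreover have "\<forall>b\<in>B. ?dec \<circ> H b \<circ> enc = f b"
    using H(2) ie by (simp add: fun_eq_iff)
  ultimately show ?thesis by (intro exI[of _ "\<lambda>x. ?dec \<circ> H x \<circ> enc"] conjI)
qed

context group begin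

lemma inv_cancel_left:
  assumes "x \<in> carrier G" "y \<in> carrier G"
  shows "inv x \<otimes> (x \<otimes> y) = y" "x \<otimes> (inv x \<otimes> y) = y"
  using assms by (simp_all add: m_assoc[symmetric])

lemma perm_action_one_inv:
  fixes h :: "'a \<Rightarrow> 'o \<Rightarrow> 'o"
  assumes K: "subgroup K G" and h0: "perm_rep G K h"
  shows "h \<one> = id" and "x \<in> K \<Longrightarrow> h (inv x) (h x w) = w" and "x \<in> K \<Longrightarrow> h x (h (inv x) w) = w"
proof -
  note h = perm_repD[OF h0]
  have one: "\<one> \<in> K" using K subgroup.one_closed by blast
  have "h \<one> \<circ> h \<one> = h \<one>" using h(2)[OF one one] by simp
  then have "h \<one> (h \<one> w) = h \<one> w" for w by (metis comp_apply)
  then show o: "h \<one> = id" using bij_is_inj[OF h(1)[OF one]] by (auto simp: inj_def)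
  assume x: "x \<in> K"
  then have xi: "inv x \<in> K" "x \<in> carrier G" using subgroup.m_inv_closed[OF K] subgroup.mem_carrier[OF K] by auto
  show "h (inv x) (h x w) = w" "h x (h (inv x) w) = w"
    using h(2)[OF x xi(1)] h(2)[OF xi(1) x] xi(2) o by (simp_all add: fun_eq_iff)
qed

lemma int_character_int_pow:
  assumes ch: "int_character (G\<lparr>carrier := K\<rparr>) e" and K: "subgroup K G" and x: "x \<in> K"
  shows "e (x [^] (i::int)) = i * e x"
proof -
  have grp: "group (G\<lparr>carrier := K\<rparr>)" using K is_group subgroup.subgroup_is_group by blast
  have nat: "e (x [^] n) = int n * e x" for n :: nat
    using int_character_pow[OF grp ch, of x n] x by (simp add: nat_pow_consistent[symmetric])
  have cl: "x [^] n \<in> K" for n :: nat using K x by (induction n) (auto simp: subgroup.one_closed subgroup.m_closed)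
  have inv: "e (inv (x [^] n)) = - e (x [^] n)" for n :: nat
    using int_character_inv[OF grp ch, of "x [^] n"] cl[of n] m_inv_consistent[OF K cl[of n]] by simp
  show ?thesis
  proof (cases i rule: int_cases2)
    case (nonneg n) then show ?thesis using nat by (simp add: int_pow_int)
  next
    case (nonpos n) then show ?thesis using nat[of n] inv[of n] subgroup.mem_carrier[OF K x] by (simp add: int_pow_neg_int)
  qed
qed

text \<open>
  The exponent sum of \<open>c\<close>, read off from the action in which \<open>c\<close> translates \<open>\<int>\<close> and the other basis elements
  act trivially. The last clause is the part of "the centraliser of \<open>b\<close> is generated by \<open>b\<close>" that is
  needed; it holds because \<open>b\<close> and a translate of \<open>b\<close> by a nonzero power of \<open>c\<close> have different supports in a
  lamplighter action.
\<close>

lemma free_basis_exponent: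
  assumes B: "free_basis G B" and c: "c \<in> B"
  obtains e where "int_character (G\<lparr>carrier := generate G B\<rparr>) e" "e c = 1"
    "\<And>b. b \<in> B \<Longrightarrow> b \<noteq> c \<Longrightarrow> e b = 0"
    "\<And>b u. b \<in> B \<Longrightarrow> b \<noteq> c \<Longrightarrow> u \<in> generate G B \<Longrightarrow> u \<otimes> b = b \<otimes> u \<Longrightarrow> e u = 0"
proof -
  let ?K = "generate G B"
  have Bc: "B \<subseteq> carrier G" using B by (simp add: free_basis_def)
  have K: "subgroup ?K G" using generate_is_subgroup[OF Bc] .
  note gc = generate_in_carrier[OF Bc]
  have "bij (\<lambda>x::int. x + 1)" by (rule o_bij[of "\<lambda>x. x - 1"]) auto
  then have fb: "bij (if b = c then (\<lambda>x::int. x + 1) else id)" for b by auto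
  have "\<exists>h. perm_rep G ?K h \<and> (\<forall>b\<in>B. h b = (if b = c then (\<lambda>x::int. x + 1) else id))"
    by (rule free_basis_extend[OF B bij_int_encode fb])
  then obtain h where h0: "perm_rep G ?K h" and hB: "\<forall>b\<in>B. h b = (if b = c then (\<lambda>x::int. x + 1) else id)"
    by (elim exE conjE)
  note h = perm_repD[OF h0] bspec[OF hB]
  define e where "e k = h k 0" for k
  have shift: "h k x = x + e k" if "k \<in> ?K" for k x
    using that
  proof (induction arbitrary: x rule: generate.induct)
    case one then show ?case using perm_action_one_inv(1)[OF K h0] by (simp add: e_def)
  next
    case (incl b) then show ?case using h(3)[of b] by (auto simp: e_def)
  next
    case (inv b)
    have b: "b \<in> ?K" using inv by (rule generate.incl)
    have s: "h b y = y + h b 0" for y using h(3)[OF inv] by auto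
    have "h b (h (inv b) y) = y" for y by (rule perm_action_one_inv(3)[OF K h0 b])
    then have "h (inv b) y = y - h b 0" for y using s by (metis add_diff_cancel_right')
    then show ?case by (simp add: e_def)
  next
    case (eng h1 h2)
    have "h (h1 \<otimes> h2) y = y + (e h2 + e h1)" for y
      unfolding h(2)[OF eng(1,2)] comp_apply eng.IH(1) eng.IH(2) by simp
    then show ?case by (simp add: e_def)
  qed
  have "e (x \<otimes> y) = e x + e y" if "x \<in> ?K" "y \<in> ?K" for x y
    using h(2)[OF that] shift[OF that(1), of "e y"] by (simp add: e_def)
  then have ch: "int_character (G\<lparr>carrier := ?K\<rparr>) e" by (simp add: int_character_def)
  have ec: "e c = 1" and eb: "\<And>b. b \<in> B \<Longrightarrow> b \<noteq> c \<Longrightarrow> e b = 0" using h(3) c by (auto simp: e_def)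
  have grp: "group (G\<lparr>carrier := ?K\<rparr>)" using K is_group subgroup.subgroup_is_group by blast
  have "e u = 0" if b: "b \<in> B" "b \<noteq> c" and u: "u \<in> ?K" "u \<otimes> b = b \<otimes> u" for b u
  proof -
    \<comment> \<open>A copy of \<open>\<int>\<close> sits over each point of \<open>\<int>\<close>: \<open>c\<close> moves the base point, \<open>b\<close> acts on the copy over \<open>0\<close> only.
      If \<open>u\<close> commutes with \<open>b\<close>, it has to preserve that copy, hence the base point.\<close>
    define f :: "'a \<Rightarrow> int \<times> int \<Rightarrow> int \<times> int" where
      "f x = (if x = c then (\<lambda>(y, i). (y, i + 1)) else if x = b then (\<lambda>(y, i). if i = 0 then (y + 1, i) else (y, i)) else id)" for x
    have "bij (\<lambda>(y::int, i::int). (y, i + 1))" by (rule o_bij[of "\<lambda>(y, i). (y, i - 1)"]) auto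
    moreover have "bij (\<lambda>(y::int, i::int). if i = 0 then (y + 1, i) else (y, i))"
      by (rule o_bij[of "\<lambda>(y, i). if i = 0 then (y - 1, i) else (y, i)"]) (auto simp: fun_eq_iff)
    ultimately have f: "bij (f x)" for x by (simp add: f_def)
    have "bij (prod_encode \<circ> map_prod int_encode int_encode)"
    proof (intro bij_comp bij_prod_encode)
      show "bij (map_prod int_encode int_encode)"
        by (rule o_bij[of "map_prod int_decode int_decode"]) (auto simp: fun_eq_iff)
    qed
    then have "\<exists>h. perm_rep G ?K h \<and> (\<forall>b\<in>B. h b = f b)"
      using f by (intro free_basis_extend[OF B])
    then obtain h where h0: "perm_rep G ?K h" and hB: "\<forall>b\<in>B. h b = f b" by (elim exE conjE)
    note h = perm_repD[OF h0] bspec[OF hB]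
    have gen: "\<exists>q. \<forall>y i. h k (y, i) = (y + q i, i + e k)" if "k \<in> B" for k
    proof -
      have "\<forall>y i. h k (y, i) = (y + (if k = b \<and> i = 0 then 1 else 0), i + e k)"
        using h(3)[OF that] b ec eb[OF that] by (auto simp: f_def)
      then show ?thesis by (rule exI[of _ "\<lambda>i. if k = b \<and> i = 0 then 1 else 0"])
    qed
    have "\<exists>q. \<forall>y i. h k (y, i) = (y + q i, i + e k)" if "k \<in> ?K" for k
      using that
    proof (induction rule: generate.induct)
      case one then show ?case using perm_action_one_inv(1)[OF K h0] int_character_one[OF grp ch]
        by (intro exI[of _ "\<lambda>_. 0"]) simp
    next
      case (incl k) then show ?case using gen by simp
    next
      case (inv k)
      have k: "k \<in> ?K" using inv by (rule generate.incl)
      obtain q where q: "h k (y, i) = (y + q i, i + e k)" for y i using gen[OF inv] by blast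
      have "e (inv k) = - e k" using int_character_inv[OF grp ch, of k] k m_inv_consistent[OF K k] by simp
      moreover have "h (inv k) (y, i) = (y - q (i - e k), i - e k)" for y i
      proof -
        have "h k (y - q (i - e k), i - e k) = (y, i)" using q by simp
        then show ?thesis using perm_action_one_inv(2)[OF K h0 k, of "(y - q (i - e k), i - e k)"] by simp
      qed
      ultimately show ?case by (intro exI[of _ "\<lambda>i. - q (i - e k)"]) simp
    next
      case (eng k l)
      then obtain q r where q: "\<forall>y i. h k (y, i) = (y + q i, i + e k)" "\<forall>y i. h l (y, i) = (y + r i, i + e l)" by auto
      have "e (k \<otimes> l) = e k + e l" using ch eng by (auto simp: int_character_def)
      then show ?case using q h(2)[OF eng(1,2)] by (intro exI[of _ "\<lambda>i. r i + q (i + e l)"]) (simp add: algebra_simps)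
    qed
    then obtain q where q: "h u (y, i) = (y + q i, i + e u)" for y i using u(1) by metis
    have bK: "b \<in> ?K" using b by (simp add: generate.incl)
    have "h u (h b (0, 0)) = h b (h u (0, 0))" using h(2)[OF u(1) bK] h(2)[OF bK u(1)] u(2) by (metis comp_apply)
    then show ?thesis using q h(3)[OF b(1)] b(2) by (auto simp: f_def split: if_splits)
  qed
  then show ?thesis using that ch ec eb by blast
qed

lemma int_pow_conj:
  assumes "h \<in> carrier G" "u \<in> carrier G" "c \<in> carrier G" "h \<otimes> c \<otimes> inv h = u \<otimes> c \<otimes> inv u"
  shows "h \<otimes> c [^] (a::int) \<otimes> inv h = u \<otimes> c [^] a \<otimes> inv u"
proof -
  have nat: "x \<otimes> c [^] (n::nat) \<otimes> inv x = (x \<otimes> c \<otimes> inv x) [^] n" if "x \<in> carrier G" for x n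
  proof (induction n)
    case (Suc n)
    have "x \<otimes> c [^] Suc n \<otimes> inv x = (x \<otimes> c [^] n \<otimes> inv x) \<otimes> (x \<otimes> c \<otimes> inv x)"
      using that assms(3) by (simp add: m_assoc inv_cancel_left)
    then show ?case unfolding Suc by simp
  qed (use that in simp)
  have "x \<otimes> c [^] a \<otimes> inv x = (x \<otimes> c \<otimes> inv x) [^] a" if x: "x \<in> carrier G" for x
  proof (cases a rule: int_cases2)
    case (nonneg n) then show ?thesis using nat[OF x] by (simp add: int_pow_int)
  next
    case (nonpos n)
    have "x \<otimes> inv (c [^] n) \<otimes> inv x = inv (x \<otimes> c [^] n \<otimes> inv x)"
      using x assms(3) by (simp add: inv_mult_group m_assoc)
    then show ?thesis using nat[OF x, of n] nonpos x assms(3) by (simp add: int_pow_neg_int)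
  qed
  then show ?thesis using assms by simp
qed

text \<open>
  Products of at most \<open>n\<close> letters from \<open>B\<close> and its inverses, reduced or not. The radius is the quantity
  on which the main induction runs.
\<close>

primrec word_ball :: "'a set \<Rightarrow> nat \<Rightarrow> 'a set" where
  "word_ball B 0 = {\<one>}"
| "word_ball B (Suc n) = insert \<one> {l \<otimes> w | l w. l \<in> B \<union> (\<lambda>b. inv b) ` B \<and> w \<in> word_ball B n}"

lemma word_ball_generate: "w \<in> word_ball B n \<Longrightarrow> w \<in> generate G B"
proof (induction n arbitrary: w)
  case (Suc n)
  have "l \<in> generate G B" if "l \<in> B \<union> (\<lambda>b. inv b) ` B" for l
    using that by (auto intro: generate.incl generate.inv)
  then show ?case using Suc by (auto intro: generate.one generate.eng)
qed (simp add: generate.one)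

lemma one_in_word_ball: "\<one> \<in> word_ball B n"
  by (cases n) auto

lemma word_ball_Suc: "w \<in> word_ball B n \<Longrightarrow> w \<in> word_ball B (Suc n)"
proof (induction n arbitrary: w)
  case (Suc n)
  show ?case
  proof (cases "w = \<one>")
    case True then show ?thesis using one_in_word_ball by simp
  next
    case False
    then obtain l u where "w = l \<otimes> u" "l \<in> B \<union> (\<lambda>b. inv b) ` B" "u \<in> word_ball B n" using Suc.prems by auto
    then show ?thesis using Suc.IH[of u] unfolding word_ball.simps(2)[of B "Suc n"] by blast
  qed
qed auto

lemma word_ball_mult:
  assumes Bc: "B \<subseteq> carrier G" and "v \<in> word_ball B m" "w \<in> word_ball B n"
  shows "v \<otimes> w \<in> word_ball B (m + n)"
  using assms(2)
proof (induction m arbitrary: v)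
  case 0 then show ?case using assms generate_in_carrier[OF Bc word_ball_generate] by simp
next
  case (Suc m)
  have wc: "w \<in> carrier G" using assms generate_in_carrier[OF Bc word_ball_generate] by blast
  have mono: "w \<in> word_ball B (k + n)" for k using assms(3) word_ball_Suc by (induction k) auto
  show ?case
  proof (cases "v = \<one>")
    case True then show ?thesis using mono[of "Suc m"] wc by simp
  next
    case False
    then obtain l u where lu: "v = l \<otimes> u" "l \<in> B \<union> (\<lambda>b. inv b) ` B" "u \<in> word_ball B m" using Suc.prems by auto
    have "l \<in> carrier G" "u \<in> carrier G" using lu Bc generate_in_carrier[OF Bc word_ball_generate] by auto
    then have "v \<otimes> w = l \<otimes> (u \<otimes> w)" using lu wc by (simp add: m_assoc)
    then show ?thesis using Suc.IH[OF lu(3)] lu(2) by auto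
  qed
qed

lemma generate_word_ball:
  assumes Bc: "B \<subseteq> carrier G" and "x \<in> generate G B" shows "\<exists>n. x \<in> word_ball B n"
  using assms(2)
proof (induction rule: generate.induct)
  case one show ?case using one_in_word_ball by blast
next
  case (incl b)
  then have "b \<otimes> \<one> \<in> word_ball B (Suc 0)" unfolding word_ball.simps by blast
  then show ?case using incl Bc by (metis r_one subsetD)
next
  case (inv b)
  then have "inv b \<otimes> \<one> \<in> word_ball B (Suc 0)" unfolding word_ball.simps by blast
  then show ?case using inv Bc by (metis r_one subsetD inv_closed)
next
  case (eng x y) then show ?case using word_ball_mult[OF Bc] by blast
qed

section \<open>Passing to a cyclic covering\<close>

text \<open>
  The Schreier basis of the kernel of (exponent sum of \<open>c\<close>) modulo \<open>p\<close>, for the transversal of powers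
  \<open>c\<^sup>a\<close> with \<open>-s \<le> a < p - s\<close>. Geometrically: loops around the punctures of a punctured plane, lifted to the
  \<open>p\<close>-fold cover branched at the puncture \<open>c\<close>, which is again a punctured plane. The free parameter \<open>s\<close>
  shifts the window of exponents.
\<close>

definition cyclic_basis :: "nat \<Rightarrow> nat \<Rightarrow> 'a set \<Rightarrow> 'a \<Rightarrow> 'a set" where
  "cyclic_basis p s B c = insert (c [^] int p)
     {c [^] a \<otimes> b \<otimes> c [^] (- a) | a b. b \<in> B \<and> b \<noteq> c \<and> - int s \<le> a \<and> a < int p - int s}"

lemma cyclic_basis_carrier:
  assumes "B \<subseteq> carrier G" "c \<in> B" shows "cyclic_basis p s B c \<subseteq> carrier G"
  using assms by (auto simp: cyclic_basis_def subset_iff)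

text \<open>
  Schreier rewriting does not increase length. Reading the word from the left, the current coset is
  remembered as an exponent \<open>j\<close> inside the window. A letter \<open>c\<close> or its inverse moves \<open>j\<close> and emits nothing
  unless \<open>j\<close> leaves the window, when one letter \<open>c\<^sup>p\<close> or its inverse is emitted; any other letter emits its
  conjugate by \<open>c\<^sup>j\<close>.
\<close>

lemma cyclic_basis_rewrite:
  assumes Bc: "B \<subseteq> carrier G" and c: "c \<in> B" and s: "s < p"
    and "w \<in> word_ball B m" "- int s \<le> j" "j < int p - int s"
  shows "\<exists>g\<in>word_ball (cyclic_basis p s B c) m. \<exists>j'. - int s \<le> j' \<and> j' < int p - int s \<and> c [^] j \<otimes> w = g \<otimes> c [^] j'"
  using assms(4-)
proof (induction m arbitrary: w j)
  case 0 then show ?case using c Bc by (auto intro!: exI[of _ j])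
next
  case (Suc m)
  let ?C = "cyclic_basis p s B c"
  have cc: "c \<in> carrier G" using c Bc by auto
  note Cc = cyclic_basis_carrier[OF Bc c, of p s]
  show ?case
  proof (cases "w = \<one>")
    case True then show ?thesis using Suc.prems cc one_in_word_ball by (auto intro!: bexI[of _ \<one>] exI[of _ j])
  next
    case False
    then obtain l u where lu: "w = l \<otimes> u" "l \<in> B \<union> (\<lambda>b. inv b) ` B" "u \<in> word_ball B m" using Suc.prems by auto
    have uc: "u \<in> carrier G" using lu generate_in_carrier[OF Bc word_ball_generate] by auto
    have lc: "l \<in> carrier G" using lu Bc by auto
    have skip: ?thesis if "- int s \<le> k" "k < int p - int s" "c [^] j \<otimes> w = c [^] k \<otimes> u" for k
      using Suc.IH[OF lu(3) that(1,2)] that(3) word_ball_Suc by metis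
    have emit: ?thesis if "- int s \<le> k" "k < int p - int s" "x \<in> ?C \<union> (\<lambda>b. inv b) ` ?C"
      "c [^] j \<otimes> w = x \<otimes> (c [^] k \<otimes> u)" for k x
    proof -
      note k = that
      obtain g j' where g: "g \<in> word_ball ?C m" "- int s \<le> j'" "j' < int p - int s" "c [^] k \<otimes> u = g \<otimes> c [^] j'"
        using Suc.IH[OF lu(3) k(1,2)] by blast
      have "x \<in> carrier G" "g \<in> carrier G" using that Cc g generate_in_carrier[OF Cc word_ball_generate] by auto
      then have "c [^] j \<otimes> w = (x \<otimes> g) \<otimes> c [^] j'" using that(4) g(4) cc by (simp add: m_assoc)
      moreover have "x \<otimes> g \<in> word_ball ?C (Suc m)" using that(3) g(1) by auto
      ultimately show ?thesis using g by blast
    qed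
    have add: "c [^] (a::int) \<otimes> (c [^] b \<otimes> u) = c [^] (a + b) \<otimes> u" for a b
      using cc uc by (simp add: int_pow_mult m_assoc)
    consider "l = c" | "l = inv c" | b where "b \<in> B" "b \<noteq> c" "l = b" | b where "b \<in> B" "b \<noteq> c" "l = inv b"
      using lu(2) by blast
    then show ?thesis
    proof cases
      case 1
      then have eq: "c [^] j \<otimes> w = c [^] (j + 1) \<otimes> u" using add[of j 1] lu cc by simp
      show ?thesis
      proof (cases "j + 1 < int p - int s")
        case True then show ?thesis using skip[of "j + 1"] eq Suc.prems by simp
      next
        case False
        then have "j + 1 = int p + - int s" using Suc.prems by simp
        then have "c [^] j \<otimes> w = c [^] int p \<otimes> (c [^] (- int s) \<otimes> u)" using eq add[of "int p" "- int s"] by simp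
        then show ?thesis using emit[of "- int s" "c [^] int p"] s by (simp add: cyclic_basis_def)
      qed
    next
      case 2
      then have eq: "c [^] j \<otimes> w = c [^] (j - 1) \<otimes> u" using add[of j "-1"] lu cc by (simp add: int_pow_neg)
      show ?thesis
      proof (cases "- int s \<le> j - 1")
        case True then show ?thesis using skip[of "j - 1"] eq Suc.prems by simp
      next
        case False
        then have "j - 1 = - int p + (int p - int s - 1)" using Suc.prems by simp
        then have "c [^] j \<otimes> w = inv (c [^] int p) \<otimes> (c [^] (int p - int s - 1) \<otimes> u)"
          using eq add[of "- int p" "int p - int s - 1"] cc by (simp add: int_pow_neg)
        then show ?thesis using emit[of "int p - int s - 1" "inv (c [^] int p)"] s by (simp add: cyclic_basis_def)
      qed
    next
      case (3 b)
      then have "c [^] j \<otimes> w = (c [^] j \<otimes> b \<otimes> c [^] (- j)) \<otimes> (c [^] j \<otimes> u)"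
        using lu lc uc cc by (simp add: m_assoc int_pow_neg inv_cancel_left)
      then show ?thesis using 3 Suc.prems by (intro emit[of j]) (auto simp: cyclic_basis_def)
    next
      case (4 b)
      then have bc: "b \<in> carrier G" using Bc by auto
      have "inv (c [^] j \<otimes> b \<otimes> c [^] (- j)) = c [^] j \<otimes> inv b \<otimes> c [^] (- j)"
        using bc cc by (simp add: inv_mult_group int_pow_neg m_assoc)
      moreover have "c [^] j \<otimes> w = (c [^] j \<otimes> inv b \<otimes> c [^] (- j)) \<otimes> (c [^] j \<otimes> u)"
        using lu(1) 4(3) uc cc bc by (simp add: m_assoc int_pow_neg inv_cancel_left)
      ultimately have "c [^] j \<otimes> w = inv (c [^] j \<otimes> b \<otimes> c [^] (- j)) \<otimes> (c [^] j \<otimes> u)" by simp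
      moreover have "c [^] j \<otimes> b \<otimes> c [^] (- j) \<in> ?C" using 4 Suc.prems by (auto simp: cyclic_basis_def)
      ultimately show ?thesis using Suc.prems by (intro emit[of j "inv (c [^] j \<otimes> b \<otimes> c [^] (- j))"]) blast+
    qed
  qed
qed

lemma cyclic_basis_generate:
  assumes Bc: "B \<subseteq> carrier G" and c: "c \<in> B"
  shows "generate G (cyclic_basis p s B c) \<subseteq> generate G B"
proof (rule generate_subgroup_incl[OF _ generate_is_subgroup[OF Bc]])
  have K: "subgroup (generate G B) G" by (rule generate_is_subgroup[OF Bc])
  have "c [^] (i::int) \<in> generate G B" for i
    using subgroup_int_pow_closed[OF K generate.incl[OF c]] .
  then show "cyclic_basis p s B c \<subseteq> generate G B" by (auto simp: cyclic_basis_def intro!: generate.eng intro: generate.incl)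
qed

text \<open>
  A prescribed action of the Schreier basis on \<open>\<nat>\<close> is extended to \<open>generate G B\<close> by inducing it: there
  are \<open>p\<close> sheets \<open>\<nat> \<times> {r}\<close>, permuted cyclically by \<open>c\<close>, and a basis element \<open>b \<noteq> c\<close> acts on sheet \<open>r\<close> the way its
  conjugate by \<open>c\<^sup>r\<^sup>-\<^sup>s\<close> should act. The prescribed action reappears on sheet \<open>s\<close>.
\<close>

lemma free_basis_cyclic_basis:
  assumes B: "free_basis G B" and c: "c \<in> B" and s: "s < p"
  shows "free_basis G (cyclic_basis p s B c)"
proof -
  let ?K = "generate G B" and ?C = "cyclic_basis p s B c"
  have Bc: "B \<subseteq> carrier G" using B by (simp add: free_basis_def)
  have cc: "c \<in> carrier G" using c Bc by auto
  note Cc = cyclic_basis_carrier[OF Bc c, of p s]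
  have K: "subgroup ?K G" using generate_is_subgroup[OF Bc] .
  have cK: "c [^] (i::int) \<in> ?K" for i using subgroup_int_pow_closed[OF K generate.incl[OF c]] .
  have "\<exists>h. perm_rep G (generate G ?C) h \<and> (\<forall>b\<in>?C. h b = f b)" if f: "\<forall>b\<in>?C. bij (f b)" for f :: "'a \<Rightarrow> nat \<Rightarrow> nat"
  proof -
    \<comment> \<open>Sheets with \<open>p \<le> r\<close> are padding, fixed pointwise, so that the carrier is all of \<open>\<nat> \<times> \<nat>\<close>.\<close>
    define F :: "'a \<Rightarrow> nat \<times> nat \<Rightarrow> nat \<times> nat" where
      "F b = (\<lambda>(w, r). if p \<le> r then (w, r)
         else if b = c then (if r = 0 then (f (c [^] int p) w, p - 1) else (w, r - 1))
         else (f (c [^] (int r - int s) \<otimes> b \<otimes> c [^] (- (int r - int s))) w, r))" for b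
    have fbij: "inv_into UNIV f' (f' x) = x" "f' (inv_into UNIV f' x) = x" if "bij f'" for f' :: "nat \<Rightarrow> nat" and x
      using that by (simp_all add: bij_is_inj bij_is_surj surj_f_inv_f)
    have mem: "c [^] (int r - int s) \<otimes> b \<otimes> c [^] (- (int r - int s)) \<in> ?C" if "b \<in> B" "b \<noteq> c" "r < p" for b r
      using that unfolding cyclic_basis_def by (intro insertI2 CollectI exI[of _ "int r - int s"] exI[of _ b]) auto
    have memc: "c [^] int p \<in> ?C" by (simp add: cyclic_basis_def)
    have "bij (F b)" if b: "b \<in> B" for b
    proof (cases "b = c")
      case True
      show ?thesis
        by (rule o_bij[of "\<lambda>(w, r). if p \<le> r then (w, r) else if r = p - 1 then (inv_into UNIV (f (c [^] int p)) w, 0) else (w, r + 1)"])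
          (use True s fbij f memc in \<open>auto simp: F_def fun_eq_iff\<close>)
    next
      case False
      have "bij (f (c [^] (int r - int s) \<otimes> b \<otimes> c [^] (- (int r - int s))))" if "r < p" for r
        using mem[OF b False that] f by blast
      note fb = fbij[OF this]
      show ?thesis
        by (rule o_bij[of "\<lambda>(w, r). if p \<le> r then (w, r) else (inv_into UNIV (f (c [^] (int r - int s) \<otimes> b \<otimes> c [^] (- (int r - int s)))) w, r)"])
          (use False fb in \<open>auto simp: F_def fun_eq_iff\<close>)
    qed
    then have "\<exists>h. perm_rep G ?K h \<and> (\<forall>b\<in>B. h b = F b)"
      by (intro free_basis_extend[OF B bij_prod_encode])
    then obtain h where h0: "perm_rep G ?K h" and hB: "\<forall>b\<in>B. h b = F b" by (elim exE conjE)
    note h = perm_repD[OF h0] bspec[OF hB]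
    have down: "h (c [^] int i) (w, r) = (w, r - i)" if "i \<le> r" "r < p" for i w r
      using that(1)
    proof (induction i)
      case 0 then show ?case using perm_action_one_inv(1)[OF K h0] by simp
    next
      case (Suc i)
      have "c [^] int (Suc i) = c \<otimes> c [^] int i" using int_pow_mult[OF cc, of 1 "int i"] cc by (simp add: add.commute)
      then have "h (c [^] int (Suc i)) (w, r) = h c (w, r - i)" using h(2)[OF generate.incl[OF c] cK] Suc by simp
      then show ?case using h(3)[OF c] Suc.prems that(2) by (simp add: F_def)
    qed
    have move: "h (c [^] (int r - int r')) (w, r) = (w, r')" if "r < p" "r' < p" for w r r'
    proof (cases "r' \<le> r")
      case True then show ?thesis using down[of "r - r'" r w] that by (simp add: of_nat_diff)
    next
      case False
      then have "h (c [^] int (r' - r)) (w, r') = (w, r)" using down[of "r' - r" r' w] that by simp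
      moreover have "c [^] (int r - int r') = inv (c [^] int (r' - r))"
        using False cc by (simp add: of_nat_diff flip: int_pow_neg)
      ultimately show ?thesis using perm_action_one_inv(2)[OF K h0 cK, of "int (r' - r)" "(w, r')"] by simp
    qed
    have onC: "h k (w, s) = (f k w, s)" if "k \<in> ?C" for k w
      using that unfolding cyclic_basis_def
    proof (elim insertE CollectE exE conjE)
      assume k: "k = c [^] int p"
      have "c [^] int p = c [^] (int (p - 1) - int s) \<otimes> (c \<otimes> c [^] (int s - int 0))"
        using cc s int_pow_mult[OF cc, of "int (p-1) - int s" "1 + int s"] int_pow_mult[OF cc, of 1 "int s"]
        by (simp add: of_nat_diff)
      then have "h (c [^] int p) (w, s) = h (c [^] (int (p - 1) - int s)) (h c (h (c [^] (int s - int 0)) (w, s)))"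
        using h(2)[OF cK generate.eng[OF generate.incl[OF c] cK], of "int (p - 1) - int s" "int s - int 0"]
          h(2)[OF generate.incl[OF c] cK, of "int s - int 0"] by simp
      also have "h (c [^] (int s - int 0)) (w, s) = (w, 0)" using move[of s 0 w] s by simp
      also have "h c (w, 0) = (f (c [^] int p) w, p - 1)" using h(3)[OF c] s by (simp add: F_def)
      also have "h (c [^] (int (p - 1) - int s)) (f (c [^] int p) w, p - 1) = (f (c [^] int p) w, s)" using move[of "p - 1" s] s by simp
      finally show ?thesis using k by simp
    next
      fix a b assume k: "k = c [^] a \<otimes> b \<otimes> c [^] - a" and b: "b \<in> B" "b \<noteq> c" and a: "- int s \<le> a" "a < int p - int s"
      define r where "r = nat (a + int s)"
      have r: "a = int r - int s" "r < p" "- a = int s - int r" using a by (auto simp: r_def)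
      have bK: "b \<in> ?K" using b by (simp add: generate.incl)
      have "h k (w, s) = h (c [^] a) (h b (h (c [^] (- a)) (w, s)))"
        using h(2)[OF generate.eng[OF cK bK] cK] h(2)[OF cK bK] k by simp
      also have "h (c [^] (- a)) (w, s) = (w, r)" unfolding r(3) using move[OF s r(2)] by simp
      also have "h b (w, r) = (f k w, r)" unfolding k r(1) using h(3)[OF b(1)] b r(2) by (simp add: F_def)
      also have "h (c [^] a) (f k w, r) = (f k w, s)" unfolding r(1) using move[OF r(2) s] by simp
      finally show ?thesis .
    qed
    have sub: "k \<in> generate G ?C \<Longrightarrow> k \<in> ?K" for k using cyclic_basis_generate[OF Bc c] by blast
    have fiber: "\<exists>g. bij g \<and> (\<forall>w. h k (w, s) = (g w, s))" if "k \<in> generate G ?C" for k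
      using that
    proof (induction rule: generate.induct)
      case one then show ?case using perm_action_one_inv(1)[OF K h0] by (intro exI[of _ id] conjI bij_id) simp
    next
      case (incl k) then show ?case using onC f by blast
    next
      case (inv k)
      have kK: "k \<in> ?K" using sub generate.incl inv by metis
      have "h (inv k) (w, s) = (inv_into UNIV (f k) w, s)" for w
        using perm_action_one_inv(2)[OF K h0 kK, of "(inv_into UNIV (f k) w, s)"] onC[OF inv] fbij(2)[of "f k"] f inv by simp
      then show ?case using f inv by (intro exI[of _ "inv_into UNIV (f k)"]) (auto intro: bij_imp_bij_inv)
    next
      case (eng x y)
      then obtain g1 g2 where "bij g1" "\<forall>w. h x (w, s) = (g1 w, s)" "bij g2" "\<forall>w. h y (w, s) = (g2 w, s)" by blast
      then show ?case using h(2)[OF sub sub] eng(1,2) by (intro exI[of _ "g1 \<circ> g2"] conjI bij_comp) simp_all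
    qed
    define H where "H k = (\<lambda>w. fst (h k (w, s)))" for k
    have HH: "bij (H k)" "h k (w, s) = (H k w, s)" if k: "k \<in> generate G ?C" for k w
    proof -
      obtain g where g: "bij g" "\<forall>w. h k (w, s) = (g w, s)" using fiber[OF k] by blast
      then have "H k = g" by (auto simp: H_def)
      then show "bij (H k)" "h k (w, s) = (H k w, s)" using g by auto
    qed
    have "H (x \<otimes> y) = H x \<circ> H y" if "x \<in> generate G ?C" "y \<in> generate G ?C" for x y
      using h(2)[OF sub sub] that HH(2)[OF that(2)] by (auto simp: H_def)
    moreover have "H k = f k" if "k \<in> ?C" for k using onC[OF that] by (auto simp: H_def)
    ultimately show ?thesis using HH(1) unfolding perm_rep_def by (intro exI[of _ H]) auto
  qed
  then show ?thesis using Cc unfolding free_basis_def by blast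
qed

section \<open>Free subgroups whose basis is preserved up to conjugacy\<close>

text \<open>
  The heart of the proof. Think of \<open>generate G B\<close> as the fundamental group of a punctured plane on which \<open>P\<close>
  acts by mapping classes that fix every puncture. An element \<open>f\<close> of length \<open>n + 1\<close> starting with \<open>c\<close> or its
  inverse is considered.

  For a basis element \<open>b \<noteq> c\<close> write \<open>h b h\<inverse> = v b v\<inverse>\<close>. The exponent of \<open>c\<close> in \<open>v\<close> depends only on \<open>h\<close>, because two
  choices of \<open>v\<close> differ by an element commuting with \<open>b\<close>; the map \<open>h \<mapsto> e v\<close> is an integer character of \<open>P\<close> and
  restricts to \<open>e\<close> on the free group. So \<open>P\<^sub>1\<close>, where all these characters are divisible by \<open>p\<close>, contains
  \<open>pstep\<close> of \<open>P\<close>, and it meets the free group in the kernel of \<open>e\<close> modulo \<open>p\<close>. Conjugation by \<open>P\<^sub>1\<close> preserves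
  the Schreier basis of that kernel up to conjugacy within the kernel, so the situation reproduces itself.
  With the window placed so that the first letter is absorbed, \<open>f\<close> has length at most \<open>n\<close> in the new basis.
  A second basis element is needed to have a character at all.
\<close>

theorem presidual_free_normal:
  assumes p: "1 < p"
  shows "subgroup P G \<Longrightarrow> free_basis G B \<Longrightarrow> b1 \<in> B \<Longrightarrow> b2 \<in> B \<Longrightarrow> b1 \<noteq> b2 \<Longrightarrow> generate G B \<subseteq> P \<Longrightarrow>
    (\<And>g b. g \<in> P \<Longrightarrow> b \<in> B \<Longrightarrow> \<exists>v\<in>generate G B. g \<otimes> b \<otimes> inv g = v \<otimes> b \<otimes> inv v) \<Longrightarrow>
    f \<in> word_ball B n \<Longrightarrow> f \<in> presidual p (G\<lparr>carrier := P\<rparr>) \<Longrightarrow> f = \<one>"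
proof (induction n arbitrary: P B b1 b2 f)
  case 0 then show ?case by simp
next
  case (Suc n P B b1 b2 f)
  note P = Suc.prems(1) and B = Suc.prems(2) and KP = Suc.prems(6) and cnj = Suc.prems(7)
  let ?K = "generate G B"
  show ?case
  proof (rule ccontr)
    assume "f \<noteq> \<one>"
    then obtain l w where lw: "f = l \<otimes> w" "l \<in> B \<union> (\<lambda>b. inv b) ` B" "w \<in> word_ball B n" using Suc.prems(8) by auto
    then obtain c where c: "c \<in> B" "l = c \<or> l = inv c" by blast
    obtain b0 where b0: "b0 \<in> B" "b0 \<noteq> c" using Suc.prems(3,4,5) by metis
    have Bc: "B \<subseteq> carrier G" using B by (simp add: free_basis_def)
    have Pc: "P \<subseteq> carrier G" using subgroup.subset[OF P] .
    have cc: "c \<in> carrier G" using c Bc by auto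
    have K: "subgroup ?K G" using generate_is_subgroup[OF Bc] .
    have Kc: "?K \<subseteq> carrier G" using subgroup.subset[OF K] .
    have gK: "group (G\<lparr>carrier := ?K\<rparr>)" using K is_group subgroup.subgroup_is_group by blast
    have gP: "group (G\<lparr>carrier := P\<rparr>)" using P is_group subgroup.subgroup_is_group by blast
    obtain e where e: "int_character (G\<lparr>carrier := ?K\<rparr>) e" "e c = 1"
      "\<And>b. b \<in> B \<Longrightarrow> b \<noteq> c \<Longrightarrow> e b = 0"
      "\<And>b u. b \<in> B \<Longrightarrow> b \<noteq> c \<Longrightarrow> u \<in> ?K \<Longrightarrow> u \<otimes> b = b \<otimes> u \<Longrightarrow> e u = 0"
      using free_basis_exponent[OF B c(1)] by metis
    have emult: "e (x \<otimes> y) = e x + e y" if "x \<in> ?K" "y \<in> ?K" for x y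
      using e(1) that by (simp add: int_character_def)
    have einv: "e (inv x) = - e x" if "x \<in> ?K" for x
      using int_character_inv[OF gK e(1), of x] m_inv_consistent[OF K that] that by simp
    have epow: "e (x [^] (i::int)) = i * e x" if "x \<in> ?K" for x i
      using int_character_int_pow[OF e(1) K that] .
    have BK: "b \<in> ?K" if "b \<in> B" for b using that by (rule generate.incl)
    have cpK: "c [^] (i::int) \<in> ?K" for i using subgroup_int_pow_closed[OF K BK[OF c(1)]] .
    have Kinv: "inv x \<in> ?K" if "x \<in> ?K" for x using subgroup.m_inv_closed[OF K that] .
    have Kmult: "x \<otimes> y \<in> ?K" if "x \<in> ?K" "y \<in> ?K" for x y using subgroup.m_closed[OF K that] .
    \<comment> \<open>Conjugation preserves the conjugacy class of every basis element, hence \<open>e\<close>.\<close>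
    have cK: "h \<otimes> k \<otimes> inv h \<in> ?K \<and> e (h \<otimes> k \<otimes> inv h) = e k" if h: "h \<in> P" and k: "k \<in> ?K" for h k
    proof -
      have hc: "h \<in> carrier G" using h Pc by auto
      have gen: "h \<otimes> b \<otimes> inv h \<in> ?K \<and> e (h \<otimes> b \<otimes> inv h) = e b" if b: "b \<in> B" for b
      proof -
        obtain v where v: "v \<in> ?K" "h \<otimes> b \<otimes> inv h = v \<otimes> b \<otimes> inv v" using cnj[OF h b] by blast
        then show ?thesis unfolding v(2) using v(1) BK[OF b] by (simp add: emult einv Kinv Kmult)
      qed
      show ?thesis using k
      proof (induction rule: generate.induct)
        case one
        have "e \<one> = 0" using int_character_one[OF gK e(1)] by simp
        then show ?case using hc by (simp add: generate.one)
      next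
        case (incl b) then show ?case by (rule gen)
      next
        case (inv b)
        have bc: "b \<in> carrier G" using inv Bc by auto
        have "h \<otimes> inv b \<otimes> inv h = inv (h \<otimes> b \<otimes> inv h)" using hc bc by (simp add: inv_mult_group m_assoc)
        then show ?case using gen[OF inv] BK[OF inv] by (simp add: einv Kinv)
      next
        case (eng x y)
        have xy: "x \<in> carrier G" "y \<in> carrier G" using eng Kc by auto
        have "h \<otimes> (x \<otimes> y) \<otimes> inv h = (h \<otimes> x \<otimes> inv h) \<otimes> (h \<otimes> y \<otimes> inv h)"
          using hc xy by (simp add: m_assoc inv_cancel_left)
        then show ?case using eng by (simp add: emult Kmult)
      qed
    qed
    have uniq: "e v = e v'" if b: "b \<in> B" "b \<noteq> c" and v: "v \<in> ?K" "v' \<in> ?K" "v \<otimes> b \<otimes> inv v = v' \<otimes> b \<otimes> inv v'" for b v v'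
    proof -
      have cs: "b \<in> carrier G" "v \<in> carrier G" "v' \<in> carrier G" using b v Kc Bc by auto
      have "(inv v' \<otimes> v) \<otimes> b = inv v' \<otimes> (v \<otimes> b \<otimes> inv v) \<otimes> v" using cs by (simp add: m_assoc)
      also have "\<dots> = b \<otimes> (inv v' \<otimes> v)" unfolding v(3) using cs by (simp add: m_assoc[symmetric])
      finally have "e (inv v' \<otimes> v) = 0" using e(4)[OF b] Kmult[OF Kinv[OF v(2)] v(1)] by blast
      then show ?thesis using v by (simp add: emult einv Kinv)
    qed
    define \<chi> where "\<chi> b h = e (SOME v. v \<in> ?K \<and> h \<otimes> b \<otimes> inv h = v \<otimes> b \<otimes> inv v)" for b h
    have \<chi>I: "\<chi> b h = e v" if "b \<in> B" "b \<noteq> c" "v \<in> ?K" "h \<otimes> b \<otimes> inv h = v \<otimes> b \<otimes> inv v" for b h v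
    proof -
      define v0 where "v0 = (SOME v. v \<in> ?K \<and> h \<otimes> b \<otimes> inv h = v \<otimes> b \<otimes> inv v)"
      have "v0 \<in> ?K \<and> h \<otimes> b \<otimes> inv h = v0 \<otimes> b \<otimes> inv v0"
        unfolding v0_def by (rule someI[of "\<lambda>v. v \<in> ?K \<and> h \<otimes> b \<otimes> inv h = v \<otimes> b \<otimes> inv v" v]) (use that in simp)
      then have v0: "v0 \<in> ?K" "v0 \<otimes> b \<otimes> inv v0 = v \<otimes> b \<otimes> inv v" using that(4) by (blast, metis)
      show ?thesis using uniq[OF that(1,2) v0(1) that(3) v0(2)] unfolding \<chi>_def v0_def .
    qed
    have \<chi>ch: "int_character (G\<lparr>carrier := P\<rparr>) (\<chi> b)" if b: "b \<in> B" "b \<noteq> c" for b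
      unfolding int_character_def
    proof (intro ballI, simp)
      fix h k assume hk: "h \<in> P" "k \<in> P"
      obtain v where v: "v \<in> ?K" "h \<otimes> b \<otimes> inv h = v \<otimes> b \<otimes> inv v" using cnj[OF hk(1) b(1)] by blast
      obtain u where u: "u \<in> ?K" "k \<otimes> b \<otimes> inv k = u \<otimes> b \<otimes> inv u" using cnj[OF hk(2) b(1)] by blast
      have cs: "h \<in> carrier G" "k \<in> carrier G" "b \<in> carrier G" "v \<in> carrier G" "u \<in> carrier G"
        using hk b u v Kc Bc Pc by auto
      let ?y = "(h \<otimes> u \<otimes> inv h) \<otimes> v"
      have "(h \<otimes> k) \<otimes> b \<otimes> inv (h \<otimes> k) = h \<otimes> (k \<otimes> b \<otimes> inv k) \<otimes> inv h"
        using cs by (simp add: inv_mult_group m_assoc)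
      also have "\<dots> = (h \<otimes> u \<otimes> inv h) \<otimes> (h \<otimes> b \<otimes> inv h) \<otimes> inv (h \<otimes> u \<otimes> inv h)"
        unfolding u(2) using cs by (simp add: inv_mult_group m_assoc inv_cancel_left)
      also have "\<dots> = ?y \<otimes> b \<otimes> inv ?y" unfolding v(2) using cs by (simp add: inv_mult_group m_assoc)
      finally have eq: "(h \<otimes> k) \<otimes> b \<otimes> inv (h \<otimes> k) = ?y \<otimes> b \<otimes> inv ?y" .
      have ck: "h \<otimes> u \<otimes> inv h \<in> ?K" "e (h \<otimes> u \<otimes> inv h) = e u" using cK[OF hk(1) u(1)] by auto
      have "\<chi> b (h \<otimes> k) = e ?y" using \<chi>I[OF b Kmult[OF ck(1) v(1)] eq] .
      then show "\<chi> b (h \<otimes> k) = \<chi> b h + \<chi> b k"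
        using ck v u \<chi>I[OF b v] \<chi>I[OF b u] by (simp add: emult)
    qed
    have \<chi>K: "\<chi> b k = e k" if "b \<in> B" "b \<noteq> c" "k \<in> ?K" for b k
      using \<chi>I[OF that] by simp
    define P1 where "P1 = {h \<in> P. \<forall>b\<in>B. b \<noteq> c \<longrightarrow> int p dvd \<chi> b h}"
    have P1: "subgroup P1 G"
    proof (rule subgroupI)
      show "P1 \<subseteq> carrier G" using Pc by (auto simp: P1_def)
      have "\<chi> b \<one> = 0" if "b \<in> B" "b \<noteq> c" for b using int_character_one[OF gP \<chi>ch[OF that]] by simp
      then show "P1 \<noteq> {}" using subgroup.one_closed[OF P] by (force simp: P1_def)
      show "inv h \<in> P1" if "h \<in> P1" for h
        using that int_character_inv[OF gP \<chi>ch, of _ h] m_inv_consistent[OF P, of h] subgroup.m_inv_closed[OF P]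
        by (auto simp: P1_def)
      show "h \<otimes> k \<in> P1" if "h \<in> P1" "k \<in> P1" for h k
        using that \<chi>ch subgroup.m_closed[OF P] by (auto simp: P1_def int_character_def)
    qed
    have fP1: "f \<in> presidual p (G\<lparr>carrier := P1\<rparr>)"
    proof -
      have "pstep p (G\<lparr>carrier := P\<rparr>) \<subseteq> P1" using \<chi>ch by (auto simp: pstep_def P1_def)
      from presidual_subgroup[OF this] show ?thesis using Suc.prems(9) by auto
    qed
    have fK: "f \<in> ?K" using word_ball_generate[OF Suc.prems(8)] .
    have "f \<in> pstep p (G\<lparr>carrier := P\<rparr>)" using subsetD[OF presidual_subset_pstep Suc.prems(9)] .
    then have "int p dvd \<chi> b0 f" using \<chi>ch[OF b0] unfolding pstep_def by blast
    then have pf: "int p dvd e f" unfolding \<chi>K[OF b0 fK] .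
    \<comment> \<open>The window \<open>[-s, p - s)\<close> has to contain \<open>1\<close> if \<open>f\<close> starts with \<open>c\<close>, and \<open>-1\<close> if it starts with its inverse.
      Then the first letter is merely the initial coset and costs no letter in the rewritten word.\<close>
    define s where "s = (if l = c then 0 else p - 1)"
    define j where "j = (if l = c then 1 else - 1 :: int)"
    have sp: "s < p" "- int s \<le> j" "j < int p - int s" using p by (auto simp: s_def j_def of_nat_diff)
    have lj: "l = c [^] j" using c(2) cc by (auto simp: j_def int_pow_neg)
    let ?C = "cyclic_basis p s B c"
    obtain g j' where g: "g \<in> word_ball ?C n" "- int s \<le> j'" "j' < int p - int s" "f = g \<otimes> c [^] j'"
      using cyclic_basis_rewrite[OF Bc c(1) sp(1) lw(3) sp(2,3)] lj lw(1) by blast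
    have Cc: "?C \<subseteq> carrier G" using cyclic_basis_carrier[OF Bc c(1)] .
    have CK: "generate G ?C \<subseteq> ?K" using cyclic_basis_generate[OF Bc c(1)] .
    have eC: "int p dvd e x" if "x \<in> ?C" for x
      using that BK[OF c(1)] e(2,3) by (auto simp: cyclic_basis_def epow emult Kmult cpK BK)
    have eg: "int p dvd e x" if "x \<in> generate G ?C" for x
      using that
    proof (induction rule: generate.induct)
      case one then show ?case using int_character_one[OF gK e(1)] by simp
    next
      case (incl x) then show ?case by (rule eC)
    next
      case (inv x)
      have "x \<in> ?K" using CK generate.incl[OF inv] by blast
      then show ?case using eC[OF inv] by (simp add: einv)
    next
      case (eng x y)
      then have "x \<in> ?K" "y \<in> ?K" using CK by auto
      then show ?case using eng by (simp add: emult)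
    qed
    have gC: "g \<in> generate G ?C" using word_ball_generate[OF g(1)] .
    have "e f = e g + j'" unfolding g(4) using gC CK cpK BK[OF c(1)] e(2) by (simp add: emult epow subset_iff)
    then have "int p dvd j'" using pf eg[OF gC] by (simp add: dvd_add_right_iff)
    moreover have "\<bar>j'\<bar> < int p" using g(2,3) sp(1) by linarith
    ultimately have "j' = 0" using zdvd_imp_le[of "int p" "\<bar>j'\<bar>"] by fastforce
    then have fg: "f = g" using g(4) gC CK Kc by (auto simp: subset_iff)
    have CP1: "generate G ?C \<subseteq> P1"
      using eg CK KP \<chi>K by (auto simp: P1_def)
    have cp: "c [^] int p \<in> ?C" by (simp add: cyclic_basis_def)
    have b0C: "b0 \<in> ?C"
    proof -
      have "b0 = c [^] (0::int) \<otimes> b0 \<otimes> c [^] (- (0::int))" using b0 Bc by auto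
      then show ?thesis unfolding cyclic_basis_def using b0 sp(1) by (intro insertI2 CollectI exI[of _ 0] exI[of _ b0]) auto
    qed
    have ne: "c [^] int p \<noteq> b0" using epow[OF BK[OF c(1)], of "int p"] e(2,3) b0 p by auto
    have cnj1: "\<exists>v\<in>generate G ?C. h \<otimes> x \<otimes> inv h = v \<otimes> x \<otimes> inv v" if h: "h \<in> P1" and x: "x \<in> ?C" for h x
    proof -
      have hP: "h \<in> P" using h by (simp add: P1_def)
      obtain u where u: "u \<in> ?K" "h \<otimes> c \<otimes> inv h = u \<otimes> c \<otimes> inv u" using cnj[OF hP c(1)] by blast
      have cs: "h \<in> carrier G" "u \<in> carrier G" using hP u Pc Kc by auto
      have conjpow: "h \<otimes> c [^] (a::int) \<otimes> inv h = u \<otimes> c [^] a \<otimes> inv u" for a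
        using int_pow_conj u(2) cs cc by metis
      have K1: "v \<in> generate G ?C" if v: "v \<in> ?K" "int p dvd e v" for v
      proof -
        obtain m where m: "v \<in> word_ball B m" using generate_word_ball[OF Bc v(1)] by blast
        have vc: "v \<in> carrier G" using v Kc by auto
        obtain g' i where g': "g' \<in> word_ball ?C m" "- int s \<le> i" "i < int p - int s" "v = g' \<otimes> c [^] i"
          using cyclic_basis_rewrite[OF Bc c(1) sp(1) m, of 0] sp vc by auto
        have g'C: "g' \<in> generate G ?C" using word_ball_generate[OF g'(1)] .
        have "e v = e g' + i" unfolding g'(4) using g'C CK cpK BK[OF c(1)] e(2) by (simp add: emult epow subset_iff)
        then have "int p dvd i" using v(2) eg[OF g'C] by (simp add: dvd_add_right_iff)
        moreover have "\<bar>i\<bar> < int p" using g'(2,3) sp(1) by linarith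
        ultimately have "i = 0" using zdvd_imp_le[of "int p" "\<bar>i\<bar>"] by fastforce
        then show ?thesis using g'(4) g'C CK Kc by (auto simp: subset_iff)
      qed
      from x consider "x = c [^] int p" | a b where "b \<in> B" "b \<noteq> c" "x = c [^] (a::int) \<otimes> b \<otimes> c [^] (- a)"
        unfolding cyclic_basis_def by blast
      then show ?thesis
      proof cases
        case 1
        \<comment> \<open>Correcting \<open>u\<close> by a power of \<open>c\<close>, which commutes with \<open>c\<^sup>p\<close>, brings it into the kernel of \<open>e\<close>.\<close>
        define v where "v = u \<otimes> c [^] (- e u)"
        have vK: "v \<in> ?K" "e v = 0" using u(1) cpK BK[OF c(1)] e(2) by (auto simp: v_def emult epow Kmult)
        have "v \<otimes> c [^] int p \<otimes> inv v = u \<otimes> (c [^] (- e u) \<otimes> c [^] int p \<otimes> c [^] (e u)) \<otimes> inv u"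
          using cs cc by (simp add: v_def inv_mult_group m_assoc int_pow_neg)
        also have "c [^] (- e u) \<otimes> c [^] int p \<otimes> c [^] (e u) = c [^] int p"
          using cc by (simp add: int_pow_mult[symmetric])
        finally show ?thesis using 1 conjpow[of "int p"] K1[OF vK(1)] vK(2) by (intro bexI[of _ v]) auto
      next
        case (2 a b)
        have bc: "b \<in> carrier G" using 2 Bc by auto
        obtain v where v: "v \<in> ?K" "h \<otimes> b \<otimes> inv h = v \<otimes> b \<otimes> inv v" using cnj[OF hP 2(1)] by blast
        have vc: "v \<in> carrier G" using v Kc by auto
        have ev: "int p dvd e v" using h \<chi>I[OF 2(1,2) v] 2(1,2) by (auto simp: P1_def)
        \<comment> \<open>Here \<open>e y = e v\<close>, and \<open>p\<close> divides \<open>e v\<close> because \<open>h \<in> P\<^sub>1\<close>.\<close>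
        define y where "y = u \<otimes> c [^] a \<otimes> inv u \<otimes> v \<otimes> c [^] (- a)"
        have yK: "y \<in> ?K" "e y = e v" using u(1) v(1) cpK BK[OF c(1)] e(2)
          by (auto simp: y_def emult epow Kmult Kinv einv)
        have yc: "y \<in> carrier G" using yK Kc by auto
        have "h \<otimes> x \<otimes> inv h = (h \<otimes> c [^] a \<otimes> inv h) \<otimes> (h \<otimes> b \<otimes> inv h) \<otimes> inv (h \<otimes> c [^] a \<otimes> inv h)"
          unfolding 2(3) using cs cc bc by (simp add: m_assoc inv_mult_group inv_cancel_left int_pow_neg)
        also have "\<dots> = (u \<otimes> c [^] a \<otimes> inv u) \<otimes> (v \<otimes> b \<otimes> inv v) \<otimes> inv (u \<otimes> c [^] a \<otimes> inv u)"
          unfolding conjpow v(2) ..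
        also have "\<dots> = y \<otimes> x \<otimes> inv y"
          unfolding 2(3) y_def using cs cc bc vc by (simp add: m_assoc inv_mult_group inv_cancel_left int_pow_neg)
        finally show ?thesis using K1[OF yK(1)] yK(2) ev by (intro bexI[of _ y]) auto
      qed
    qed
    have "g = \<one>"
      by (rule Suc.IH[OF P1 free_basis_cyclic_basis[OF B c(1) sp(1)] cp b0C ne CP1 cnj1 g(1)])
        (use fP1 fg in auto)
    then have "f = \<one>" unfolding fg .
    with \<open>f \<noteq> \<one>\<close> show False by simp
  qed
qed

end

section \<open>Subgroups, finite extensions and extensions by free groups\<close>

lemma (in group) finite_index_vimage:
  assumes "subgroup P G" "finite (rcosets P)" "h \<in> hom G Q" "group Q" "subgroup H Q" "finite (rcosets\<^bsub>Q\<^esub> H)"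
  shows "subgroup {g \<in> P. h g \<in> H} G" and "finite (rcosets {g \<in> P. h g \<in> H})"
proof -
  interpret Q: group Q by fact
  interpret h: group_hom G Q h by unfold_locales fact
  note Pc = subgroup.subset[OF assms(1)] and Hc = subgroup.subset[OF assms(5)]
  show sub: "subgroup {g \<in> P. h g \<in> H} G"
  proof (rule subgroupI)
    show "{g \<in> P. h g \<in> H} \<noteq> {}" using subgroup.one_closed[OF assms(1)] subgroup.one_closed[OF assms(5)] by force
    show "inv x \<in> {g \<in> P. h g \<in> H}" if "x \<in> {g \<in> P. h g \<in> H}" for x
      using that Pc by (auto simp: subset_iff subgroup.m_inv_closed[OF assms(1)] subgroup.m_inv_closed[OF assms(5)])
    show "x \<otimes> y \<in> {g \<in> P. h g \<in> H}" if "x \<in> {g \<in> P. h g \<in> H}" "y \<in> {g \<in> P. h g \<in> H}" for x y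
      using that Pc by (auto simp: subset_iff subgroup.m_closed[OF assms(1)] subgroup.m_closed[OF assms(5)])
  qed (use Pc in auto)
  show "finite (rcosets {g \<in> P. h g \<in> H})"
  proof (rule finite_index_if_invariant[OF sub, of "\<lambda>g. (P #> g, H #>\<^bsub>Q\<^esub> h g)"])
    have "(\<lambda>g. (P #> g, H #>\<^bsub>Q\<^esub> h g)) ` carrier G \<subseteq> (rcosets P) \<times> (rcosets\<^bsub>Q\<^esub> H)"
      unfolding RCOSETS_def using h.hom_closed by blast
    then show "finite ((\<lambda>g. (P #> g, H #>\<^bsub>Q\<^esub> h g)) ` carrier G)"
      using assms(2,6) by (meson finite_SigmaI finite_subset)
    fix g k assume gk: "g \<in> carrier G" "k \<in> carrier G" "(P #> g, H #>\<^bsub>Q\<^esub> h g) = (P #> k, H #>\<^bsub>Q\<^esub> h k)"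
    then have "g \<otimes> inv k \<in> P" "h g \<otimes>\<^bsub>Q\<^esub> inv\<^bsub>Q\<^esub> h k \<in> H"
      using rcos_eq_imp[OF assms(1)] Q.rcos_eq_imp[OF assms(5)] by auto
    then show "g \<otimes> inv k \<in> {g \<in> P. h g \<in> H}" using gk by simp
  qed
qed

lemma virtually_separated_embed:
  assumes h: "h \<in> hom A B" and A: "group A" and inj: "inj_on h (carrier A)" and B: "virtually_separated p B"
  shows "virtually_separated p A"
proof -
  interpret A: group A by fact
  obtain H where H: "group B" "subgroup H B" "finite (rcosets\<^bsub>B\<^esub> H)" "presidual p (B\<lparr>carrier := H\<rparr>) = {\<one>\<^bsub>B\<^esub>}"
    using B by (auto simp: virtually_separated_def)
  interpret B: group B by (rule H(1))
  interpret h: group_hom A B h by unfold_locales (rule h)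
  have "finite (rcosets\<^bsub>A\<^esub> (carrier A))"
    by (rule A.finite_index_if_invariant[OF A.subgroup_self, of "\<lambda>_. ()"]) auto
  note P = A.finite_index_vimage[OF A.subgroup_self this h H(1-3)]
  let ?P = "{g \<in> carrier A. h g \<in> H}"
  have "presidual p (A\<lparr>carrier := ?P\<rparr>) = {\<one>\<^bsub>A\<^esub>}"
  proof
    have "group (A\<lparr>carrier := ?P\<rparr>)" using P(1) A.is_group subgroup.subgroup_is_group by blast
    from one_in_presidual[OF this] show "{\<one>\<^bsub>A\<^esub>} \<subseteq> presidual p (A\<lparr>carrier := ?P\<rparr>)" by simp
    show "presidual p (A\<lparr>carrier := ?P\<rparr>) \<subseteq> {\<one>\<^bsub>A\<^esub>}"
    proof
      fix x assume x: "x \<in> presidual p (A\<lparr>carrier := ?P\<rparr>)"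
      have "h \<in> hom (A\<lparr>carrier := ?P\<rparr>) (B\<lparr>carrier := H\<rparr>)" by (auto simp: hom_def)
      from presidual_hom[OF this x] have "h x = \<one>\<^bsub>B\<^esub>" using H(4) by simp
      moreover have "x \<in> pchain p (A\<lparr>carrier := ?P\<rparr>) 0" using x unfolding presidual_def by blast
      ultimately show "x \<in> {\<one>\<^bsub>A\<^esub>}" using inj h.hom_one by (auto simp: inj_on_def)
    qed
  qed
  then show ?thesis using P A by (auto simp: virtually_separated_def)
qed

lemma virtually_separated_finite_extension:
  fixes A (structure)
  assumes i: "i \<in> hom B A" and A: "group A" and inj: "inj_on i (carrier B)" and B: "virtually_separated p B"
    and J: "finite J" "r \<in> J \<rightarrow> carrier A" and cover: "\<And>g. g \<in> carrier A \<Longrightarrow> \<exists>j\<in>J. \<exists>b\<in>carrier B. g = r j \<otimes> i b"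
  shows "virtually_separated p A"
proof -
  interpret A: group A by fact
  obtain H where H: "group B" "subgroup H B" "finite (rcosets\<^bsub>B\<^esub> H)" "presidual p (B\<lparr>carrier := H\<rparr>) = {\<one>\<^bsub>B\<^esub>}"
    using B by (auto simp: virtually_separated_def)
  interpret B: group B by (rule H(1))
  interpret i: group_hom B A i by unfold_locales (rule i)
  note Hc = subgroup.subset[OF H(2)]
  have P: "subgroup (i ` H) A" using i.subgroup_img_is_subgroup[OF H(2)] .
  have "\<exists>jb. fst jb \<in> J \<and> snd jb \<in> carrier B \<and> inv g = r (fst jb) \<otimes> i (snd jb)" if "g \<in> carrier A" for g
    using cover[of "inv g"] that by force
  then obtain q where q: "\<And>g. g \<in> carrier A \<Longrightarrow> fst (q g) \<in> J \<and> snd (q g) \<in> carrier B \<and> inv g = r (fst (q g)) \<otimes> i (snd (q g))"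
    by metis
  have fin: "finite (rcosets (i ` H))"
  proof (rule A.finite_index_if_invariant[OF P, of "\<lambda>g. (fst (q g), H #>\<^bsub>B\<^esub> (inv\<^bsub>B\<^esub> snd (q g)))"])
    have "(\<lambda>g. (fst (q g), H #>\<^bsub>B\<^esub> (inv\<^bsub>B\<^esub> snd (q g)))) ` carrier A \<subseteq> J \<times> (rcosets\<^bsub>B\<^esub> H)"
      using q by (auto simp: RCOSETS_def)
    then show "finite ((\<lambda>g. (fst (q g), H #>\<^bsub>B\<^esub> (inv\<^bsub>B\<^esub> snd (q g)))) ` carrier A)"
      using J(1) H(3) by (meson finite_SigmaI finite_subset)
    fix g k assume gk: "g \<in> carrier A" "k \<in> carrier A"
      and eq: "(fst (q g), H #>\<^bsub>B\<^esub> (inv\<^bsub>B\<^esub> snd (q g))) = (fst (q k), H #>\<^bsub>B\<^esub> (inv\<^bsub>B\<^esub> snd (q k)))"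
    obtain j b where jb: "j \<in> J" "b \<in> carrier B" "inv g = r j \<otimes> i b" "q g = (j, b)" using q[OF gk(1)] by (metis prod.collapse)
    obtain c where c: "c \<in> carrier B" "inv k = r j \<otimes> i c" "q k = (j, c)" using q[OF gk(2)] eq jb(4) by (metis prod.collapse fst_conv prod.inject)
    have rj: "r j \<in> carrier A" using J(2) jb(1) by auto
    have "inv\<^bsub>B\<^esub> b \<otimes>\<^bsub>B\<^esub> inv\<^bsub>B\<^esub> (inv\<^bsub>B\<^esub> c) \<in> H"
      using eq jb c by (intro B.rcos_eq_imp[OF H(2)]) auto
    then have "i (inv\<^bsub>B\<^esub> b \<otimes>\<^bsub>B\<^esub> c) \<in> i ` H" using c by simp
    moreover have "g \<otimes> inv k = inv (inv g) \<otimes> inv k" using gk by simp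
    moreover have "\<dots> = i (inv\<^bsub>B\<^esub> b \<otimes>\<^bsub>B\<^esub> c)"
      unfolding jb(3) c(2) using jb(2) c(1) rj by (simp add: A.inv_mult_group A.m_assoc A.inv_cancel_left)
    ultimately show "g \<otimes> inv k \<in> i ` H" by simp
  qed
  have "presidual p (A\<lparr>carrier := i ` H\<rparr>) = {\<one>}"
  proof
    have "group (A\<lparr>carrier := i ` H\<rparr>)" using P A.is_group subgroup.subgroup_is_group by blast
    from one_in_presidual[OF this] show "{\<one>} \<subseteq> presidual p (A\<lparr>carrier := i ` H\<rparr>)" by simp
    show "presidual p (A\<lparr>carrier := i ` H\<rparr>) \<subseteq> {\<one>}"
    proof
      fix x assume x: "x \<in> presidual p (A\<lparr>carrier := i ` H\<rparr>)"
      then have "x \<in> pchain p (A\<lparr>carrier := i ` H\<rparr>) 0" unfolding presidual_def by blast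
      then obtain b where b: "b \<in> H" "x = i b" by auto
      let ?t = "inv_into (carrier B) i"
      have ti: "?t (i b) = b" if "b \<in> H" for b using inj Hc that by (intro inv_into_f_f) auto
      have "?t \<in> hom (A\<lparr>carrier := i ` H\<rparr>) (B\<lparr>carrier := H\<rparr>)"
      proof (rule homI)
        fix x y assume "x \<in> carrier (A\<lparr>carrier := i ` H\<rparr>)" "y \<in> carrier (A\<lparr>carrier := i ` H\<rparr>)"
        then obtain b c where bc: "b \<in> H" "x = i b" "c \<in> H" "y = i c" by auto
        then have "x \<otimes> y = i (b \<otimes>\<^bsub>B\<^esub> c)" using Hc by (simp add: subset_iff)
        then show "?t (x \<otimes>\<^bsub>A\<lparr>carrier := i ` H\<rparr>\<^esub> y) = ?t x \<otimes>\<^bsub>B\<lparr>carrier := H\<rparr>\<^esub> ?t y"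
          using ti bc subgroup.m_closed[OF H(2)] by simp
      qed (use ti in auto)
      from presidual_hom[OF this x] have "b = \<one>\<^bsub>B\<^esub>" using H(4) ti b by simp
      then show "x \<in> {\<one>}" using b by simp
    qed
  qed
  then show ?thesis using P fin A by (auto simp: virtually_separated_def)
qed

text \<open>
  What survives in every term of the chain dies in \<open>Q\<close> by functoriality, so it
  lies in the free kernel, where \<open>presidual_free_normal\<close> applies.
\<close>

lemma virtually_separated_free_kernel:
  fixes G (structure)
  assumes p: "1 < p" and G: "group G" and h: "h \<in> hom G Q" and Q: "virtually_separated p Q"
    and B: "free_basis G B" "b1 \<in> B" "b2 \<in> B" "b1 \<noteq> b2"
    and ker: "\<And>g. g \<in> carrier G \<Longrightarrow> h g = \<one>\<^bsub>Q\<^esub> \<longleftrightarrow> g \<in> generate G B"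
    and P: "subgroup P G" "finite (rcosets P)" "generate G B \<subseteq> P"
    and cnj: "\<And>g b. g \<in> P \<Longrightarrow> b \<in> B \<Longrightarrow> \<exists>v\<in>generate G B. g \<otimes> b \<otimes> inv g = v \<otimes> b \<otimes> inv v"
  shows "virtually_separated p G"
proof -
  interpret G: group G by fact
  obtain H where H: "group Q" "subgroup H Q" "finite (rcosets\<^bsub>Q\<^esub> H)" "presidual p (Q\<lparr>carrier := H\<rparr>) = {\<one>\<^bsub>Q\<^esub>}"
    using Q by (auto simp: virtually_separated_def)
  let ?P = "{g \<in> P. h g \<in> H}"
  note P' = G.finite_index_vimage[OF P(1,2) h H(1-3)]
  have Bc: "B \<subseteq> carrier G" using B(1) by (simp add: free_basis_def)
  have Kc: "generate G B \<subseteq> carrier G" using G.generate_in_carrier[OF Bc] by blast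
  have KP: "generate G B \<subseteq> ?P"
  proof
    fix g assume g: "g \<in> generate G B"
    then have "h g = \<one>\<^bsub>Q\<^esub>" using ker[of g] Kc by blast
    then show "g \<in> ?P" using g P(3) subgroup.one_closed[OF H(2)] by auto
  qed
  have "presidual p (G\<lparr>carrier := ?P\<rparr>) = {\<one>}"
  proof
    have "group (G\<lparr>carrier := ?P\<rparr>)" using P'(1) G subgroup.subgroup_is_group by blast
    from one_in_presidual[OF this] show "{\<one>} \<subseteq> presidual p (G\<lparr>carrier := ?P\<rparr>)" by simp
    show "presidual p (G\<lparr>carrier := ?P\<rparr>) \<subseteq> {\<one>}"
    proof
      fix x assume x: "x \<in> presidual p (G\<lparr>carrier := ?P\<rparr>)"
      have "h \<in> hom (G\<lparr>carrier := ?P\<rparr>) (Q\<lparr>carrier := H\<rparr>)"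
        using h subgroup.subset[OF P(1)] by (auto simp: hom_def)
      from presidual_hom[OF this x] have "h x = \<one>\<^bsub>Q\<^esub>" using H(4) by simp
      moreover have "x \<in> pchain p (G\<lparr>carrier := ?P\<rparr>) 0" using x unfolding presidual_def by blast
      ultimately have "x \<in> generate G B" using ker subgroup.subset[OF P(1)] by auto
      then obtain n where n: "x \<in> G.word_ball B n" using G.generate_word_ball[OF Bc] by blast
      have "x = \<one>"
        by (rule G.presidual_free_normal[OF p P'(1) B KP _ n x]) (use cnj in auto)
      then show "x \<in> {\<one>}" by simp
    qed
  qed
  then show ?thesis using P' G by (auto simp: virtually_separated_def)
qed

text \<open>
  If the group permutes the conjugacy classes of a finite basis, the elements fixing every class
  form a subgroup of finite index, to which the previous lemma applies. This is the passage from braids to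
  pure braids.
\<close>

lemma virtually_separated_free_kernel_permuted:
  fixes G (structure)
  assumes p: "1 < p" and G: "group G" and h: "h \<in> hom G Q" and Q: "virtually_separated p Q"
    and B: "free_basis G B" "b1 \<in> B" "b2 \<in> B" "b1 \<noteq> b2" "finite B"
    and ker: "\<And>g. g \<in> carrier G \<Longrightarrow> h g = \<one>\<^bsub>Q\<^esub> \<longleftrightarrow> g \<in> generate G B"
    and S: "S \<subseteq> carrier G" "generate G S = carrier G"
    and cnj: "\<And>s b. s \<in> S \<Longrightarrow> b \<in> B \<Longrightarrow> (\<exists>b'\<in>B. \<exists>v\<in>generate G B. s \<otimes> b \<otimes> inv s = v \<otimes> b' \<otimes> inv v) \<and>
        (\<exists>b'\<in>B. \<exists>v\<in>generate G B. inv s \<otimes> b \<otimes> s = v \<otimes> b' \<otimes> inv v)"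
  shows "virtually_separated p G"
proof -
  interpret G: group G by fact
  interpret Q: group Q using Q by (simp add: virtually_separated_def)
  interpret h: group_hom G Q h by unfold_locales (rule h)
  let ?K = "generate G B"
  have Bc: "B \<subseteq> carrier G" using B(1) by (simp add: free_basis_def)
  have K: "subgroup ?K G" using G.generate_is_subgroup[OF Bc] .
  have Kc: "k \<in> carrier G" if "k \<in> ?K" for k using G.generate_in_carrier[OF Bc that] .
  have normal: "g \<otimes> k \<otimes> inv g \<in> ?K" if "g \<in> carrier G" "k \<in> ?K" for g k
    using that ker[of k] ker[of "g \<otimes> k \<otimes> inv g"] Kc by simp
  have normal': "inv g \<otimes> k \<otimes> g \<in> ?K" if "g \<in> carrier G" "k \<in> ?K" for g k
    using normal[of "inv g" k] that by simp
  have Kmult: "x \<otimes> y \<in> ?K" if "x \<in> ?K" "y \<in> ?K" for x y using subgroup.m_closed[OF K that] .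
  have Kinv: "inv x \<in> ?K" if "x \<in> ?K" for x using subgroup.m_inv_closed[OF K that] .
  have all: "\<forall>b\<in>B. \<exists>b'\<in>B. \<exists>v\<in>?K. g \<otimes> b \<otimes> inv g = v \<otimes> b' \<otimes> inv v" if "g \<in> generate G S" for g
    using that
  proof (induction rule: generate.induct)
    case one
    have "\<one> \<otimes> b \<otimes> inv \<one> = \<one> \<otimes> b \<otimes> inv \<one>" for b ..
    then show ?case using generate.one by metis
  next
    case (incl s) then show ?case using cnj by blast
  next
    case (inv s) then show ?case using cnj[OF inv] S by (auto simp: subset_iff)
  next
    case (eng g k)
    have gk: "g \<in> carrier G" "k \<in> carrier G" using eng S by auto
    show ?case
    proof
      fix b assume b: "b \<in> B"
      then obtain b' v where v: "b' \<in> B" "v \<in> ?K" "k \<otimes> b \<otimes> inv k = v \<otimes> b' \<otimes> inv v" using eng by blast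
      then obtain b'' u where u: "b'' \<in> B" "u \<in> ?K" "g \<otimes> b' \<otimes> inv g = u \<otimes> b'' \<otimes> inv u" using eng by blast
      have cs: "b \<in> carrier G" "b' \<in> carrier G" "b'' \<in> carrier G" "v \<in> carrier G" "u \<in> carrier G" using b v u Bc Kc by auto
      have "(g \<otimes> k) \<otimes> b \<otimes> inv (g \<otimes> k) = g \<otimes> (k \<otimes> b \<otimes> inv k) \<otimes> inv g"
        using gk cs by (simp add: G.inv_mult_group G.m_assoc)
      also have "\<dots> = (g \<otimes> v \<otimes> inv g) \<otimes> (g \<otimes> b' \<otimes> inv g) \<otimes> inv (g \<otimes> v \<otimes> inv g)"
        unfolding v(3) using gk cs by (simp add: G.inv_mult_group G.m_assoc G.inv_cancel_left)
      also have "\<dots> = (g \<otimes> v \<otimes> inv g \<otimes> u) \<otimes> b'' \<otimes> inv (g \<otimes> v \<otimes> inv g \<otimes> u)"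
        unfolding u(3) using gk cs by (simp add: G.inv_mult_group G.m_assoc)
      finally show "\<exists>b'\<in>B. \<exists>v\<in>?K. g \<otimes> k \<otimes> b \<otimes> inv (g \<otimes> k) = v \<otimes> b' \<otimes> inv v"
        using u(1) Kmult[OF normal[OF gk(1) v(2)] u(2)] by blast
    qed
  qed
  define P where "P = {g \<in> carrier G. \<forall>b\<in>B. \<exists>v\<in>?K. g \<otimes> b \<otimes> inv g = v \<otimes> b \<otimes> inv v}"
  \<comment> \<open>Two elements whose inverses send every basis element to the same class differ by an element of \<open>P\<close>. This gives
    finite index, and closure under products as the case of the trivial permutation.\<close>
  have quot: "g \<otimes> inv k \<in> P" if gk: "g \<in> carrier G" "k \<in> carrier G"
    and q: "\<And>b. b \<in> B \<Longrightarrow> \<exists>b'\<in>B. \<exists>u\<in>?K. \<exists>v\<in>?K. inv g \<otimes> b \<otimes> g = v \<otimes> b' \<otimes> inv v \<and> inv k \<otimes> b \<otimes> k = u \<otimes> b' \<otimes> inv u" for g k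
  proof -
    have "\<exists>v\<in>?K. (g \<otimes> inv k) \<otimes> b \<otimes> inv (g \<otimes> inv k) = v \<otimes> b \<otimes> inv v" if b: "b \<in> B" for b
    proof -
      obtain b' u v where uv: "b' \<in> B" "u \<in> ?K" "v \<in> ?K" "inv g \<otimes> b \<otimes> g = v \<otimes> b' \<otimes> inv v" "inv k \<otimes> b \<otimes> k = u \<otimes> b' \<otimes> inv u"
        using q[OF b] by blast
      have cs: "b \<in> carrier G" "b' \<in> carrier G" "v \<in> carrier G" "u \<in> carrier G" using b uv Bc Kc by auto
      let ?w = "g \<otimes> (u \<otimes> inv v) \<otimes> inv g"
      have "(g \<otimes> inv k) \<otimes> b \<otimes> inv (g \<otimes> inv k) = g \<otimes> (inv k \<otimes> b \<otimes> k) \<otimes> inv g"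
        using gk cs by (simp add: G.inv_mult_group G.m_assoc)
      also have "\<dots> = g \<otimes> (u \<otimes> inv v \<otimes> (v \<otimes> b' \<otimes> inv v) \<otimes> inv (u \<otimes> inv v)) \<otimes> inv g"
        unfolding uv(5) using cs gk by (simp add: G.inv_mult_group G.m_assoc G.inv_cancel_left)
      also have "\<dots> = ?w \<otimes> b \<otimes> inv ?w"
        unfolding uv(4)[symmetric] using cs gk by (simp add: G.inv_mult_group G.m_assoc G.inv_cancel_left)
      finally show ?thesis using normal[OF gk(1) Kmult[OF uv(2) Kinv[OF uv(3)]]] by blast
    qed
    then show ?thesis using gk by (simp add: P_def)
  qed
  have KP: "?K \<subseteq> P" using Kc by (auto simp: P_def)
  have Pinv: "\<exists>v\<in>?K. inv g \<otimes> b \<otimes> g = v \<otimes> b \<otimes> inv v" if g: "g \<in> P" and b: "b \<in> B" for g b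
  proof -
    obtain v where v: "v \<in> ?K" "g \<otimes> b \<otimes> inv g = v \<otimes> b \<otimes> inv v" using g b by (auto simp: P_def)
    have cs: "g \<in> carrier G" "b \<in> carrier G" "v \<in> carrier G" using g b v Bc Kc by (auto simp: P_def)
    have "b = inv v \<otimes> (v \<otimes> b \<otimes> inv v) \<otimes> v" using cs by (simp add: G.m_assoc G.inv_cancel_left)
    also have "\<dots> = inv v \<otimes> (g \<otimes> b \<otimes> inv g) \<otimes> v" unfolding v(2) ..
    finally have "inv g \<otimes> b \<otimes> g = inv g \<otimes> (inv v \<otimes> (g \<otimes> b \<otimes> inv g) \<otimes> v) \<otimes> g" by (rule arg_cong)
    also have "\<dots> = (inv g \<otimes> inv v \<otimes> g) \<otimes> b \<otimes> inv (inv g \<otimes> inv v \<otimes> g)"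
      using cs by (simp add: G.inv_mult_group G.m_assoc)
    finally show ?thesis using normal'[OF cs(1) Kinv[OF v(1)]] by blast
  qed
  have oneP: "\<one> \<in> P" using KP generate.one by blast
  have PG: "subgroup P G"
  proof (rule G.subgroupI)
    show "P \<subseteq> carrier G" "P \<noteq> {}" using oneP by (auto simp: P_def)
    show invP: "inv x \<in> P" if x: "x \<in> P" for x
      using Pinv[OF x] x by (auto simp: P_def)
    show "x \<otimes> y \<in> P" if x: "x \<in> P" and y: "y \<in> P" for x y
    proof -
      have "x \<otimes> inv (inv y) \<in> P"
      proof (rule quot)
        show "x \<in> carrier G" "inv y \<in> carrier G" using x y by (auto simp: P_def)
        fix b assume b: "b \<in> B"
        from Pinv[OF x b] Pinv[OF invP[OF y] b]
        show "\<exists>b'\<in>B. \<exists>u\<in>?K. \<exists>v\<in>?K. inv x \<otimes> b \<otimes> x = v \<otimes> b' \<otimes> inv v \<and> inv (inv y) \<otimes> b \<otimes> inv y = u \<otimes> b' \<otimes> inv u"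
          using b by blast
      qed
      then show ?thesis using y by (simp add: P_def)
    qed
  qed
  have "\<exists>t. \<forall>b\<in>B. t b \<in> B \<and> (\<exists>v\<in>?K. inv g \<otimes> b \<otimes> g = v \<otimes> t b \<otimes> inv v)" if g: "g \<in> carrier G" for g
  proof -
    have "inv g \<in> generate G S" using g S by simp
    from all[OF this] have "\<forall>b\<in>B. \<exists>b'. b' \<in> B \<and> (\<exists>v\<in>?K. inv g \<otimes> b \<otimes> g = v \<otimes> b' \<otimes> inv v)" using g by (simp add: Bex_def)
    then show ?thesis by (rule bchoice)
  qed
  then obtain t where t: "\<And>g b. g \<in> carrier G \<Longrightarrow> b \<in> B \<Longrightarrow> t g b \<in> B \<and> (\<exists>v\<in>?K. inv g \<otimes> b \<otimes> g = v \<otimes> t g b \<otimes> inv v)"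
    by metis
  have fin: "finite (rcosets P)"
  proof (rule G.finite_index_if_invariant[OF PG, of "\<lambda>g. restrict (t g) B"])
    have "(\<lambda>g. restrict (t g) B) ` carrier G \<subseteq> B \<rightarrow>\<^sub>E B" using t by auto
    then show "finite ((\<lambda>g. restrict (t g) B) ` carrier G)" using B(5) by (meson finite_PiE finite_subset)
    fix g k assume gk: "g \<in> carrier G" "k \<in> carrier G" and eq: "restrict (t g) B = restrict (t k) B"
    show "g \<otimes> inv k \<in> P"
    proof (rule quot[OF gk])
      fix b assume b: "b \<in> B"
      have "t g b = t k b" using fun_cong[OF eq, of b] b by simp
      then show "\<exists>b'\<in>B. \<exists>u\<in>?K. \<exists>v\<in>?K. inv g \<otimes> b \<otimes> g = v \<otimes> b' \<otimes> inv v \<and> inv k \<otimes> b \<otimes> k = u \<otimes> b' \<otimes> inv u"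
        using t[OF gk(1) b] t[OF gk(2) b] by metis
    qed
  qed
  have "\<exists>v\<in>?K. g \<otimes> b \<otimes> inv g = v \<otimes> b \<otimes> inv v" if "g \<in> P" "b \<in> B" for g b
    using that unfolding P_def by blast
  from virtually_separated_free_kernel[OF p G h Q B(1-4) ker PG fin KP this] show ?thesis by blast
qed

text \<open>
  Division by \<open>p\<^sup>i\<close> is a character of \<open>p\<^sup>i\<int>\<close>, so the chain consists of the subgroups \<open>p\<^sup>i\<int>\<close>.
\<close>

lemma virtually_separated_integer_group: assumes "1 < p" shows "virtually_separated p integer_group"
proof -
  have "pchain p integer_group i \<subseteq> {x. int p ^ i dvd x}" for i
  proof (induction i)
    case (Suc i)
    show ?case
    proof
      fix x assume x: "x \<in> pchain p integer_group (Suc i)"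
      have "int_character (integer_group\<lparr>carrier := pchain p integer_group i\<rparr>) (\<lambda>x. x div int p ^ i)"
        using Suc by (auto simp: int_character_def div_add subset_iff)
      then have "int p dvd x div int p ^ i" "int p ^ i dvd x" using x Suc by (auto simp: pstep_def)
      then show "x \<in> {x. int p ^ Suc i dvd x}" using assms by (auto simp: dvd_div_iff_mult mult.commute)
    qed
  qed simp
  then have d: "int p ^ i dvd x" if "x \<in> presidual p integer_group" for x i using that by (auto simp: presidual_def)
  have "x = 0" if x: "x \<in> presidual p integer_group" for x
  proof (rule ccontr)
    assume "x \<noteq> 0"
    have "int p ^ nat \<bar>x\<bar> \<le> \<bar>x\<bar>" using dvd_imp_le_int[OF \<open>x \<noteq> 0\<close> d[OF x, of "nat \<bar>x\<bar>"]] by simp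
    moreover have "nat \<bar>x\<bar> < p ^ nat \<bar>x\<bar>" using assms by (simp add: power_gt_expt)
    then have "\<bar>x\<bar> < int p ^ nat \<bar>x\<bar>" by (metis int_nat_eq nat_less_iff of_nat_power abs_ge_zero zless_nat_conj nat_int)
    ultimately show False by simp
  qed
  have eq: "integer_group\<lparr>carrier := carrier integer_group\<rparr> = integer_group" by (simp add: integer_group_def)
  have "presidual p (integer_group\<lparr>carrier := carrier integer_group\<rparr>) = {\<one>\<^bsub>integer_group\<^esub>}"
    unfolding eq using one_in_presidual[OF group_integer_group, of p] \<open>\<And>x. x \<in> presidual p integer_group \<Longrightarrow> x = 0\<close> by auto
  moreover interpret group integer_group by simp
  have "finite (rcosets\<^bsub>integer_group\<^esub> (carrier integer_group))"
    by (rule finite_index_if_invariant[OF subgroup_self, of "\<lambda>_. ()"]) auto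
  ultimately show ?thesis using subgroup_self unfolding virtually_separated_def by auto
qed

text \<open>
  Used to establish normal forms: a set closed under left multiplication by generators and their
  inverses, and containing \<open>\<one>\<close>, is everything.
\<close>

lemma (in group) generate_left_induct:
  assumes S: "S \<subseteq> carrier G" and X: "X \<subseteq> carrier G" "\<one> \<in> X"
    "\<And>s x. s \<in> S \<Longrightarrow> x \<in> X \<Longrightarrow> s \<otimes> x \<in> X" "\<And>s x. s \<in> S \<Longrightarrow> x \<in> X \<Longrightarrow> inv s \<otimes> x \<in> X"
  shows "generate G S \<subseteq> X"
proof
  fix g assume "g \<in> generate G S"
  then have "g \<in> carrier G \<and> (\<forall>x\<in>X. g \<otimes> x \<in> X)"
  proof (induction rule: generate.induct)
    case (eng g k)
    have "g \<otimes> k \<otimes> x \<in> X" if "x \<in> X" for x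
      using eng X(1) that by (auto simp: m_assoc subset_iff)
    then show ?case using eng by auto
  qed (use S X in \<open>auto simp: subset_iff\<close>)
  then show "g \<in> X" using X(2) by force
qed

lemma hom_eq_on_generate:
  assumes "group G" "group H" "h \<in> hom G H" "k \<in> hom G H" "S \<subseteq> carrier G" "\<And>s. s \<in> S \<Longrightarrow> h s = k s" "g \<in> generate G S"
  shows "h g = k g"
proof -
  interpret h: group_hom G H h by (intro group_hom.intro group_hom_axioms.intro assms)
  interpret k: group_hom G H k by (intro group_hom.intro group_hom_axioms.intro assms)
  show ?thesis using assms(7)
  proof (induction rule: generate.induct)
    case (inv s) then show ?case using assms(5,6) by (auto simp: subset_iff)
  next
    case (eng x y)
    then have "x \<in> carrier G" "y \<in> carrier G" using h.G.generate_in_carrier[OF assms(5)] by auto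
    then show ?case using eng by simp
  qed (use assms in auto)
qed

section \<open>Wreath products\<close>

text \<open>
  The unrestricted permutational wreath product. A homomorphism into it is an action on the index
  set together with a cocycle, and the cocycle restricted to the stabiliser of an index is a homomorphism
  into \<open>G\<close>. All freeness and injectivity statements below are proved by prescribing such a pair on generators.
\<close>

definition wreath :: "('a, 'b) monoid_scheme \<Rightarrow> (('i \<Rightarrow> 'i) \<times> ('i \<Rightarrow> 'a)) monoid" where
  "wreath G = \<lparr>carrier = {(\<pi>, c). bij \<pi> \<and> range c \<subseteq> carrier G},
     monoid.mult = (\<lambda>(\<pi>, c) (\<sigma>, d). (\<pi> \<circ> \<sigma>, \<lambda>i. c (\<sigma> i) \<otimes>\<^bsub>G\<^esub> d i)),
     one = (id, \<lambda>_. \<one>\<^bsub>G\<^esub>)\<rparr>"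

lemma wreath_carrier: "(\<pi>, c) \<in> carrier (wreath G) \<longleftrightarrow> bij \<pi> \<and> (\<forall>i. c i \<in> carrier G)"
  by (auto simp: wreath_def)

lemma wreath_mult: "(\<pi>, c) \<otimes>\<^bsub>wreath G\<^esub> (\<sigma>, d) = (\<pi> \<circ> \<sigma>, \<lambda>i. c (\<sigma> i) \<otimes>\<^bsub>G\<^esub> d i)"
  by (simp add: wreath_def)

lemma wreath_one: "\<one>\<^bsub>wreath G\<^esub> = (id, \<lambda>_. \<one>\<^bsub>G\<^esub>)"
  by (simp add: wreath_def)

lemma group_wreath:
  fixes G (structure)
  assumes "group G" shows "group (wreath G)"
proof -
  interpret group G by fact
  show ?thesis
  proof (rule groupI)
    show "\<one>\<^bsub>wreath G\<^esub> \<in> carrier (wreath G)" by (simp add: wreath_carrier wreath_one)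
    fix x y z :: "('i \<Rightarrow> 'i) \<times> ('i \<Rightarrow> 'a)"
    obtain a c where x: "x = (a, c)" by (cases x)
    obtain b d where y: "y = (b, d)" by (cases y)
    obtain e f where z: "z = (e, f)" by (cases z)
    assume xc: "x \<in> carrier (wreath G)"
    show "\<one>\<^bsub>wreath G\<^esub> \<otimes>\<^bsub>wreath G\<^esub> x = x" using xc by (simp add: x wreath_carrier wreath_one wreath_mult)
    have ac: "bij a" "\<And>i. c i \<in> carrier G" using xc by (auto simp: x wreath_carrier)
    let ?a = "inv_into UNIV a"
    have "(?a, \<lambda>i. inv (c (?a i))) \<in> carrier (wreath G)" using ac by (simp add: wreath_carrier bij_imp_bij_inv)
    moreover have "(?a, \<lambda>i. inv (c (?a i))) \<otimes>\<^bsub>wreath G\<^esub> x = \<one>\<^bsub>wreath G\<^esub>"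
      using ac by (simp add: x wreath_mult wreath_one bij_is_inj inv_f_f fun_eq_iff)
    ultimately show "\<exists>y\<in>carrier (wreath G). y \<otimes>\<^bsub>wreath G\<^esub> x = \<one>\<^bsub>wreath G\<^esub>" by blast
    assume yc: "y \<in> carrier (wreath G)"
    show "x \<otimes>\<^bsub>wreath G\<^esub> y \<in> carrier (wreath G)" using xc yc by (simp add: x y wreath_carrier wreath_mult bij_comp)
    assume zc: "z \<in> carrier (wreath G)"
    show "x \<otimes>\<^bsub>wreath G\<^esub> y \<otimes>\<^bsub>wreath G\<^esub> z = x \<otimes>\<^bsub>wreath G\<^esub> (y \<otimes>\<^bsub>wreath G\<^esub> z)"
      using xc yc zc by (simp add: x y z wreath_carrier wreath_mult fun_eq_iff m_assoc)
  qed
qed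

definition perms :: "('o \<Rightarrow> 'o) monoid" where
  "perms = \<lparr>carrier = {f. bij f}, monoid.mult = (\<circ>), one = id\<rparr>"

lemma perms_simps [simp]: "carrier perms = {f. bij f}" "f \<otimes>\<^bsub>perms\<^esub> g = f \<circ> g" "\<one>\<^bsub>perms\<^esub> = id"
  by (simp_all add: perms_def)

lemma group_perms: "group perms"
proof (rule groupI)
  fix x :: "'o \<Rightarrow> 'o" assume "x \<in> carrier perms"
  then show "\<exists>y\<in>carrier perms. y \<otimes>\<^bsub>perms\<^esub> x = \<one>\<^bsub>perms\<^esub>"
    by (intro bexI[of _ "inv_into UNIV x"]) (auto simp: bij_imp_bij_inv bij_is_inj)
qed (auto intro: bij_comp)

lemma wreath_fixed_hom:
  assumes "group G" "h \<in> hom A (wreath G)" "group A" "S \<subseteq> carrier A"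
    "\<And>s. s \<in> S \<Longrightarrow> fst (h s) i = i" "x \<in> generate A S"
  shows "fst (h x) i = i"
proof -
  interpret group_hom A "wreath G" h by (intro group_hom.intro group_hom_axioms.intro assms group_wreath)
  interpret W: group "wreath G" by (rule group_wreath) fact
  show ?thesis using assms(6)
  proof (induction rule: generate.induct)
    case one then show ?case by (simp add: wreath_one)
  next
    case (incl s) then show ?case using assms(5) by simp
  next
    case (inv s)
    have s: "s \<in> carrier A" using inv assms(4) by auto
    then have "h (inv\<^bsub>A\<^esub> s) \<otimes>\<^bsub>wreath G\<^esub> h s = \<one>\<^bsub>wreath G\<^esub>" by (simp flip: hom_mult)
    moreover obtain a c b d where "h (inv\<^bsub>A\<^esub> s) = (a, c)" "h s = (b, d)" by (meson surj_pair)
    ultimately have "a \<circ> b = id" "b i = i" "fst (h (inv\<^bsub>A\<^esub> s)) = a" using assms(5)[OF inv] by (auto simp: wreath_mult wreath_one)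
    then show ?case by (metis comp_apply id_apply)
  next
    case (eng x y)
    then have "x \<in> carrier A" "y \<in> carrier A" using group.generate_in_carrier[OF assms(3,4)] by auto
    moreover obtain a c b d where "h x = (a, c)" "h y = (b, d)" by (meson surj_pair)
    ultimately show ?case using eng by (simp add: wreath_mult)
  qed
qed

lemma snd_wreath_mult: "snd (x \<otimes>\<^bsub>wreath G\<^esub> y) i = snd x (fst y i) \<otimes>\<^bsub>G\<^esub> snd y i"
  by (cases x; cases y) (simp add: wreath_mult)

lemma wreath_snd_closed: "x \<in> carrier (wreath G) \<Longrightarrow> snd x i \<in> carrier G"
  by (cases x) (simp add: wreath_carrier)

text \<open>
  Homomorphisms of the whole group into \<open>wreath perms\<close> can be written down from a presentation; the
  basis only has to fix one index.
\<close>

lemma free_basisI: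
  assumes "group G" "B \<subseteq> carrier G"
    and h: "\<And>f :: 'a \<Rightarrow> nat \<Rightarrow> nat. (\<And>b. b \<in> B \<Longrightarrow> bij (f b)) \<Longrightarrow>
      \<exists>h \<in> hom G (wreath perms). \<exists>i :: 'i. \<forall>b\<in>B. fst (h b) i = i \<and> snd (h b) i = f b"
  shows "free_basis G B"
  unfolding free_basis_def
proof (intro conjI allI impI)
  interpret group G by fact
  fix f :: "'a \<Rightarrow> nat \<Rightarrow> nat" assume f: "\<forall>b\<in>B. bij (f b)"
  have "\<exists>h \<in> hom G (wreath perms). \<exists>i :: 'i. \<forall>b\<in>B. fst (h b) i = i \<and> snd (h b) i = f b"
  proof (rule h[of f])
    show "bij (f b)" if "b \<in> B" for b using f that by (rule bspec)
  qed
  then obtain h and i :: 'i where h0: "h \<in> hom G (wreath perms)" "\<forall>b\<in>B. fst (h b) i = i \<and> snd (h b) i = f b"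
    by (elim bexE exE)
  have h: "h \<in> hom G (wreath perms)" "\<And>b. b \<in> B \<Longrightarrow> fst (h b) i = i" "\<And>b. b \<in> B \<Longrightarrow> snd (h b) i = f b"
    using h0 by simp_all
  have hc: "h x \<in> carrier (wreath perms)" if "x \<in> generate G B" for x
    using that h(1) generate_in_carrier[OF assms(2)] by (auto simp: hom_def)
  have fix0: "fst (h x) i = i" if "x \<in> generate G B" for x
    using wreath_fixed_hom[OF group_perms h(1) assms(1,2) h(2) that] .
  have "perm_rep G (generate G B) (\<lambda>x. snd (h x) i)"
    unfolding perm_rep_def
  proof (intro conjI ballI)
    show "bij (snd (h x) i)" if "x \<in> generate G B" for x using wreath_snd_closed[OF hc[OF that]] by simp
    show "snd (h (x \<otimes>\<^bsub>G\<^esub> y)) i = snd (h x) i \<circ> snd (h y) i" if "x \<in> generate G B" "y \<in> generate G B" for x y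
      using that fix0[OF that(2)] hom_mult[OF h(1)] generate_in_carrier[OF assms(2)]
      by (simp add: snd_wreath_mult hom_multD[OF h(1)])
  qed
  then show "\<exists>h. perm_rep G (generate G B) h \<and> (\<forall>b\<in>B. h b = f b)" using h(3) by blast
qed fact

text \<open>
  The cocycle at the fixed index is a left inverse of \<open>a\<close>.
\<close>

lemma inj_via_wreath:
  fixes i0 :: 'i
  assumes "group A" "group B" "a \<in> hom A B" "h \<in> hom B (wreath A)" "S \<subseteq> carrier A" "generate A S = carrier A"
    and "\<And>s. s \<in> S \<Longrightarrow> fst (h (a s)) i0 = i0" "\<And>s. s \<in> S \<Longrightarrow> snd (h (a s)) i0 = s"
  shows "inj_on a (carrier A)"
proof -
  interpret A: group A by fact
  have ha: "h \<circ> a \<in> hom A (wreath A)" using assms(3,4) by (rule hom_compose)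
  have fix0: "fst ((h \<circ> a) x) i0 = i0" if "x \<in> generate A S" for x
    using assms(7) by (intro wreath_fixed_hom[OF assms(1) ha assms(1,5) _ that]) simp
  have homA: "(\<lambda>x. snd ((h \<circ> a) x) i0) \<in> hom A A"
  proof (rule homI)
    show "snd ((h \<circ> a) x) i0 \<in> carrier A" if "x \<in> carrier A" for x
      using ha that by (intro wreath_snd_closed) (auto simp: hom_def)
    show "snd ((h \<circ> a) (x \<otimes>\<^bsub>A\<^esub> y)) i0 = snd ((h \<circ> a) x) i0 \<otimes>\<^bsub>A\<^esub> snd ((h \<circ> a) y) i0" if "x \<in> carrier A" "y \<in> carrier A" for x y
      unfolding hom_multD[OF ha that] snd_wreath_mult using fix0 that assms(6) by simp
  qed
  have idA: "(\<lambda>x. x) \<in> hom A A" by (simp add: hom_def)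
  have r: "snd (h (a x)) i0 = x" if x: "x \<in> carrier A" for x
  proof -
    have "x \<in> generate A S" unfolding assms(6) by (rule x)
    then have "(\<lambda>x. snd ((h \<circ> a) x) i0) x = (\<lambda>x. x) x"
      by (rule hom_eq_on_generate[OF assms(1,1) homA idA assms(5), rotated]) (simp only: comp_apply assms(8))
    then show ?thesis by (simp only: comp_apply)
  qed
  show ?thesis
  proof (rule inj_onI)
    fix x y assume xy: "x \<in> carrier A" "y \<in> carrier A" "a x = a y"
    show "x = y" using r[OF xy(1)] r[OF xy(2)] unfolding xy(3) by metis
  qed
qed

section \<open>Groups given by generators and relations\<close>

definition word_eval :: "('a, 'b) monoid_scheme \<Rightarrow> ('s \<Rightarrow> 'a) \<Rightarrow> 's word \<Rightarrow> 'a" where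
  "word_eval H f w = foldr (\<lambda>(s, b) x. (if b then f s else inv\<^bsub>H\<^esub> f s) \<otimes>\<^bsub>H\<^esub> x) w \<one>\<^bsub>H\<^esub>"

definition presentation_generator :: "'s set \<Rightarrow> ('s word \<times> 's word) set \<Rightarrow> 's \<Rightarrow> 's word set" where
  "presentation_generator S R s = presentation_cong S R `` {[(s, True)]}"

lemma word_eval_simps [simp]:
  "word_eval H f [] = \<one>\<^bsub>H\<^esub>"
  "word_eval H f ((s, b) # w) = (if b then f s else inv\<^bsub>H\<^esub> f s) \<otimes>\<^bsub>H\<^esub> word_eval H f w"
  by (simp_all add: word_eval_def)

context group begin

lemma word_eval_closed:
  assumes "f \<in> S \<rightarrow> carrier G" shows "w \<in> words S \<Longrightarrow> word_eval G f w \<in> carrier G"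
proof (induction w)
  case (Cons a w) then show ?case using assms by (cases a) (auto simp: Pi_iff)
qed simp

lemma word_eval_append:
  assumes "f \<in> S \<rightarrow> carrier G" "v \<in> words S"
  shows "u \<in> words S \<Longrightarrow> word_eval G f (u @ v) = word_eval G f u \<otimes> word_eval G f v"
proof (induction u)
  case Nil then show ?case using word_eval_closed[OF assms] by simp
next
  case (Cons a u)
  then show ?case using word_eval_closed[OF assms] word_eval_closed[OF assms(1)] assms(1)
    by (cases a) (auto simp: Pi_iff m_assoc)
qed

lemma word_eval_cong:
  assumes f: "f \<in> S \<rightarrow> carrier G"
    and R: "\<And>l r. (l, r) \<in> R \<Longrightarrow> l \<in> words S \<Longrightarrow> r \<in> words S \<Longrightarrow> word_eval G f l = word_eval G f r"
  shows "(u, v) \<in> presentation_cong S R \<Longrightarrow> word_eval G f u = word_eval G f v"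
proof (induction rule: presentation_cong.induct)
  case (append u u' v v')
  then show ?case using presentation_cong_words[OF append(1)] presentation_cong_words[OF append(2)]
    by (simp add: word_eval_append[OF f])
next
  case (cancel s b) then show ?case using f by (auto simp: Pi_iff)
qed (use R in auto)

text \<open>
  The universal property of a presentation; the only way in which homomorphisms out of Artin groups
  are constructed.
\<close>

lemma presented_group_hom:
  assumes f: "f \<in> S \<rightarrow> carrier G"
    and R: "\<And>l r. (l, r) \<in> R \<Longrightarrow> l \<in> words S \<Longrightarrow> r \<in> words S \<Longrightarrow> word_eval G f l = word_eval G f r"
  shows "\<exists>h \<in> hom (presented_group S R) G. \<forall>s\<in>S. h (presentation_generator S R s) = f s"
proof -
  let ?cls = "\<lambda>w. presentation_cong S R `` {w}"
  define h where "h X = word_eval G f (SOME w. w \<in> X)" for X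
  have hcls: "h (?cls w) = word_eval G f w" if "w \<in> words S" for w
  proof -
    have "w \<in> ?cls w" using that by (simp add: presentation_cong.refl)
    then have "(SOME v. v \<in> ?cls w) \<in> ?cls w" by (rule someI)
    then have "(w, SOME v. v \<in> ?cls w) \<in> presentation_cong S R" by simp
    from word_eval_cong[OF f R this] show ?thesis unfolding h_def by simp
  qed
  have carr: "carrier (presented_group S R) = ?cls ` words S"
    by (auto simp: presented_group_def quotient_def)
  have "h \<in> hom (presented_group S R) G"
  proof (rule homI)
    show "h x \<in> carrier G" if "x \<in> carrier (presented_group S R)" for x
      using that hcls word_eval_closed[OF f] by (auto simp: carr)
    fix x y assume "x \<in> carrier (presented_group S R)" "y \<in> carrier (presented_group S R)"
    then obtain u v where "u \<in> words S" "x = ?cls u" "v \<in> words S" "y = ?cls v" by (auto simp: carr)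
    then show "h (x \<otimes>\<^bsub>presented_group S R\<^esub> y) = h x \<otimes> h y"
      by (simp add: presented_group_mult hcls word_eval_append[OF f])
  qed
  moreover have "h (presentation_generator S R s) = f s" if "s \<in> S" for s
    using that f hcls[of "[(s, True)]"] by (auto simp: presentation_generator_def Pi_iff)
  ultimately show ?thesis by blast
qed

end

lemma presentation_generator_closed: "s \<in> S \<Longrightarrow> presentation_generator S R s \<in> carrier (presented_group S R)"
  by (auto simp: presentation_generator_def presented_group_def quotient_def)

text \<open>
  The class of a word is its value on the generators, which turns relators into equations in
  the group.
\<close>

lemma presented_group_eval:
  assumes "w \<in> words S"
  shows "word_eval (presented_group S R) (presentation_generator S R) w = presentation_cong S R `` {w}"
  using assms
proof (induction w)
  case Nil then show ?case by (simp add: presented_group_def)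
next
  case (Cons a w)
  let ?P = "presented_group S R" and ?cls = "\<lambda>w. presentation_cong S R `` {w}"
  interpret P: group ?P by (rule group_presented_group)
  obtain s b where a: "a = (s, b)" by (cases a)
  have s: "s \<in> S" and w: "w \<in> words S" using Cons.prems a by auto
  have sb: "?cls [(s, b)] \<in> carrier ?P" for b using s by (auto simp: presented_group_def quotient_def)
  have "?cls [(s, False)] \<otimes>\<^bsub>?P\<^esub> ?cls [(s, True)] = ?cls ([(s, False)] @ [(s, True)])"
    using s by (intro presented_group_mult) auto
  also have "\<dots> = ?cls []"
    using presentation_cong.cancel[OF s, of False R] by (intro equiv_class_eq[OF equiv_presentation_cong]) simp
  finally have "inv\<^bsub>?P\<^esub> presentation_generator S R s = ?cls [(s, False)]"
    using sb by (intro P.inv_equality) (auto simp: presentation_generator_def presented_group_def)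
  then have "(if b then presentation_generator S R s else inv\<^bsub>?P\<^esub> presentation_generator S R s) = ?cls [(s, b)]" by (cases b) (auto simp: presentation_generator_def)
  then show ?case using Cons.IH[OF w] presented_group_mult[of "[(s, b)]" S w R] s w by (simp add: a)
qed

lemma presented_group_generate: "generate (presented_group S R) (presentation_generator S R ` S) = carrier (presented_group S R)"
proof -
  let ?P = "presented_group S R"
  interpret P: group ?P by (rule group_presented_group)
  have S: "presentation_generator S R ` S \<subseteq> carrier ?P" by (intro image_subsetI presentation_generator_closed)
  have gen: "word_eval ?P (presentation_generator S R) w \<in> generate ?P (presentation_generator S R ` S)" if "w \<in> words S" for w
    using that
  proof (induction w)
    case (Cons a w) then show ?case
      by (cases a) (auto intro!: generate.eng intro: generate.incl generate.inv)
  qed (simp add: generate.one)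
  have "carrier ?P \<subseteq> generate ?P (presentation_generator S R ` S)"
  proof
    fix x assume "x \<in> carrier ?P"
    then obtain w where w: "w \<in> words S" "x = presentation_cong S R `` {w}" by (auto simp: presented_group_def quotient_def)
    show "x \<in> generate ?P (presentation_generator S R ` S)" using gen[OF w(1)] unfolding presented_group_eval[OF w(1)] w(2) .
  qed
  then show ?thesis using P.generate_incl[OF S] by blast
qed

section \<open>Artin groups of paths and cycles\<close>

primrec alt_prod :: "('a, 'b) monoid_scheme \<Rightarrow> nat \<Rightarrow> 'a \<Rightarrow> 'a \<Rightarrow> 'a" where
  "alt_prod G 0 = (\<lambda>x y. \<one>\<^bsub>G\<^esub>)"
| "alt_prod G (Suc k) = (\<lambda>x y. x \<otimes>\<^bsub>G\<^esub> alt_prod G k y x)"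

lemma word_eval_alternating: "word_eval G f (alternating_word s t k) = alt_prod G k (f s) (f t)"
  by (induction k arbitrary: s t) auto

lemma alternating_words: "s \<in> S \<Longrightarrow> t \<in> S \<Longrightarrow> alternating_word s t k \<in> words S"
  by (induction k arbitrary: s t) auto

definition artin_generator :: "'v coxeter_graph \<Rightarrow> 'v \<Rightarrow> 'v word set" where
  "artin_generator \<Gamma> = presentation_generator (verts \<Gamma>) (artin_relations \<Gamma>)"

lemma group_artin: "group (artin_group \<Gamma>)"
  unfolding artin_group_def by (rule group_presented_group)

lemma artin_generator_closed: "s \<in> verts \<Gamma> \<Longrightarrow> artin_generator \<Gamma> s \<in> carrier (artin_group \<Gamma>)"
  unfolding artin_group_def artin_generator_def by (rule presentation_generator_closed)

lemma artin_generate: "generate (artin_group \<Gamma>) (artin_generator \<Gamma> ` verts \<Gamma>) = carrier (artin_group \<Gamma>)"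
  unfolding artin_group_def artin_generator_def by (rule presented_group_generate)

lemma finitely_generated_artin: "finite (verts \<Gamma>) \<Longrightarrow> finitely_generated_group (artin_group \<Gamma>)"
  unfolding finitely_generated_group_def using artin_generate[of \<Gamma>]
  by (intro conjI exI[of _ "artin_generator \<Gamma> ` verts \<Gamma>"] group_artin image_subsetI artin_generator_closed finite_imageI) assumption+

lemma (in group) artin_hom:
  assumes "f \<in> verts \<Gamma> \<rightarrow> carrier G"
    and "\<And>s t k. s \<in> verts \<Gamma> \<Longrightarrow> t \<in> verts \<Gamma> \<Longrightarrow> s \<noteq> t \<Longrightarrow> label \<Gamma> s t = enat k \<Longrightarrow> alt_prod G k (f s) (f t) = alt_prod G k (f t) (f s)"
  shows "\<exists>h \<in> hom (artin_group \<Gamma>) G. \<forall>s\<in>verts \<Gamma>. h (artin_generator \<Gamma> s) = f s"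
  unfolding artin_group_def artin_generator_def
proof (rule presented_group_hom[OF assms(1)])
  fix l r assume "(l, r) \<in> artin_relations \<Gamma>"
  then obtain s t k where "l = alternating_word s t k" "r = alternating_word t s k"
    "s \<in> verts \<Gamma>" "t \<in> verts \<Gamma>" "s \<noteq> t" "label \<Gamma> s t = enat k" by (auto simp: artin_relations_def)
  then show "word_eval G f l = word_eval G f r" using assms(2) by (simp add: word_eval_alternating)
qed

lemma artin_relation:
  assumes "s \<in> verts \<Gamma>" "t \<in> verts \<Gamma>" "s \<noteq> t" "label \<Gamma> s t = enat k"
  shows "alt_prod (artin_group \<Gamma>) k (artin_generator \<Gamma> s) (artin_generator \<Gamma> t) = alt_prod (artin_group \<Gamma>) k (artin_generator \<Gamma> t) (artin_generator \<Gamma> s)"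
proof -
  let ?S = "verts \<Gamma>" and ?R = "artin_relations \<Gamma>"
  have "(alternating_word s t k, alternating_word t s k) \<in> presentation_cong ?S ?R"
    using assms by (intro presentation_cong.relation alternating_words) (auto simp: artin_relations_def)
  then have "presentation_cong ?S ?R `` {alternating_word s t k} = presentation_cong ?S ?R `` {alternating_word t s k}"
    by (rule equiv_class_eq[OF equiv_presentation_cong])
  then show ?thesis
    unfolding presented_group_eval[OF alternating_words[OF assms(1,2)], symmetric]
      presented_group_eval[OF alternating_words[OF assms(2,1)], symmetric]
      word_eval_alternating artin_group_def artin_generator_def .
qed

lemma path_simps: "verts (coxeter_path n l) = {..<n}"
  "label (coxeter_path n l) = (\<lambda>i j. if j = Suc i then l i else if i = Suc j then l j else 2)"
  by (simp_all add: coxeter_path_def)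

lemma alt_prod2: "alt_prod G 2 x y = x \<otimes>\<^bsub>G\<^esub> (y \<otimes>\<^bsub>G\<^esub> \<one>\<^bsub>G\<^esub>)" by (simp add: numeral_2_eq_2)
lemma alt_prod3: "alt_prod G 3 x y = x \<otimes>\<^bsub>G\<^esub> (y \<otimes>\<^bsub>G\<^esub> (x \<otimes>\<^bsub>G\<^esub> \<one>\<^bsub>G\<^esub>))" by (simp add: numeral_3_eq_3)
lemma alt_prod4: "alt_prod G 4 x y = x \<otimes>\<^bsub>G\<^esub> (y \<otimes>\<^bsub>G\<^esub> (x \<otimes>\<^bsub>G\<^esub> (y \<otimes>\<^bsub>G\<^esub> \<one>\<^bsub>G\<^esub>)))" by (simp add: eval_nat_numeral)

lemma enat_numeral_eq: "(numeral k :: enat) = enat n \<longleftrightarrow> n = numeral k"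
  by (auto simp: numeral_eq_enat)

lemma (in group) path_hom:
  assumes f: "\<And>i. i < n \<Longrightarrow> f i \<in> carrier G"
    and adj: "\<And>i k. Suc i < n \<Longrightarrow> l i = enat k \<Longrightarrow> alt_prod G k (f i) (f (Suc i)) = alt_prod G k (f (Suc i)) (f i)"
    and far: "\<And>i j. Suc i < j \<Longrightarrow> j < n \<Longrightarrow> f i \<otimes> f j = f j \<otimes> f i"
  shows "\<exists>h \<in> hom (artin_group (coxeter_path n l)) G. \<forall>i<n. h (artin_generator (coxeter_path n l) i) = f i"
proof -
  have "\<exists>h \<in> hom (artin_group (coxeter_path n l)) G. \<forall>i\<in>verts (coxeter_path n l). h (artin_generator (coxeter_path n l) i) = f i"
  proof (rule artin_hom)
    show "f \<in> verts (coxeter_path n l) \<rightarrow> carrier G" using f by (simp add: path_simps)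
    fix s t k assume st: "s \<in> verts (coxeter_path n l)" "t \<in> verts (coxeter_path n l)" "s \<noteq> t" "label (coxeter_path n l) s t = enat k"
    consider "t = Suc s" | "s = Suc t" | "Suc s < t" | "Suc t < s" using st(3) by linarith
    then show "alt_prod G k (f s) (f t) = alt_prod G k (f t) (f s)"
    proof cases
      case 1 then show ?thesis using st adj by (simp add: path_simps)
    next
      case 2 then show ?thesis using st adj[of t k] by (simp add: path_simps)
    next
      case 3 then show ?thesis using st far[of s t] f[of s] f[of t] by (simp add: path_simps enat_numeral_eq alt_prod2)
    next
      case 4 then show ?thesis using st far[of t s] f[of s] f[of t] by (simp add: path_simps enat_numeral_eq alt_prod2)
    qed
  qed
  then show ?thesis by (simp add: path_simps Ball_def)
qed

lemma path_gen_closed: "i < n \<Longrightarrow> artin_generator (coxeter_path n l) i \<in> carrier (artin_group (coxeter_path n l))"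
  by (rule artin_generator_closed) (simp add: path_simps)

lemma path_adjacent:
  assumes "Suc i < n" "l i = enat k"
  shows "alt_prod (artin_group (coxeter_path n l)) k (artin_generator (coxeter_path n l) i) (artin_generator (coxeter_path n l) (Suc i)) =
    alt_prod (artin_group (coxeter_path n l)) k (artin_generator (coxeter_path n l) (Suc i)) (artin_generator (coxeter_path n l) i)"
  by (rule artin_relation) (use assms in \<open>auto simp: path_simps\<close>)

lemma path_far:
  assumes "Suc i < j" "j < n"
  shows "artin_generator (coxeter_path n l) i \<otimes>\<^bsub>artin_group (coxeter_path n l)\<^esub> artin_generator (coxeter_path n l) j =
    artin_generator (coxeter_path n l) j \<otimes>\<^bsub>artin_group (coxeter_path n l)\<^esub> artin_generator (coxeter_path n l) i"
proof -
  interpret group "artin_group (coxeter_path n l)" by (rule group_artin)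
  have "alt_prod (artin_group (coxeter_path n l)) 2 (artin_generator (coxeter_path n l) i) (artin_generator (coxeter_path n l) j) =
    alt_prod (artin_group (coxeter_path n l)) 2 (artin_generator (coxeter_path n l) j) (artin_generator (coxeter_path n l) i)"
    by (rule artin_relation) (use assms in \<open>auto simp: path_simps enat_numeral_eq\<close>)
  then show ?thesis using assms by (simp add: alt_prod2 path_gen_closed)
qed

lemma cycle_simps: "verts (coxeter_cycle n) = {..<n}"
  "label (coxeter_cycle n) = (\<lambda>i j. if j = Suc i mod n \<or> i = Suc j mod n then 3 else 2)"
  by (simp_all add: coxeter_cycle_def)

lemma (in group) cycle_hom:
  assumes f: "\<And>i. i < n \<Longrightarrow> f i \<in> carrier G"
    and adj: "\<And>i. i < n \<Longrightarrow> f i \<otimes> f (Suc i mod n) \<otimes> f i = f (Suc i mod n) \<otimes> f i \<otimes> f (Suc i mod n)"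
    and far: "\<And>i j. i < j \<Longrightarrow> j < n \<Longrightarrow> j \<noteq> Suc i mod n \<Longrightarrow> i \<noteq> Suc j mod n \<Longrightarrow> f i \<otimes> f j = f j \<otimes> f i"
  shows "\<exists>h \<in> hom (artin_group (coxeter_cycle n)) G. \<forall>i<n. h (artin_generator (coxeter_cycle n) i) = f i"
proof -
  have "\<exists>h \<in> hom (artin_group (coxeter_cycle n)) G. \<forall>i\<in>verts (coxeter_cycle n). h (artin_generator (coxeter_cycle n) i) = f i"
  proof (rule artin_hom)
    show "f \<in> verts (coxeter_cycle n) \<rightarrow> carrier G" using f by (simp add: cycle_simps)
    fix s t k assume st: "s \<in> verts (coxeter_cycle n)" "t \<in> verts (coxeter_cycle n)" "s \<noteq> t" "label (coxeter_cycle n) s t = enat k"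
    have c: "f s \<in> carrier G" "f t \<in> carrier G" "s < n" "t < n" using st f by (auto simp: cycle_simps)
    show "alt_prod G k (f s) (f t) = alt_prod G k (f t) (f s)"
    proof (cases "t = Suc s mod n \<or> s = Suc t mod n")
      case True
      then have "f s \<otimes> f t \<otimes> f s = f t \<otimes> f s \<otimes> f t" using adj[OF c(3)] adj[OF c(4)] by auto
      then show ?thesis using True st c by (simp add: cycle_simps enat_numeral_eq alt_prod3 m_assoc)
    next
      case False
      then have "f s \<otimes> f t = f t \<otimes> f s" using far[of s t] far[of t s] st(3) c by (cases "s < t") auto
      then show ?thesis using False st c by (simp add: cycle_simps enat_numeral_eq alt_prod2)
    qed
  qed
  then show ?thesis by (simp add: cycle_simps Ball_def)
qed

lemma cycle_gen_closed: "i < n \<Longrightarrow> artin_generator (coxeter_cycle n) i \<in> carrier (artin_group (coxeter_cycle n))"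
  by (rule artin_generator_closed) (simp add: cycle_simps)

lemma cycle_adjacent:
  fixes n
  defines "G \<equiv> artin_group (coxeter_cycle n)" and "g \<equiv> artin_generator (coxeter_cycle n)"
  assumes "i < n" "2 \<le> n"
  shows "g i \<otimes>\<^bsub>G\<^esub> g (Suc i mod n) \<otimes>\<^bsub>G\<^esub> g i = g (Suc i mod n) \<otimes>\<^bsub>G\<^esub> g i \<otimes>\<^bsub>G\<^esub> g (Suc i mod n)"
proof -
  interpret group G unfolding G_def by (rule group_artin)
  have cl: "g i \<in> carrier G" "g (Suc i mod n) \<in> carrier G" using assms cycle_gen_closed by auto
  have ne: "i \<noteq> Suc i mod n" using assms by (auto simp: mod_Suc)
  have "alt_prod G 3 (g i) (g (Suc i mod n)) = alt_prod G 3 (g (Suc i mod n)) (g i)"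
    unfolding G_def g_def by (rule artin_relation) (use assms ne in \<open>auto simp: cycle_simps enat_numeral_eq\<close>)
  then show ?thesis using cl by (simp add: alt_prod3 m_assoc)
qed

lemma cycle_far:
  fixes n
  defines "G \<equiv> artin_group (coxeter_cycle n)" and "g \<equiv> artin_generator (coxeter_cycle n)"
  assumes "i < n" "j < n" "i \<noteq> j" "j \<noteq> Suc i mod n" "i \<noteq> Suc j mod n"
  shows "g i \<otimes>\<^bsub>G\<^esub> g j = g j \<otimes>\<^bsub>G\<^esub> g i"
proof -
  interpret group G unfolding G_def by (rule group_artin)
  have cl: "g i \<in> carrier G" "g j \<in> carrier G" using assms cycle_gen_closed by auto
  have "alt_prod G 2 (g i) (g j) = alt_prod G 2 (g j) (g i)"
    unfolding G_def g_def by (rule artin_relation) (use assms in \<open>auto simp: cycle_simps enat_numeral_eq\<close>)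
  then show ?thesis using cl by (simp add: alt_prod2)
qed

lemma path_generate: "generate (artin_group (coxeter_path n l)) (artin_generator (coxeter_path n l) ` {..<n}) = carrier (artin_group (coxeter_path n l))"
  using artin_generate[of "coxeter_path n l"] by (simp add: path_simps)

lemma cycle_generate: "generate (artin_group (coxeter_cycle n)) (artin_generator (coxeter_cycle n) ` {..<n}) = carrier (artin_group (coxeter_cycle n))"
  using artin_generate[of "coxeter_cycle n"] by (simp add: cycle_simps)

text \<open>
  Basis elements given by a family are distinct because the action may be prescribed index by index.
\<close>

lemma free_basis_family:
  fixes x :: "'j \<Rightarrow> 'a"
  assumes "group G" "x \<in> J \<rightarrow> carrier G"
    and h: "\<And>y :: 'j \<Rightarrow> nat \<Rightarrow> nat. (\<And>j. bij (y j)) \<Longrightarrow>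
      \<exists>h \<in> hom G (wreath perms). \<exists>i :: 'i. \<forall>j\<in>J. fst (h (x j)) i = i \<and> snd (h (x j)) i = y j"
  shows "free_basis G (x ` J)" and "inj_on x J"
proof -
  show inj: "inj_on x J"
  proof (rule inj_onI, rule ccontr)
    fix j k assume jk: "j \<in> J" "k \<in> J" "x j = x k" "j \<noteq> k"
    define y :: "'j \<Rightarrow> nat \<Rightarrow> nat" where "y i = (if i = j then id else (\<lambda>n. if n = 0 then 1 else if n = 1 then 0 else n))" for i
    have "bij (\<lambda>n::nat. if n = 0 then 1 else if n = 1 then 0 else n)"
      by (rule o_bij[of "\<lambda>n. if n = 0 then 1 else if n = 1 then 0 else n"]) (auto simp: fun_eq_iff)
    then have "bij (y i)" for i by (simp add: y_def)
    from h[of y, OF this] obtain H and i :: 'i where H: "\<forall>j\<in>J. fst (H (x j)) i = i \<and> snd (H (x j)) i = y j" by (elim bexE exE)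
    have "y j = y k" using H jk(1,2,3) by metis
    then have "y j 0 = y k 0" by simp
    then show False using jk(4) by (simp add: y_def)
  qed
  show "free_basis G (x ` J)"
  proof (rule free_basisI[OF assms(1)])
    show "x ` J \<subseteq> carrier G" using assms(2) by auto
    fix f :: "'a \<Rightarrow> nat \<Rightarrow> nat" assume f: "\<And>b. b \<in> x ` J \<Longrightarrow> bij (f b)"
    have "bij (if j \<in> J then f (x j) else id)" for j using f by auto
    from h[of "\<lambda>j. if j \<in> J then f (x j) else id", OF this]
    obtain H and i :: 'i where H: "H \<in> hom G (wreath perms)"
      "\<forall>j\<in>J. fst (H (x j)) i = i \<and> snd (H (x j)) i = (if j \<in> J then f (x j) else id)" by (elim bexE exE)
    show "\<exists>h \<in> hom G (wreath perms). \<exists>i :: 'i. \<forall>b\<in>x ` J. fst (h b) i = i \<and> snd (h b) i = f b"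
      by (rule bexI[OF _ H(1)], rule exI[of _ i]) (use H(2) in auto)
  qed
qed

section \<open>Type B over type A\<close>

definition conj_by :: "('a, 'b) monoid_scheme \<Rightarrow> 'a \<Rightarrow> 'a \<Rightarrow> 'a" where
  "conj_by G g x = g \<otimes>\<^bsub>G\<^esub> x \<otimes>\<^bsub>G\<^esub> inv\<^bsub>G\<^esub> g"

context group begin

abbreviation cj where "cj \<equiv> conj_by G"

lemma cj_closed [simp]: "g \<in> carrier G \<Longrightarrow> x \<in> carrier G \<Longrightarrow> cj g x \<in> carrier G"
  by (simp add: conj_by_def)

lemma cj_mult: "g \<in> carrier G \<Longrightarrow> x \<in> carrier G \<Longrightarrow> y \<in> carrier G \<Longrightarrow> cj g (x \<otimes> y) = cj g x \<otimes> cj g y"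
  by (simp add: conj_by_def m_assoc inv_cancel_left)

lemma cj_inv: "g \<in> carrier G \<Longrightarrow> x \<in> carrier G \<Longrightarrow> cj g (inv x) = inv (cj g x)"
  by (simp add: conj_by_def m_assoc inv_mult_group)

lemma cj_comp: "g \<in> carrier G \<Longrightarrow> h \<in> carrier G \<Longrightarrow> x \<in> carrier G \<Longrightarrow> cj (g \<otimes> h) x = cj g (cj h x)"
  by (simp add: conj_by_def m_assoc inv_mult_group)

lemma cj_eq_iff: "g \<in> carrier G \<Longrightarrow> x \<in> carrier G \<Longrightarrow> y \<in> carrier G \<Longrightarrow> cj g x = y \<longleftrightarrow> g \<otimes> x = y \<otimes> g"
  unfolding conj_by_def by (metis inv_closed inv_solve_right m_closed inv_inv)

lemma cj_inv_cancel: "g \<in> carrier G \<Longrightarrow> x \<in> carrier G \<Longrightarrow> cj (inv g) (cj g x) = x"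
  by (simp add: conj_by_def m_assoc inv_cancel_left)

lemma cj_swap:
  "g \<in> carrier G \<Longrightarrow> h \<in> carrier G \<Longrightarrow> x \<in> carrier G \<Longrightarrow> g \<otimes> h = h \<otimes> g \<Longrightarrow> cj g (cj h x) = cj h (cj g x)"
  by (metis cj_comp)

lemma cj_cj: "g \<in> carrier G \<Longrightarrow> a \<in> carrier G \<Longrightarrow> x \<in> carrier G \<Longrightarrow> cj g (cj a x) = cj (cj g a) (cj g x)"
  by (simp add: conj_by_def m_assoc inv_mult_group inv_cancel_left)

lemma cj_generate:
  assumes B: "B \<subseteq> carrier G" and g: "g \<in> carrier G" "\<And>x. x \<in> B \<Longrightarrow> cj g x \<in> generate G B" and k: "k \<in> generate G B"
  shows "cj g k \<in> generate G B"
proof -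
  have K: "subgroup (generate G B) G" by (rule generate_is_subgroup[OF B])
  show ?thesis using k
  proof (induction rule: generate.induct)
    case one then show ?case using g(1) by (simp add: conj_by_def generate.one)
  next
    case (incl h) then show ?case by (rule g(2))
  next
    case (inv h)
    then have "h \<in> carrier G" using B by auto
    then show ?case using g inv subgroup.m_inv_closed[OF K] by (simp add: cj_inv)
  next
    case (eng x y)
    then have "x \<in> carrier G" "y \<in> carrier G" using generate_in_carrier[OF B] by auto
    then show ?case using g(1) eng by (simp add: cj_mult generate.eng)
  qed
qed

end

text \<open>
  In the group of type \<open>B\<close>, viewed as braids of \<open>n\<close> strands around an axis, the loop of the axis around
  the \<open>j\<close>th strand, the others being passed on one side.
\<close>

primrec strand_loop :: "('a, 'b) monoid_scheme \<Rightarrow> (nat \<Rightarrow> 'a) \<Rightarrow> nat \<Rightarrow> 'a" where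
  "strand_loop G b 0 = b 0"
| "strand_loop G b (Suc j) = conj_by G (b (Suc j)) (strand_loop G b j)"

lemma hom_conj_by:
  assumes "group G" "group H" "h \<in> hom G H" "g \<in> carrier G" "x \<in> carrier G"
  shows "h (conj_by G g x) = conj_by H (h g) (h x)"
proof -
  interpret group_hom G H h by (intro group_hom.intro group_hom_axioms.intro assms)
  show ?thesis using assms by (simp add: conj_by_def)
qed

text \<open>
  Elements satisfying the relations of type \<open>B\<close>. No presentation is assumed, so that the locale serves for
  the Artin group itself and for the images under which it is compared with other groups.
\<close>

locale type_B = group G for G (structure) +
  fixes b :: "nat \<Rightarrow> 'a" and n :: nat
  assumes b_closed [simp]: "i < n \<Longrightarrow> b i \<in> carrier G"
    and quad: "2 \<le> n \<Longrightarrow> b 0 \<otimes> (b 1 \<otimes> (b 0 \<otimes> b 1)) = b 1 \<otimes> (b 0 \<otimes> (b 1 \<otimes> b 0))"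
    and braid: "1 \<le> i \<Longrightarrow> Suc i < n \<Longrightarrow> b i \<otimes> (b (Suc i) \<otimes> b i) = b (Suc i) \<otimes> (b i \<otimes> b (Suc i))"
    and far: "Suc i < j \<Longrightarrow> j < n \<Longrightarrow> b i \<otimes> b j = b j \<otimes> b i"
begin

abbreviation X where "X \<equiv> strand_loop G b"

lemma X_closed [simp]: "j < n \<Longrightarrow> X j \<in> carrier G"
  by (induction j) auto

lemma commute: "Suc i < j \<or> Suc j < i \<Longrightarrow> i < n \<Longrightarrow> j < n \<Longrightarrow> b i \<otimes> b j = b j \<otimes> b i"
  using far[of i j] far[of j i] by auto

lemma cj_far: "Suc i < j \<or> Suc j < i \<Longrightarrow> i < n \<Longrightarrow> j < n \<Longrightarrow> cj (b i) (b j) = b j"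
  using commute[of i j] by (simp add: cj_eq_iff)

lemma cj_braid: "1 \<le> i \<Longrightarrow> Suc i < n \<Longrightarrow> cj (b i) (cj (b (Suc i)) (b i)) = b (Suc i)"
  using braid[of i] by (simp add: cj_comp[symmetric] cj_eq_iff m_assoc)

lemma cj_braid3: "1 \<le> i \<Longrightarrow> Suc i < n \<Longrightarrow> x \<in> carrier G \<Longrightarrow>
    cj (b i) (cj (b (Suc i)) (cj (b i) x)) = cj (b (Suc i)) (cj (b i) (cj (b (Suc i)) x))"
  using braid[of i] by (simp add: cj_comp[symmetric])

lemma X_far_above: "Suc j < i \<Longrightarrow> i < n \<Longrightarrow> cj (b i) (X j) = X j"
proof (induction j)
  case 0 then show ?case using cj_far[of i 0] by simp
next
  case (Suc j)
  have "cj (b i) (X (Suc j)) = cj (b (Suc j)) (cj (b i) (X j))"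
    using Suc.prems commute[of i "Suc j"] by (simp add: cj_swap)
  then show ?case using Suc by simp
qed

lemma X_far_below: "1 \<le> i \<Longrightarrow> i < j \<Longrightarrow> j < n \<Longrightarrow> cj (b i) (X j) = X j"
proof (induction j)
  case (Suc j)
  show ?case
  proof (cases "i = j")
    case True
    then obtain k where k: "j = Suc k" using Suc.prems by (cases j) auto
    have "cj (b j) (X (Suc j)) = cj (b (Suc j)) (cj (b j) (cj (b (Suc j)) (X k)))"
      using Suc.prems True cj_braid3[of j "X k"] by (simp add: k)
    also have "cj (b (Suc j)) (X k) = X k" using X_far_above[of k "Suc j"] Suc.prems k by simp
    finally show ?thesis using True k by simp
  next
    case False
    have "cj (b i) (X (Suc j)) = cj (b (Suc j)) (cj (b i) (X j))"
      using Suc.prems False commute[of i "Suc j"] by (simp add: cj_swap)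
    then show ?thesis using Suc False by simp
  qed
qed simp

lemma X_far: "1 \<le> i \<Longrightarrow> i < n \<Longrightarrow> j < n \<Longrightarrow> i \<noteq> j \<Longrightarrow> i \<noteq> Suc j \<Longrightarrow> cj (b i) (X j) = X j"
  using X_far_above[of j i] X_far_below[of i j] by linarith

text \<open>
  The product of two adjacent loops is unchanged when the two strands are exchanged. The first instance is the
  relation of length four; the others follow from it by a conjugation that shifts all indices.
\<close>

lemma X_pair: "Suc j < n \<Longrightarrow> cj (b (Suc j)) (X j \<otimes> X (Suc j)) = X j \<otimes> X (Suc j)"
proof (induction j)
  case 0
  then have c: "b 0 \<in> carrier G" "b 1 \<in> carrier G" "2 \<le> n" by auto
  have "b 1 \<otimes> (X 0 \<otimes> X 1) = (b 1 \<otimes> (b 0 \<otimes> (b 1 \<otimes> b 0))) \<otimes> inv (b 1)"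
    using c by (simp add: conj_by_def m_assoc)
  also have "\<dots> = (b 0 \<otimes> (b 1 \<otimes> (b 0 \<otimes> b 1))) \<otimes> inv (b 1)" using quad c by simp
  also have "\<dots> = (X 0 \<otimes> X 1) \<otimes> b 1" using c by (simp add: conj_by_def m_assoc)
  finally show ?case using c by (simp add: cj_eq_iff)
next
  case (Suc j)
  let ?y = "b (Suc j) \<otimes> b (Suc (Suc j))"
  have c: "j < n" "Suc j < n" "Suc (Suc j) < n" using Suc.prems by auto
  have 1: "cj ?y (X j) = X (Suc j)" using c X_far[of "Suc (Suc j)" j] by (simp add: cj_comp)
  have 2: "cj ?y (X (Suc j)) = X (Suc (Suc j))"
    using c X_far[of "Suc j" "Suc (Suc j)"] by (simp add: cj_comp)
  have 3: "cj ?y (b (Suc j)) = b (Suc (Suc j))" using c cj_braid[of "Suc j"] by (simp add: cj_comp)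
  have "cj (b (Suc (Suc j))) (X (Suc j) \<otimes> X (Suc (Suc j))) = cj (cj ?y (b (Suc j))) (cj ?y (X j \<otimes> X (Suc j)))"
    using 1 2 3 c by (simp add: cj_mult del: strand_loop.simps)
  also have "\<dots> = cj ?y (cj (b (Suc j)) (X j \<otimes> X (Suc j)))"
    by (rule cj_cj[symmetric]) (use c in \<open>simp_all del: strand_loop.simps\<close>)
  also have "\<dots> = cj ?y (X j \<otimes> X (Suc j))" using Suc.IH c by simp
  also have "\<dots> = X (Suc j) \<otimes> X (Suc (Suc j))" using 1 2 c by (simp add: cj_mult del: strand_loop.simps)
  finally show ?case .
qed

lemma X_top: assumes "Suc j < n" shows "cj (b (Suc j)) (X (Suc j)) = inv (X (Suc j)) \<otimes> X j \<otimes> X (Suc j)"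
proof -
  have c: "X j \<in> carrier G" "X (Suc j) \<in> carrier G" "b (Suc j) \<in> carrier G"
    using assms by (simp_all del: strand_loop.simps)
  have f: "X (Suc j) = cj (b (Suc j)) (X j)" by simp
  have e: "X (Suc j) \<otimes> cj (b (Suc j)) (X (Suc j)) = X j \<otimes> X (Suc j)"
    using X_pair[OF assms] unfolding cj_mult[OF c(3,1,2)] f[symmetric] .
  have "cj (b (Suc j)) (X (Suc j)) = inv (X (Suc j)) \<otimes> (X (Suc j) \<otimes> cj (b (Suc j)) (X (Suc j)))"
    by (rule inv_cancel_left(1)[symmetric]) (use c in \<open>simp_all del: strand_loop.simps\<close>)
  then show ?thesis unfolding e using c by (simp add: m_assoc del: strand_loop.simps)
qed

lemma X_bottom: assumes "Suc j < n" shows "cj (inv (b (Suc j))) (X j) = X j \<otimes> X (Suc j) \<otimes> inv (X j)"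
proof -
  have c: "X j \<in> carrier G" "X (Suc j) \<in> carrier G" "b (Suc j) \<in> carrier G"
    using assms by (simp_all del: strand_loop.simps)
  have "X j \<otimes> X (Suc j) = cj (inv (b (Suc j))) (cj (b (Suc j)) (X j \<otimes> X (Suc j)))"
    using c by (simp add: cj_inv_cancel del: strand_loop.simps)
  also have "\<dots> = cj (inv (b (Suc j))) (X j) \<otimes> cj (inv (b (Suc j))) (X (Suc j))"
    unfolding X_pair[OF assms] using c by (simp add: cj_mult del: strand_loop.simps)
  also have "cj (inv (b (Suc j))) (X (Suc j)) = X j" using c by (simp add: cj_inv_cancel)
  finally have e: "cj (inv (b (Suc j))) (X j) \<otimes> X j = X j \<otimes> X (Suc j)" ..
  have "cj (inv (b (Suc j))) (X j) = (cj (inv (b (Suc j))) (X j) \<otimes> X j) \<otimes> inv (X j)"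
    using c by (simp add: m_assoc)
  then show ?thesis unfolding e .
qed

text \<open>
  The standard generators act on the loops as braids act on loops in a punctured disc: they permute
  their conjugacy classes.
\<close>

lemma X_conj:
  assumes "i < n" "j < n"
  shows "\<exists>j'<n. \<exists>v\<in>generate G (X ` {..<n}). cj (b i) (X j) = v \<otimes> X j' \<otimes> inv v"
    "\<exists>j'<n. \<exists>v\<in>generate G (X ` {..<n}). cj (inv (b i)) (X j) = v \<otimes> X j' \<otimes> inv v"
proof -
  have Xg: "X k \<in> generate G (X ` {..<n})" "inv (X k) \<in> generate G (X ` {..<n})" if "k < n" for k
    using that by (auto intro: generate.incl generate.inv)
  have triv: "\<exists>j'<n. \<exists>v\<in>generate G (X ` {..<n}). X k = v \<otimes> X j' \<otimes> inv v" if "k < n" for k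
    using that by (intro exI[of _ k] conjI bexI[of _ \<one>]) (auto intro: generate.one)
  consider "i = 0" | "i = Suc j" | k where "i = Suc k" "j = Suc k" | "1 \<le> i" "i \<noteq> j" "i \<noteq> Suc j" by (cases i) auto
  then have "(\<exists>j'<n. \<exists>v\<in>generate G (X ` {..<n}). cj (b i) (X j) = v \<otimes> X j' \<otimes> inv v) \<and>
    (\<exists>j'<n. \<exists>v\<in>generate G (X ` {..<n}). cj (inv (b i)) (X j) = v \<otimes> X j' \<otimes> inv v)"
  proof cases
    case 1
    have "cj (b i) (X j) = X 0 \<otimes> X j \<otimes> inv (X 0)" "cj (inv (b i)) (X j) = inv (X 0) \<otimes> X j \<otimes> inv (inv (X 0))"
      using 1 by (simp_all add: conj_by_def)
    then show ?thesis using assms Xg[of 0] 1 by blast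
  next
    case 2
    then have "cj (inv (b i)) (X j) = X j \<otimes> X (Suc j) \<otimes> inv (X j)" using X_bottom assms by simp
    moreover have "cj (b i) (X j) = X (Suc j)" using 2 by simp
    ultimately show ?thesis using assms 2 Xg[of j] triv[of "Suc j"] by metis
  next
    case (3 k)
    then have "cj (b i) (X j) = inv (X j) \<otimes> X k \<otimes> inv (inv (X j))" using X_top[of k] assms by simp
    moreover have "cj (inv (b i)) (X j) = X k" using 3 assms by (simp add: cj_inv_cancel)
    ultimately show ?thesis using assms 3 Xg[of j] triv[of k] by (metis Suc_lessD)
  next
    case 4
    then have e: "cj (b i) (X j) = X j" using X_far assms by simp
    then have "cj (inv (b i)) (X j) = X j" using cj_inv_cancel[of "b i" "X j"] assms by simp
    then show ?thesis using e triv[OF assms(2)] by simp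
  qed
  then show "\<exists>j'<n. \<exists>v\<in>generate G (X ` {..<n}). cj (b i) (X j) = v \<otimes> X j' \<otimes> inv v"
    "\<exists>j'<n. \<exists>v\<in>generate G (X ` {..<n}). cj (inv (b i)) (X j) = v \<otimes> X j' \<otimes> inv v" by blast+
qed

end

lemma type_B_artin: "type_B (artin_group (graph_B n)) (artin_generator (graph_B n)) n"
proof -
  interpret group "artin_group (graph_B n)" by (rule group_artin)
  have cl: "artin_generator (graph_B n) i \<in> carrier (artin_group (graph_B n))" if "i < n" for i
    unfolding graph_B_def using that by (rule path_gen_closed)
  show ?thesis
  proof (unfold_locales, goal_cases)
    case (1 i) then show ?case by (rule cl)
  next
    case 2
    then show ?case
      using path_adjacent[of 0 n "\<lambda>i. if i = 0 then 4 else 3" 4] cl[of 0] cl[of 1]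
      unfolding graph_B_def[symmetric] by (simp add: alt_prod4 numeral_eq_enat)
  next
    case (3 i)
    then show ?case
      using path_adjacent[of i n "\<lambda>i. if i = 0 then 4 else 3" 3] cl[of i] cl[of "Suc i"]
      unfolding graph_B_def[symmetric] by (simp add: alt_prod3 numeral_eq_enat)
  next
    case (4 i j) then show ?case using path_far unfolding graph_B_def by blast
  qed
qed

lemma artin_B_hom:
  assumes "type_B H b n"
  shows "\<exists>h \<in> hom (artin_group (graph_B n)) H. \<forall>i<n. h (artin_generator (graph_B n) i) = b i"
proof -
  interpret type_B H b n by fact
  show ?thesis unfolding graph_B_def
  proof (rule path_hom)
    fix i k assume "Suc i < n" "(if i = 0 then 4 else 3) = enat k"
    then show "alt_prod H k (b i) (b (Suc i)) = alt_prod H k (b (Suc i)) (b i)"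
      using quad braid[of i] by (auto simp: enat_numeral_eq alt_prod4 alt_prod3 split: if_splits)
  qed (auto intro: far)
qed

locale type_A = group G for G (structure) +
  fixes a :: "nat \<Rightarrow> 'a" and n :: nat
  assumes a_closed [simp]: "i < n \<Longrightarrow> a i \<in> carrier G"
    and braid: "Suc i < n \<Longrightarrow> a i \<otimes> (a (Suc i) \<otimes> a i) = a (Suc i) \<otimes> (a i \<otimes> a (Suc i))"
    and far: "Suc i < j \<Longrightarrow> j < n \<Longrightarrow> a i \<otimes> a j = a j \<otimes> a i"

lemma type_A_artin: "type_A (artin_group (graph_A n)) (artin_generator (graph_A n)) n"
proof -
  interpret group "artin_group (graph_A n)" by (rule group_artin)
  have cl: "artin_generator (graph_A n) i \<in> carrier (artin_group (graph_A n))" if "i < n" for i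
    unfolding graph_A_def using that by (rule path_gen_closed)
  show ?thesis
  proof (unfold_locales, goal_cases)
    case (1 i) then show ?case by (rule cl)
  next
    case (2 i)
    then show ?case
      using path_adjacent[of i n "\<lambda>_. 3" 3] cl[of i] cl[of "Suc i"]
      unfolding graph_A_def[symmetric] by (simp add: alt_prod3 numeral_eq_enat)
  next
    case (3 i j) then show ?case using path_far unfolding graph_A_def by blast
  qed
qed

lemma artin_A_hom:
  assumes "type_A H a n"
  shows "\<exists>h \<in> hom (artin_group (graph_A n)) H. \<forall>i<n. h (artin_generator (graph_A n) i) = a i"
proof -
  interpret type_A H a n by fact
  show ?thesis unfolding graph_A_def
    by (rule path_hom) (auto simp: enat_numeral_eq alt_prod3 braid intro: far)
qed

text \<open>
  The Hurwitz move on sequences of permutations. Sequences with an entry that is not bijective are fixed,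
  which makes the move a bijection of the full function space.
\<close>

definition hurwitz :: "nat \<Rightarrow> (nat \<Rightarrow> nat \<Rightarrow> nat) \<Rightarrow> nat \<Rightarrow> nat \<Rightarrow> nat" where
  "hurwitz i y = (if \<forall>j. bij (y j) then y(i := y i \<circ> y (Suc i) \<circ> inv_into UNIV (y i), Suc i := y i) else y)"

lemma bij_inv_simps:
  assumes "bij f"
  shows "inv_into UNIV f \<circ> f = id" "f \<circ> inv_into UNIV f = id"
    "inv_into UNIV f \<circ> (f \<circ> g) = g" "f \<circ> (inv_into UNIV f \<circ> g) = g"
  using assms by (simp_all add: bij_is_inj bij_is_surj surj_f_inv_f fun_eq_iff)

lemma hurwitz_good: "(\<forall>j. bij (hurwitz i y j)) \<longleftrightarrow> (\<forall>j. bij (y j))"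
proof (cases "\<forall>j. bij (y j)")
  case True
  then have "bij (hurwitz i y j)" for j by (auto simp: hurwitz_def intro!: bij_comp bij_imp_bij_inv)
  then show ?thesis using True by simp
qed (auto simp: hurwitz_def)

lemma bij_hurwitz: "bij (hurwitz i)"
proof -
  define k where "k y = (if \<forall>j. bij (y j) then y(i := y (Suc i), Suc i := inv_into UNIV (y (Suc i)) \<circ> y i \<circ> y (Suc i)) else y)" for y :: "nat \<Rightarrow> nat \<Rightarrow> nat"
  have kg: "(\<forall>j. bij (k y j)) \<longleftrightarrow> (\<forall>j. bij (y j))" for y
  proof (cases "\<forall>j. bij (y j)")
    case True
    then have "bij (k y j)" for j by (auto simp: k_def intro!: bij_comp bij_imp_bij_inv)
    then show ?thesis using True by simp
  qed (auto simp: k_def)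
  have "k (hurwitz i y) = y" for y
  proof (cases "\<forall>j. bij (y j)")
    case True
    then have "k (hurwitz i y) = (hurwitz i y)(i := hurwitz i y (Suc i), Suc i := inv_into UNIV (hurwitz i y (Suc i)) \<circ> hurwitz i y i \<circ> hurwitz i y (Suc i))"
      using hurwitz_good[of i y] by (simp add: k_def)
    then show ?thesis using True bij_inv_simps[of "y i"] by (simp add: hurwitz_def fun_eq_iff comp_assoc)
  qed (use hurwitz_good[of i y] in \<open>auto simp: k_def hurwitz_def\<close>)
  moreover have "hurwitz i (k y) = y" for y
  proof (cases "\<forall>j. bij (y j)")
    case True
    then have "hurwitz i (k y) = (k y)(i := k y i \<circ> k y (Suc i) \<circ> inv_into UNIV (k y i), Suc i := k y i)"
      using kg[of y] by (simp add: hurwitz_def)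
    then show ?thesis using True bij_inv_simps[of "y (Suc i)"] by (simp add: k_def fun_eq_iff comp_assoc)
  qed (use kg[of y] in \<open>auto simp: k_def hurwitz_def\<close>)
  ultimately show ?thesis by (intro o_bij[of k]) (auto simp: fun_eq_iff)
qed

lemma hurwitz_at:
  assumes "\<forall>j. bij (y j)"
  shows "hurwitz i y j = (if j = Suc i then y i else if j = i then y i \<circ> y (Suc i) \<circ> inv_into UNIV (y i) else y j)"
  using assms by (simp add: hurwitz_def)

lemma hurwitz_bad: "\<not> (\<forall>j. bij (y j)) \<Longrightarrow> hurwitz i y = y"
  unfolding hurwitz_def by (rule if_not_P)

lemma inv_comp_bij: "bij f \<Longrightarrow> bij g \<Longrightarrow> inv_into UNIV (f \<circ> g) = inv_into UNIV g \<circ> inv_into UNIV f"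
  by (rule o_inv_distrib)

text \<open>
  Both sides send \<open>(x, y, z)\<close> to \<open>(x y z y\<inverse> x\<inverse>, x y x\<inverse>, x)\<close>.
\<close>

lemma hurwitz_braid: "hurwitz i (hurwitz (Suc i) (hurwitz i y)) = hurwitz (Suc i) (hurwitz i (hurwitz (Suc i) y))"
proof (cases "\<forall>j. bij (y j)")
  case True
  note g = True hurwitz_good[of i y] hurwitz_good[of "Suc i" y] hurwitz_good[of "Suc i" "hurwitz i y"] hurwitz_good[of i "hurwitz (Suc i) y"]
  have b: "bij (y i)" "bij (y (Suc i))" "bij (y (Suc (Suc i)))" using True by auto
  have bi: "bij (inv_into UNIV (y i))" using b by (simp add: bij_imp_bij_inv)
  have ii: "inv_into UNIV (inv_into UNIV (y i)) = y i" using b by (simp add: inv_inv_eq)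
  show ?thesis
  proof
    fix j
    show "hurwitz i (hurwitz (Suc i) (hurwitz i y)) j = hurwitz (Suc i) (hurwitz i (hurwitz (Suc i) y)) j"
      using g b bi by (simp add: hurwitz_at inv_comp_bij bij_comp ii comp_assoc bij_inv_simps[OF b(1)])
  qed
next
  case False
  then show ?thesis by (simp only: hurwitz_bad[OF False])
qed

lemma hurwitz_far: assumes "Suc i < k" shows "hurwitz i (hurwitz k y) = hurwitz k (hurwitz i y)"
proof (cases "\<forall>j. bij (y j)")
  case True
  note g = True hurwitz_good[of i y] hurwitz_good[of k y]
  show ?thesis
  proof
    fix j show "hurwitz i (hurwitz k y) j = hurwitz k (hurwitz i y) j"
      using g assms by (simp add: hurwitz_at)
  qed
next
  case False
  then show ?thesis by (simp only: hurwitz_bad[OF False])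
qed

text \<open>
  The group of type \<open>B\<close> acts on sequences of permutations by Hurwitz moves, \<open>b\<^sub>0\<close> acting trivially but with the
  first entry as cocycle. On sequences beginning with \<open>x, y\<close> both sides of the length-four relation have the cocycle
  \<open>x y\<close>.
\<close>

lemma type_B_hurwitz:
  "type_B (wreath perms) (\<lambda>i. if i = 0 then (id, \<lambda>y. if \<forall>j. bij (y j) then y 0 else id) else (hurwitz (i - 1), \<lambda>_. id)) n"
  (is "type_B _ ?b n")
proof -
  interpret group "wreath perms :: (((nat \<Rightarrow> nat \<Rightarrow> nat) \<Rightarrow> nat \<Rightarrow> nat \<Rightarrow> nat) \<times> ((nat \<Rightarrow> nat \<Rightarrow> nat) \<Rightarrow> nat \<Rightarrow> nat)) monoid"
    by (rule group_wreath[OF group_perms])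
  show ?thesis
  proof unfold_locales
    show "?b i \<in> carrier (wreath perms)" for i by (simp add: wreath_carrier bij_hurwitz)
    define g where g: "g = (\<lambda>y :: nat \<Rightarrow> nat \<Rightarrow> nat. if \<forall>j. bij (y j) then y 0 else id)"
    then have g_def: "g y = (if \<forall>j. bij (y j) then y 0 else id)" for y by simp
    have "g (hurwitz 0 (hurwitz 0 y)) \<circ> g (hurwitz 0 y) = g (hurwitz 0 y) \<circ> g y" for y
    proof (cases "\<forall>j. bij (y j)")
      case True
      then have b: "bij (y 0)" "bij (y (Suc 0))" by auto
      have bi: "bij (inv_into UNIV (y 0))" using b by (simp add: bij_imp_bij_inv)
      have ii: "inv_into UNIV (inv_into UNIV (y 0)) = y 0" using b by (simp add: inv_inv_eq)
      show ?thesis using True hurwitz_good[of 0 y] hurwitz_good[of 0 "hurwitz 0 y"] b bi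
        by (simp add: g_def hurwitz_at inv_comp_bij bij_comp ii comp_assoc bij_inv_simps[OF b(1)] bij_inv_simps[OF b(2)])
    next
      case False
      show ?thesis by (simp only: hurwitz_bad[OF False])
    qed
    moreover have "?b 0 = (id, g)" "?b 1 = (hurwitz 0, \<lambda>_. id)" by (simp_all add: g)
    ultimately show "?b 0 \<otimes>\<^bsub>wreath perms\<^esub> (?b 1 \<otimes>\<^bsub>wreath perms\<^esub> (?b 0 \<otimes>\<^bsub>wreath perms\<^esub> ?b 1)) = ?b 1 \<otimes>\<^bsub>wreath perms\<^esub> (?b 0 \<otimes>\<^bsub>wreath perms\<^esub> (?b 1 \<otimes>\<^bsub>wreath perms\<^esub> ?b 0))"
      by (simp only:) (simp add: wreath_mult)
    show "?b i \<otimes>\<^bsub>wreath perms\<^esub> (?b (Suc i) \<otimes>\<^bsub>wreath perms\<^esub> ?b i) = ?b (Suc i) \<otimes>\<^bsub>wreath perms\<^esub> (?b i \<otimes>\<^bsub>wreath perms\<^esub> ?b (Suc i))" if "1 \<le> i" for i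
      using that hurwitz_braid[of "i - 1"] by (simp add: wreath_mult fun_eq_iff)
    show "?b i \<otimes>\<^bsub>wreath perms\<^esub> ?b j = ?b j \<otimes>\<^bsub>wreath perms\<^esub> ?b i" if "Suc i < j" for i j
    proof (cases "i = 0")
      case True
      define g where g: "g = (\<lambda>y :: nat \<Rightarrow> nat \<Rightarrow> nat. if \<forall>j. bij (y j) then y 0 else id)"
      have "g (hurwitz (j - 1) y) = g y" for y
        using that True by (simp add: g hurwitz_good hurwitz_at)
      moreover have "?b i = (id, g)" "?b j = (hurwitz (j - 1), \<lambda>_. id)" using that True by (simp_all add: g)
      ultimately show ?thesis by (simp only:) (simp add: wreath_mult)
    next
      case False
      then show ?thesis using that hurwitz_far[of "i - 1" "j - 1"] by (simp add: wreath_mult fun_eq_iff)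
    qed
  qed
qed

lemma graph_B_generate: "generate (artin_group (graph_B n)) (artin_generator (graph_B n) ` {..<n}) = carrier (artin_group (graph_B n))"
  unfolding graph_B_def by (rule path_generate)

lemma graph_A_generate: "generate (artin_group (graph_A n)) (artin_generator (graph_A n) ` {..<n}) = carrier (artin_group (graph_A n))"
  unfolding graph_A_def by (rule path_generate)

text \<open>
  The \<open>j\<close>th loop fixes every sequence, and its cocycle is the \<open>j\<close>th entry. As the sequence is arbitrary, the
  loops freely generate their span.
\<close>

lemma strand_loop_wreath:
  assumes "h \<in> hom (artin_group (graph_B n)) (wreath perms)"
    "\<And>i. i < n \<Longrightarrow> h (artin_generator (graph_B n) i) = (if i = 0 then (id, \<lambda>y. if \<forall>j. bij (y j) then y 0 else id) else (hurwitz (i - 1), \<lambda>_. id))"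
  shows "j < n \<Longrightarrow> h (strand_loop (artin_group (graph_B n)) (artin_generator (graph_B n)) j) = (id, \<lambda>y. if \<forall>i. bij (y i) then y j else id)"
proof (induction j)
  case 0 show ?case unfolding strand_loop.simps assms(2)[OF 0] by (rule if_P) simp
next
  case (Suc j)
  interpret B: type_B "artin_group (graph_B n)" "artin_generator (graph_B n)" n by (rule type_B_artin)
  interpret W: group "wreath perms :: (((nat \<Rightarrow> nat \<Rightarrow> nat) \<Rightarrow> nat \<Rightarrow> nat \<Rightarrow> nat) \<times> ((nat \<Rightarrow> nat \<Rightarrow> nat) \<Rightarrow> nat \<Rightarrow> nat)) monoid"
    by (rule group_wreath[OF group_perms])
  let ?c = "\<lambda>j. (id, \<lambda>y. if \<forall>i. bij (y i) then y j else id)"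
  let ?h = "(hurwitz j, \<lambda>_. id)"
  have cl: "?h \<in> carrier (wreath perms)" "?c j \<in> carrier (wreath perms)" "?c (Suc j) \<in> carrier (wreath perms)"
    by (simp_all add: wreath_carrier bij_hurwitz)
  have "(if \<forall>i. bij (hurwitz j y i) then hurwitz j y (Suc j) else id) = (if \<forall>i. bij (y i) then y j else id)" for y
    by (simp add: hurwitz_good hurwitz_at)
  then have "?h \<otimes>\<^bsub>wreath perms\<^esub> ?c j = ?c (Suc j) \<otimes>\<^bsub>wreath perms\<^esub> ?h"
    by (simp add: wreath_mult)
  then have m1: "conj_by (wreath perms) ?h (?c j) = ?c (Suc j)" using cl W.cj_eq_iff by blast
  have m2: "h (strand_loop (artin_group (graph_B n)) (artin_generator (graph_B n)) (Suc j)) = conj_by (wreath perms) ?h (?c j)"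
  proof -
    have e: "h (artin_generator (graph_B n) (Suc j)) = ?h" using assms(2)[OF Suc.prems] by (simp del: id_apply)
    show ?thesis unfolding strand_loop.simps e[symmetric] Suc.IH[OF Suc_lessD[OF Suc.prems], symmetric]
      by (rule hom_conj_by[OF B.is_group W.is_group assms(1)]) (use Suc.prems in simp_all)
  qed
  show ?case using m2 unfolding m1 .
qed

text \<open>
  Killing \<open>b\<^sub>0\<close> is a split surjection onto the braid group on the \<open>n\<close> strands, with kernel free on the loops of
  the axis.
\<close>

theorem virtually_separated_B_if_A:
  assumes p: "1 < p" and n: "2 \<le> n" and Q: "virtually_separated p (artin_group (graph_A (n - 1)))"
  shows "virtually_separated p (artin_group (graph_B n))"
proof -
  define m where "m = n - 1"
  have n_m: "n = Suc m" using n by (simp add: m_def)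
  let ?G = "artin_group (graph_B n)" and ?Q = "artin_group (graph_A m)"
  let ?b = "artin_generator (graph_B n)" and ?a = "artin_generator (graph_A m)"
  interpret B: type_B ?G ?b n by (rule type_B_artin)
  interpret A: type_A ?Q ?a m by (rule type_A_artin)
  \<comment> \<open>The surjection \<open>h\<close> and its section \<open>k\<close>.\<close>
  have "type_B ?Q (\<lambda>i. if i = 0 then \<one>\<^bsub>?Q\<^esub> else ?a (i - 1)) n"
  proof (unfold_locales, goal_cases)
    case (3 i) then show ?case using A.braid[of "i - 1"] n_m by simp
  next
    case (4 i j)
    then have "j - 1 < m" "i \<noteq> 0 \<Longrightarrow> Suc (i - 1) < j - 1" using n_m by linarith+
    then show ?case using 4 A.far[of "i - 1" "j - 1"] A.a_closed[of "j - 1"] by (cases "i = 0") simp_all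
  qed (use n n_m in simp_all)
  from artin_B_hom[OF this] obtain h where h: "h \<in> hom ?G ?Q"
    "\<And>i. i < n \<Longrightarrow> h (?b i) = (if i = 0 then \<one>\<^bsub>?Q\<^esub> else ?a (i - 1))" by blast
  interpret h: group_hom ?G ?Q h by unfold_locales (rule h(1))
  have "type_A ?G (\<lambda>i. ?b (Suc i)) m"
  proof (unfold_locales, goal_cases)
    case (1 i) then show ?case using B.b_closed[of "Suc i"] n_m by simp
  next
    case (2 i) then show ?case using B.braid[of "Suc i"] n_m by simp
  next
    case (3 i j) then show ?case using B.far[of "Suc i" "Suc j"] n_m by simp
  qed
  from artin_A_hom[OF this] obtain k where k: "k \<in> hom ?Q ?G"
    "\<And>i. i < m \<Longrightarrow> k (?a i) = ?b (Suc i)" by blast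
  interpret k: group_hom ?Q ?G k by unfold_locales (rule k(1))
  let ?B = "B.X ` {..<n}"
  let ?N = "generate ?G ?B"
  have Bc: "?B \<subseteq> carrier ?G" by auto
  note Nc = B.generate_in_carrier[OF Bc]
  have hk: "h (k q) = q" if "q \<in> carrier ?Q" for q
  proof -
    have "(h \<circ> k) q = id q"
      by (rule hom_eq_on_generate[OF A.is_group A.is_group hom_compose[OF k(1) h(1)] _ _ _ that[folded graph_A_generate]])
        (use h(2) k(2) n_m in \<open>auto simp: hom_def\<close>)
    then show ?thesis by simp
  qed
  have hX: "h (B.X j) = \<one>\<^bsub>?Q\<^esub>" if "j < n" for j
    using that
  proof (induction j)
    case 0 then show ?case using h(2)[of 0] by simp
  next
    case (Suc j)
    then have "j < m" using n_m by linarith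
    then show ?case using Suc hom_conj_by[OF B.is_group A.is_group h(1), of "?b (Suc j)" "B.X j"] h(2)[of "Suc j"]
      by (simp add: conj_by_def)
  qed
  have hN: "h x = \<one>\<^bsub>?Q\<^esub>" if "x \<in> ?N" for x
    using that
  proof (induction rule: generate.induct)
    case (inv x)
    then obtain j where "j < n" "x = B.X j" by auto
    then show ?case using hX[of j] by simp
  next
    case (eng x y) then show ?case using Nc by simp
  qed (use hX in auto)
  have norm: "B.cj s x \<in> ?N \<and> B.cj (inv\<^bsub>?G\<^esub> s) x \<in> ?N" if sx: "s \<in> ?b ` {..<n}" "x \<in> ?N" for s x
  proof -
    obtain i where i: "i < n" "s = ?b i" using sx by auto
    have mem: "v \<otimes>\<^bsub>?G\<^esub> B.X j \<otimes>\<^bsub>?G\<^esub> inv\<^bsub>?G\<^esub> v \<in> ?N" if "v \<in> ?N" "j < n" for v j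
      using that by (intro generate.eng B.generate_m_inv_closed[OF Bc]) (auto intro: generate.incl)
    have g: "B.cj (?b i) y \<in> ?N" "B.cj (inv\<^bsub>?G\<^esub> ?b i) y \<in> ?N" if y: "y \<in> ?B" for y
    proof -
      obtain j where j: "j < n" "y = B.X j" using y by auto
      show "B.cj (?b i) y \<in> ?N" using B.X_conj(1)[OF i(1) j(1)] mem j(2) by fastforce
      show "B.cj (inv\<^bsub>?G\<^esub> ?b i) y \<in> ?N" using B.X_conj(2)[OF i(1) j(1)] mem j(2) by fastforce
    qed
    show ?thesis using B.cj_generate[OF Bc _ g(1) sx(2)] B.cj_generate[OF Bc _ g(2) sx(2)] i by simp
  qed
  let ?W = "{x \<otimes>\<^bsub>?G\<^esub> k q | x q. x \<in> ?N \<and> q \<in> carrier ?Q}"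
  have WI: "x \<otimes>\<^bsub>?G\<^esub> k q \<in> ?W" if "x \<in> ?N" "q \<in> carrier ?Q" for x q using that by blast
  have b0: "?b 0 \<in> ?N"
  proof -
    have "B.X 0 \<in> ?B" using n by (intro imageI) simp
    then show ?thesis by (simp add: generate.incl)
  qed
  \<comment> \<open>Every element is a product of an element of the span of the loops and one of the image of \<open>k\<close>, so the
    kernel of \<open>h\<close> is that span.\<close>
  have "carrier ?G \<subseteq> ?W"
    unfolding graph_B_generate[symmetric]
  proof (rule B.generate_left_induct)
    show "?b ` {..<n} \<subseteq> carrier ?G" by auto
    show "?W \<subseteq> carrier ?G" using Nc by auto
    have "\<one>\<^bsub>?G\<^esub> \<otimes>\<^bsub>?G\<^esub> k \<one>\<^bsub>?Q\<^esub> \<in> ?W" by (rule WI[OF generate.one A.one_closed])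
    then show "\<one>\<^bsub>?G\<^esub> \<in> ?W" by simp
    fix s w assume s: "s \<in> ?b ` {..<n}" and "w \<in> ?W"
    then obtain x q where xq: "w = x \<otimes>\<^bsub>?G\<^esub> k q" "x \<in> ?N" "q \<in> carrier ?Q" by blast
    obtain i where i: "i < n" "s = ?b i" using s by auto
    have c: "s \<in> carrier ?G" "x \<in> carrier ?G" "k q \<in> carrier ?G" using i xq Nc by auto
    have step: "t \<otimes>\<^bsub>?G\<^esub> w \<in> ?W" if t: "t \<in> carrier ?G" "B.cj t x \<in> ?N" "t \<in> ?N \<or> (\<exists>r\<in>carrier ?Q. t = k r)" for t
      using t(3)
    proof
      assume "t \<in> ?N"
      from WI[OF generate.eng[OF this xq(2)] xq(3)] show ?thesis
        unfolding xq(1) B.m_assoc[OF t(1) c(2,3)] .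
    next
      assume "\<exists>r\<in>carrier ?Q. t = k r"
      then obtain r where r: "r \<in> carrier ?Q" "t = k r" by blast
      have "B.cj t x \<otimes>\<^bsub>?G\<^esub> k (r \<otimes>\<^bsub>?Q\<^esub> q) \<in> ?W" by (rule WI[OF t(2) A.m_closed[OF r(1) xq(3)]])
      moreover have "B.cj t x \<otimes>\<^bsub>?G\<^esub> k (r \<otimes>\<^bsub>?Q\<^esub> q) = t \<otimes>\<^bsub>?G\<^esub> w"
        unfolding k.hom_mult[OF r(1) xq(3)] r(2)[symmetric] xq(1) using c t(1) by (simp add: conj_by_def B.m_assoc B.inv_cancel_left)
      ultimately show ?thesis by (simp only:)
    qed
    have sc: "s \<in> ?N \<or> (\<exists>r\<in>carrier ?Q. s = k r)"
    proof (cases "i = 0")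
      case False
      then have "s = k (?a (i - 1))" "?a (i - 1) \<in> carrier ?Q" using i k(2)[of "i - 1"] n_m by auto
      then show ?thesis by blast
    qed (use b0 i in simp)
    then have "inv\<^bsub>?G\<^esub> s \<in> ?N \<or> (\<exists>r\<in>carrier ?Q. inv\<^bsub>?G\<^esub> s = k r)"
    proof
      assume "s \<in> ?N" then show ?thesis using B.generate_m_inv_closed[OF Bc] by blast
    next
      assume "\<exists>r\<in>carrier ?Q. s = k r"
      then obtain r where r: "r \<in> carrier ?Q" "s = k r" by (elim bexE)
      have "inv\<^bsub>?G\<^esub> s = k (inv\<^bsub>?Q\<^esub> r)" unfolding r(2) by (rule k.hom_inv[OF r(1), symmetric])
      then show ?thesis using A.inv_closed[OF r(1)] by blast
    qed
    then show "s \<otimes>\<^bsub>?G\<^esub> w \<in> ?W" "inv\<^bsub>?G\<^esub> s \<otimes>\<^bsub>?G\<^esub> w \<in> ?W"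
      using step[OF c(1) conjunct1[OF norm[OF s xq(2)]] sc]
        step[OF B.inv_closed[OF c(1)] conjunct2[OF norm[OF s xq(2)]]] by blast+
  qed
  then have W: "g \<in> ?W" if "g \<in> carrier ?G" for g using that by blast
  have ker: "h g = \<one>\<^bsub>?Q\<^esub> \<longleftrightarrow> g \<in> ?N" if g: "g \<in> carrier ?G" for g
  proof
    assume h1: "h g = \<one>\<^bsub>?Q\<^esub>"
    obtain x q where xq: "g = x \<otimes>\<^bsub>?G\<^esub> k q" "x \<in> ?N" "q \<in> carrier ?Q" using W[OF g] by blast
    then have "h g = q" using hN[OF xq(2)] hk[OF xq(3)] Nc[OF xq(2)] by simp
    then have "q = \<one>\<^bsub>?Q\<^esub>" using h1 by simp
    then show "g \<in> ?N" using xq Nc[OF xq(2)] by simp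
  qed (rule hN)
  have fam: "\<exists>h \<in> hom ?G (wreath perms). \<exists>i :: nat \<Rightarrow> nat \<Rightarrow> nat. \<forall>j\<in>{..<n}. fst (h (B.X j)) i = i \<and> snd (h (B.X j)) i = y j"
    if y: "\<And>j. bij (y j)" for y :: "nat \<Rightarrow> nat \<Rightarrow> nat"
  proof -
    from artin_B_hom[OF type_B_hurwitz[of n]] obtain \<Phi> where \<Phi>: "\<Phi> \<in> hom ?G (wreath perms)"
      "\<forall>i<n. \<Phi> (?b i) = (if i = 0 then (id, \<lambda>y. if \<forall>j. bij (y j) then y 0 else id) else (hurwitz (i - 1), \<lambda>_. id))" by (elim bexE)
    have "\<Phi> (B.X j) = (id, \<lambda>y. if \<forall>i. bij (y i) then y j else id)" if "j < n" for j
      by (rule strand_loop_wreath[OF \<Phi>(1) _ that]) (use \<Phi>(2) in blast)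
    then show ?thesis using y by (intro bexI[OF _ \<Phi>(1)] exI[of _ y]) simp
  qed
  have "B.X \<in> {..<n} \<rightarrow> carrier ?G" by auto
  note fb = free_basis_family[OF B.is_group this fam]
  have X01: "B.X 0 \<in> ?B" "B.X 1 \<in> ?B" using n by (intro imageI; simp)+
  have ne: "B.X 0 \<noteq> B.X 1" using inj_onD[OF fb(2), of 0 1] n by (auto simp del: strand_loop.simps)
  have fin: "finite ?B" by simp
  have cnj: "(\<exists>b'\<in>?B. \<exists>v\<in>?N. s \<otimes>\<^bsub>?G\<^esub> b \<otimes>\<^bsub>?G\<^esub> inv\<^bsub>?G\<^esub> s = v \<otimes>\<^bsub>?G\<^esub> b' \<otimes>\<^bsub>?G\<^esub> inv\<^bsub>?G\<^esub> v) \<and>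
        (\<exists>b'\<in>?B. \<exists>v\<in>?N. inv\<^bsub>?G\<^esub> s \<otimes>\<^bsub>?G\<^esub> b \<otimes>\<^bsub>?G\<^esub> s = v \<otimes>\<^bsub>?G\<^esub> b' \<otimes>\<^bsub>?G\<^esub> inv\<^bsub>?G\<^esub> v)"
    if sb: "s \<in> ?b ` {..<n}" "b \<in> ?B" for s b
  proof -
    obtain i j where ij: "i < n" "s = ?b i" "j < n" "b = B.X j" using sb by auto
    have "B.cj (inv\<^bsub>?G\<^esub> s) b = inv\<^bsub>?G\<^esub> s \<otimes>\<^bsub>?G\<^esub> b \<otimes>\<^bsub>?G\<^esub> s" using ij by (simp add: conj_by_def)
    then show ?thesis using B.X_conj[OF ij(1,3)] ij(2,4) by (force simp: conj_by_def)
  qed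
  have S: "?b ` {..<n} \<subseteq> carrier ?G" by auto
  show ?thesis
    by (rule virtually_separated_free_kernel_permuted[OF p B.is_group h(1) Q[folded m_def] fb(1) X01 ne fin ker S graph_B_generate cnj])
qed

section \<open>Type A over type B\<close>

text \<open>
  Braids on \<open>n + 1\<close> strands in which one strand returns to position \<open>0\<close> form a copy of the group of type \<open>B\<close>
  inside that of type \<open>A\<close>, of index \<open>n + 1\<close>. The generator \<open>a\<^sub>i\<close> moves the distinguished strand by
  \<open>swap_pos i\<close>.
\<close>

definition swap_pos :: "nat \<Rightarrow> nat \<Rightarrow> nat" where
  "swap_pos i j = (if j = i then Suc i else if j = Suc i then i else j)"

text \<open>
  The element of type \<open>B\<close> picked up when \<open>a\<^sub>i\<close> is applied with the distinguished strand in position \<open>j\<close>, relative to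
  the coset representatives \<open>a\<^sub>j\<^sub>-\<^sub>1 \<cdots> a\<^sub>0\<close>. Positions beyond \<open>n\<close> do not occur and get the value \<open>\<one>\<close>.
\<close>

definition strand_cocycle :: "('a, 'b) monoid_scheme \<Rightarrow> (nat \<Rightarrow> 'a) \<Rightarrow> nat \<Rightarrow> nat \<Rightarrow> nat \<Rightarrow> 'a" where
  "strand_cocycle G b n i j = (if n < j then \<one>\<^bsub>G\<^esub> else if j = Suc i then strand_loop G b i
     else if j = i then \<one>\<^bsub>G\<^esub> else if j < i then b i else b (Suc i))"

lemma bij_swap_pos: "bij (swap_pos i)"
  by (rule o_bij[of "swap_pos i"]) (auto simp: swap_pos_def fun_eq_iff)

context type_B begin

lemma X_comm: "1 \<le> i \<Longrightarrow> i < n \<Longrightarrow> j < n \<Longrightarrow> i \<noteq> j \<Longrightarrow> i \<noteq> Suc j \<Longrightarrow> b i \<otimes> X j = X j \<otimes> b i"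
  using X_far[of i j] by (simp add: cj_eq_iff)

lemma X_Suc_comm: "Suc j < n \<Longrightarrow> b (Suc j) \<otimes> X j = X (Suc j) \<otimes> b (Suc j)"
proof -
  assume j: "Suc j < n"
  have "cj (b (Suc j)) (X j) = X (Suc j)" by simp
  then show ?thesis using j X_closed[OF j] by (simp only: cj_eq_iff b_closed X_closed Suc_lessD)
qed

lemma X_pair_comm: "Suc j < n \<Longrightarrow> b (Suc j) \<otimes> (X j \<otimes> X (Suc j)) = X j \<otimes> (X (Suc j) \<otimes> b (Suc j))"
proof -
  assume j: "Suc j < n"
  have c: "X j \<in> carrier G" "X (Suc j) \<in> carrier G" "b (Suc j) \<in> carrier G"
    using j by (simp_all del: strand_loop.simps)
  have "b (Suc j) \<otimes> (X j \<otimes> X (Suc j)) = X j \<otimes> X (Suc j) \<otimes> b (Suc j)"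
    using X_pair[OF j] cj_eq_iff[OF c(3) m_closed[OF c(1,2)] m_closed[OF c(1,2)]] by blast
  then show ?thesis using c by (simp only: m_assoc)
qed

lemma strand_cocycle_closed: "i < n \<Longrightarrow> strand_cocycle G b n i j \<in> carrier G"
  by (auto simp: strand_cocycle_def)

lemma type_A_strand_wreath: "type_A (wreath G) (\<lambda>i. (swap_pos i, strand_cocycle G b n i)) n"
proof -
  interpret W: group "wreath G :: ((nat \<Rightarrow> nat) \<times> (nat \<Rightarrow> 'a)) monoid" by (rule group_wreath[OF is_group])
  note d = strand_cocycle_def swap_pos_def
  show ?thesis
  proof (unfold_locales, goal_cases)
    case (1 i) then show ?case by (simp add: wreath_carrier bij_swap_pos strand_cocycle_closed)
  next
    case (2 i)
    then have i: "i < n" "Suc i < n" by auto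
    let ?c = "strand_cocycle G b n"
    have "?c i (swap_pos (Suc i) (swap_pos i j)) \<otimes> (?c (Suc i) (swap_pos i j) \<otimes> ?c i j) =
      ?c (Suc i) (swap_pos i (swap_pos (Suc i) j)) \<otimes> (?c i (swap_pos (Suc i) j) \<otimes> ?c (Suc i) j)" for j
    proof -
      consider "n < j" | "j = i" | "j = Suc i" | "j = Suc (Suc i)" | "j < i" | "Suc (Suc i) < j" "j \<le> n" by linarith
      then show ?thesis
      proof cases
        case 1 then show ?thesis using i by (simp add: d)
      next
        case 2 then show ?thesis using i by (simp add: d)
      next
        case 3 then show ?thesis using i X_Suc_comm[OF i(2)] by (simp add: d del: strand_loop.simps)
      next
        case 4 then show ?thesis using i X_pair_comm[OF i(2)] by (simp add: d del: strand_loop.simps)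
      next
        case 5 then show ?thesis using i braid[of i] by (simp add: d)
      next
        case 6 then show ?thesis using i braid[of "Suc i"] by (simp add: d)
      qed
    qed
    moreover have "swap_pos i \<circ> (swap_pos (Suc i) \<circ> swap_pos i) = swap_pos (Suc i) \<circ> (swap_pos i \<circ> swap_pos (Suc i))"
      by (auto simp: swap_pos_def fun_eq_iff)
    ultimately show ?case by (simp add: wreath_mult)
  next
    case (3 i k)
    then have ik: "i < n" "k < n" "Suc i < k" by auto
    let ?c = "strand_cocycle G b n"
    have "?c i (swap_pos k j) \<otimes> ?c k j = ?c k (swap_pos i j) \<otimes> ?c i j" for j
    proof -
      consider "n < j" | "j < i" | "j = i" | "j = Suc i" | "Suc i < j" "j < k" | "j = k" | "j = Suc k" | "Suc k < j" "j \<le> n" by linarith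
      then show ?thesis
      proof cases
        case 1 then show ?thesis using ik by (simp add: d)
      next
        case 2 then show ?thesis using ik far[of i k] by (simp add: d)
      next
        case 3 then show ?thesis using ik by (simp add: d)
      next
        case 4 then show ?thesis using ik X_comm[of k i] by (simp add: d)
      next
        case 5 then show ?thesis using ik far[of "Suc i" k] by (simp add: d)
      next
        case 6 then show ?thesis using ik by (simp add: d)
      next
        case 7 then show ?thesis using ik X_comm[of "Suc i" k] by (simp add: d)
      next
        case 8 then show ?thesis using ik far[of "Suc i" "Suc k"] by (simp add: d)
      qed
    qed
    moreover have "swap_pos i \<circ> swap_pos k = swap_pos k \<circ> swap_pos i"
      using ik by (auto simp: swap_pos_def fun_eq_iff)
    ultimately show ?case by (simp add: wreath_mult)
  qed
qed

end

primrec strand_transversal :: "('a, 'b) monoid_scheme \<Rightarrow> (nat \<Rightarrow> 'a) \<Rightarrow> nat \<Rightarrow> 'a" where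
  "strand_transversal G a 0 = \<one>\<^bsub>G\<^esub>"
| "strand_transversal G a (Suc j) = a j \<otimes>\<^bsub>G\<^esub> strand_transversal G a j"

context group begin

lemma square_commute:
  assumes "x \<in> carrier G" "y \<in> carrier G" "x \<otimes> y = y \<otimes> x"
  shows "(x \<otimes> x) \<otimes> y = y \<otimes> (x \<otimes> x)"
proof -
  have "(x \<otimes> x) \<otimes> y = x \<otimes> (y \<otimes> x)" unfolding assms(3)[symmetric] using assms(1,2) by (simp add: m_assoc)
  also have "\<dots> = (x \<otimes> y) \<otimes> x" using assms(1,2) by (simp add: m_assoc)
  finally show ?thesis unfolding assms(3) using assms(1,2) by (simp add: m_assoc)
qed

text \<open>
  The squares of a braid generator and its neighbour satisfy the relation of length four: \<open>y x x y\<close> commutes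
  with \<open>x\<close>.
\<close>

lemma square_quad:
  assumes c: "x \<in> carrier G" "y \<in> carrier G" and br: "x \<otimes> (y \<otimes> x) = y \<otimes> (x \<otimes> y)"
  shows "(x \<otimes> x) \<otimes> (y \<otimes> ((x \<otimes> x) \<otimes> y)) = y \<otimes> ((x \<otimes> x) \<otimes> (y \<otimes> (x \<otimes> x)))"
proof -
  have br': "x \<otimes> (y \<otimes> (x \<otimes> z)) = y \<otimes> (x \<otimes> (y \<otimes> z))" if "z \<in> carrier G" for z
  proof -
    have "(x \<otimes> (y \<otimes> x)) \<otimes> z = (y \<otimes> (x \<otimes> y)) \<otimes> z" using br by simp
    then show ?thesis using c that by (simp add: m_assoc)
  qed
  let ?z = "y \<otimes> (x \<otimes> (x \<otimes> y))"
  have "x \<otimes> ?z = y \<otimes> (x \<otimes> (y \<otimes> (x \<otimes> y)))" using br'[of "x \<otimes> y"] c by simp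
  also have "\<dots> = ?z \<otimes> x" using c br by (simp add: m_assoc)
  finally have xz: "x \<otimes> ?z = ?z \<otimes> x" .
  have zc: "?z \<in> carrier G" using c by simp
  show ?thesis using square_commute[OF c(1) zc xz] c by (simp add: m_assoc)
qed

end

context type_A begin

abbreviation r where "r \<equiv> strand_transversal G a"
abbreviation bb where "bb \<equiv> (\<lambda>i. if i = 0 then a 0 \<otimes> a 0 else a i)"

lemma r_closed [simp]: "j \<le> n \<Longrightarrow> r j \<in> carrier G"
  by (induction j) auto

lemma cj_flip: "Suc i < n \<Longrightarrow> cj (a (Suc i)) (a i) = cj (inv (a i)) (a (Suc i))"
proof -
  assume i: "Suc i < n"
  let ?x = "a i" and ?y = "a (Suc i)"
  have c: "?x \<in> carrier G" "?y \<in> carrier G" using i by auto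
  have "?y \<otimes> ?x \<otimes> inv ?y = inv ?x \<otimes> (?x \<otimes> (?y \<otimes> ?x)) \<otimes> inv ?y" using c by (simp add: inv_cancel_left)
  also have "\<dots> = inv ?x \<otimes> (?y \<otimes> (?x \<otimes> ?y)) \<otimes> inv ?y" using braid[OF i] by simp
  also have "\<dots> = inv ?x \<otimes> ?y \<otimes> ?x" using c by (simp add: m_assoc)
  finally show ?thesis using c by (simp add: conj_by_def)
qed

lemma type_B_squared: "type_B G bb n"
proof (unfold_locales, goal_cases)
  case (1 i) then show ?case by simp
next
  case 2
  then show ?case using square_quad[of "a 0" "a 1"] braid[of 0] by simp
next
  case (3 i) then show ?case using braid[of i] by simp
next
  case (4 i j)
  then show ?case using far[of i j] a_closed[of i] a_closed[of j] square_commute[of "a i" "a j"]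
    by (cases "i = 0") simp_all
qed

lemma r_commute: "j < i \<Longrightarrow> i < n \<Longrightarrow> a i \<otimes> r j = r j \<otimes> a i"
proof (induction j)
  case (Suc j)
  have c: "a i \<in> carrier G" "a j \<in> carrier G" "r j \<in> carrier G" using Suc.prems by auto
  have "a i \<otimes> r (Suc j) = (a i \<otimes> a j) \<otimes> r j" using c by (simp add: m_assoc)
  also have "\<dots> = a j \<otimes> (a i \<otimes> r j)" using far[of j i, symmetric] Suc.prems c by (simp add: m_assoc)
  also have "\<dots> = r (Suc j) \<otimes> a i" using Suc c by (simp add: m_assoc)
  finally show ?case .
qed simp

lemma r_shift: "Suc i < j \<Longrightarrow> j \<le> n \<Longrightarrow> a i \<otimes> r j = r j \<otimes> a (Suc i)"
proof (induction j)
  case (Suc j)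
  show ?case
  proof (cases "j = Suc i")
    case True
    have c: "a i \<in> carrier G" "a (Suc i) \<in> carrier G" "r i \<in> carrier G" using Suc.prems True by auto
    have "a i \<otimes> r (Suc j) = (a i \<otimes> (a (Suc i) \<otimes> a i)) \<otimes> r i" using c True by (simp add: m_assoc)
    also have "\<dots> = a (Suc i) \<otimes> (a i \<otimes> (a (Suc i) \<otimes> r i))" using braid[of i] Suc.prems c True by (simp add: m_assoc)
    also have "\<dots> = r (Suc j) \<otimes> a (Suc i)" using r_commute[of i "Suc i"] c True Suc.prems by (simp add: m_assoc)
    finally show ?thesis .
  next
    case False
    have c: "a i \<in> carrier G" "a (Suc i) \<in> carrier G" "a j \<in> carrier G" "r j \<in> carrier G" using Suc.prems by auto
    have "a i \<otimes> r (Suc j) = (a i \<otimes> a j) \<otimes> r j" using c by (simp add: m_assoc)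
    also have "\<dots> = a j \<otimes> (a i \<otimes> r j)" using far[of i j] Suc.prems False c by (simp add: m_assoc)
    also have "\<dots> = r (Suc j) \<otimes> a (Suc i)" using Suc False c by (simp add: m_assoc)
    finally show ?thesis .
  qed
qed simp

lemma r_square: "i < n \<Longrightarrow> cj (r i) (strand_loop G bb i) = a i \<otimes> a i"
proof (induction i)
  case 0 then show ?case by (simp add: conj_by_def)
next
  case (Suc i)
  interpret B: type_B G bb n by (rule type_B_squared)
  have c: "a i \<in> carrier G" "a (Suc i) \<in> carrier G" "r i \<in> carrier G" "B.X i \<in> carrier G" using Suc.prems B.X_closed[of i] by auto
  have br: "cj (a i) (cj (a (Suc i)) (a i)) = a (Suc i)"
    using cj_flip[OF Suc.prems] cj_inv_cancel[of "inv (a i)" "a (Suc i)"] c by simp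
  have "cj (r (Suc i)) (B.X (Suc i)) = cj (a i) (cj (r i) (cj (a (Suc i)) (B.X i)))"
    using c by (simp add: cj_comp)
  also have "cj (r i) (cj (a (Suc i)) (B.X i)) = cj (a (Suc i)) (cj (r i) (B.X i))"
    by (rule cj_swap) (use c r_commute[of i "Suc i"] Suc.prems in simp_all)
  also have "cj (r i) (B.X i) = a i \<otimes> a i" using Suc by simp
  also have "cj (a i) (cj (a (Suc i)) (a i \<otimes> a i)) = a (Suc i) \<otimes> a (Suc i)"
    using c br by (simp add: cj_mult)
  finally show ?case .
qed

text \<open>
  This identifies \<open>strand_cocycle\<close>, for the elements \<open>a\<^sub>0\<^sup>2, a\<^sub>1, \<dots>\<close>, as the Schreier cocycle of the
  transversal.
\<close>

lemma a_transversal: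
  assumes "i < n" "j \<le> n"
  shows "a i \<otimes> r j = r (swap_pos i j) \<otimes> strand_cocycle G bb n i j"
proof -
  interpret B: type_B G bb n by (rule type_B_squared)
  consider "j = i" | "j = Suc i" | "j < i" | "Suc i < j" by linarith
  then show ?thesis
  proof cases
    case 1 then show ?thesis using assms by (simp add: swap_pos_def strand_cocycle_def)
  next
    case 2
    have "r i \<otimes> B.X i = (a i \<otimes> a i) \<otimes> r i"
      using r_square[OF assms(1)] assms B.X_closed[of i] by (simp add: cj_eq_iff)
    then show ?thesis using assms 2 by (simp add: swap_pos_def strand_cocycle_def m_assoc)
  next
    case 3 then show ?thesis using assms r_commute[of j i] by (simp add: swap_pos_def strand_cocycle_def)
  next
    case 4 then show ?thesis using assms r_shift[of i j] by (simp add: swap_pos_def strand_cocycle_def)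
  qed
qed

end

lemma hom_strand_loop:
  assumes "group G" "group H" "h \<in> hom G H" "\<And>i. i < n \<Longrightarrow> b i \<in> carrier G" "\<And>i. i < n \<Longrightarrow> h (b i) = c i"
  shows "j < n \<Longrightarrow> h (strand_loop G b j) = strand_loop H c j \<and> strand_loop G b j \<in> carrier G"
proof (induction j)
  case 0 then show ?case using assms by simp
next
  case (Suc j)
  interpret group G by fact
  show ?case using Suc assms(4,5)[of "Suc j"] hom_conj_by[OF assms(1-3), of "b (Suc j)" "strand_loop G b j"] by simp
qed

text \<open>
  The homomorphism with \<open>b\<^sub>0 \<mapsto> a\<^sub>0\<^sup>2\<close> and \<open>b\<^sub>i \<mapsto> a\<^sub>i\<close> is injective, since the cocycle inverts it, and its image
  has finite index, since the transversal is finite.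
\<close>

theorem virtually_separated_A_if_B:
  assumes n: "1 \<le> n" and B: "virtually_separated p (artin_group (graph_B n))"
  shows "virtually_separated p (artin_group (graph_A n))"
proof -
  let ?A = "artin_group (graph_A n)" and ?B = "artin_group (graph_B n)"
  let ?a = "artin_generator (graph_A n)" and ?b = "artin_generator (graph_B n)"
  interpret A: type_A ?A ?a n by (rule type_A_artin)
  interpret B: type_B ?B ?b n by (rule type_B_artin)
  from artin_B_hom[OF A.type_B_squared] obtain k where k: "k \<in> hom ?B ?A"
    "\<forall>i<n. k (?b i) = A.bb i" by (elim bexE)
  interpret k: group_hom ?B ?A k by unfold_locales (rule k(1))
  from artin_A_hom[OF B.type_A_strand_wreath] obtain h where h: "h \<in> hom ?A (wreath ?B)"
    "\<forall>i<n. h (?a i) = (swap_pos i, strand_cocycle ?B ?b n i)" by (elim bexE)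
  have hk: "fst (h (k s)) 0 = 0 \<and> snd (h (k s)) 0 = s" if s: "s \<in> ?b ` {..<n}" for s
  proof -
    obtain i where i: "i < n" "s = ?b i" using s by auto
    show ?thesis
    proof (cases "i = 0")
      case True
      have "h (?a 0 \<otimes>\<^bsub>?A\<^esub> ?a 0) = (swap_pos 0, strand_cocycle ?B ?b n 0) \<otimes>\<^bsub>wreath ?B\<^esub> (swap_pos 0, strand_cocycle ?B ?b n 0)"
        using hom_multD[OF h(1), of "?a 0" "?a 0"] h(2) i(1) True by simp
      then show ?thesis using i True k(2) by (simp add: wreath_mult swap_pos_def strand_cocycle_def)
    next
      case False
      then show ?thesis using i h(2) k(2) by (simp add: swap_pos_def strand_cocycle_def)
    qed
  qed
  have S: "?b ` {..<n} \<subseteq> carrier ?B" by auto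
  have inj: "inj_on k (carrier ?B)"
    by (rule inj_via_wreath[OF B.is_group A.is_group k(1) h(1) S graph_B_generate]) (use hk in auto)
  have kc: "k (strand_cocycle ?B ?b n i j) = strand_cocycle ?A A.bb n i j" if "i < n" for i j
    using that hom_strand_loop[OF B.is_group A.is_group k(1), of n ?b A.bb i] k(2)
    by (simp add: strand_cocycle_def)
  let ?W = "{A.r j \<otimes>\<^bsub>?A\<^esub> k x | j x. j \<le> n \<and> x \<in> carrier ?B}"
  have WI: "A.r j \<otimes>\<^bsub>?A\<^esub> k x \<in> ?W" if "j \<le> n" "x \<in> carrier ?B" for j x using that by blast
  have "carrier ?A \<subseteq> ?W"
    unfolding graph_A_generate[symmetric]
  proof (rule A.generate_left_induct)
    show "?a ` {..<n} \<subseteq> carrier ?A" by auto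
    show "?W \<subseteq> carrier ?A" by auto
    have "A.r 0 \<otimes>\<^bsub>?A\<^esub> k \<one>\<^bsub>?B\<^esub> \<in> ?W" by (rule WI) auto
    then show "\<one>\<^bsub>?A\<^esub> \<in> ?W" by simp
    fix s w assume s: "s \<in> ?a ` {..<n}" and "w \<in> ?W"
    then obtain j x where w: "w = A.r j \<otimes>\<^bsub>?A\<^esub> k x" "j \<le> n" "x \<in> carrier ?B" by blast
    obtain i where i: "i < n" "s = ?a i" using s by auto
    have j': "swap_pos i j \<le> n" "swap_pos i (swap_pos i j) = j" using w(2) i(1) by (auto simp: swap_pos_def)
    let ?c = "\<lambda>j. strand_cocycle ?B ?b n i j"
    have c: "?c j \<in> carrier ?B" for j using B.strand_cocycle_closed[OF i(1)] .
    have "s \<otimes>\<^bsub>?A\<^esub> w = A.r (swap_pos i j) \<otimes>\<^bsub>?A\<^esub> k (?c j \<otimes>\<^bsub>?B\<^esub> x)"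
    proof -
      have "s \<otimes>\<^bsub>?A\<^esub> w = (?a i \<otimes>\<^bsub>?A\<^esub> A.r j) \<otimes>\<^bsub>?A\<^esub> k x" using i w by (simp add: A.m_assoc)
      also have "\<dots> = (A.r (swap_pos i j) \<otimes>\<^bsub>?A\<^esub> k (?c j)) \<otimes>\<^bsub>?A\<^esub> k x"
        unfolding A.a_transversal[OF i(1) w(2)] kc[OF i(1)] ..
      finally show ?thesis using j' c w(3) by (simp add: A.m_assoc)
    qed
    then show "s \<otimes>\<^bsub>?A\<^esub> w \<in> ?W" using WI[OF j'(1) B.m_closed[OF c w(3)]] by (simp only:)
    have "inv\<^bsub>?A\<^esub> s \<otimes>\<^bsub>?A\<^esub> w = A.r (swap_pos i j) \<otimes>\<^bsub>?A\<^esub> k (inv\<^bsub>?B\<^esub> ?c (swap_pos i j) \<otimes>\<^bsub>?B\<^esub> x)"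
    proof -
      let ?r = "A.r (swap_pos i j)" and ?d = "?c (swap_pos i j)"
      have cl: "?r \<in> carrier ?A" "A.r j \<in> carrier ?A" "s \<in> carrier ?A" "k ?d \<in> carrier ?A" "k x \<in> carrier ?A" using j' w i c by simp_all
      have e: "s \<otimes>\<^bsub>?A\<^esub> ?r = A.r j \<otimes>\<^bsub>?A\<^esub> k ?d"
        using A.a_transversal[OF i(1) j'(1)] unfolding j'(2) kc[OF i(1)] i(2) .
      have "A.r j = (s \<otimes>\<^bsub>?A\<^esub> ?r) \<otimes>\<^bsub>?A\<^esub> inv\<^bsub>?A\<^esub> (k ?d)" unfolding e using cl by (simp add: A.m_assoc)
      then have "inv\<^bsub>?A\<^esub> s \<otimes>\<^bsub>?A\<^esub> w = inv\<^bsub>?A\<^esub> s \<otimes>\<^bsub>?A\<^esub> ((s \<otimes>\<^bsub>?A\<^esub> ?r) \<otimes>\<^bsub>?A\<^esub> inv\<^bsub>?A\<^esub> (k ?d) \<otimes>\<^bsub>?A\<^esub> k x)"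
        unfolding w(1) by (rule arg_cong)
      also have "\<dots> = ?r \<otimes>\<^bsub>?A\<^esub> (inv\<^bsub>?A\<^esub> (k ?d) \<otimes>\<^bsub>?A\<^esub> k x)" using cl by (simp add: A.m_assoc A.inv_cancel_left)
      finally show ?thesis using c w(3) by simp
    qed
    then show "inv\<^bsub>?A\<^esub> s \<otimes>\<^bsub>?A\<^esub> w \<in> ?W" using WI[OF j'(1) B.m_closed[OF B.inv_closed[OF c] w(3)]] by (simp only:)
  qed
  then have cover: "\<exists>j\<in>{..n}. \<exists>x\<in>carrier ?B. g = A.r j \<otimes>\<^bsub>?A\<^esub> k x" if "g \<in> carrier ?A" for g using that by blast
  have "A.r \<in> {..n} \<rightarrow> carrier ?A" by simp
  from virtually_separated_finite_extension[OF k(1) A.is_group inj B finite_atMost this cover] show ?thesis .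
qed

lemma virtually_separated_A_1: assumes "1 < p" shows "virtually_separated p (artin_group (graph_A 1))"
proof -
  let ?A = "artin_group (graph_A 1)"
  interpret A: type_A ?A "artin_generator (graph_A 1)" 1 by (rule type_A_artin)
  interpret Z: group integer_group by simp
  have "type_A integer_group (\<lambda>_. 1) 1" by unfold_locales auto
  from artin_A_hom[OF this] obtain h where h: "h \<in> hom ?A integer_group" "h (artin_generator (graph_A 1) 0) = 1" by auto
  interpret h: group_hom ?A integer_group h by unfold_locales (rule h(1))
  have g: "artin_generator (graph_A 1) 0 \<in> carrier ?A" by (rule A.a_closed) simp
  have "\<exists>i. x = artin_generator (graph_A 1) 0 [^]\<^bsub>?A\<^esub> (i::int)" if "x \<in> carrier ?A" for x
  proof -
    have e: "artin_generator (graph_A 1) ` {..<1} = {artin_generator (graph_A 1) 0}" by auto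
    have "x \<in> generate ?A (artin_generator (graph_A 1) ` {..<1})" unfolding graph_A_generate by (rule that)
    then show ?thesis unfolding e A.generate_pow[OF g] by blast
  qed
  moreover have "h (artin_generator (graph_A 1) 0 [^]\<^bsub>?A\<^esub> (i::int)) = i" for i
    using h.hom_int_pow[OF g, of i] h(2) by (simp add: group_int_pow_integer_group)
  ultimately have "inj_on h (carrier ?A)" by (metis inj_onI)
  then show ?thesis using virtually_separated_embed[OF h(1) A.is_group _ virtually_separated_integer_group[OF assms]] by blast
qed

text \<open>
  Type \<open>B\<^sub>n\<close> is obtained from \<open>A\<^sub>n\<^sub>-\<^sub>1\<close> and type \<open>A\<^sub>n\<close> from \<open>B\<^sub>n\<close>; the induction starts at the infinite cyclic group.
\<close>

theorem virtually_separated_A: assumes "1 < p" shows "1 \<le> n \<Longrightarrow> virtually_separated p (artin_group (graph_A n))"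
proof (induction n)
  case (Suc n)
  show ?case
  proof (cases "n = 0")
    case True then show ?thesis using virtually_separated_A_1[OF assms] by simp
  next
    case False
    then show ?thesis using Suc virtually_separated_B_if_A[OF assms, of "Suc n"] by (intro virtually_separated_A_if_B) auto
  qed
qed simp

corollary virtually_separated_B: assumes "1 < p" "2 \<le> n" shows "virtually_separated p (artin_group (graph_B n))"
  using virtually_separated_B_if_A[OF assms virtually_separated_A[OF assms(1)]] assms by simp

section \<open>The affine type A\<close>

lemma (in group) left_cancel_eq:
  assumes "x \<in> carrier G" "y \<in> carrier G" "z \<in> carrier G" "x \<otimes> y = x \<otimes> z" shows "y = z"
proof -
  have "inv x \<otimes> (x \<otimes> y) = inv x \<otimes> (x \<otimes> z)" using assms(4) by (rule arg_cong)
  then show ?thesis using assms(1-3) by (simp only: inv_cancel_left)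
qed

context type_A begin

text \<open>
  The transversal of the subchain that omits \<open>a\<^sub>0\<close>. It equals \<open>r (j + 1) a\<^sub>0\<inverse>\<close>, and \<open>r n\<close> conjugates it to \<open>r j\<close>.
\<close>

abbreviation r' where "r' \<equiv> strand_transversal G (\<lambda>i. a (Suc i))"

lemma r'_closed: "Suc j \<le> n \<Longrightarrow> r' j \<in> carrier G"
  by (induction j) auto

lemma r_Suc_right: "Suc j \<le> n \<Longrightarrow> r (Suc j) = r' j \<otimes> a 0"
proof (induction j)
  case (Suc j)
  have c: "a (Suc j) \<in> carrier G" "r' j \<in> carrier G" "a 0 \<in> carrier G" using Suc.prems r'_closed[of j] by auto
  have "r (Suc (Suc j)) = a (Suc j) \<otimes> r (Suc j)" by simp
  also have "r (Suc j) = r' j \<otimes> a 0" using Suc by simp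
  finally show ?case using c by (simp add: m_assoc)
qed simp

lemma r_r': "Suc j \<le> n \<Longrightarrow> r n \<otimes> r' j = r j \<otimes> r n"
proof (induction j)
  case (Suc j)
  have c: "a (Suc j) \<in> carrier G" "a j \<in> carrier G" "r' j \<in> carrier G" "r j \<in> carrier G" "r n \<in> carrier G"
    using Suc.prems r'_closed[of j] by auto
  have "r n \<otimes> r' (Suc j) = (r n \<otimes> a (Suc j)) \<otimes> r' j" using c by (simp add: m_assoc)
  also have "\<dots> = a j \<otimes> (r n \<otimes> r' j)" using r_shift[of j n, symmetric] Suc.prems c by (simp add: m_assoc)
  also have "\<dots> = r (Suc j) \<otimes> r n" using Suc c by (simp add: m_assoc)
  finally show ?case .
qed simp

lemma r'_commute:
  assumes t: "t \<in> carrier G" "\<forall>i\<in>{1..<n}. t \<otimes> a i = a i \<otimes> t"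
  shows "Suc j \<le> n \<Longrightarrow> t \<otimes> r' j = r' j \<otimes> t"
proof (induction j)
  case (Suc j)
  have c: "a (Suc j) \<in> carrier G" "r' j \<in> carrier G" using Suc.prems r'_closed[of j] by auto
  have "t \<otimes> r' (Suc j) = (t \<otimes> a (Suc j)) \<otimes> r' j" using c t by (simp add: m_assoc)
  also have "t \<otimes> a (Suc j) = a (Suc j) \<otimes> t" using t(2) Suc.prems by simp
  also have "(a (Suc j) \<otimes> t) \<otimes> r' j = a (Suc j) \<otimes> (t \<otimes> r' j)" using c t(1) by (simp add: m_assoc)
  finally show ?case using Suc c t(1) by (simp add: m_assoc)
qed (use t in simp)

text \<open>
  With \<open>t = b\<^sub>0\<close>, the element \<open>\<rho> = r n \<otimes> t\<close> is the rotation of the annular braid group by one position. Both sides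
  of the relation that closes the cycle become \<open>r n \<otimes> r' m\<close> times the two sides of the relation of
  length four between \<open>t\<close> and \<open>a\<^sub>0\<close>, so the two relations are equivalent.
\<close>

lemma rotation_square:
  assumes n: "n = Suc m" and t: "t \<in> carrier G" "\<forall>i\<in>{1..<n}. t \<otimes> a i = a i \<otimes> t"
  shows "(r n \<otimes> t) \<otimes> ((r n \<otimes> t) \<otimes> a 0) = (r n \<otimes> r' m) \<otimes> (t \<otimes> (a 0 \<otimes> (t \<otimes> a 0)))"
    and "a m \<otimes> ((r n \<otimes> t) \<otimes> (r n \<otimes> t)) = (r n \<otimes> r' m) \<otimes> (a 0 \<otimes> (t \<otimes> (a 0 \<otimes> t)))"
proof -
  have c: "r n \<in> carrier G" "r' m \<in> carrier G" "a 0 \<in> carrier G" "a m \<in> carrier G" "r m \<in> carrier G" using n r'_closed[of m] by auto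
  have rn: "r n = r' m \<otimes> a 0" using r_Suc_right[of m] n by simp
  have tr: "t \<otimes> r' m = r' m \<otimes> t" using r'_commute[OF t, of m] n by simp
  have trn: "t \<otimes> r n = r' m \<otimes> (t \<otimes> a 0)"
  proof -
    have "t \<otimes> r n = (t \<otimes> r' m) \<otimes> a 0" unfolding rn using c t(1) by (simp add: m_assoc)
    then show ?thesis unfolding tr using c t(1) by (simp add: m_assoc)
  qed
  have "(r n \<otimes> t) \<otimes> ((r n \<otimes> t) \<otimes> a 0) = r n \<otimes> ((t \<otimes> r n) \<otimes> (t \<otimes> a 0))" using c t(1) by (simp add: m_assoc)
  then show "(r n \<otimes> t) \<otimes> ((r n \<otimes> t) \<otimes> a 0) = (r n \<otimes> r' m) \<otimes> (t \<otimes> (a 0 \<otimes> (t \<otimes> a 0)))"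
    unfolding trn using c t(1) by (simp add: m_assoc)
  have "a m \<otimes> ((r n \<otimes> t) \<otimes> (r n \<otimes> t)) = a m \<otimes> (r n \<otimes> ((t \<otimes> r n) \<otimes> t))" using c t(1) by (simp add: m_assoc)
  also have "\<dots> = a m \<otimes> ((r n \<otimes> r' m) \<otimes> (t \<otimes> (a 0 \<otimes> t)))" unfolding trn using c t(1) by (simp add: m_assoc)
  also have "\<dots> = (a m \<otimes> r m) \<otimes> (r n \<otimes> (t \<otimes> (a 0 \<otimes> t)))" using r_r'[of m] n c t(1) by (simp add: m_assoc)
  also have "a m \<otimes> r m = r n" using n by simp
  also have "r n \<otimes> (r n \<otimes> (t \<otimes> (a 0 \<otimes> t))) = r n \<otimes> ((r' m \<otimes> a 0) \<otimes> (t \<otimes> (a 0 \<otimes> t)))" using rn by simp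
  finally show "a m \<otimes> ((r n \<otimes> t) \<otimes> (r n \<otimes> t)) = (r n \<otimes> r' m) \<otimes> (a 0 \<otimes> (t \<otimes> (a 0 \<otimes> t)))"
    using c t(1) by (simp add: m_assoc)
qed

lemma rotation_forward:
  assumes n: "n = Suc m" and t: "t \<in> carrier G" "\<forall>i\<in>{1..<n}. t \<otimes> a i = a i \<otimes> t"
    and q: "t \<otimes> (a 0 \<otimes> (t \<otimes> a 0)) = a 0 \<otimes> (t \<otimes> (a 0 \<otimes> t))"
  shows "Suc i < n \<Longrightarrow> (r n \<otimes> t) \<otimes> a (Suc i) = a i \<otimes> (r n \<otimes> t)"
    and "(r n \<otimes> t) \<otimes> ((r n \<otimes> t) \<otimes> a 0) = a m \<otimes> ((r n \<otimes> t) \<otimes> (r n \<otimes> t))"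
proof -
  show "(r n \<otimes> t) \<otimes> ((r n \<otimes> t) \<otimes> a 0) = a m \<otimes> ((r n \<otimes> t) \<otimes> (r n \<otimes> t))"
    unfolding rotation_square[OF n t] q ..
  assume i: "Suc i < n"
  have c: "r n \<in> carrier G" "a i \<in> carrier G" "a (Suc i) \<in> carrier G" using i by auto
  have "(r n \<otimes> t) \<otimes> a (Suc i) = r n \<otimes> (t \<otimes> a (Suc i))" using c t(1) by (simp add: m_assoc)
  also have "t \<otimes> a (Suc i) = a (Suc i) \<otimes> t" using t(2) i by simp
  also have "r n \<otimes> (a (Suc i) \<otimes> t) = (r n \<otimes> a (Suc i)) \<otimes> t" using c t(1) by (simp add: m_assoc)
  also have "\<dots> = a i \<otimes> (r n \<otimes> t)" using r_shift[of i n, symmetric] i c t(1) by (simp add: m_assoc)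
  finally show "(r n \<otimes> t) \<otimes> a (Suc i) = a i \<otimes> (r n \<otimes> t)" .
qed

text \<open>
  Conversely, a chain of type \<open>A\<close> with an element that rotates it produces elements of type \<open>B\<close>. This gives the
  second presentation of the group of type \<open>B\<close>, by the chain and a rotation, which makes it easy to map it
  into wreath products over \<open>\<int>\<close>.
\<close>

lemma type_B_rotation:
  assumes n: "n = Suc m" and \<rho>: "\<rho> \<in> carrier G" "\<And>i. Suc i < n \<Longrightarrow> \<rho> \<otimes> a (Suc i) = a i \<otimes> \<rho>"
    "\<rho> \<otimes> (\<rho> \<otimes> a 0) = a m \<otimes> (\<rho> \<otimes> \<rho>)"
  shows "type_B G (\<lambda>i. if i = 0 then inv (r n) \<otimes> \<rho> else a (i - 1)) (Suc n)"
proof -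
  define t where "t = inv (r n) \<otimes> \<rho>"
  have rc: "r n \<in> carrier G" by simp
  have tc: "t \<in> carrier G" using \<rho>(1) by (simp add: t_def)
  have rt: "r n \<otimes> t = \<rho>" using \<rho>(1) by (simp add: t_def inv_cancel_left)
  have tcomm: "t \<otimes> a i = a i \<otimes> t" if i: "1 \<le> i" "i < n" for i
  proof -
    obtain k where k: "i = Suc k" using i by (cases i) auto
    have c: "a k \<in> carrier G" "a i \<in> carrier G" using i k by auto
    have "r n \<otimes> (t \<otimes> a i) = (r n \<otimes> t) \<otimes> a i" using c tc by (simp add: m_assoc)
    also have "\<dots> = a k \<otimes> (r n \<otimes> t)" unfolding rt k by (rule \<rho>(2)) (use i k in simp)
    also have "\<dots> = (a k \<otimes> r n) \<otimes> t" using c tc by (simp add: m_assoc)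
    also have "\<dots> = r n \<otimes> (a i \<otimes> t)" using r_shift[of k n] i k c tc by (simp add: m_assoc)
    finally have eq: "r n \<otimes> (t \<otimes> a i) = r n \<otimes> (a i \<otimes> t)" .
    show ?thesis by (rule left_cancel_eq[OF rc _ _ eq]) (use c tc in simp_all)
  qed
  have tcomm': "\<forall>i\<in>{1..<n}. t \<otimes> a i = a i \<otimes> t" using tcomm by simp
  have quad: "t \<otimes> (a 0 \<otimes> (t \<otimes> a 0)) = a 0 \<otimes> (t \<otimes> (a 0 \<otimes> t))"
  proof -
    have a0: "a 0 \<in> carrier G" "r' m \<in> carrier G" using n r'_closed[of m] by auto
    have eq: "(r n \<otimes> r' m) \<otimes> (t \<otimes> (a 0 \<otimes> (t \<otimes> a 0))) = (r n \<otimes> r' m) \<otimes> (a 0 \<otimes> (t \<otimes> (a 0 \<otimes> t)))"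
      using \<rho>(3)[folded rt] unfolding rotation_square[OF n tc tcomm'] .
    show ?thesis by (rule left_cancel_eq[OF m_closed[OF rc a0(2)] _ _ eq]) (use a0 tc in simp_all)
  qed
  show ?thesis unfolding t_def[symmetric]
  proof (unfold_locales, goal_cases)
    case (1 i) then show ?case using tc a_closed[of "i - 1"] by (cases i) auto
  next
    case 2 then show ?case using quad by simp
  next
    case (3 i) then show ?case using braid[of "i - 1"] by (cases i) auto
  next
    case (4 i j) then show ?case using tcomm[of "j - 1"] far[of "i - 1" "j - 1"] by (cases i; cases j) auto
  qed
qed

lemma rotation_recover: "\<rho> \<in> carrier G \<Longrightarrow> r n \<otimes> (inv (r n) \<otimes> \<rho>) = \<rho>"
  by (simp add: inv_cancel_left)

end

lemma (in type_B) type_A_tail: "n = Suc m \<Longrightarrow> type_A G (\<lambda>i. b (Suc i)) m"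
proof (unfold_locales, goal_cases)
  case (1 i) then show ?case by (intro b_closed) simp
next
  case (2 i) then show ?case by (intro braid) simp_all
next
  case (3 i j) then show ?case by (intro far) simp_all
qed

lemma hom_transversal:
  assumes "group G" "group H" "h \<in> hom G H" "\<And>i. i < n \<Longrightarrow> a i \<in> carrier G" "\<And>i. i < n \<Longrightarrow> h (a i) = c i"
  shows "j \<le> n \<Longrightarrow> h (strand_transversal G a j) = strand_transversal H c j \<and> strand_transversal G a j \<in> carrier G"
proof (induction j)
  case 0
  interpret group_hom G H h by (intro group_hom.intro group_hom_axioms.intro assms)
  show ?case by simp
next
  case (Suc j)
  interpret group G by fact
  show ?case using Suc assms(4,5)[of j] hom_multD[OF assms(3), of "a j" "strand_transversal G a j"] by simp
qed

lemma wreath_eqI: "(\<And>i. fst x i = fst y i) \<Longrightarrow> (\<And>i. snd x i = snd y i) \<Longrightarrow> x = y"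
  by (cases x; cases y) (auto simp: fun_eq_iff)

lemma fst_wreath_mult: "fst (x \<otimes>\<^bsub>wreath G\<^esub> y) i = fst x (fst y i)"
  by (cases x; cases y) (simp add: wreath_mult)

text \<open>
  The conjugates of one chain generator under the rotation satisfy the relations of the cycle, which gives
  a homomorphism into the group of type \<open>B\<close>. It is injective: in the wreath product of the cyclic Artin
  group over \<open>\<int>\<close>, translation plays the rotation and the \<open>i\<close>th generator is spread out as \<open>j \<mapsto> s\<^sub>i\<^sub>+\<^sub>j\<close>, with indices
  modulo \<open>n + 1\<close>; at the index \<open>0\<close> the original generators reappear.
\<close>

theorem virtually_separated_cycle:
  assumes n: "2 \<le> n" and B: "virtually_separated p (artin_group (graph_B (Suc n)))"
  shows "virtually_separated p (artin_group (coxeter_cycle (Suc n)))"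
proof -
  let ?A = "artin_group (coxeter_cycle (Suc n))" and ?B = "artin_group (graph_B (Suc n))"
  let ?s = "artin_generator (coxeter_cycle (Suc n))" and ?b = "artin_generator (graph_B (Suc n))"
  obtain m where m: "n = Suc m" using n by (cases n) auto
  interpret A: group ?A by (rule group_artin)
  interpret B: type_B ?B ?b "Suc n" by (rule type_B_artin)
  interpret T: type_A ?B "\<lambda>i. ?b (Suc i)" n by (rule B.type_A_tail[OF HOL.refl])
  let ?a = "\<lambda>i. ?b (Suc i)"
  define \<rho> where "\<rho> = T.r n \<otimes>\<^bsub>?B\<^esub> ?b 0"
  have b0: "?b 0 \<in> carrier ?B" by simp
  have \<rho>c: "\<rho> \<in> carrier ?B" by (simp add: \<rho>_def)
  have b0c: "\<forall>i\<in>{1..<n}. ?b 0 \<otimes>\<^bsub>?B\<^esub> ?a i = ?a i \<otimes>\<^bsub>?B\<^esub> ?b 0"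
  proof
    fix i assume "i \<in> {1..<n}"
    then show "?b 0 \<otimes>\<^bsub>?B\<^esub> ?a i = ?a i \<otimes>\<^bsub>?B\<^esub> ?b 0" by (intro B.far) auto
  qed
  have quad: "?b 0 \<otimes>\<^bsub>?B\<^esub> (?a 0 \<otimes>\<^bsub>?B\<^esub> (?b 0 \<otimes>\<^bsub>?B\<^esub> ?a 0)) = ?a 0 \<otimes>\<^bsub>?B\<^esub> (?b 0 \<otimes>\<^bsub>?B\<^esub> (?a 0 \<otimes>\<^bsub>?B\<^esub> ?b 0))"
    using B.quad n by simp
  note rot = T.rotation_forward[OF m b0 b0c quad, folded \<rho>_def]
  \<comment> \<open>The additional generator closes the cycle: conjugation by \<open>\<rho>\<close> lowers all indices by one modulo \<open>n + 1\<close>.\<close>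
  define f where "f i = (if i < n then ?a i else B.cj \<rho> (?a 0))" for i
  have fc: "f i \<in> carrier ?B" for i using \<rho>c n by (simp add: f_def)
  have rf: "B.cj \<rho> (f (Suc i mod Suc n)) = f i" if i: "i < Suc n" for i
  proof -
    consider "Suc i < n" | "Suc i = n" | "i = n" using i by linarith
    then show ?thesis
    proof cases
      case 1 then show ?thesis using rot(1)[OF 1] \<rho>c by (simp add: f_def B.cj_eq_iff)
    next
      case 2
      have "(\<rho> \<otimes>\<^bsub>?B\<^esub> \<rho>) \<otimes>\<^bsub>?B\<^esub> ?a 0 = ?a m \<otimes>\<^bsub>?B\<^esub> (\<rho> \<otimes>\<^bsub>?B\<^esub> \<rho>)"
        using rot(2) \<rho>c n by (simp add: B.m_assoc)
      moreover have "?a 0 \<in> carrier ?B" "?a m \<in> carrier ?B"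
        using B.b_closed[of "Suc 0"] B.b_closed[of "Suc m"] m by simp_all
      ultimately have "B.cj \<rho> (B.cj \<rho> (?a 0)) = ?a m"
        using \<rho>c by (simp add: B.cj_comp[symmetric] B.cj_eq_iff)
      then show ?thesis using 2 m by (simp add: f_def)
    next
      case 3 then show ?thesis using n by (simp add: f_def)
    qed
  qed
  have br_conj: "f i \<otimes>\<^bsub>?B\<^esub> f j \<otimes>\<^bsub>?B\<^esub> f i = f j \<otimes>\<^bsub>?B\<^esub> f i \<otimes>\<^bsub>?B\<^esub> f j"
    if "f i = B.cj \<rho> (f k)" "f j = B.cj \<rho> (f l)" "f k \<otimes>\<^bsub>?B\<^esub> f l \<otimes>\<^bsub>?B\<^esub> f k = f l \<otimes>\<^bsub>?B\<^esub> f k \<otimes>\<^bsub>?B\<^esub> f l" for i j k l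
    unfolding that(1,2) using arg_cong[OF that(3), of "B.cj \<rho>"] \<rho>c fc by (simp add: B.cj_mult)
  have adj0: "f i \<otimes>\<^bsub>?B\<^esub> f (Suc i) \<otimes>\<^bsub>?B\<^esub> f i = f (Suc i) \<otimes>\<^bsub>?B\<^esub> f i \<otimes>\<^bsub>?B\<^esub> f (Suc i)" if "Suc i < n" for i
    using T.braid[OF that] that by (simp add: f_def B.m_assoc)
  have adj: "f i \<otimes>\<^bsub>?B\<^esub> f (Suc i mod Suc n) \<otimes>\<^bsub>?B\<^esub> f i = f (Suc i mod Suc n) \<otimes>\<^bsub>?B\<^esub> f i \<otimes>\<^bsub>?B\<^esub> f (Suc i mod Suc n)"
    if i: "i < Suc n" for i
  proof -
    have n0: "f n \<otimes>\<^bsub>?B\<^esub> f 0 \<otimes>\<^bsub>?B\<^esub> f n = f 0 \<otimes>\<^bsub>?B\<^esub> f n \<otimes>\<^bsub>?B\<^esub> f 0"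
      by (rule br_conj[OF _ _ adj0[of 0]]) (use rf[of n] rf[of 0] n in auto)
    consider "Suc i < n" | "Suc i = n" | "i = n" using i by linarith
    then show ?thesis
    proof cases
      case 1 then show ?thesis using adj0 by simp
    next
      case 2
      have "f i \<otimes>\<^bsub>?B\<^esub> f n \<otimes>\<^bsub>?B\<^esub> f i = f n \<otimes>\<^bsub>?B\<^esub> f i \<otimes>\<^bsub>?B\<^esub> f n"
        by (rule br_conj[OF _ _ n0]) (use rf[of i] rf[of n] 2 in auto)
      then show ?thesis using 2 by simp
    next
      case 3 then show ?thesis using n0 by simp
    qed
  qed
  have farf: "f i \<otimes>\<^bsub>?B\<^esub> f j = f j \<otimes>\<^bsub>?B\<^esub> f i"
    if ij: "i < j" "j < Suc n" "j \<noteq> Suc i mod Suc n" "i \<noteq> Suc j mod Suc n" for i j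
  proof -
    have d: "Suc i < j" using ij by auto
    show ?thesis
    proof (cases "j < n")
      case True then show ?thesis using T.far[OF d True] d by (simp add: f_def)
    next
      case False
      then have jn: "j = n" using ij by simp
      have j: "j = n" "i \<noteq> 0" using ij(4) unfolding jn by auto
      have "f 0 \<otimes>\<^bsub>?B\<^esub> f (Suc i) = f (Suc i) \<otimes>\<^bsub>?B\<^esub> f 0" using T.far[of 0 "Suc i"] d j by (simp add: f_def)
      then have "B.cj \<rho> (f 0) \<otimes>\<^bsub>?B\<^esub> B.cj \<rho> (f (Suc i)) = B.cj \<rho> (f (Suc i)) \<otimes>\<^bsub>?B\<^esub> B.cj \<rho> (f 0)"
        using \<rho>c fc by (simp flip: B.cj_mult)
      moreover have "B.cj \<rho> (f 0) = f n" using rf[of n] by simp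
      moreover have "B.cj \<rho> (f (Suc i)) = f i" using rf[of i] d j by simp
      ultimately show ?thesis using j by simp
    qed
  qed
  have "\<exists>h\<in>hom ?A ?B. \<forall>i<Suc n. h (?s i) = f i"
  proof (rule B.cycle_hom, goal_cases)
    case (1 i) then show ?case using fc by simp
  next
    case (2 i) then show ?case by (rule adj)
  next
    case (3 i j) then show ?case by (rule farf)
  qed
  then obtain k where k: "k \<in> hom ?A ?B" "\<forall>i<Suc n. k (?s i) = f i" by (elim bexE)
  let ?W = "wreath ?A :: ((int \<Rightarrow> int) \<times> (int \<Rightarrow> _)) monoid"
  interpret W: group ?W by (rule group_wreath[OF A.is_group])
  let ?N = "int (Suc n)"
  define z where "z x = ?s (nat (x mod ?N))" for x :: int
  have zc: "z x \<in> carrier ?A" for x unfolding z_def by (rule cycle_gen_closed) (simp add: nat_less_iff)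
  have zs: "z (int i) = ?s i" if "i < Suc n" for i using that by (simp add: z_def)
  have zper: "z (x + ?N) = z x" for x by (simp add: z_def)
  have zadj: "z x \<otimes>\<^bsub>?A\<^esub> (z (x + 1) \<otimes>\<^bsub>?A\<^esub> z x) = z (x + 1) \<otimes>\<^bsub>?A\<^esub> (z x \<otimes>\<^bsub>?A\<^esub> z (x + 1))" for x
  proof -
    define i where "i = nat (x mod ?N)"
    have i: "i < Suc n" by (simp add: i_def nat_less_iff)
    have "(x + 1) mod ?N = (x mod ?N + 1) mod ?N" by (simp only: mod_add_left_eq)
    also have "x mod ?N = int i" by (simp add: i_def)
    also have "(int i + 1) mod ?N = int (Suc i mod Suc n)" by (simp add: zmod_int add.commute)
    finally have "z (x + 1) = ?s (Suc i mod Suc n)" unfolding z_def by (simp only: nat_int)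
    moreover have "z x = ?s i" by (simp add: z_def i_def)
    ultimately show ?thesis using cycle_adjacent[OF i] zc[of x] zc[of "x+1"] n by (simp add: A.m_assoc)
  qed
  have zfar: "z (x + int i) \<otimes>\<^bsub>?A\<^esub> z (x + int j) = z (x + int j) \<otimes>\<^bsub>?A\<^esub> z (x + int i)" if ij: "Suc i < j" "j < n" for x i j
  proof -
    define k l where kl: "k = nat ((x + int i) mod ?N)" "l = nat ((x + int j) mod ?N)"
    have k: "k < Suc n" "l < Suc n" by (simp_all add: kl nat_less_iff)
    have e: "int k = (x + int i) mod ?N" "int l = (x + int j) mod ?N" by (simp_all add: kl)
    have "(int l - int k) mod ?N = (int j - int i) mod ?N" unfolding e
      by (simp only: mod_diff_eq) simp
    also have "\<dots> = int j - int i" using ij by (intro mod_pos_pos_trivial) auto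
    finally have d: "(int l - int k) mod ?N = int j - int i" .
    have "(int l - int k) mod ?N = (if k \<le> l then int l - int k else int l - int k + ?N)"
    proof (cases "k \<le> l")
      case True then show ?thesis using k by (simp add: mod_pos_pos_trivial)
    next
      case False
      have "(int l - int k) mod ?N = (int l - int k + ?N) mod ?N" by simp
      also have "\<dots> = int l - int k + ?N" using False k by (intro mod_pos_pos_trivial) auto
      finally show ?thesis using False by simp
    qed
    then have d': "(if k \<le> l then int l - int k else int l - int k + ?N) = int j - int i" using d by simp
    have ne: "k \<noteq> l" "l \<noteq> Suc k mod Suc n" "k \<noteq> Suc l mod Suc n"
      using d' ij k by (auto simp: mod_Suc split: if_splits)
    show ?thesis using cycle_far[OF k ne] by (simp add: z_def kl)
  qed
  define S where "S i = (id :: int \<Rightarrow> int, \<lambda>j. z (int i + j))" for i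
  define R where "R = (\<lambda>j::int. j + 1, \<lambda>j::int. \<one>\<^bsub>?A\<^esub>)"
  have bR: "bij (\<lambda>j::int. j + 1)" by (rule o_bij[of "\<lambda>j. j - 1"]) auto
  have Rc: "R \<in> carrier ?W" using bR by (simp add: R_def wreath_carrier)
  have Sc: "S i \<in> carrier ?W" for i by (simp add: S_def wreath_carrier zc)
  have RS: "R \<otimes>\<^bsub>?W\<^esub> S (Suc i) = S i \<otimes>\<^bsub>?W\<^esub> R" for i
    by (rule wreath_eqI) (simp_all add: R_def S_def wreath_mult zc algebra_simps)
  interpret TW: type_A ?W S n
  proof (unfold_locales, goal_cases)
    case (1 i) show ?case by (rule Sc)
  next
    case (2 i)
    have "z (int (Suc i) + j) = z ((int i + j) + 1)" for j by (simp add: algebra_simps)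
    then show ?case using zadj by (simp add: S_def wreath_mult)
  next
    case (3 i j)
    then show ?case using zfar[OF 3] by (simp add: S_def wreath_mult add.commute)
  qed
  have RRS: "R \<otimes>\<^bsub>?W\<^esub> (R \<otimes>\<^bsub>?W\<^esub> S 0) = S m \<otimes>\<^bsub>?W\<^esub> (R \<otimes>\<^bsub>?W\<^esub> R)"
  proof (rule wreath_eqI)
    fix j
    have "z (int m + (j + 1 + 1)) = z (j + ?N)" using m by (simp add: algebra_simps)
    then show "snd (R \<otimes>\<^bsub>?W\<^esub> (R \<otimes>\<^bsub>?W\<^esub> S 0)) j = snd (S m \<otimes>\<^bsub>?W\<^esub> (R \<otimes>\<^bsub>?W\<^esub> R)) j"
      unfolding zper by (simp add: R_def S_def wreath_mult zc)
  qed (simp add: R_def S_def wreath_mult)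
  from artin_B_hom[OF TW.type_B_rotation[OF m Rc RS RRS]]
  obtain h where h: "h \<in> hom ?B ?W"
    "\<forall>i<Suc n. h (?b i) = (if i = 0 then inv\<^bsub>?W\<^esub> TW.r n \<otimes>\<^bsub>?W\<^esub> R else S (i - 1))" by (elim bexE)
  have ha: "h (?a i) = S i" if "i < n" for i using h(2) that by simp
  have hr: "h (T.r n) = TW.r n"
    using hom_transversal[OF B.is_group W.is_group h(1), of n ?a S n] ha by simp
  have h\<rho>: "h \<rho> = R"
    unfolding \<rho>_def hom_multD[OF h(1) T.r_closed[OF order.refl] b0] hr using h(2) TW.rotation_recover[OF Rc] by simp
  have "W.cj R (S 0) = S n"
  proof -
    have "R \<otimes>\<^bsub>?W\<^esub> S 0 = S n \<otimes>\<^bsub>?W\<^esub> R"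
    proof (rule wreath_eqI)
      fix j
      have "z (int n + (j + 1)) = z (j + ?N)" by (simp add: algebra_simps)
      then show "snd (R \<otimes>\<^bsub>?W\<^esub> S 0) j = snd (S n \<otimes>\<^bsub>?W\<^esub> R) j"
        unfolding zper by (simp add: R_def S_def wreath_mult zc)
    qed (simp add: R_def S_def wreath_mult)
    then show ?thesis using W.cj_eq_iff[OF Rc Sc Sc] by blast
  qed
  then have hf: "h (f i) = S i" if "i < Suc n" for i
    using that ha hom_conj_by[OF B.is_group W.is_group h(1) \<rho>c, of "?a 0"] h\<rho> n by (cases "i = n") (auto simp: f_def)
  have Sg: "?s ` {..<Suc n} \<subseteq> carrier ?A" using cycle_gen_closed by (auto simp del: lessThan_Suc)
  have "inj_on k (carrier ?A)"
  proof (rule inj_via_wreath[OF A.is_group B.is_group k(1) h(1) Sg cycle_generate])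
    fix s assume "s \<in> ?s ` {..<Suc n}"
    then obtain i where i: "i < Suc n" "s = ?s i" by (auto simp del: lessThan_Suc)
    have e: "h (k s) = S i" using k(2) i hf[OF i(1)] by simp
    show "fst (h (k s)) (0::int) = 0" unfolding e by (simp add: S_def)
    show "snd (h (k s)) (0::int) = s" unfolding e using zs[OF i(1)] i(2) by (simp add: S_def)
  qed
  then show ?thesis by (rule virtually_separated_embed[OF k(1) A.is_group _ B])
qed

section \<open>The affine type C\<close>

text \<open>
  The elements \<open>b\<^sub>0, \<dots>, b\<^sub>n\<^sub>-\<^sub>1, u\<close> satisfy the relations of the path with both end edges labelled \<open>4\<close>. The group of
  this type embeds into that of type \<open>B\<^sub>n\<^sub>+\<^sub>1\<close> by \<open>u \<mapsto> b\<^sub>n\<^sup>2\<close>, as the annular braids on \<open>n + 1\<close> strands in which one strand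
  returns to its position without winding around the axis. To invert this, the cocycle of that strand is written down. As the strands may
  turn around the axis, positions form the universal cover \<open>\<int>\<close> of the cycle of length \<open>N = n + 1\<close>.
\<close>

locale type_C = type_B +
  fixes u :: 'a
  assumes n2: "2 \<le> n" and u_closed [simp]: "u \<in> carrier G"
    and u_far: "Suc i < n \<Longrightarrow> u \<otimes> b i = b i \<otimes> u"
    and u_quad: "u \<otimes> (b (n - 1) \<otimes> (u \<otimes> b (n - 1))) = b (n - 1) \<otimes> (u \<otimes> (b (n - 1) \<otimes> u))"
begin

definition "m = n - 1"
lemma n_eq: "n = Suc m" "1 \<le> m" using n2 by (auto simp: m_def)

sublocale T: type_A G "\<lambda>i. b (Suc i)" m
  by (rule type_A_tail) (rule n_eq)

definition "\<rho> = T.r m \<otimes> b 0"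
definition "w = b m"

lemma closed [simp]: "\<rho> \<in> carrier G" "w \<in> carrier G" "b 0 \<in> carrier G"
  using n_eq by (simp_all add: \<rho>_def w_def)

lemma rho_rotation: "1 \<le> i \<Longrightarrow> i < m \<Longrightarrow> \<rho> \<otimes> b (Suc i) = b i \<otimes> \<rho>"
  and rho_square: "\<rho> \<otimes> (\<rho> \<otimes> b 1) = w \<otimes> (\<rho> \<otimes> \<rho>)"
proof -
  obtain k where k: "m = Suc k" using n_eq by (cases m) auto
  have c: "\<forall>i\<in>{1..<m}. b 0 \<otimes> b (Suc i) = b (Suc i) \<otimes> b 0"
    using far[of 0] n_eq(1) by auto
  have q: "b 0 \<otimes> (b (Suc 0) \<otimes> (b 0 \<otimes> b (Suc 0))) = b (Suc 0) \<otimes> (b 0 \<otimes> (b (Suc 0) \<otimes> b 0))"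
    using quad n2 by simp
  note rot = T.rotation_forward[OF k closed(3) c q, folded \<rho>_def]
  show "\<rho> \<otimes> (\<rho> \<otimes> b 1) = w \<otimes> (\<rho> \<otimes> \<rho>)" using rot(2) k by (simp add: w_def)
  show "\<rho> \<otimes> b (Suc i) = b i \<otimes> \<rho>" if "1 \<le> i" "i < m"
    using rot(1)[of "i - 1"] that by simp
qed

lemma u_transversal: "Suc j \<le> m \<Longrightarrow> u \<otimes> T.r j = T.r j \<otimes> u"
proof (induction j)
  case (Suc j)
  have c: "b (Suc j) \<in> carrier G" "T.r j \<in> carrier G" using Suc.prems n_eq(1) T.r_closed[of j] by auto
  have "u \<otimes> T.r (Suc j) = (u \<otimes> b (Suc j)) \<otimes> T.r j" using c by (simp add: m_assoc)
  also have "u \<otimes> b (Suc j) = b (Suc j) \<otimes> u" using u_far[of "Suc j"] Suc.prems n_eq(1) by simp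
  also have "(b (Suc j) \<otimes> u) \<otimes> T.r j = b (Suc j) \<otimes> (u \<otimes> T.r j)" using c by (simp add: m_assoc)
  also have "u \<otimes> T.r j = T.r j \<otimes> u" using Suc by simp
  finally show ?case using c by (simp add: m_assoc)
qed simp

lemma rho_u: "\<rho> \<otimes> u = w \<otimes> (u \<otimes> (inv w \<otimes> \<rho>))"
proof -
  obtain k where k: "m = Suc k" using n_eq by (cases m) auto
  have c: "T.r k \<in> carrier G" "b m \<in> carrier G" using k n_eq(1) T.r_closed[of k] by auto
  have \<rho>: "\<rho> = w \<otimes> (T.r k \<otimes> b 0)" using c by (simp add: \<rho>_def w_def k m_assoc)
  have u0: "u \<otimes> b 0 = b 0 \<otimes> u" using u_far[of 0] n2 by simp
  have "\<rho> \<otimes> u = w \<otimes> (T.r k \<otimes> (b 0 \<otimes> u))" unfolding \<rho> using c by (simp add: m_assoc)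
  also have "\<dots> = w \<otimes> ((T.r k \<otimes> u) \<otimes> b 0)" unfolding u0[symmetric] using c by (simp add: m_assoc)
  also have "\<dots> = w \<otimes> (u \<otimes> (T.r k \<otimes> b 0))" unfolding u_transversal[of k, unfolded k, OF order.refl, symmetric] using c by (simp add: m_assoc)
  also have "T.r k \<otimes> b 0 = inv w \<otimes> \<rho>" unfolding \<rho> using c by (simp add: inv_cancel_left)
  finally show ?thesis .
qed

text \<open>
  The elements \<open>\<rho>\<close> and \<open>\<sigma>\<close> are the two ways of rotating the remaining \<open>n\<close> strands past the distinguished one,
  on either side of it. The equations up to \<open>rho_inv_shift\<close> are the values of the braid and commutation relations on the
  cocycle defined after them.
\<close>

definition "\<sigma> = u \<otimes> \<rho>"

lemma sigma_closed [simp]: "\<sigma> \<in> carrier G" by (simp add: \<sigma>_def)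

lemma w_quad: "u \<otimes> (w \<otimes> (u \<otimes> w)) = w \<otimes> (u \<otimes> (w \<otimes> u))"
  using u_quad by (simp add: w_def m_def)

lemma sigma_sigma: "\<sigma> \<otimes> \<sigma> = u \<otimes> (w \<otimes> (u \<otimes> (inv w \<otimes> (\<rho> \<otimes> \<rho>))))"
proof -
  have "\<sigma> \<otimes> \<sigma> = u \<otimes> ((\<rho> \<otimes> u) \<otimes> \<rho>)" by (simp add: \<sigma>_def m_assoc)
  then show ?thesis unfolding rho_u by (simp add: m_assoc)
qed

lemma b1_closed [simp]: "b (Suc 0) \<in> carrier G" using n2 by simp

lemma sigma_square: "w \<otimes> (\<sigma> \<otimes> \<sigma>) = \<sigma> \<otimes> (\<sigma> \<otimes> b 1)"
proof -
  have "\<sigma> \<otimes> (\<sigma> \<otimes> b 1) = (\<sigma> \<otimes> \<sigma>) \<otimes> b 1" by (simp add: m_assoc)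
  also have "\<dots> = u \<otimes> (w \<otimes> (u \<otimes> (inv w \<otimes> (\<rho> \<otimes> (\<rho> \<otimes> b 1)))))" unfolding sigma_sigma by (simp add: m_assoc)
  also have "\<dots> = u \<otimes> (w \<otimes> (u \<otimes> (\<rho> \<otimes> \<rho>)))" unfolding rho_square by (simp add: inv_cancel_left)
  finally have r: "\<sigma> \<otimes> (\<sigma> \<otimes> b 1) = u \<otimes> (w \<otimes> (u \<otimes> (\<rho> \<otimes> \<rho>)))" .
  have "w \<otimes> (\<sigma> \<otimes> \<sigma>) = (w \<otimes> (u \<otimes> (w \<otimes> u))) \<otimes> (inv w \<otimes> (\<rho> \<otimes> \<rho>))" unfolding sigma_sigma by (simp add: m_assoc)
  also have "\<dots> = u \<otimes> (w \<otimes> (u \<otimes> (\<rho> \<otimes> \<rho>)))" unfolding w_quad[symmetric] by (simp add: m_assoc inv_cancel_left)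
  finally show ?thesis unfolding r .
qed

lemma sigma_rho_inv: "\<sigma> \<otimes> (b 1 \<otimes> inv \<rho>) = inv \<rho> \<otimes> (w \<otimes> \<sigma>)"
proof -
  have "\<rho> \<otimes> (\<sigma> \<otimes> b 1) = (\<rho> \<otimes> u) \<otimes> (\<rho> \<otimes> b 1)" by (simp add: \<sigma>_def m_assoc)
  also have "\<dots> = w \<otimes> (u \<otimes> (inv w \<otimes> (\<rho> \<otimes> (\<rho> \<otimes> b 1))))" unfolding rho_u by (simp add: m_assoc)
  also have "\<dots> = (w \<otimes> \<sigma>) \<otimes> \<rho>" unfolding rho_square by (simp add: \<sigma>_def m_assoc inv_cancel_left)
  finally have e: "\<rho> \<otimes> (\<sigma> \<otimes> b 1) = (w \<otimes> \<sigma>) \<otimes> \<rho>" .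
  have "\<sigma> \<otimes> (b 1 \<otimes> inv \<rho>) = inv \<rho> \<otimes> (\<rho> \<otimes> (\<sigma> \<otimes> b 1)) \<otimes> inv \<rho>" by (simp add: m_assoc inv_cancel_left)
  then show ?thesis unfolding e by (simp add: m_assoc)
qed

lemma rho_inv_square: "inv \<rho> \<otimes> (inv \<rho> \<otimes> w) = b 1 \<otimes> (inv \<rho> \<otimes> inv \<rho>)"
proof -
  have "inv \<rho> \<otimes> (inv \<rho> \<otimes> w) = inv \<rho> \<otimes> (inv \<rho> \<otimes> ((w \<otimes> (\<rho> \<otimes> \<rho>)) \<otimes> (inv \<rho> \<otimes> inv \<rho>)))"
    by (simp add: m_assoc inv_cancel_left)
  then show ?thesis unfolding rho_square[symmetric] by (simp add: m_assoc inv_cancel_left)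
qed

lemma sigma_shift: "2 \<le> i \<Longrightarrow> i \<le> m \<Longrightarrow> \<sigma> \<otimes> b i = b (i - 1) \<otimes> \<sigma>"
proof -
  assume i: "2 \<le> i" "i \<le> m"
  then obtain k where k: "i = Suc k" by (cases i) auto
  have c: "b i \<in> carrier G" "b k \<in> carrier G" using i k n_eq(1) by auto
  have "\<sigma> \<otimes> b i = u \<otimes> (\<rho> \<otimes> b (Suc k))" using c k by (simp add: \<sigma>_def m_assoc)
  also have "\<rho> \<otimes> b (Suc k) = b k \<otimes> \<rho>" by (rule rho_rotation) (use i k in auto)
  also have "u \<otimes> (b k \<otimes> \<rho>) = (u \<otimes> b k) \<otimes> \<rho>" using c by (simp add: m_assoc)
  also have "u \<otimes> b k = b k \<otimes> u" by (rule u_far) (use i k n_eq(1) in auto)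
  finally show ?thesis using c k by (simp add: \<sigma>_def m_assoc)
qed

lemma rho_inv_shift: "2 \<le> i \<Longrightarrow> i \<le> m \<Longrightarrow> inv \<rho> \<otimes> b (i - 1) = b i \<otimes> inv \<rho>"
proof -
  assume i: "2 \<le> i" "i \<le> m"
  then obtain k where k: "i = Suc k" by (cases i) auto
  have c: "b i \<in> carrier G" "b k \<in> carrier G" using i k n_eq(1) by auto
  have e: "\<rho> \<otimes> b (Suc k) = b k \<otimes> \<rho>" by (rule rho_rotation) (use i k in auto)
  have "inv \<rho> \<otimes> b k = inv \<rho> \<otimes> ((b k \<otimes> \<rho>) \<otimes> inv \<rho>)" using c by (simp add: m_assoc)
  then show ?thesis unfolding e[symmetric] using c k by (simp add: m_assoc inv_cancel_left)
qed

abbreviation N :: int where "N \<equiv> int n + 1"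

text \<open>
  The action of the \<open>k\<close>th generator on the position \<open>j\<close> of the distinguished strand. Only positions congruent
  to \<open>k\<close> or \<open>k + 1\<close> modulo \<open>N\<close> move. Elsewhere the generator exchanges two other strands; numbered starting
  after the distinguished strand, these are the strands exchanged by \<open>b\<^sub>N\<^sub>-\<^sub>e\<close>.
\<close>

definition S :: "nat \<Rightarrow> (int \<Rightarrow> int) \<times> (int \<Rightarrow> 'a)" where
  "S k = (\<lambda>j. let e = (j - int k) mod N in if e = 0 then j + 1 else if e = 1 then j - 1 else j,
          \<lambda>j. let e = (j - int k) mod N in if e = 0 then \<sigma> else if e = 1 then inv \<rho> else b (nat (N - e)))"

lemma S_at:
  assumes "j = int k + e + N * q" "0 \<le> e" "e < N"
  shows "fst (S k) j = (if e = 0 then j + 1 else if e = 1 then j - 1 else j)"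
    "snd (S k) j = (if e = 0 then \<sigma> else if e = 1 then inv \<rho> else b (nat (N - e)))"
proof -
  have "(j - int k) mod N = (e + N * q) mod N" using assms(1) by (simp add: algebra_simps)
  also have "\<dots> = e" using assms(2,3) by (simp only: mod_mult_self2 mod_pos_pos_trivial)
  finally show "fst (S k) j = (if e = 0 then j + 1 else if e = 1 then j - 1 else j)"
    "snd (S k) j = (if e = 0 then \<sigma> else if e = 1 then inv \<rho> else b (nat (N - e)))"
    by (simp_all add: S_def Let_def)
qed

lemma S_up: "j = int k + N * q \<Longrightarrow> fst (S k) j = j + 1 \<and> snd (S k) j = \<sigma>"
  using S_at[of j k 0 q] by simp

lemma S_down: "j = int k + 1 + N * q \<Longrightarrow> fst (S k) j = j - 1 \<and> snd (S k) j = inv \<rho>"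
  using S_at[of j k 1 q] n2 by simp

lemma S_stay: "j = int k + e + N * q \<Longrightarrow> 2 \<le> e \<Longrightarrow> e \<le> int n \<Longrightarrow> i = nat (N - e) \<Longrightarrow> fst (S k) j = j \<and> snd (S k) j = b i"
  using S_at[of j k e q] by simp

lemma position: obtains e q where "j = int k + e + N * q" "0 \<le> e" "e \<le> int n"
proof
  have "N * ((j - int k) div N) + (j - int k) mod N = j - int k" by (rule mult_div_mod_eq)
  then show "j = int k + (j - int k) mod N + N * ((j - int k) div N)" by linarith
  show "0 \<le> (j - int k) mod N" by simp
  have "(j - int k) mod N < N" by (rule pos_mod_bound) simp
  then show "(j - int k) mod N \<le> int n" by simp
qed

lemma S_closed: "S k \<in> carrier (wreath G)"
proof -
  have "fst (S k) (fst (S k) j) = j" for j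
  proof -
    obtain e q where e: "j = int k + e + N * q" "0 \<le> e" "e \<le> int n" by (rule position)
    consider "e = 0" | "e = 1" | "2 \<le> e" using e by linarith
    then show ?thesis
    proof cases
      case 1 then show ?thesis using S_up[of j k q] S_down[of "j + 1" k q] e by simp
    next
      case 2 then show ?thesis using S_down[of j k q] S_up[of "j - 1" k q] e by simp
    next
      case 3 then show ?thesis using S_stay[OF e(1) 3 e(3)] by simp
    qed
  qed
  then have "bij (fst (S k))" by (intro o_bij[of "fst (S k)"]) (auto simp: fun_eq_iff)
  moreover have "snd (S k) j \<in> carrier G" for j
  proof -
    obtain e q where e: "j = int k + e + N * q" "0 \<le> e" "e \<le> int n" by (rule position)
    consider "e = 0" | "e = 1" | "2 \<le> e" using e by linarith
    then show ?thesis
    proof cases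
      case 1 then show ?thesis using S_up[of j k q] e by simp
    next
      case 2 then show ?thesis using S_down[of j k q] e by simp
    next
      case 3 then show ?thesis using S_stay[OF e(1) 3 e(3) HOL.refl] e(3) by (simp add: nat_less_iff)
    qed
  qed
  ultimately show ?thesis by (cases "S k") (simp add: wreath_carrier)
qed

lemma S_braid: "S k \<otimes>\<^bsub>wreath G\<^esub> (S (Suc k) \<otimes>\<^bsub>wreath G\<^esub> S k) = S (Suc k) \<otimes>\<^bsub>wreath G\<^esub> (S k \<otimes>\<^bsub>wreath G\<^esub> S (Suc k))"
proof -
  have "fst (S k) (fst (S (Suc k)) (fst (S k) j)) = fst (S (Suc k)) (fst (S k) (fst (S (Suc k)) j)) \<and>
    snd (S k) (fst (S (Suc k)) (fst (S k) j)) \<otimes> (snd (S (Suc k)) (fst (S k) j) \<otimes> snd (S k) j) =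
    snd (S (Suc k)) (fst (S k) (fst (S (Suc k)) j)) \<otimes> (snd (S k) (fst (S (Suc k)) j) \<otimes> snd (S (Suc k)) j)" for j
  proof -
    obtain e q where e: "j = int k + e + N * q" "0 \<le> e" "e \<le> int n" by (rule position)
    have mm: "nat (N - 2) = m" "nat (N - int n) = 1" using n_eq by auto
    consider "e = 0" | "e = 1" | "e = 2" | "3 \<le> e" using e by linarith
    then show ?thesis
    proof cases
      case 1
      have "fst (S k) j = j + 1 \<and> snd (S k) j = \<sigma>" by (rule S_up[of _ _ q]) (use e 1 in simp)
      moreover have "fst (S (Suc k)) (j + 1) = j + 1 + 1 \<and> snd (S (Suc k)) (j + 1) = \<sigma>" by (rule S_up[of _ _ q]) (use e 1 in simp)
      moreover have "fst (S k) (j + 1 + 1) = j + 1 + 1 \<and> snd (S k) (j + 1 + 1) = b m" by (rule S_stay[of _ _ 2 q]) (use e 1 n2 mm in simp_all)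
      moreover have "fst (S (Suc k)) j = j \<and> snd (S (Suc k)) j = b 1"
        by (rule S_stay[of _ _ "int n" "q - 1"]) (use e 1 n2 mm in \<open>simp_all add: algebra_simps\<close>)
      ultimately show ?thesis using sigma_square by (simp add: w_def)
    next
      case 2
      have "fst (S k) j = j - 1 \<and> snd (S k) j = inv \<rho>" by (rule S_down[of _ _ q]) (use e 2 in simp)
      moreover have "fst (S (Suc k)) (j - 1) = j - 1 \<and> snd (S (Suc k)) (j - 1) = b 1"
        by (rule S_stay[of _ _ "int n" "q - 1"]) (use e 2 n2 mm in \<open>simp_all add: algebra_simps\<close>)
      moreover have "fst (S k) (j - 1) = j - 1 + 1 \<and> snd (S k) (j - 1) = \<sigma>" by (rule S_up[of _ _ q]) (use e 2 in simp)
      moreover have "fst (S (Suc k)) j = j + 1 \<and> snd (S (Suc k)) j = \<sigma>" by (rule S_up[of _ _ q]) (use e 2 in simp)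
      moreover have "fst (S k) (j + 1) = j + 1 \<and> snd (S k) (j + 1) = b m" by (rule S_stay[of _ _ 2 q]) (use e 2 n2 mm in simp_all)
      moreover have "fst (S (Suc k)) (j + 1) = j + 1 - 1 \<and> snd (S (Suc k)) (j + 1) = inv \<rho>" by (rule S_down[of _ _ q]) (use e 2 in simp)
      ultimately show ?thesis using sigma_rho_inv by (simp add: w_def)
    next
      case 3
      have "fst (S k) j = j \<and> snd (S k) j = b m" by (rule S_stay[of _ _ 2 q]) (use e 3 n2 mm in simp_all)
      moreover have "fst (S (Suc k)) j = j - 1 \<and> snd (S (Suc k)) j = inv \<rho>" by (rule S_down[of _ _ q]) (use e 3 in simp)
      moreover have "fst (S k) (j - 1) = j - 1 - 1 \<and> snd (S k) (j - 1) = inv \<rho>" by (rule S_down[of _ _ q]) (use e 3 in simp)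
      moreover have "fst (S (Suc k)) (j - 1 - 1) = j - 1 - 1 \<and> snd (S (Suc k)) (j - 1 - 1) = b 1"
        by (rule S_stay[of _ _ "int n" "q - 1"]) (use e 3 n2 mm in \<open>simp_all add: algebra_simps\<close>)
      ultimately show ?thesis using rho_inv_square by (simp add: w_def)
    next
      case 4
      define i where "i = nat (N - e)"
      have i: "1 \<le> i" "Suc i < n" "nat (N - (e - 1)) = Suc i" using e 4 by (auto simp: i_def)
      have "fst (S k) j = j \<and> snd (S k) j = b i" by (rule S_stay[of _ _ e q]) (use e 4 in \<open>simp_all add: i_def\<close>)
      moreover have "fst (S (Suc k)) j = j \<and> snd (S (Suc k)) j = b (Suc i)" by (rule S_stay[of _ _ "e - 1" q]) (use e 4 i(3) in simp_all)
      ultimately show ?thesis using braid[OF i(1,2)] by simp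
    qed
  qed
  then show ?thesis by (intro wreath_eqI) (simp_all add: fst_wreath_mult snd_wreath_mult)
qed

lemma S_far: assumes kl: "Suc k < l" "l < n" shows "S k \<otimes>\<^bsub>wreath G\<^esub> S l = S l \<otimes>\<^bsub>wreath G\<^esub> S k"
proof -
  define d where "d = int l - int k"
  have d: "int l = int k + d" "2 \<le> d" "d < int n" using kl by (auto simp: d_def)
  have dn: "int (nat d) = d" "int (nat (N - d)) = N - d" "2 \<le> nat d" "nat d \<le> m" "2 \<le> nat (N - d)" "nat (N - d) \<le> m" using d n_eq by auto
  have "fst (S k) (fst (S l) j) = fst (S l) (fst (S k) j) \<and>
    snd (S k) (fst (S l) j) \<otimes> snd (S l) j = snd (S l) (fst (S k) j) \<otimes> snd (S k) j" for j
  proof -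
    obtain e q where e: "j = int k + e + N * q" "0 \<le> e" "e \<le> int n" by (rule position)
    consider "e = 0" | "e = 1" | "e = d" | "e = d + 1" | "2 \<le> e" "e < d" | "d + 1 < e" using e by linarith
    then show ?thesis
    proof cases
      case 1
      have "fst (S k) j = j + 1 \<and> snd (S k) j = \<sigma>" by (rule S_up[of _ _ q]) (use e 1 in simp)
      moreover have "fst (S l) j = j \<and> snd (S l) j = b (nat d)"
        by (rule S_stay[of _ _ "N - d" "q - 1"]) (use e 1 d in \<open>simp_all add: algebra_simps\<close>)
      moreover have "fst (S l) (j + 1) = j + 1 \<and> snd (S l) (j + 1) = b (nat d - 1)"
        by (rule S_stay[of _ _ "N - d + 1" "q - 1"]) (use e 1 d in \<open>simp_all add: algebra_simps\<close>)
      ultimately show ?thesis using sigma_shift[of "nat d"] dn by simp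
    next
      case 2
      have "fst (S k) j = j - 1 \<and> snd (S k) j = inv \<rho>" by (rule S_down[of _ _ q]) (use e 2 in simp)
      moreover have "fst (S l) j = j \<and> snd (S l) j = b (nat d - 1)"
        by (rule S_stay[of _ _ "N - d + 1" "q - 1"]) (use e 2 d in \<open>simp_all add: algebra_simps\<close>)
      moreover have "fst (S l) (j - 1) = j - 1 \<and> snd (S l) (j - 1) = b (nat d)"
        by (rule S_stay[of _ _ "N - d" "q - 1"]) (use e 2 d in \<open>simp_all add: algebra_simps\<close>)
      ultimately show ?thesis using rho_inv_shift[of "nat d"] dn by simp
    next
      case 3
      have "fst (S l) j = j + 1 \<and> snd (S l) j = \<sigma>" by (rule S_up[of _ _ q]) (use e 3 d in simp)
      moreover have "fst (S k) j = j \<and> snd (S k) j = b (nat (N - d))"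
        by (rule S_stay[of _ _ d q]) (use e 3 d in simp_all)
      moreover have "fst (S k) (j + 1) = j + 1 \<and> snd (S k) (j + 1) = b (nat (N - d) - 1)"
        by (rule S_stay[of _ _ "d + 1" q]) (use e 3 d in \<open>auto\<close>)
      ultimately show ?thesis using sigma_shift[of "nat (N - d)"] dn by simp
    next
      case 4
      have "fst (S l) j = j - 1 \<and> snd (S l) j = inv \<rho>" by (rule S_down[of _ _ q]) (use e 4 d in simp)
      moreover have "fst (S k) j = j \<and> snd (S k) j = b (nat (N - d) - 1)"
        by (rule S_stay[of _ _ "d + 1" q]) (use e 4 d in \<open>auto\<close>)
      moreover have "fst (S k) (j - 1) = j - 1 \<and> snd (S k) (j - 1) = b (nat (N - d))"
        by (rule S_stay[of _ _ d q]) (use e 4 d in simp_all)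
      ultimately show ?thesis using rho_inv_shift[of "nat (N - d)"] dn by simp
    next
      case 5
      have "fst (S k) j = j \<and> snd (S k) j = b (nat (N - e))" by (rule S_stay[of _ _ e q]) (use e 5 in simp_all)
      moreover have "fst (S l) j = j \<and> snd (S l) j = b (nat (d - e))"
        by (rule S_stay[of _ _ "e - d + N" "q - 1"]) (use e 5 d in \<open>simp_all add: algebra_simps\<close>)
      moreover have "b (nat (N - e)) \<otimes> b (nat (d - e)) = b (nat (d - e)) \<otimes> b (nat (N - e))"
        by (rule commute) (use e 5 d in auto)
      ultimately show ?thesis by simp
    next
      case 6
      have "fst (S k) j = j \<and> snd (S k) j = b (nat (N - e))" by (rule S_stay[of _ _ e q]) (use e 6 d in simp_all)
      moreover have "fst (S l) j = j \<and> snd (S l) j = b (nat (N - e + d))"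
        by (rule S_stay[of _ _ "e - d" q]) (use e 6 d in \<open>simp_all add: algebra_simps\<close>)
      moreover have "b (nat (N - e)) \<otimes> b (nat (N - e + d)) = b (nat (N - e + d)) \<otimes> b (nat (N - e))"
        by (rule commute) (use e 6 d in auto)
      ultimately show ?thesis by simp
    qed
  qed
  then show ?thesis by (intro wreath_eqI) (simp_all add: fst_wreath_mult snd_wreath_mult)
qed

definition R :: "(int \<Rightarrow> int) \<times> (int \<Rightarrow> 'a)" where "R = (\<lambda>j. j - 1, \<lambda>j. \<one>)"

lemma R_closed: "R \<in> carrier (wreath G)"
proof -
  have "bij (\<lambda>j::int. j - 1)" by (rule o_bij[of "\<lambda>j. j + 1"]) auto
  then show ?thesis by (simp add: R_def wreath_carrier)
qed

lemma S_snd_closed: "snd (S k) j \<in> carrier G"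
  using wreath_snd_closed[OF S_closed] .

lemma S_shift: "fst (S (Suc k)) j = fst (S k) (j - 1) + 1" "snd (S (Suc k)) j = snd (S k) (j - 1)"
proof -
  have e: "j - int (Suc k) = j - 1 - int k" by simp
  show "fst (S (Suc k)) j = fst (S k) (j - 1) + 1" unfolding S_def Let_def fst_conv e by simp
  show "snd (S (Suc k)) j = snd (S k) (j - 1)" unfolding S_def Let_def snd_conv e ..
qed

lemma R_S: "R \<otimes>\<^bsub>wreath G\<^esub> S (Suc k) = S k \<otimes>\<^bsub>wreath G\<^esub> R"
  by (rule wreath_eqI) (simp_all add: R_def fst_wreath_mult snd_wreath_mult S_shift S_snd_closed)

lemma S_period: "fst (S (k + Suc n)) j = fst (S k) j" "snd (S (k + Suc n)) j = snd (S k) j"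
proof -
  have "(j - int (k + Suc n)) mod N = (j - int k - N) mod N" by (simp add: algebra_simps)
  also have "\<dots> = (j - int k) mod N" by (rule minus_mod_self2)
  finally show "fst (S (k + Suc n)) j = fst (S k) j" "snd (S (k + Suc n)) j = snd (S k) j"
    unfolding S_def by simp_all
qed

lemma R_R_S: "R \<otimes>\<^bsub>wreath G\<^esub> (R \<otimes>\<^bsub>wreath G\<^esub> S 0) = S m \<otimes>\<^bsub>wreath G\<^esub> (R \<otimes>\<^bsub>wreath G\<^esub> R)"
proof -
  interpret W: group "wreath G :: ((int \<Rightarrow> int) \<times> (int \<Rightarrow> 'a)) monoid" by (rule group_wreath[OF is_group])
  have "S (Suc (Suc m)) = S 0"
    using n_eq(1) S_period[of 0] by (intro wreath_eqI) simp_all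
  then have "R \<otimes>\<^bsub>wreath G\<^esub> (R \<otimes>\<^bsub>wreath G\<^esub> S 0) = R \<otimes>\<^bsub>wreath G\<^esub> (S (Suc m) \<otimes>\<^bsub>wreath G\<^esub> R)"
    using R_S[of "Suc m"] by simp
  also have "\<dots> = (R \<otimes>\<^bsub>wreath G\<^esub> S (Suc m)) \<otimes>\<^bsub>wreath G\<^esub> R" using R_closed S_closed by (simp add: W.m_assoc)
  finally show ?thesis unfolding R_S using R_closed S_closed by (simp add: W.m_assoc)
qed

lemma type_A_S: "type_A (wreath G) S n"
proof -
  interpret W: group "wreath G :: ((int \<Rightarrow> int) \<times> (int \<Rightarrow> 'a)) monoid" by (rule group_wreath[OF is_group])
  show ?thesis
  proof (unfold_locales, goal_cases)
    case (1 i) show ?case by (rule S_closed)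
  next
    case (2 i) show ?case by (rule S_braid)
  next
    case (3 i j) then show ?case by (rule S_far)
  qed
qed

lemma S_transversal: "j \<le> m \<Longrightarrow> fst (strand_transversal (wreath G) S j) (int n) = int n \<and>
    snd (strand_transversal (wreath G) S j) (int n) = T.r j"
proof (induction j)
  case 0 then show ?case by (simp add: wreath_one)
next
  case (Suc j)
  have "fst (S j) (int n) = int n \<and> snd (S j) (int n) = b (Suc j)"
    by (rule S_stay[of _ _ "int n - int j" 0]) (use Suc.prems n_eq in auto)
  then show ?case using Suc by (simp add: fst_wreath_mult snd_wreath_mult)
qed

lemma S_last:
  shows "fst (S m) (int n) = int n - 1" "snd (S m) (int n) = inv \<rho>"
    "fst (S m) (int n - 1) = int n" "snd (S m) (int n - 1) = \<sigma>"
  using S_down[of "int n" m 0] S_up[of "int n - 1" m 0] n_eq(1) by simp_all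

text \<open>
  The image of \<open>b\<^sub>0\<close> in the wreath product is the quotient of the rotation \<open>R\<close> by the transversal; at the index \<open>n\<close> it
  fixes the position and takes the value \<open>b\<^sub>0\<close>.
\<close>

lemma tail_value:
  assumes t: "t \<in> carrier (wreath G)" "strand_transversal (wreath G) S n \<otimes>\<^bsub>wreath G\<^esub> t = R"
  shows "fst t (int n) = int n" "snd t (int n) = b 0"
proof -
  interpret W: type_A "wreath G" S n by (rule type_A_S)
  have rn: "fst (W.r n) (int n) = int n - 1" "snd (W.r n) (int n) = inv \<rho> \<otimes> T.r m"
    unfolding arg_cong[OF n_eq(1), of W.r] strand_transversal.simps
    using S_transversal[OF order.refl] S_last by (simp_all add: fst_wreath_mult snd_wreath_mult)
  have "bij (fst (W.r n))" using W.r_closed[OF order.refl] by (cases "W.r n") (simp add: wreath_carrier)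
  moreover have "fst (W.r n) (fst t (int n)) = int n - 1"
    using arg_cong[OF t(2), of "\<lambda>x. fst x (int n)"] by (simp add: fst_wreath_mult R_def)
  ultimately show f: "fst t (int n) = int n" using rn(1) by (metis bij_is_inj injD)
  have tc: "snd t (int n) \<in> carrier G" using wreath_snd_closed[OF t(1)] .
  have Tc: "T.r m \<in> carrier G" by simp
  have "(inv \<rho> \<otimes> T.r m) \<otimes> snd t (int n) = \<one>"
    using arg_cong[OF t(2), of "\<lambda>x. snd x (int n)"] f rn(2) by (simp add: snd_wreath_mult R_def)
  then have "inv (snd t (int n)) = inv \<rho> \<otimes> T.r m"
    using tc Tc by (intro inv_equality) simp_all
  then have "inv (inv (snd t (int n))) = inv (inv \<rho> \<otimes> T.r m)" by (rule arg_cong)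
  then have "snd t (int n) = inv (inv \<rho> \<otimes> T.r m)" using tc by simp
  then have "snd t (int n) = inv (T.r m) \<otimes> \<rho>" using Tc by (simp add: inv_mult_group)
  then show "snd t (int n) = b 0" using Tc by (simp add: \<rho>_def inv_cancel_left)
qed

end

text \<open>
  The group of type affine \<open>C\<^sub>n\<close> is embedded into that of type \<open>B\<^sub>n\<^sub>+\<^sub>1\<close>, the left inverse being the cocycle at position
  \<open>n\<close>.
\<close>

theorem virtually_separated_affine_C:
  assumes n: "2 \<le> n" and B: "virtually_separated p (artin_group (graph_B (Suc n)))"
  shows "virtually_separated p (artin_group (graph_affine_C n))"
proof -
  let ?A = "artin_group (graph_affine_C n)" and ?B = "artin_group (graph_B (Suc n))"
  let ?c = "artin_generator (graph_affine_C n)" and ?b = "artin_generator (graph_B (Suc n))"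
  let ?l = "\<lambda>i. if i = 0 \<or> Suc i = n then (4 :: enat) else 3"
  have gC: "graph_affine_C n = coxeter_path (Suc n) ?l" by (simp add: graph_affine_C_def)
  interpret A: group ?A by (rule group_artin)
  interpret B: type_B ?B ?b "Suc n" by (rule type_B_artin)
  have cl: "?c i \<in> carrier ?A" if "i < Suc n" for i unfolding gC using that by (rule path_gen_closed)
  have adj: "alt_prod ?A k (?c i) (?c (Suc i)) = alt_prod ?A k (?c (Suc i)) (?c i)" if "i < n" "?l i = enat k" for i k
    unfolding gC using that by (intro path_adjacent) auto
  have far: "?c i \<otimes>\<^bsub>?A\<^esub> ?c j = ?c j \<otimes>\<^bsub>?A\<^esub> ?c i" if "Suc i < j" "j < Suc n" for i j
    unfolding gC using that by (rule path_far)
  interpret C: type_C ?A ?c n "?c n"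
  proof (unfold_locales, goal_cases)
    case (1 i) then show ?case by (intro cl) simp
  next
    case 2 then show ?case using adj[of 0 4] cl[of 0] cl[of 1] by (simp add: alt_prod4 numeral_eq_enat)
  next
    case (3 i) then show ?case using adj[of i 3] cl[of i] cl[of "Suc i"] by (simp add: alt_prod3 numeral_eq_enat)
  next
    case (4 i j) then show ?case by (intro far) simp_all
  next
    case 5 show ?case by (rule n)
  next
    case 6 show ?case by (rule cl) simp
  next
    case (7 i) then show ?case by (intro far[symmetric]) simp_all
  next
    case 8
    have "Suc (n - 1) = n" using n by simp
    then show ?case using adj[of "n - 1" 4] cl[of n] cl[of "n - 1"] n by (simp add: alt_prod4 numeral_eq_enat)
  qed
  define f where "f i = (if i < n then ?b i else ?b n \<otimes>\<^bsub>?B\<^esub> ?b n)" for i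
  have "\<exists>h \<in> hom (artin_group (coxeter_path (Suc n) ?l)) ?B. \<forall>i<Suc n. h (artin_generator (coxeter_path (Suc n) ?l) i) = f i"
  proof (rule B.path_hom, goal_cases)
    case (1 i) then show ?case by (simp add: f_def)
  next
    case (2 i k)
    then consider "i = 0" "k = 4" | "Suc i = n" "k = 4" | "1 \<le> i" "Suc i < n" "k = 3"
      using n by (auto simp: enat_numeral_eq split: if_splits)
    then show ?case
    proof cases
      case 1 then show ?thesis using n B.quad by (simp add: f_def alt_prod4)
    next
      case 2
      have "?b n \<otimes>\<^bsub>?B\<^esub> (?b i \<otimes>\<^bsub>?B\<^esub> ?b n) = ?b i \<otimes>\<^bsub>?B\<^esub> (?b n \<otimes>\<^bsub>?B\<^esub> ?b i)"
        using B.braid[of i] 2 n by auto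
      then have "(?b n \<otimes>\<^bsub>?B\<^esub> ?b n) \<otimes>\<^bsub>?B\<^esub> (?b i \<otimes>\<^bsub>?B\<^esub> ((?b n \<otimes>\<^bsub>?B\<^esub> ?b n) \<otimes>\<^bsub>?B\<^esub> ?b i)) =
          ?b i \<otimes>\<^bsub>?B\<^esub> ((?b n \<otimes>\<^bsub>?B\<^esub> ?b n) \<otimes>\<^bsub>?B\<^esub> (?b i \<otimes>\<^bsub>?B\<^esub> (?b n \<otimes>\<^bsub>?B\<^esub> ?b n)))"
        by (intro B.square_quad) (use 2 in auto)
      moreover have "f i = ?b i" "f (Suc i) = ?b n \<otimes>\<^bsub>?B\<^esub> ?b n" using 2 by (auto simp: f_def)
      moreover have "?b i \<in> carrier ?B" "?b n \<otimes>\<^bsub>?B\<^esub> ?b n \<in> carrier ?B" using 2 by auto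
      ultimately show ?thesis unfolding \<open>k = 4\<close> alt_prod4 by (simp only: B.r_one)
    next
      case 3 then show ?thesis using B.braid[of i] by (simp add: f_def alt_prod3)
    qed
  next
    case (3 i j)
    then have "?b i \<otimes>\<^bsub>?B\<^esub> ?b j = ?b j \<otimes>\<^bsub>?B\<^esub> ?b i" by (intro B.far)
    then show ?case using 3 B.square_commute[of "?b n" "?b i"] by (cases "j < n") (auto simp: f_def less_Suc_eq)
  qed
  then obtain k where k: "k \<in> hom ?A ?B" "\<forall>i<Suc n. k (?c i) = f i" unfolding gC by (elim bexE)
  let ?W = "wreath ?A :: ((int \<Rightarrow> int) \<times> (int \<Rightarrow> _)) monoid"
  interpret TW: type_A ?W C.S n by (rule C.type_A_S)
  from artin_B_hom[OF TW.type_B_rotation[OF C.n_eq(1) C.R_closed C.R_S C.R_R_S]]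
  obtain h where h: "h \<in> hom ?B ?W"
    "\<forall>i<Suc n. h (?b i) = (if i = 0 then inv\<^bsub>?W\<^esub> TW.r n \<otimes>\<^bsub>?W\<^esub> C.R else C.S (i - 1))" by (elim bexE)
  have g: "generate ?A (?c ` {..<Suc n}) = carrier ?A" unfolding gC by (rule path_generate)
  have hk: "fst (h (k (?c i))) (int n) = int n \<and> snd (h (k (?c i))) (int n) = ?c i" if i: "i < Suc n" for i
  proof -
    consider "i = 0" | "1 \<le> i" "i < n" | "i = n" using i by linarith
    then show ?thesis
    proof cases
      case 1
      have e: "h (k (?c i)) = inv\<^bsub>?W\<^esub> TW.r n \<otimes>\<^bsub>?W\<^esub> C.R" using 1 k(2) h(2) n by (simp add: f_def)
      have "inv\<^bsub>?W\<^esub> TW.r n \<otimes>\<^bsub>?W\<^esub> C.R \<in> carrier ?W" using C.R_closed by simp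
      from C.tail_value[OF this TW.rotation_recover[OF C.R_closed]] show ?thesis unfolding e using 1 by simp
    next
      case 2
      have e: "h (k (?c i)) = C.S (i - 1)" using 2 k(2) h(2) by (simp add: f_def)
      show ?thesis unfolding e by (rule C.S_stay[of _ _ "int n - int (i - 1)" 0]) (use 2 in auto)
    next
      case 3
      have bn: "?b n \<in> carrier ?B" "h (?b n) = C.S C.m" using h(2) n by (auto simp: C.m_def)
      have e: "h (k (?c i)) = C.S C.m \<otimes>\<^bsub>?W\<^esub> C.S C.m"
        using 3 k(2) hom_multD[OF h(1) bn(1) bn(1)] bn(2) by (simp add: f_def)
      show ?thesis unfolding e using C.S_last 3 cl[of n]
        by (simp add: fst_wreath_mult snd_wreath_mult C.\<sigma>_def A.m_assoc)
    qed
  qed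
  have Sg: "?c ` {..<Suc n} \<subseteq> carrier ?A" using cl by (auto simp del: lessThan_Suc)
  have "inj_on k (carrier ?A)"
    by (rule inj_via_wreath[OF A.is_group B.is_group k(1) h(1) Sg g, of "int n"]) (use hk in \<open>auto simp del: lessThan_Suc\<close>)
  then show ?thesis by (rule virtually_separated_embed[OF k(1) A.is_group _ B])
qed

section \<open>The free group and the dihedral types\<close>

text \<open>
  The affine type \<open>A\<^sub>1\<close>: no relations, so any action of the two generators extends, and conjugation by the group
  itself is inner.
\<close>

theorem virtually_separated_free2: assumes p: "1 < p" shows "virtually_separated p (artin_group (coxeter_path 2 (\<lambda>_. \<infinity>)))"
proof -
  let ?G = "artin_group (coxeter_path 2 (\<lambda>_. \<infinity>))" and ?g = "artin_generator (coxeter_path 2 (\<lambda>_. \<infinity>))"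
  interpret G: group ?G by (rule group_artin)
  have cl: "?g \<in> {..<2} \<rightarrow> carrier ?G" using path_gen_closed by auto
  have fam: "\<exists>h \<in> hom ?G (wreath perms). \<exists>i :: unit. \<forall>j\<in>{..<2}. fst (h (?g j)) i = i \<and> snd (h (?g j)) i = y j"
    if y: "\<And>j. bij (y j)" for y :: "nat \<Rightarrow> nat \<Rightarrow> nat"
  proof -
    interpret W: group "wreath perms :: ((unit \<Rightarrow> unit) \<times> (unit \<Rightarrow> nat \<Rightarrow> nat)) monoid" by (rule group_wreath[OF group_perms])
    have "\<exists>h \<in> hom ?G (wreath perms). \<forall>i<2. h (?g i) = (id :: unit \<Rightarrow> unit, \<lambda>_. y i)"
      by (rule W.path_hom) (use y in \<open>auto simp: wreath_carrier\<close>)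
    then obtain h where h: "h \<in> hom ?G (wreath perms)" "\<forall>i<2. h (?g i) = (id :: unit \<Rightarrow> unit, \<lambda>_. y i)" by (elim bexE)
    show ?thesis by (rule bexI[OF _ h(1)], rule exI[of _ "()"]) (use h(2) in simp)
  qed
  note fb = free_basis_family[OF G.is_group cl fam]
  have B: "?g 0 \<in> ?g ` {..<2}" "?g 1 \<in> ?g ` {..<2}" by auto
  have ne: "?g 0 \<noteq> ?g 1" using inj_onD[OF fb(2), of 0 1] by auto
  have h: "(\<lambda>_. 0) \<in> hom ?G integer_group" by (auto simp: hom_def)
  note gen = path_generate[of 2 "\<lambda>_. \<infinity>"]
  have ker: "(0::int) = \<one>\<^bsub>integer_group\<^esub> \<longleftrightarrow> g \<in> generate ?G (?g ` {..<2})" if "g \<in> carrier ?G" for g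
    unfolding gen using that by simp
  have fin: "finite (rcosets\<^bsub>?G\<^esub> (carrier ?G))"
    by (rule G.finite_index_if_invariant[OF G.subgroup_self, of "\<lambda>_. ()"]) auto
  have KP: "generate ?G (?g ` {..<2}) \<subseteq> carrier ?G" unfolding gen ..
  have cnj: "\<exists>v\<in>generate ?G (?g ` {..<2}). g \<otimes>\<^bsub>?G\<^esub> b \<otimes>\<^bsub>?G\<^esub> inv\<^bsub>?G\<^esub> g = v \<otimes>\<^bsub>?G\<^esub> b \<otimes>\<^bsub>?G\<^esub> inv\<^bsub>?G\<^esub> v"
    if "g \<in> carrier ?G" for g b
    unfolding gen using that by blast
  show ?thesis
    by (rule virtually_separated_free_kernel[OF p G.is_group h virtually_separated_integer_group[OF p] fb(1) B ne ker G.subgroup_self fin KP cnj])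
qed

text \<open>
  A finite-index subgroup is the product of a free group and a central one, and central elements
  conjugate trivially.
\<close>

lemma virtually_separated_center_times_free:
  fixes G (structure) and d :: int
  assumes p: "1 < p" and G: "group G" and h: "h \<in> hom G integer_group"
    and B: "free_basis G B" "b1 \<in> B" "b2 \<in> B" "b1 \<noteq> b2"
    and ker: "\<And>g. g \<in> carrier G \<Longrightarrow> h g = 0 \<longleftrightarrow> g \<in> generate G B"
    and d: "0 < d"
    and split: "\<And>g. g \<in> carrier G \<Longrightarrow> d dvd h g \<Longrightarrow>
      \<exists>n\<in>generate G B. \<exists>c\<in>carrier G. (\<forall>x\<in>carrier G. c \<otimes> x = x \<otimes> c) \<and> g = n \<otimes> c"
  shows "virtually_separated p G"
proof -
  interpret G: group G by fact
  interpret h: group_hom G integer_group h by (intro group_hom.intro group_hom_axioms.intro G group_integer_group h)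
  have hm: "h (x \<otimes> y) = h x + h y" if "x \<in> carrier G" "y \<in> carrier G" for x y
    using h.hom_mult[OF that] by simp
  have hi: "h (inv x) = - h x" if "x \<in> carrier G" for x
    using hm[of x "inv x"] h.hom_one that by simp
  let ?P = "{g \<in> carrier G. d dvd h g}"
  have Bc: "B \<subseteq> carrier G" using B(1) by (simp add: free_basis_def)
  note Nc = G.generate_in_carrier[OF Bc]
  have P: "subgroup ?P G"
  proof (rule G.subgroupI)
    show "?P \<noteq> {}" using h.hom_one by (auto intro!: exI[of _ \<one>])
  qed (auto simp: hm hi)
  have fin: "finite (rcosets ?P)"
  proof (rule G.finite_index_if_invariant[OF P, of "\<lambda>g. h g mod d"])
    have "(\<lambda>g. h g mod d) ` carrier G \<subseteq> {0..<d}" using d by auto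
    then show "finite ((\<lambda>g. h g mod d) ` carrier G)" by (rule finite_subset) simp
    fix g k assume "g \<in> carrier G" "k \<in> carrier G" "h g mod d = h k mod d"
    then show "g \<otimes> inv k \<in> ?P" by (simp add: hm hi mod_eq_dvd_iff)
  qed
  have NP: "generate G B \<subseteq> ?P"
  proof
    fix g assume g: "g \<in> generate G B"
    then have "h g = 0" using ker[OF Nc[OF g]] by blast
    then show "g \<in> ?P" using Nc[OF g] by simp
  qed
  have cnj: "\<exists>v\<in>generate G B. g \<otimes> b \<otimes> inv g = v \<otimes> b \<otimes> inv v" if g: "g \<in> ?P" and b: "b \<in> B" for g b
  proof -
    obtain n c where nc: "n \<in> generate G B" "c \<in> carrier G" "\<forall>x\<in>carrier G. c \<otimes> x = x \<otimes> c" "g = n \<otimes> c"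
      using split g by blast
    have bc: "b \<in> carrier G" using b Bc by auto
    have "g \<otimes> b \<otimes> inv g = n \<otimes> (c \<otimes> b) \<otimes> inv c \<otimes> inv n"
      unfolding nc(4) using nc(2) Nc[OF nc(1)] bc by (simp add: G.inv_mult_group G.m_assoc)
    also have "c \<otimes> b = b \<otimes> c" using nc(3) bc by blast
    finally have "g \<otimes> b \<otimes> inv g = n \<otimes> b \<otimes> inv n"
      using nc(2) Nc[OF nc(1)] bc by (simp add: G.m_assoc)
    then show ?thesis using nc(1) by blast
  qed
  have ker': "h g = \<one>\<^bsub>integer_group\<^esub> \<longleftrightarrow> g \<in> generate G B" if "g \<in> carrier G" for g using ker[OF that] by simp
  show ?thesis
    by (rule virtually_separated_free_kernel[OF p G h virtually_separated_integer_group[OF p] B ker' P fin NP cnj])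
qed

context group begin

lemma alt_prod_pow:
  assumes "x \<in> carrier G" "y \<in> carrier G"
  shows "alt_prod G (2 * k) x y = (x \<otimes> y) [^] k" "alt_prod G (Suc (2 * k)) x y = (x \<otimes> y) [^] k \<otimes> x"
proof -
  have "alt_prod G (2 * k) x y = (x \<otimes> y) [^] k \<and> alt_prod G (Suc (2 * k)) x y = (x \<otimes> y) [^] k \<otimes> x"
  proof (induction k)
    case 0 then show ?case using assms by simp
  next
    case (Suc k)
    have "alt_prod G (Suc (Suc i)) x y = (x \<otimes> y) \<otimes> alt_prod G i x y" if "alt_prod G i x y \<in> carrier G" for i
      using assms that by (simp add: m_assoc)
    from this[of "2 * k"] this[of "Suc (2 * k)"] Suc assms
    have "alt_prod G (Suc (Suc (2 * k))) x y = (x \<otimes> y) \<otimes> (x \<otimes> y) [^] k"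
      "alt_prod G (Suc (Suc (Suc (2 * k)))) x y = (x \<otimes> y) \<otimes> ((x \<otimes> y) [^] k \<otimes> x)" by simp_all
    moreover have "(x \<otimes> y) \<otimes> (x \<otimes> y) [^] k = (x \<otimes> y) [^] Suc k" using assms nat_pow_Suc2[of "x \<otimes> y" k] by simp
    ultimately show ?case using assms by (simp add: m_assoc[symmetric] del: alt_prod.simps nat_pow_Suc)
  qed
  then show "alt_prod G (2 * k) x y = (x \<otimes> y) [^] k" "alt_prod G (Suc (2 * k)) x y = (x \<otimes> y) [^] k \<otimes> x" by blast+
qed

lemma pow_slide: "x \<in> carrier G \<Longrightarrow> y \<in> carrier G \<Longrightarrow> x \<otimes> (y \<otimes> x) [^] (k::nat) = (x \<otimes> y) [^] k \<otimes> x"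
proof (induction k)
  case (Suc k)
  have "x \<otimes> (y \<otimes> x) [^] Suc k = (x \<otimes> (y \<otimes> x) [^] k) \<otimes> (y \<otimes> x)" using Suc.prems by (simp add: m_assoc)
  then show ?case unfolding Suc.IH[OF Suc.prems] using Suc.prems by (simp add: m_assoc)
qed simp

lemma central_generate:
  assumes "S \<subseteq> carrier G" "c \<in> carrier G" "\<And>s. s \<in> S \<Longrightarrow> c \<otimes> s = s \<otimes> c" "g \<in> generate G S"
  shows "c \<otimes> g = g \<otimes> c"
proof -
  have "cj c g = g" using assms(4)
  proof (induction rule: generate.induct)
    case one then show ?case using assms(2) by (simp add: conj_by_def)
  next
    case (incl s) then show ?case using assms by (auto simp: cj_eq_iff)
  next
    case (inv s)
    then have s: "s \<in> carrier G" using assms(1) by auto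
    then have "cj c s = s" using assms(2,3) inv by (simp add: cj_eq_iff)
    then show ?case using s assms(2) by (simp add: cj_inv)
  next
    case (eng x y)
    then have "x \<in> carrier G" "y \<in> carrier G" using generate_in_carrier[OF assms(1)] by auto
    then show ?case using eng assms(2) by (simp add: cj_mult)
  qed
  then show ?thesis using assms(2) generate_in_carrier[OF assms(1,4)] by (simp add: cj_eq_iff)
qed

lemma int_pow_commute:
  assumes "c \<in> carrier G" "g \<in> carrier G" "c \<otimes> g = g \<otimes> c"
  shows "c [^] (q::int) \<otimes> g = g \<otimes> c [^] q"
proof -
  have "g \<otimes> c \<otimes> inv g = \<one> \<otimes> c \<otimes> inv \<one>" using assms by (simp add: assms(3)[symmetric] m_assoc)
  from int_pow_conj[OF assms(2) one_closed assms(1) this, of q]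
  have "cj g (c [^] q) = c [^] q" using assms by (simp add: conj_by_def)
  then show ?thesis using assms by (simp add: cj_eq_iff)
qed

end

lemma wreath_shift_pow:
  fixes s :: "'i \<Rightarrow> 'i"
  assumes "bij s"
  shows "(s, \<lambda>_. id :: 'o \<Rightarrow> 'o) [^]\<^bsub>wreath perms\<^esub> (k::nat) = (s ^^ k, \<lambda>_. id :: 'o \<Rightarrow> 'o)"
proof (induction k)
  case 0
  have "(s, \<lambda>_. id :: 'o \<Rightarrow> 'o) [^]\<^bsub>wreath perms\<^esub> (0::nat) = \<one>\<^bsub>wreath perms\<^esub>" by (rule nat_pow_0)
  then show ?case by (simp add: wreath_one id_def)
next
  case (Suc k)
  have "(s, \<lambda>_. id :: 'o \<Rightarrow> 'o) [^]\<^bsub>wreath perms\<^esub> Suc k = (s ^^ k, \<lambda>_. id :: 'o \<Rightarrow> 'o) \<otimes>\<^bsub>wreath perms\<^esub> (s, \<lambda>_. id :: 'o \<Rightarrow> 'o)"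
    by (simp only: nat_pow_Suc Suc)
  then show ?case by (simp only: wreath_mult) (simp add: fun_eq_iff perms_def funpow_swap1)
qed

lemma funpow_minus: "((\<lambda>i::int. i - 1) ^^ k) i = i - int k"
  by (induction k) auto

text \<open>
  With \<open>x = a b\<close> the group is generated by \<open>a\<close> and \<open>x\<close> subject to \<open>x\<^sup>k\<close> being central. The character with \<open>a \<mapsto> 0\<close> and
  \<open>x \<mapsto> 1\<close> has kernel generated by the conjugates of \<open>a\<close> by \<open>1, x, \<dots>, x\<^sup>k\<^sup>-\<^sup>1\<close>. They are free: let \<open>x\<close> translate the index set
  \<open>\<int>\<close> and give \<open>a\<close> a prescribed cocycle of period \<open>k\<close>.
\<close>

theorem virtually_separated_I2_even:
  assumes p: "1 < p" and k: "2 \<le> k"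
  shows "virtually_separated p (artin_group (coxeter_path 2 (\<lambda>_. enat (2 * k))))"
proof -
  let ?l = "\<lambda>_::nat. enat (2 * k)"
  let ?G = "artin_group (coxeter_path 2 ?l)" and ?g = "artin_generator (coxeter_path 2 ?l)"
  interpret G: group ?G by (rule group_artin)
  define a where "a = ?g 0"
  define x where "x = ?g 0 \<otimes>\<^bsub>?G\<^esub> ?g 1"
  have gc: "?g 0 \<in> carrier ?G" "?g 1 \<in> carrier ?G" using path_gen_closed by auto
  have ac [simp]: "a \<in> carrier ?G" and xc [simp]: "x \<in> carrier ?G" using gc by (auto simp: a_def x_def)
  have g1: "?g 1 = inv\<^bsub>?G\<^esub> a \<otimes>\<^bsub>?G\<^esub> x" using gc by (simp add: a_def x_def G.inv_cancel_left)
  have rel: "(?g 0 \<otimes>\<^bsub>?G\<^esub> ?g 1) [^]\<^bsub>?G\<^esub> k = (?g 1 \<otimes>\<^bsub>?G\<^esub> ?g 0) [^]\<^bsub>?G\<^esub> k"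
    using path_adjacent[of 0 2 ?l "2 * k"] G.alt_prod_pow(1)[OF gc] G.alt_prod_pow(1)[OF gc(2,1)] by simp
  define z where "z = x [^]\<^bsub>?G\<^esub> int k"
  have zc [simp]: "z \<in> carrier ?G" by (simp add: z_def)
  have za: "z \<otimes>\<^bsub>?G\<^esub> a = a \<otimes>\<^bsub>?G\<^esub> z"
    using G.pow_slide[OF gc, of k] rel by (simp add: z_def x_def a_def int_pow_int)
  have zx: "z \<otimes>\<^bsub>?G\<^esub> x = x \<otimes>\<^bsub>?G\<^esub> z" unfolding z_def by (rule G.int_pow_commute) simp_all
  have zq: "z [^]\<^bsub>?G\<^esub> (q::int) \<otimes>\<^bsub>?G\<^esub> g = g \<otimes>\<^bsub>?G\<^esub> z [^]\<^bsub>?G\<^esub> q" if g: "g \<in> carrier ?G" for q g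
  proof (rule G.int_pow_commute[OF zc g], rule G.central_generate[OF _ zc])
    show "?g ` {..<2} \<subseteq> carrier ?G" using path_gen_closed by auto
    show "g \<in> generate ?G (?g ` {..<2})" unfolding path_generate by (rule g)
    fix s assume "s \<in> ?g ` {..<2}"
    then consider "s = ?g 0" | "s = ?g 1" by (auto simp: less_2_cases_iff)
    then show "z \<otimes>\<^bsub>?G\<^esub> s = s \<otimes>\<^bsub>?G\<^esub> z"
    proof cases
      case 2
      have "G.cj z (inv\<^bsub>?G\<^esub> a \<otimes>\<^bsub>?G\<^esub> x) = inv\<^bsub>?G\<^esub> a \<otimes>\<^bsub>?G\<^esub> x"
        using za zx G.cj_eq_iff[OF zc ac ac] G.cj_eq_iff[OF zc xc xc] by (simp add: G.cj_mult G.cj_inv)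
      then show ?thesis unfolding 2 g1 by (simp add: G.cj_eq_iff)
    qed (use za a_def in simp)
  qed
  define A where "A j = G.cj (x [^]\<^bsub>?G\<^esub> (j::int)) a" for j
  have Ac [simp]: "A j \<in> carrier ?G" for j by (simp add: A_def)
  have Ashift: "G.cj (x [^]\<^bsub>?G\<^esub> (i::int)) (A j) = A (i + j)" for i j
    by (simp add: A_def G.int_pow_mult G.cj_comp)
  have Aper: "A (j mod int k) = A j" for j
  proof -
    have "x [^]\<^bsub>?G\<^esub> (j mod int k + int k * (j div int k)) = x [^]\<^bsub>?G\<^esub> (j mod int k) \<otimes>\<^bsub>?G\<^esub> z [^]\<^bsub>?G\<^esub> (j div int k)"
      unfolding z_def G.int_pow_pow[OF xc] by (rule G.int_pow_mult[OF xc])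
    then have "x [^]\<^bsub>?G\<^esub> j = x [^]\<^bsub>?G\<^esub> (j mod int k) \<otimes>\<^bsub>?G\<^esub> z [^]\<^bsub>?G\<^esub> (j div int k)" by simp
    then have "A j = G.cj (x [^]\<^bsub>?G\<^esub> (j mod int k)) (G.cj (z [^]\<^bsub>?G\<^esub> (j div int k)) a)"
      by (simp add: A_def G.cj_comp)
    also have "G.cj (z [^]\<^bsub>?G\<^esub> (j div int k)) a = a" using zq[OF ac] by (simp add: G.cj_eq_iff)
    finally show ?thesis by (simp add: A_def)
  qed
  let ?\<kappa> = "\<lambda>j::nat. A (int j)"
  let ?B = "?\<kappa> ` {..<k}"
  let ?N = "generate ?G ?B"
  have Bc: "?B \<subseteq> carrier ?G" by auto
  note Nc = G.generate_in_carrier[OF Bc]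
  have AB: "A j \<in> ?B" for j
  proof -
    have "A j = ?\<kappa> (nat (j mod int k))" using k by (simp add: Aper)
    moreover have "nat (j mod int k) \<in> {..<k}" using k by (simp add: nat_less_iff)
    ultimately show ?thesis by blast
  qed
  have Nx: "G.cj (x [^]\<^bsub>?G\<^esub> (i::int)) n \<in> ?N" if "n \<in> ?N" for i n
    by (rule G.cj_generate[OF Bc _ _ that]) (auto simp: Ashift intro: generate.incl[OF AB])
  have aN: "a \<in> ?N" "inv\<^bsub>?G\<^esub> a \<in> ?N" using generate.incl[OF AB[of 0]] generate.inv[OF AB[of 0]] by (simp_all add: A_def conj_by_def)
  let ?W = "{n \<otimes>\<^bsub>?G\<^esub> x [^]\<^bsub>?G\<^esub> i | n (i::int). n \<in> ?N}"
  have Wa: "t \<otimes>\<^bsub>?G\<^esub> w \<in> ?W" if t: "t \<in> ?N" and w: "w \<in> ?W" for t w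
  proof -
    obtain n i where ni: "w = n \<otimes>\<^bsub>?G\<^esub> x [^]\<^bsub>?G\<^esub> (i::int)" "n \<in> ?N" using w by blast
    have "t \<otimes>\<^bsub>?G\<^esub> w = (t \<otimes>\<^bsub>?G\<^esub> n) \<otimes>\<^bsub>?G\<^esub> x [^]\<^bsub>?G\<^esub> i" using ni Nc t by (simp add: G.m_assoc)
    then show ?thesis using generate.eng[OF t ni(2)] by blast
  qed
  have Wx: "x [^]\<^bsub>?G\<^esub> (q::int) \<otimes>\<^bsub>?G\<^esub> w \<in> ?W" if w: "w \<in> ?W" for q w
  proof -
    obtain n i where ni: "w = n \<otimes>\<^bsub>?G\<^esub> x [^]\<^bsub>?G\<^esub> (i::int)" "n \<in> ?N" using w by blast
    have "x [^]\<^bsub>?G\<^esub> q \<otimes>\<^bsub>?G\<^esub> w = G.cj (x [^]\<^bsub>?G\<^esub> q) n \<otimes>\<^bsub>?G\<^esub> x [^]\<^bsub>?G\<^esub> (q + i)"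
      using ni Nc by (simp add: conj_by_def G.m_assoc G.int_pow_mult G.inv_cancel_left)
    then show ?thesis using Nx[OF ni(2)] by blast
  qed
  have "carrier ?G \<subseteq> ?W"
    unfolding path_generate[of 2 ?l, symmetric]
  proof (rule G.generate_left_induct)
    show "?g ` {..<2} \<subseteq> carrier ?G" using path_gen_closed by auto
    show "?W \<subseteq> carrier ?G" using Nc by auto
    have "\<one>\<^bsub>?G\<^esub> = \<one>\<^bsub>?G\<^esub> \<otimes>\<^bsub>?G\<^esub> x [^]\<^bsub>?G\<^esub> (0::int)" by simp
    then show "\<one>\<^bsub>?G\<^esub> \<in> ?W" using generate.one by blast
    fix s w assume s: "s \<in> ?g ` {..<2}" and w: "w \<in> ?W"
    have wc: "w \<in> carrier ?G" using w Nc by auto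
    from s have "s = ?g 0 \<or> s = ?g 1" by (auto simp: less_2_cases_iff)
    then have "s = a \<or> s = inv\<^bsub>?G\<^esub> a \<otimes>\<^bsub>?G\<^esub> x" unfolding g1 unfolding a_def .
    then consider "s = a" | "s = inv\<^bsub>?G\<^esub> a \<otimes>\<^bsub>?G\<^esub> x" by blast
    then have "s \<otimes>\<^bsub>?G\<^esub> w \<in> ?W \<and> inv\<^bsub>?G\<^esub> s \<otimes>\<^bsub>?G\<^esub> w \<in> ?W"
    proof cases
      case 1 then show ?thesis using Wa[OF aN(1) w] Wa[OF aN(2) w] by simp
    next
      case 2
      have "s \<otimes>\<^bsub>?G\<^esub> w = inv\<^bsub>?G\<^esub> a \<otimes>\<^bsub>?G\<^esub> (x [^]\<^bsub>?G\<^esub> (1::int) \<otimes>\<^bsub>?G\<^esub> w)"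
        "inv\<^bsub>?G\<^esub> s \<otimes>\<^bsub>?G\<^esub> w = x [^]\<^bsub>?G\<^esub> (-1::int) \<otimes>\<^bsub>?G\<^esub> (a \<otimes>\<^bsub>?G\<^esub> w)"
        using 2 wc by (simp_all add: G.m_assoc G.inv_mult_group G.int_pow_neg)
      then show ?thesis using Wa[OF aN(2) Wx[OF w, of 1]] Wx[OF Wa[OF aN(1) w], of "-1"] by (simp only: simp_thms)
    qed
    then show "s \<otimes>\<^bsub>?G\<^esub> w \<in> ?W" "inv\<^bsub>?G\<^esub> s \<otimes>\<^bsub>?G\<^esub> w \<in> ?W" by blast+
  qed
  then have W: "g \<in> ?W" if "g \<in> carrier ?G" for g using that by blast
  have "\<exists>h\<in>hom ?G integer_group. \<forall>i<2. h (?g i) = int i"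
  proof (rule group.path_hom[OF group_integer_group], goal_cases)
    case (2 i n)
    have "alt_prod integer_group (2 * j) 0 1 = int j \<and> alt_prod integer_group (2 * j) 1 0 = int j" for j by (induction j) auto
    then show ?case using 2 by auto
  qed auto
  then obtain h where h: "h \<in> hom ?G integer_group" "\<forall>i<2. h (?g i) = int i" by (elim bexE)
  interpret h: group_hom ?G integer_group h by (intro group_hom.intro group_hom_axioms.intro G.is_group group_integer_group h(1))
  have hx: "h (x [^]\<^bsub>?G\<^esub> (i::int)) = i" for i
    using h.hom_int_pow[OF xc, of i] h(2) gc by (simp add: x_def)
  have hA: "h (A j) = 0" for j
    unfolding A_def hom_conj_by[OF G.is_group group_integer_group h(1) G.int_pow_closed[OF xc] ac]
    using h(2) by (simp add: conj_by_def a_def)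
  have hN: "h n = 0" if "n \<in> ?N" for n
    using that
  proof (induction rule: generate.induct)
    case one then show ?case using h.hom_one by simp
  next
    case (incl n)
    then obtain j where "n = A j" by blast
    then show ?case using hA Ac by simp
  next
    case (inv n)
    then obtain j where "n = A j" by blast
    then show ?case using hA Ac by simp
  next
    case (eng m n) then show ?case using Nc by simp
  qed
  have hW: "h (n \<otimes>\<^bsub>?G\<^esub> x [^]\<^bsub>?G\<^esub> i) = i" if "n \<in> ?N" for n and i :: int using that Nc hN hx by simp
  have ker: "h g = 0 \<longleftrightarrow> g \<in> ?N" if g: "g \<in> carrier ?G" for g
  proof
    assume "h g = 0"
    moreover obtain n i where ni: "g = n \<otimes>\<^bsub>?G\<^esub> x [^]\<^bsub>?G\<^esub> (i::int)" "n \<in> ?N" using W[OF g] by blast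
    ultimately have "i = 0" using hW by simp
    then show "g \<in> ?N" using ni Nc by simp
  qed (rule hN)
  have fam: "\<exists>h \<in> hom ?G (wreath perms). \<exists>i :: int. \<forall>j\<in>{..<k}. fst (h (?\<kappa> j)) i = i \<and> snd (h (?\<kappa> j)) i = y j"
    if y: "\<And>j. bij (y j)" for y :: "nat \<Rightarrow> nat \<Rightarrow> nat"
  proof -
    let ?W = "wreath perms :: ((int \<Rightarrow> int) \<times> (int \<Rightarrow> nat \<Rightarrow> nat)) monoid"
    interpret W: group ?W by (rule group_wreath[OF group_perms])
    let ?s = "\<lambda>i::int. i - 1"
    define Y where "Y j = (id :: int \<Rightarrow> int, \<lambda>i::int. y (nat ((i + j) mod int k)))" for j :: int
    define X where "X = (?s, \<lambda>_::int. id :: nat \<Rightarrow> nat)"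
    have bs: "bij ?s" by (rule o_bij[of "\<lambda>j. j + 1"]) auto
    have Yc: "Y j \<in> carrier ?W" for j using y by (simp add: Y_def wreath_carrier)
    have Xc: "X \<in> carrier ?W" using bs by (simp add: X_def wreath_carrier)
    have Xpow: "X [^]\<^bsub>?W\<^esub> n = (\<lambda>i. i - int n, \<lambda>_. id)" for n :: nat
      unfolding X_def wreath_shift_pow[OF bs] by (simp add: funpow_minus fun_eq_iff)
    have XY: "X [^]\<^bsub>?W\<^esub> n \<otimes>\<^bsub>?W\<^esub> Y 0 = Y (int n) \<otimes>\<^bsub>?W\<^esub> X [^]\<^bsub>?W\<^esub> n" for n :: nat
      unfolding Xpow by (rule wreath_eqI) (simp_all add: Y_def wreath_mult)
    have Yk: "Y (int k) = Y 0" by (simp add: Y_def)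
    define b where "b = inv\<^bsub>?W\<^esub> (Y 0) \<otimes>\<^bsub>?W\<^esub> X"
    have bc: "b \<in> carrier ?W" using Yc Xc by (simp add: b_def)
    have ab: "Y 0 \<otimes>\<^bsub>?W\<^esub> b = X" using Yc Xc by (simp add: b_def W.inv_cancel_left)
    have "Y 0 \<otimes>\<^bsub>?W\<^esub> (b \<otimes>\<^bsub>?W\<^esub> Y 0) [^]\<^bsub>?W\<^esub> k = Y 0 \<otimes>\<^bsub>?W\<^esub> X [^]\<^bsub>?W\<^esub> k"
      using W.pow_slide[OF Yc[of 0] bc, of k] XY[of k] unfolding ab Yk by simp
    then have "(b \<otimes>\<^bsub>?W\<^esub> Y 0) [^]\<^bsub>?W\<^esub> k = X [^]\<^bsub>?W\<^esub> k"
      by (rule W.left_cancel_eq[OF Yc[of 0], rotated 2]) (use bc Yc Xc in simp_all)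
    then have "alt_prod ?W (2 * k) (Y 0) b = alt_prod ?W (2 * k) b (Y 0)"
      unfolding W.alt_prod_pow(1)[OF Yc bc] W.alt_prod_pow(1)[OF bc Yc] ab by (rule HOL.sym)
    moreover have "(if i = 0 then Y 0 else b) \<in> carrier ?W" for i :: nat using Yc bc by simp
    ultimately have "\<exists>h\<in>hom ?G ?W. \<forall>i<2. h (?g i) = (if i = 0 then Y 0 else b)"
      by (intro W.path_hom) (auto simp: less_2_cases_iff)
    then obtain H where H: "H \<in> hom ?G ?W" "\<forall>i<2. H (?g i) = (if i = 0 then Y 0 else b)" by (elim bexE)
    interpret H: group_hom ?G ?W H by (intro group_hom.intro group_hom_axioms.intro G.is_group W.is_group H(1))
    have Ha: "H a = Y 0" using H(2) by (simp add: a_def)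
    have Hx: "H x = X" using H(2) gc ab by (simp add: x_def)
    have H\<kappa>: "H (?\<kappa> j) = Y (int j)" for j
    proof -
      have "H (x [^]\<^bsub>?G\<^esub> int j) = X [^]\<^bsub>?W\<^esub> j" using H.hom_nat_pow[OF xc, of j] Hx by (simp add: int_pow_int)
      then have "H (?\<kappa> j) = W.cj (X [^]\<^bsub>?W\<^esub> j) (Y 0)"
        using hom_conj_by[OF G.is_group W.is_group H(1), of "x [^]\<^bsub>?G\<^esub> int j" a] Ha by (simp add: A_def)
      also have "\<dots> = Y (int j)" using W.cj_eq_iff[OF W.nat_pow_closed[OF Xc] Yc Yc] XY by blast
      finally show ?thesis .
    qed
    show ?thesis
      by (rule bexI[OF _ H(1)], rule exI[of _ 0]) (simp add: H\<kappa>, simp add: Y_def)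
  qed
  have \<kappa>c: "?\<kappa> \<in> {..<k} \<rightarrow> carrier ?G" by simp
  note fb = free_basis_family[OF G.is_group \<kappa>c fam]
  have B: "?\<kappa> 0 \<in> ?B" "?\<kappa> 1 \<in> ?B" by (rule AB)+
  have ne: "?\<kappa> 0 \<noteq> ?\<kappa> 1" using inj_onD[OF fb(2), of 0 1] k by auto
  have sp: "\<exists>n\<in>?N. \<exists>c\<in>carrier ?G. (\<forall>x\<in>carrier ?G. c \<otimes>\<^bsub>?G\<^esub> x = x \<otimes>\<^bsub>?G\<^esub> c) \<and> g = n \<otimes>\<^bsub>?G\<^esub> c"
    if g: "g \<in> carrier ?G" "int k dvd h g" for g
  proof -
    obtain n i where ni: "g = n \<otimes>\<^bsub>?G\<^esub> x [^]\<^bsub>?G\<^esub> (i::int)" "n \<in> ?N" using W[OF g(1)] by blast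
    then obtain q where "i = int k * q" using g(2) hW by auto
    then have "x [^]\<^bsub>?G\<^esub> i = z [^]\<^bsub>?G\<^esub> q" by (simp add: z_def G.int_pow_pow)
    then show ?thesis using ni zq by (intro bexI[OF _ ni(2)] bexI[of _ "z [^]\<^bsub>?G\<^esub> q"]) auto
  qed
  have "0 < int k" using k by simp
  from virtually_separated_center_times_free[OF p G.is_group h(1) fb(1) B ne ker this sp] show ?thesis .
qed

text \<open>
  With \<open>m = 2 k + 1\<close>, \<open>y = a b\<close> and \<open>x = y\<^sup>k a\<close> this is the group of the torus knot, \<open>x\<^sup>2 = y\<^sup>m\<close>, and \<open>z = y\<^sup>m\<close> is central. The
  character with value \<open>1\<close> on both generators has kernel generated by the commutators \<open>\<kappa>\<^sub>j\<close> of \<open>x\<close> and \<open>y\<^sup>j\<close> for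
  \<open>1 \<le> j < m\<close>; indeed, every element is \<open>y\<^sup>j n\<close> or \<open>y\<^sup>j x n\<close> with \<open>n\<close> in their span. They are free: two copies of the
  index set \<open>\<int>\<close> are translated by \<open>y\<close> and exchanged by \<open>x\<close>, and \<open>x\<close> has a prescribed cocycle of period \<open>m\<close> on one copy and
  its inverse on the other.
\<close>

theorem virtually_separated_I2_odd:
  assumes p: "1 < p" and k: "1 \<le> k"
  shows "virtually_separated p (artin_group (coxeter_path 2 (\<lambda>_. enat (Suc (2 * k)))))"
proof -
  let ?l = "\<lambda>_::nat. enat (Suc (2 * k))" and ?m = "Suc (2 * k)"
  let ?G = "artin_group (coxeter_path 2 ?l)" and ?g = "artin_generator (coxeter_path 2 ?l)"
  interpret G: group ?G by (rule group_artin)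
  define a where "a = ?g 0"
  define y where "y = ?g 0 \<otimes>\<^bsub>?G\<^esub> ?g 1"
  define x where "x = y [^]\<^bsub>?G\<^esub> int k \<otimes>\<^bsub>?G\<^esub> a"
  have gc: "?g 0 \<in> carrier ?G" "?g 1 \<in> carrier ?G" using path_gen_closed by auto
  have ac [simp]: "a \<in> carrier ?G" and yc [simp]: "y \<in> carrier ?G" using gc by (auto simp: a_def y_def)
  have xc [simp]: "x \<in> carrier ?G" by (simp add: x_def)
  have g1: "?g 1 = inv\<^bsub>?G\<^esub> a \<otimes>\<^bsub>?G\<^esub> y" using gc by (simp add: a_def y_def G.inv_cancel_left)
  have a_eq: "a = y [^]\<^bsub>?G\<^esub> (- int k) \<otimes>\<^bsub>?G\<^esub> x" by (simp add: x_def G.int_pow_neg G.inv_cancel_left)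
  have rel: "x = (?g 1 \<otimes>\<^bsub>?G\<^esub> ?g 0) [^]\<^bsub>?G\<^esub> k \<otimes>\<^bsub>?G\<^esub> ?g 1"
    using path_adjacent[of 0 2 ?l ?m] G.alt_prod_pow(2)[OF gc] G.alt_prod_pow(2)[OF gc(2,1)]
    by (simp add: x_def y_def a_def int_pow_int)
  define z where "z = y [^]\<^bsub>?G\<^esub> int ?m"
  have zc [simp]: "z \<in> carrier ?G" by (simp add: z_def)
  have xx: "x \<otimes>\<^bsub>?G\<^esub> x = z"
  proof -
    have c: "?g 1 \<otimes>\<^bsub>?G\<^esub> ?g 0 \<in> carrier ?G" using gc by simp
    have "x \<otimes>\<^bsub>?G\<^esub> x = (y [^]\<^bsub>?G\<^esub> k \<otimes>\<^bsub>?G\<^esub> a) \<otimes>\<^bsub>?G\<^esub> ((?g 1 \<otimes>\<^bsub>?G\<^esub> ?g 0) [^]\<^bsub>?G\<^esub> k \<otimes>\<^bsub>?G\<^esub> ?g 1)"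
      using rel by (simp add: x_def int_pow_int)
    also have "\<dots> = y [^]\<^bsub>?G\<^esub> k \<otimes>\<^bsub>?G\<^esub> (a \<otimes>\<^bsub>?G\<^esub> (?g 1 \<otimes>\<^bsub>?G\<^esub> ?g 0) [^]\<^bsub>?G\<^esub> k) \<otimes>\<^bsub>?G\<^esub> ?g 1"
      using c gc by (simp add: G.m_assoc)
    also have "a \<otimes>\<^bsub>?G\<^esub> (?g 1 \<otimes>\<^bsub>?G\<^esub> ?g 0) [^]\<^bsub>?G\<^esub> k = y [^]\<^bsub>?G\<^esub> k \<otimes>\<^bsub>?G\<^esub> a"
      unfolding a_def y_def by (rule G.pow_slide[OF gc])
    also have "y [^]\<^bsub>?G\<^esub> k \<otimes>\<^bsub>?G\<^esub> (y [^]\<^bsub>?G\<^esub> k \<otimes>\<^bsub>?G\<^esub> a) \<otimes>\<^bsub>?G\<^esub> ?g 1 = (y [^]\<^bsub>?G\<^esub> k \<otimes>\<^bsub>?G\<^esub> y [^]\<^bsub>?G\<^esub> k) \<otimes>\<^bsub>?G\<^esub> y"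
      using gc by (simp add: a_def y_def G.m_assoc)
    also have "\<dots> = y [^]\<^bsub>?G\<^esub> ?m" by (simp only: nat_pow_Suc G.nat_pow_mult[OF yc] mult_2[symmetric])
    finally show ?thesis unfolding z_def int_pow_int .
  qed
  have zx: "z \<otimes>\<^bsub>?G\<^esub> x = x \<otimes>\<^bsub>?G\<^esub> z" unfolding xx[symmetric] by (simp add: G.m_assoc)
  have zy: "z \<otimes>\<^bsub>?G\<^esub> y = y \<otimes>\<^bsub>?G\<^esub> z" unfolding z_def by (rule G.int_pow_commute) simp_all
  have zyi: "z \<otimes>\<^bsub>?G\<^esub> y [^]\<^bsub>?G\<^esub> (i::int) = y [^]\<^bsub>?G\<^esub> i \<otimes>\<^bsub>?G\<^esub> z" for i
    by (rule G.int_pow_commute[OF yc zc zy[symmetric], symmetric])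
  have za: "z \<otimes>\<^bsub>?G\<^esub> a = a \<otimes>\<^bsub>?G\<^esub> z"
    unfolding a_eq using zx zyi[of "- int k"] by (metis G.m_assoc G.int_pow_closed xc yc zc)
  have zq: "z [^]\<^bsub>?G\<^esub> (q::int) \<otimes>\<^bsub>?G\<^esub> g = g \<otimes>\<^bsub>?G\<^esub> z [^]\<^bsub>?G\<^esub> q" if g: "g \<in> carrier ?G" for q g
  proof (rule G.int_pow_commute[OF zc g], rule G.central_generate[OF _ zc])
    show "?g ` {..<2} \<subseteq> carrier ?G" using path_gen_closed by auto
    show "g \<in> generate ?G (?g ` {..<2})" unfolding path_generate by (rule g)
    fix s assume "s \<in> ?g ` {..<2}"
    then consider "s = ?g 0" | "s = ?g 1" by (auto simp: less_2_cases_iff)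
    then show "z \<otimes>\<^bsub>?G\<^esub> s = s \<otimes>\<^bsub>?G\<^esub> z"
    proof cases
      case 2
      have "G.cj z (inv\<^bsub>?G\<^esub> a \<otimes>\<^bsub>?G\<^esub> y) = inv\<^bsub>?G\<^esub> a \<otimes>\<^bsub>?G\<^esub> y"
        using za zy G.cj_eq_iff[OF zc ac ac] G.cj_eq_iff[OF zc yc yc] by (simp add: G.cj_mult G.cj_inv)
      then show ?thesis unfolding 2 g1 by (simp add: G.cj_eq_iff)
    qed (use za a_def in simp)
  qed
  define \<kappa> where "\<kappa> j = inv\<^bsub>?G\<^esub> x \<otimes>\<^bsub>?G\<^esub> (inv\<^bsub>?G\<^esub> (y [^]\<^bsub>?G\<^esub> j) \<otimes>\<^bsub>?G\<^esub> (x \<otimes>\<^bsub>?G\<^esub> y [^]\<^bsub>?G\<^esub> j))" for j :: int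
  have \<kappa>c [simp]: "\<kappa> j \<in> carrier ?G" for j by (simp add: \<kappa>_def)
  have K: "y [^]\<^bsub>?G\<^esub> j \<otimes>\<^bsub>?G\<^esub> (x \<otimes>\<^bsub>?G\<^esub> \<kappa> j) = x \<otimes>\<^bsub>?G\<^esub> y [^]\<^bsub>?G\<^esub> j" for j by (simp add: \<kappa>_def G.inv_cancel_left)
  have \<kappa>0: "\<kappa> 0 = \<one>\<^bsub>?G\<^esub>" by (simp add: \<kappa>_def)
  have Kper: "\<kappa> (j mod int ?m) = \<kappa> j" for j
  proof -
    let ?r = "j mod int ?m" and ?c = "z [^]\<^bsub>?G\<^esub> (j div int ?m)"
    have "y [^]\<^bsub>?G\<^esub> (?r + int ?m * (j div int ?m)) = y [^]\<^bsub>?G\<^esub> ?r \<otimes>\<^bsub>?G\<^esub> ?c"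
      unfolding z_def G.int_pow_pow[OF yc] by (rule G.int_pow_mult[OF yc])
    then have e: "y [^]\<^bsub>?G\<^esub> j = y [^]\<^bsub>?G\<^esub> ?r \<otimes>\<^bsub>?G\<^esub> ?c" by simp
    have "y [^]\<^bsub>?G\<^esub> j \<otimes>\<^bsub>?G\<^esub> (x \<otimes>\<^bsub>?G\<^esub> \<kappa> ?r) = (y [^]\<^bsub>?G\<^esub> ?r \<otimes>\<^bsub>?G\<^esub> (?c \<otimes>\<^bsub>?G\<^esub> x)) \<otimes>\<^bsub>?G\<^esub> \<kappa> ?r" unfolding e by (simp add: G.m_assoc)
    also have "?c \<otimes>\<^bsub>?G\<^esub> x = x \<otimes>\<^bsub>?G\<^esub> ?c" by (rule zq) simp
    also have "(y [^]\<^bsub>?G\<^esub> ?r \<otimes>\<^bsub>?G\<^esub> (x \<otimes>\<^bsub>?G\<^esub> ?c)) \<otimes>\<^bsub>?G\<^esub> \<kappa> ?r = y [^]\<^bsub>?G\<^esub> ?r \<otimes>\<^bsub>?G\<^esub> (x \<otimes>\<^bsub>?G\<^esub> (?c \<otimes>\<^bsub>?G\<^esub> \<kappa> ?r))" by (simp add: G.m_assoc)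
    also have "?c \<otimes>\<^bsub>?G\<^esub> \<kappa> ?r = \<kappa> ?r \<otimes>\<^bsub>?G\<^esub> ?c" by (rule zq) simp
    also have "y [^]\<^bsub>?G\<^esub> ?r \<otimes>\<^bsub>?G\<^esub> (x \<otimes>\<^bsub>?G\<^esub> (\<kappa> ?r \<otimes>\<^bsub>?G\<^esub> ?c)) = (y [^]\<^bsub>?G\<^esub> ?r \<otimes>\<^bsub>?G\<^esub> (x \<otimes>\<^bsub>?G\<^esub> \<kappa> ?r)) \<otimes>\<^bsub>?G\<^esub> ?c" by (simp add: G.m_assoc)
    also have "\<dots> = x \<otimes>\<^bsub>?G\<^esub> y [^]\<^bsub>?G\<^esub> j" unfolding K e by (simp add: G.m_assoc)
    also have "\<dots> = y [^]\<^bsub>?G\<^esub> j \<otimes>\<^bsub>?G\<^esub> (x \<otimes>\<^bsub>?G\<^esub> \<kappa> j)" by (rule K[symmetric])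
    finally have eq: "y [^]\<^bsub>?G\<^esub> j \<otimes>\<^bsub>?G\<^esub> (x \<otimes>\<^bsub>?G\<^esub> \<kappa> ?r) = y [^]\<^bsub>?G\<^esub> j \<otimes>\<^bsub>?G\<^esub> (x \<otimes>\<^bsub>?G\<^esub> \<kappa> j)" .
    have "x \<otimes>\<^bsub>?G\<^esub> \<kappa> ?r = x \<otimes>\<^bsub>?G\<^esub> \<kappa> j" by (rule G.left_cancel_eq[OF _ _ _ eq]) simp_all
    then show ?thesis by (rule G.left_cancel_eq[rotated 3]) simp_all
  qed
  let ?J = "{1..<?m}"
  let ?\<kappa> = "\<lambda>j::nat. \<kappa> (int j)"
  let ?B = "?\<kappa> ` ?J"
  let ?N = "generate ?G ?B"
  have Bc: "?B \<subseteq> carrier ?G" by auto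
  note Nc = G.generate_in_carrier[OF Bc]
  have KN: "\<kappa> j \<in> ?N" for j
  proof -
    define i where "i = nat (j mod int ?m)"
    have i: "\<kappa> j = ?\<kappa> i" "i < ?m" by (simp_all add: i_def Kper nat_less_iff del: of_nat_Suc)
    show ?thesis
    proof (cases "i = 0")
      case True then show ?thesis using i(1) \<kappa>0 generate.one by simp
    next
      case False
      then have "i \<in> ?J" using i(2) by simp
      then show ?thesis unfolding i(1) by (intro generate.incl) blast
    qed
  qed
  have KiN: "inv\<^bsub>?G\<^esub> \<kappa> j \<in> ?N" for j by (rule G.generate_m_inv_closed[OF Bc KN])
  let ?W = "{g. \<exists>n\<in>?N. \<exists>j::int. g = y [^]\<^bsub>?G\<^esub> j \<otimes>\<^bsub>?G\<^esub> n \<or> g = y [^]\<^bsub>?G\<^esub> j \<otimes>\<^bsub>?G\<^esub> (x \<otimes>\<^bsub>?G\<^esub> n)}"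
  have W1: "y [^]\<^bsub>?G\<^esub> j \<otimes>\<^bsub>?G\<^esub> n \<in> ?W" if "n \<in> ?N" for j :: int and n using that by blast
  have W2: "y [^]\<^bsub>?G\<^esub> j \<otimes>\<^bsub>?G\<^esub> (x \<otimes>\<^bsub>?G\<^esub> n) \<in> ?W" if "n \<in> ?N" for j :: int and n using that by blast
  have Wy: "y [^]\<^bsub>?G\<^esub> (i::int) \<otimes>\<^bsub>?G\<^esub> w \<in> ?W" if w: "w \<in> ?W" for i w
  proof -
    obtain n j where n: "n \<in> ?N" and w: "w = y [^]\<^bsub>?G\<^esub> (j::int) \<otimes>\<^bsub>?G\<^esub> n \<or> w = y [^]\<^bsub>?G\<^esub> j \<otimes>\<^bsub>?G\<^esub> (x \<otimes>\<^bsub>?G\<^esub> n)" using w by blast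
    have nc: "n \<in> carrier ?G" by (rule Nc[OF n])
    from w have "y [^]\<^bsub>?G\<^esub> i \<otimes>\<^bsub>?G\<^esub> w = y [^]\<^bsub>?G\<^esub> (i + j) \<otimes>\<^bsub>?G\<^esub> n \<or> y [^]\<^bsub>?G\<^esub> i \<otimes>\<^bsub>?G\<^esub> w = y [^]\<^bsub>?G\<^esub> (i + j) \<otimes>\<^bsub>?G\<^esub> (x \<otimes>\<^bsub>?G\<^esub> n)"
    proof
      assume "w = y [^]\<^bsub>?G\<^esub> j \<otimes>\<^bsub>?G\<^esub> n"
      then have "y [^]\<^bsub>?G\<^esub> i \<otimes>\<^bsub>?G\<^esub> w = y [^]\<^bsub>?G\<^esub> (i + j) \<otimes>\<^bsub>?G\<^esub> n" using nc by (simp add: G.m_assoc G.int_pow_mult)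
      then show ?thesis ..
    next
      assume "w = y [^]\<^bsub>?G\<^esub> j \<otimes>\<^bsub>?G\<^esub> (x \<otimes>\<^bsub>?G\<^esub> n)"
      then have "y [^]\<^bsub>?G\<^esub> i \<otimes>\<^bsub>?G\<^esub> w = y [^]\<^bsub>?G\<^esub> (i + j) \<otimes>\<^bsub>?G\<^esub> (x \<otimes>\<^bsub>?G\<^esub> n)" using nc by (simp add: G.m_assoc G.int_pow_mult)
      then show ?thesis ..
    qed
    then show ?thesis using n by blast
  qed
  have Wx: "x \<otimes>\<^bsub>?G\<^esub> w \<in> ?W" if w: "w \<in> ?W" for w
  proof -
    obtain n j where n: "n \<in> ?N" and w: "w = y [^]\<^bsub>?G\<^esub> (j::int) \<otimes>\<^bsub>?G\<^esub> n \<or> w = y [^]\<^bsub>?G\<^esub> j \<otimes>\<^bsub>?G\<^esub> (x \<otimes>\<^bsub>?G\<^esub> n)" using w by blast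
    have nc: "n \<in> carrier ?G" by (rule Nc[OF n])
    from w show ?thesis
    proof
      assume e: "w = y [^]\<^bsub>?G\<^esub> j \<otimes>\<^bsub>?G\<^esub> n"
      have "x \<otimes>\<^bsub>?G\<^esub> w = (x \<otimes>\<^bsub>?G\<^esub> y [^]\<^bsub>?G\<^esub> j) \<otimes>\<^bsub>?G\<^esub> n" unfolding e using nc by (simp add: G.m_assoc)
      also have "\<dots> = y [^]\<^bsub>?G\<^esub> j \<otimes>\<^bsub>?G\<^esub> (x \<otimes>\<^bsub>?G\<^esub> (\<kappa> j \<otimes>\<^bsub>?G\<^esub> n))" unfolding K[symmetric] using nc by (simp add: G.m_assoc)
      finally show ?thesis using W2[OF generate.eng[OF KN n]] by (simp only:)
    next
      assume e: "w = y [^]\<^bsub>?G\<^esub> j \<otimes>\<^bsub>?G\<^esub> (x \<otimes>\<^bsub>?G\<^esub> n)"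
      have "x \<otimes>\<^bsub>?G\<^esub> w = (x \<otimes>\<^bsub>?G\<^esub> y [^]\<^bsub>?G\<^esub> j) \<otimes>\<^bsub>?G\<^esub> (x \<otimes>\<^bsub>?G\<^esub> n)" unfolding e using nc by (simp add: G.m_assoc)
      also have "\<dots> = (x \<otimes>\<^bsub>?G\<^esub> x) \<otimes>\<^bsub>?G\<^esub> (inv\<^bsub>?G\<^esub> x \<otimes>\<^bsub>?G\<^esub> (y [^]\<^bsub>?G\<^esub> j \<otimes>\<^bsub>?G\<^esub> (x \<otimes>\<^bsub>?G\<^esub> n)))"
        using nc by (simp add: G.m_assoc G.inv_cancel_left)
      also have "inv\<^bsub>?G\<^esub> x \<otimes>\<^bsub>?G\<^esub> (y [^]\<^bsub>?G\<^esub> j \<otimes>\<^bsub>?G\<^esub> (x \<otimes>\<^bsub>?G\<^esub> n)) = y [^]\<^bsub>?G\<^esub> j \<otimes>\<^bsub>?G\<^esub> (inv\<^bsub>?G\<^esub> \<kappa> j \<otimes>\<^bsub>?G\<^esub> n)"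
        using nc by (simp add: \<kappa>_def G.inv_mult_group G.m_assoc G.inv_cancel_left)
      also have "(x \<otimes>\<^bsub>?G\<^esub> x) \<otimes>\<^bsub>?G\<^esub> (y [^]\<^bsub>?G\<^esub> j \<otimes>\<^bsub>?G\<^esub> (inv\<^bsub>?G\<^esub> \<kappa> j \<otimes>\<^bsub>?G\<^esub> n)) = y [^]\<^bsub>?G\<^esub> (int ?m + j) \<otimes>\<^bsub>?G\<^esub> (inv\<^bsub>?G\<^esub> \<kappa> j \<otimes>\<^bsub>?G\<^esub> n)"
        unfolding xx z_def G.int_pow_mult[OF yc] using nc by (simp add: G.m_assoc del: of_nat_Suc)
      finally show ?thesis using W1[OF generate.eng[OF KiN n]] by (simp only:)
    qed
  qed
  have WW: "w \<in> carrier ?G" if "w \<in> ?W" for w using that Nc by auto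
  have Wxi: "inv\<^bsub>?G\<^esub> x \<otimes>\<^bsub>?G\<^esub> w \<in> ?W" if w: "w \<in> ?W" for w
  proof -
    have "x \<otimes>\<^bsub>?G\<^esub> (y [^]\<^bsub>?G\<^esub> (- int ?m) \<otimes>\<^bsub>?G\<^esub> w) = x \<otimes>\<^bsub>?G\<^esub> (inv\<^bsub>?G\<^esub> z \<otimes>\<^bsub>?G\<^esub> w)" by (simp only: z_def G.int_pow_neg[OF yc])
    also have "\<dots> = inv\<^bsub>?G\<^esub> x \<otimes>\<^bsub>?G\<^esub> w" unfolding xx[symmetric] using WW[OF w] by (simp add: G.inv_mult_group G.m_assoc G.inv_cancel_left)
    finally show ?thesis using Wx[OF Wy[OF w, of "- int ?m"]] by (simp only:)
  qed
  have Wa: "a \<otimes>\<^bsub>?G\<^esub> w \<in> ?W" if w: "w \<in> ?W" for w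
  proof -
    have "a \<otimes>\<^bsub>?G\<^esub> w = y [^]\<^bsub>?G\<^esub> (- int k) \<otimes>\<^bsub>?G\<^esub> (x \<otimes>\<^bsub>?G\<^esub> w)" using WW[OF w] by (subst a_eq) (simp add: G.m_assoc)
    then show ?thesis using Wy[OF Wx[OF w], of "- int k"] by (simp only:)
  qed
  have Wai: "inv\<^bsub>?G\<^esub> a \<otimes>\<^bsub>?G\<^esub> w \<in> ?W" if w: "w \<in> ?W" for w
  proof -
    have "inv\<^bsub>?G\<^esub> a \<otimes>\<^bsub>?G\<^esub> w = inv\<^bsub>?G\<^esub> x \<otimes>\<^bsub>?G\<^esub> (y [^]\<^bsub>?G\<^esub> int k \<otimes>\<^bsub>?G\<^esub> w)" using WW[OF w]
      by (subst a_eq) (simp add: G.m_assoc G.inv_mult_group G.int_pow_neg)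
    then show ?thesis using Wxi[OF Wy[OF w], of "int k"] by (simp only:)
  qed
  have "carrier ?G \<subseteq> ?W"
    unfolding path_generate[of 2 ?l, symmetric]
  proof (rule G.generate_left_induct)
    show "?g ` {..<2} \<subseteq> carrier ?G" using path_gen_closed by auto
    show "?W \<subseteq> carrier ?G" using WW by blast
    show "\<one>\<^bsub>?G\<^esub> \<in> ?W" using W1[OF generate.one, of 0] by simp
    fix s w assume s: "s \<in> ?g ` {..<2}" and w: "w \<in> ?W"
    from s have "s = ?g 0 \<or> s = ?g 1" by (auto simp: less_2_cases_iff)
    then have "s = a \<or> s = inv\<^bsub>?G\<^esub> a \<otimes>\<^bsub>?G\<^esub> y" unfolding g1 unfolding a_def .
    then have "s \<otimes>\<^bsub>?G\<^esub> w \<in> ?W \<and> inv\<^bsub>?G\<^esub> s \<otimes>\<^bsub>?G\<^esub> w \<in> ?W"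
    proof
      assume "s = a" then show ?thesis using Wa[OF w] Wai[OF w] by (simp only: simp_thms)
    next
      assume s: "s = inv\<^bsub>?G\<^esub> a \<otimes>\<^bsub>?G\<^esub> y"
      have "s \<otimes>\<^bsub>?G\<^esub> w = inv\<^bsub>?G\<^esub> a \<otimes>\<^bsub>?G\<^esub> (y [^]\<^bsub>?G\<^esub> (1::int) \<otimes>\<^bsub>?G\<^esub> w)"
        "inv\<^bsub>?G\<^esub> s \<otimes>\<^bsub>?G\<^esub> w = y [^]\<^bsub>?G\<^esub> (-1::int) \<otimes>\<^bsub>?G\<^esub> (a \<otimes>\<^bsub>?G\<^esub> w)"
        using s WW[OF w] by (simp_all add: G.m_assoc G.inv_mult_group G.int_pow_neg)
      then show ?thesis using Wai[OF Wy[OF w], of 1] Wy[OF Wa[OF w], of "-1"] by (simp only: simp_thms)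
    qed
    then show "s \<otimes>\<^bsub>?G\<^esub> w \<in> ?W" "inv\<^bsub>?G\<^esub> s \<otimes>\<^bsub>?G\<^esub> w \<in> ?W" by blast+
  qed
  then have W: "g \<in> ?W" if "g \<in> carrier ?G" for g using that by blast
  have "\<exists>h\<in>hom ?G integer_group. \<forall>i<2. h (?g i) = 1"
    by (rule group.path_hom[OF group_integer_group]) auto
  then obtain h where h: "h \<in> hom ?G integer_group" "\<forall>i<2. h (?g i) = 1" by (elim bexE)
  interpret h: group_hom ?G integer_group h by (intro group_hom.intro group_hom_axioms.intro G.is_group group_integer_group h(1))
  have hi: "h (inv\<^bsub>?G\<^esub> u) = - h u" if "u \<in> carrier ?G" for u
    using that by simp
  have hy: "h (y [^]\<^bsub>?G\<^esub> (i::int)) = 2 * i" for i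
    using h.hom_int_pow[OF yc, of i] h(2) gc by (simp add: y_def)
  have hx: "h x = int ?m" using h(2) by (simp add: x_def hy a_def[symmetric]) (simp add: a_def)
  have hN: "h n = 0" if "n \<in> ?N" for n
    using that
  proof (induction rule: generate.induct)
    case one then show ?case using h.hom_one by simp
  next
    case (incl n)
    then obtain j where "n = \<kappa> j" by blast
    then show ?case by (simp add: \<kappa>_def hi)
  next
    case (inv n)
    then obtain j where "n = \<kappa> j" by blast
    then show ?case by (simp add: \<kappa>_def hi)
  next
    case (eng m n) then show ?case using Nc by simp
  qed
  have hW: "h (y [^]\<^bsub>?G\<^esub> j \<otimes>\<^bsub>?G\<^esub> n) = 2 * j" "h (y [^]\<^bsub>?G\<^esub> j \<otimes>\<^bsub>?G\<^esub> (x \<otimes>\<^bsub>?G\<^esub> n)) = 2 * (j + int k) + 1"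
    if "n \<in> ?N" for n and j :: int
    using that Nc hN hx hy by simp_all
  have ker: "h g = 0 \<longleftrightarrow> g \<in> ?N" if g: "g \<in> carrier ?G" for g
  proof
    assume 0: "h g = 0"
    obtain n j where n: "n \<in> ?N" and "g = y [^]\<^bsub>?G\<^esub> (j::int) \<otimes>\<^bsub>?G\<^esub> n \<or> g = y [^]\<^bsub>?G\<^esub> j \<otimes>\<^bsub>?G\<^esub> (x \<otimes>\<^bsub>?G\<^esub> n)" using W[OF g] by blast
    from this(2) show "g \<in> ?N"
    proof
      assume e: "g = y [^]\<^bsub>?G\<^esub> j \<otimes>\<^bsub>?G\<^esub> n"
      then have "j = 0" using 0 hW(1)[OF n] by simp
      then show ?thesis using e n Nc[OF n] by simp
    next
      assume e: "g = y [^]\<^bsub>?G\<^esub> j \<otimes>\<^bsub>?G\<^esub> (x \<otimes>\<^bsub>?G\<^esub> n)"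
      then have "2 * (j + int k) + 1 = 0" using 0 hW(2)[OF n, of j] by (simp only:)
      then have False by presburger
      then show ?thesis ..
    qed
  qed (rule hN)
  have fam: "\<exists>h \<in> hom ?G (wreath perms). \<exists>i :: bool \<times> int. \<forall>j\<in>?J. fst (h (?\<kappa> j)) i = i \<and> snd (h (?\<kappa> j)) i = v j"
    if v: "\<And>j. bij (v j)" for v :: "nat \<Rightarrow> nat \<Rightarrow> nat"
  proof -
    let ?W = "wreath perms :: ((bool \<times> int \<Rightarrow> bool \<times> int) \<times> (bool \<times> int \<Rightarrow> nat \<Rightarrow> nat)) monoid"
    interpret W: group ?W by (rule group_wreath[OF group_perms])
    \<comment> \<open>The cocycle is trivial at multiples of \<open>m\<close>, in accordance with \<open>\<kappa>\<^sub>0 = \<one>\<close>.\<close>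
    define F where "F j = (if j mod int ?m = 0 then id else v (nat (j mod int ?m)))" for j :: int
    have Fb: "bij (F j)" for j using v by (simp add: F_def)
    have Fper: "F (j + int ?m) = F j" for j by (simp add: F_def del: of_nat_Suc)
    have F0: "F 0 = id" by (simp add: F_def)
    have FJ: "F (int j) = v j" if "j \<in> ?J" for j using that by (simp add: F_def mod_pos_pos_trivial del: of_nat_Suc)
    let ?s = "\<lambda>u::bool \<times> int. (fst u, snd u + 1)"
    have s_pow: "(?s ^^ n) u = (fst u, snd u + int n)" for n u by (induction n) auto
    define Y where "Y = (?s, \<lambda>_::bool \<times> int. id :: nat \<Rightarrow> nat)"
    define \<pi> where "\<pi> u = (if fst u then (False, snd u + int ?m) else (True, snd u))" for u :: "bool \<times> int"
    define X where "X = (\<pi>, \<lambda>u. if fst u then inv_into UNIV (F (snd u)) else F (snd u))"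
    have bs: "bij ?s" by (rule o_bij[of "\<lambda>u. (fst u, snd u - 1)"]) auto
    have b\<pi>: "bij \<pi>" by (rule o_bij[of "\<lambda>u. if fst u then (False, snd u) else (True, snd u - int ?m)"]) (auto simp: \<pi>_def fun_eq_iff)
    have Yc: "Y \<in> carrier ?W" using bs by (simp add: Y_def wreath_carrier)
    have Xc: "X \<in> carrier ?W" using b\<pi> Fb by (simp add: X_def wreath_carrier bij_imp_bij_inv)
    have Ypow: "Y [^]\<^bsub>?W\<^esub> n = (\<lambda>u. (fst u, snd u + int n), \<lambda>_. id)" for n :: nat
      unfolding Y_def wreath_shift_pow[OF bs] by (simp add: s_pow fun_eq_iff)
    have XX: "X \<otimes>\<^bsub>?W\<^esub> X = Y [^]\<^bsub>?W\<^esub> ?m"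
      unfolding Ypow
    proof (rule wreath_eqI)
      fix u :: "bool \<times> int"
      show "fst (X \<otimes>\<^bsub>?W\<^esub> X) u = fst (\<lambda>u. (fst u, snd u + int ?m), \<lambda>_::bool \<times> int. id :: nat \<Rightarrow> nat) u"
        by (simp add: X_def wreath_mult \<pi>_def prod_eq_iff)
      have "F (snd u + int ?m) \<circ> inv_into UNIV (F (snd u)) = id" unfolding Fper
        by (rule iffD1[OF surj_iff bij_is_surj[OF Fb]])
      moreover have "inv_into UNIV (F (snd u)) \<circ> F (snd u) = id"
        by (rule iffD1[OF inj_iff bij_is_inj[OF Fb]])
      ultimately show "snd (X \<otimes>\<^bsub>?W\<^esub> X) u = snd (\<lambda>u::bool \<times> int. (fst u, snd u + int ?m), \<lambda>_. id) u"
        by (simp add: X_def wreath_mult \<pi>_def del: of_nat_Suc)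
    qed
    define A where "A = inv\<^bsub>?W\<^esub> (Y [^]\<^bsub>?W\<^esub> k) \<otimes>\<^bsub>?W\<^esub> X"
    define B where "B = inv\<^bsub>?W\<^esub> A \<otimes>\<^bsub>?W\<^esub> Y"
    have Ac: "A \<in> carrier ?W" using Yc Xc by (simp add: A_def)
    have Bc': "B \<in> carrier ?W" using Yc Ac by (simp add: B_def)
    have AB: "A \<otimes>\<^bsub>?W\<^esub> B = Y" using Yc Ac by (simp add: B_def W.inv_cancel_left)
    have YA: "Y [^]\<^bsub>?W\<^esub> k \<otimes>\<^bsub>?W\<^esub> A = X" using Yc Xc by (simp add: A_def W.inv_cancel_left)
    have "A \<otimes>\<^bsub>?W\<^esub> X = inv\<^bsub>?W\<^esub> (Y [^]\<^bsub>?W\<^esub> k) \<otimes>\<^bsub>?W\<^esub> (X \<otimes>\<^bsub>?W\<^esub> X)" using Yc Xc by (simp add: A_def W.m_assoc)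
    also have "X \<otimes>\<^bsub>?W\<^esub> X = Y [^]\<^bsub>?W\<^esub> k \<otimes>\<^bsub>?W\<^esub> Y [^]\<^bsub>?W\<^esub> Suc k"
      unfolding XX W.nat_pow_mult[OF Yc] by (simp add: mult_2 del: nat_pow_Suc)
    also have "inv\<^bsub>?W\<^esub> (Y [^]\<^bsub>?W\<^esub> k) \<otimes>\<^bsub>?W\<^esub> \<dots> = Y [^]\<^bsub>?W\<^esub> Suc k" using Yc by (simp add: W.inv_cancel_left del: nat_pow_Suc)
    also have "\<dots> = A \<otimes>\<^bsub>?W\<^esub> (B \<otimes>\<^bsub>?W\<^esub> Y [^]\<^bsub>?W\<^esub> k)"
      using W.nat_pow_Suc2[OF Yc, of k] Yc Ac Bc' AB by (simp add: W.m_assoc[symmetric] del: nat_pow_Suc)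
    finally have eq: "A \<otimes>\<^bsub>?W\<^esub> X = A \<otimes>\<^bsub>?W\<^esub> (B \<otimes>\<^bsub>?W\<^esub> Y [^]\<^bsub>?W\<^esub> k)" .
    \<comment> \<open>The relation between \<open>A\<close> and \<open>B\<close> is equivalent to this equation by \<open>alt_prod_pow\<close> and \<open>pow_slide\<close>.\<close>
    have BY: "X = B \<otimes>\<^bsub>?W\<^esub> Y [^]\<^bsub>?W\<^esub> k" by (rule W.left_cancel_eq[OF Ac _ _ eq]) (use Xc Yc Bc' in simp_all)
    have AA: "alt_prod ?W ?m A B = alt_prod ?W ?m B A"
      unfolding W.alt_prod_pow(2)[OF Ac Bc'] W.alt_prod_pow(2)[OF Bc' Ac] W.pow_slide[OF Bc' Ac, symmetric] AB YA by (rule BY)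
    have "\<exists>H\<in>hom ?G ?W. \<forall>i<2. H (?g i) = (if i = 0 then A else B)"
    proof (rule W.path_hom, goal_cases)
      case (1 i) then show ?case using Ac Bc' by simp
    next
      case (2 i n) then show ?case using AA by (auto simp del: alt_prod.simps)
    next
      case (3 i j) then show ?case by simp
    qed
    then obtain H where H: "H \<in> hom ?G ?W" "\<forall>i<2. H (?g i) = (if i = 0 then A else B)" by (elim bexE)
    interpret H: group_hom ?G ?W H by (intro group_hom.intro group_hom_axioms.intro G.is_group W.is_group H(1))
    have Ha: "H a = A" using H(2) by (simp add: a_def)
    have Hy: "H y = Y" using H(2) gc AB by (simp add: y_def)
    have Hyj: "H (y [^]\<^bsub>?G\<^esub> int j) = Y [^]\<^bsub>?W\<^esub> j" for j :: nat using H.hom_nat_pow[OF yc, of j] Hy by (simp add: int_pow_int)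
    have Hx: "H x = X" using YA Ha Hyj by (simp add: x_def)
    have H\<kappa>: "fst (H (?\<kappa> j)) (False, 0) = (False, 0) \<and> snd (H (?\<kappa> j)) (False, 0) = F (int j)" for j
    proof -
      have "Y [^]\<^bsub>?W\<^esub> j \<otimes>\<^bsub>?W\<^esub> (X \<otimes>\<^bsub>?W\<^esub> H (?\<kappa> j)) = X \<otimes>\<^bsub>?W\<^esub> Y [^]\<^bsub>?W\<^esub> j"
        using arg_cong[OF K[of "int j"], of H] Hyj Hx by simp
      then have e: "fst (Y [^]\<^bsub>?W\<^esub> j \<otimes>\<^bsub>?W\<^esub> (X \<otimes>\<^bsub>?W\<^esub> H (?\<kappa> j))) (False, 0) = fst (X \<otimes>\<^bsub>?W\<^esub> Y [^]\<^bsub>?W\<^esub> j) (False, 0)"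
        "snd (Y [^]\<^bsub>?W\<^esub> j \<otimes>\<^bsub>?W\<^esub> (X \<otimes>\<^bsub>?W\<^esub> H (?\<kappa> j))) (False, 0) = snd (X \<otimes>\<^bsub>?W\<^esub> Y [^]\<^bsub>?W\<^esub> j) (False, 0)" by simp_all
      have 1: "fst (H (?\<kappa> j)) (False, 0) = (False, 0)"
        using e(1) by (auto simp: fst_wreath_mult Ypow X_def \<pi>_def prod_eq_iff split: if_splits)
      show ?thesis using 1 e(2) by (simp add: fst_wreath_mult snd_wreath_mult Ypow X_def F0)
    qed
    show ?thesis
      by (rule bexI[OF _ H(1)], rule exI[of _ "(False, 0)"]) (use H\<kappa> FJ in \<open>simp del: of_nat_Suc\<close>)
  qed
  have \<kappa>J: "?\<kappa> \<in> ?J \<rightarrow> carrier ?G" by simp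
  note fb = free_basis_family[OF G.is_group \<kappa>J fam]
  have J: "1 \<in> ?J" "2 \<in> ?J" using k by auto
  have B: "?\<kappa> 1 \<in> ?B" "?\<kappa> 2 \<in> ?B" using J by blast+
  have ne: "?\<kappa> 1 \<noteq> ?\<kappa> 2" using inj_onD[OF fb(2) _ J] by auto
  have sp: "\<exists>n\<in>?N. \<exists>c\<in>carrier ?G. (\<forall>x\<in>carrier ?G. c \<otimes>\<^bsub>?G\<^esub> x = x \<otimes>\<^bsub>?G\<^esub> c) \<and> g = n \<otimes>\<^bsub>?G\<^esub> c"
    if g: "g \<in> carrier ?G" "2 * int ?m dvd h g" for g
  proof -
    obtain n j where n: "n \<in> ?N" and "g = y [^]\<^bsub>?G\<^esub> (j::int) \<otimes>\<^bsub>?G\<^esub> n \<or> g = y [^]\<^bsub>?G\<^esub> j \<otimes>\<^bsub>?G\<^esub> (x \<otimes>\<^bsub>?G\<^esub> n)" using W[OF g(1)] by blast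
    from this(2) show ?thesis
    proof
      assume e: "g = y [^]\<^bsub>?G\<^esub> j \<otimes>\<^bsub>?G\<^esub> n"
      then have "int ?m dvd j" using g(2) hW(1)[OF n, of j] by (simp del: of_nat_Suc)
      then obtain q where "j = int ?m * q" by blast
      then have "y [^]\<^bsub>?G\<^esub> j = z [^]\<^bsub>?G\<^esub> q" by (simp add: z_def G.int_pow_pow del: of_nat_Suc)
      then have "g = n \<otimes>\<^bsub>?G\<^esub> z [^]\<^bsub>?G\<^esub> q" using e zq[OF Nc[OF n], of q] by simp
      moreover have "\<forall>u\<in>carrier ?G. z [^]\<^bsub>?G\<^esub> q \<otimes>\<^bsub>?G\<^esub> u = u \<otimes>\<^bsub>?G\<^esub> z [^]\<^bsub>?G\<^esub> q" using zq by blast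
      ultimately show ?thesis using n G.int_pow_closed[OF zc] by blast
    next
      assume e: "g = y [^]\<^bsub>?G\<^esub> j \<otimes>\<^bsub>?G\<^esub> (x \<otimes>\<^bsub>?G\<^esub> n)"
      have "2 dvd h g" using g(2) by (rule dvd_mult_left)
      then have "2 dvd 2 * (j + int k) + 1" unfolding e hW(2)[OF n] .
      then have False by presburger
      then show ?thesis ..
    qed
  qed
  have "0 < 2 * int ?m" by simp
  from virtually_separated_center_times_free[OF p G.is_group h(1) fb(1) B ne ker this sp] show ?thesis .
qed

section \<open>The Artin groups of the statement\<close>

theorem corollary0p3:
  fixes p :: nat
  assumes "Factorial_Ring.prime p"
  shows "(\<forall>n\<ge>1. virtually_RFRp p (artin_group (graph_A n))) \<and>
         (\<forall>n\<ge>2. virtually_RFRp p (artin_group (graph_B n))) \<and>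
         (\<forall>n\<ge>3. virtually_RFRp p (artin_group (graph_I2 n))) \<and>
         (\<forall>n\<ge>1. virtually_RFRp p (artin_group (graph_affine_A n))) \<and>
         (\<forall>n\<ge>2. virtually_RFRp p (artin_group (graph_affine_C n)))"
proof -
  have p: "1 < p" using assms by (rule prime_gt_1_nat)
  then have p0: "0 < p" by simp
  have conclude: "virtually_RFRp p (artin_group \<Gamma>)"
    if "virtually_separated p (artin_group \<Gamma>)" "is_coxeter_graph \<Gamma>" for \<Gamma> :: "nat coxeter_graph"
    using virtually_RFRp_if_virtually_separated[OF that(1) finitely_generated_artin p0] that(2)
    by (simp add: is_coxeter_graph_def)
  have I2: "virtually_separated p (artin_group (graph_I2 n))" if n: "3 \<le> n" for n
  proof (cases "even n")
    case True
    then obtain k where k: "n = 2 * k" by blast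
    then have "2 \<le> k" using n by simp
    then show ?thesis unfolding graph_I2_def k by (rule virtually_separated_I2_even[OF p])
  next
    case False
    then obtain k where k: "n = Suc (2 * k)" by (elim oddE) simp
    then have "1 \<le> k" using n by simp
    then show ?thesis unfolding graph_I2_def k by (rule virtually_separated_I2_odd[OF p])
  qed
  have affine_A: "virtually_separated p (artin_group (graph_affine_A n))" if n: "1 \<le> n" for n
  proof (cases "n = 1")
    case True then show ?thesis using virtually_separated_free2[OF p] by (simp add: graph_affine_A_def)
  next
    case False
    then have "2 \<le> n" "2 \<le> Suc n" using n by simp_all
    then have "virtually_separated p (artin_group (coxeter_cycle (Suc n)))" by (intro virtually_separated_cycle virtually_separated_B[OF p])
    then show ?thesis using False by (simp add: graph_affine_A_def)
  qed
  have affine_C: "virtually_separated p (artin_group (graph_affine_C n))" if n: "2 \<le> n" for n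
    by (rule virtually_separated_affine_C[OF n], rule virtually_separated_B[OF p]) (use n in simp)
  show ?thesis
    by (intro conjI allI impI conclude virtually_separated_A[OF p] virtually_separated_B[OF p] I2 affine_A affine_C is_coxeter_graph_graphs) simp_all
qed

end
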